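(* Let $k$ be a field, $n\geq 2$ an integer and $E\in GL_n(k)$. Let $$X_0(E)=\{F\in GL_m(k)\mid m\geq 2,\ \operatorname{Tr}(F^{-1}F^t)=\operatorname{Tr}(E^{-1}E^t)\}$$ (with $m$ ranging over all integers $\geq 2$), and let $X(E)=X_0(E)/\!\sim$, where $F_1\sim F_2$ if and only if $F_1,F_2$ have the same size and there exists an invertible matrix $P$ over $k$ of that size with $F_1=PF_2P^t$. Then there is a bijection $\psi:X(E)\to\operatorname{Gal}(\mathcal{B}(E))$ sending the class of $F$ to the isomorphism class $[\mathcal{B}(E,F)]$.
   Context: $\otimes=\otimes_k$; $M^t$ denotes the transpose of a matrix $M$. Galois objects. Let $H$ be a Hopf algebra over $k$ and $Z$ a left $H$-comodule algebra with coaction $\delta:Z\to H\otimes Z$. Its coinvariants are $Z^{co H}=\{z\in Z\mid \delta(z)=1\otimes z\}$. $Z$ is a (left) $H$-Galois object if $Z^{co H}=k$, the canonical map $\operatorname{can}:Z\otimes Z\to H\otimes Z$, $z\otimes z'\mapsto\delta(z)(1\otimes z')$, is bijective, and $Z$ is faithfully flat over $k$ (over a field: nonzero). $\operatorname{Gal}(H)$ denotes the set of isomorphism classes (as left $H$-comodule algebras) of left $H$-Galois objects. The Hopf algebra $\mathcal{B}(E)$. For $E\in GL_n(k)$, $\mathcal{B}(E)$ is the $k$-algebra generated by $a_{ij}$, $1\leq i,j\leq n$, subject to the matrix relations $E^{-1}a^tEa=I_n=aE^{-1}a^tE$ where $a=(a_{ij})$. It is a Hopf algebra with $\Delta(a_{ij})=\sum_{l=1}^n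 a_{il}\otimes a_{lj}$, $\varepsilon(a_{ij})=\delta_{ij}$, $S(a)=E^{-1}a^tE$. The algebra $\mathcal{B}(E,F)$. For $E\in GL_n(k)$, $F\in GL_m(k)$, $\mathcal{B}(E,F)$ is the $k$-algebra generated by $z_{ij}$, $1\leq i\leq n$, $1\leq j\leq m$, subject to the matrix relations $F^{-1}z^tEz=I_m$ and $zF^{-1}z^tE=I_n$ where $z=(z_{ij})$. It is a left $\mathcal{B}(E)$-comodule algebra via $\delta(z_{ij})=\sum_{l=1}^n a_{il}\otimes z_{lj}$. *)

theory Defs
  imports
    "HOL-Algebra.QuotRing"
    "HOL-Library.Poly_Mapping"
    "Jordan_Normal_Form.VS_Connect"
    "Jordan_Normal_Form.Gauss_Jordan_Elimination"
begin

section \<open>Algebras over a field\<close>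

text \<open>
  The ground field is a type of class \<^class>\<open>field\<close>; algebras over it are
  records of type \<open>module\<close> (ring operations plus \<^const>\<open>smult\<close>).
  The locale \<open>algebra\<close> of HOL-Algebra requires commutative multiplication, hence this predicate.
\<close>

definition k_algebra :: "('k::field, 'a, 'm) module_scheme \<Rightarrow> bool" where
  "k_algebra A \<longleftrightarrow>
     module (class_ring :: 'k ring) A \<and> ring A \<and>
     (\<forall>c. \<forall>x\<in>carrier A. \<forall>y\<in>carrier A.
        (c \<odot>\<^bsub>A\<^esub> x) \<otimes>\<^bsub>A\<^esub> y = c \<odot>\<^bsub>A\<^esub> (x \<otimes>\<^bsub>A\<^esub> y) \<and>
        x \<otimes>\<^bsub>A\<^esub> (c \<odot>\<^bsub>A\<^esub> y) = c \<odot>\<^bsub>A\<^esub> (x \<otimes>\<^bsub>A\<^esub> y))"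

definition lin_hom ::
    "('k::field, 'a, 'm) module_scheme \<Rightarrow> ('k, 'b, 'n) module_scheme \<Rightarrow> ('a \<Rightarrow> 'b) set" where
  "lin_hom A B = {f \<in> carrier A \<rightarrow> carrier B.
     (\<forall>x\<in>carrier A. \<forall>y\<in>carrier A. f (x \<oplus>\<^bsub>A\<^esub> y) = f x \<oplus>\<^bsub>B\<^esub> f y) \<and>
     (\<forall>c. \<forall>x\<in>carrier A. f (c \<odot>\<^bsub>A\<^esub> x) = c \<odot>\<^bsub>B\<^esub> f x)}"

definition alg_hom ::
    "('k::field, 'a, 'm) module_scheme \<Rightarrow> ('k, 'b, 'n) module_scheme \<Rightarrow> ('a \<Rightarrow> 'b) set" where
  "alg_hom A B = Ring.ring_hom A B \<inter> lin_hom A B"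

definition ground_alg :: "('k::field, 'k) module" where
  "ground_alg = \<lparr>carrier = UNIV, mult = (*), one = 1, zero = 0, add = (+), smult = (*)\<rparr>"

definition opposite_alg :: "('k::field, 'a) module \<Rightarrow> ('k, 'a) module" where
  "opposite_alg A = A\<lparr>mult := \<lambda>x y. y \<otimes>\<^bsub>A\<^esub> x\<rparr>"

definition quotient_alg :: "('k::field, 'a) module \<Rightarrow> 'a set \<Rightarrow> ('k, 'a set) module" where
  "quotient_alg A I =
     ring.extend (A Quot I) \<lparr>smult = \<lambda>c X. \<Union>x\<in>X. I +>\<^bsub>A\<^esub> (c \<odot>\<^bsub>A\<^esub> x)\<rparr>"


section \<open>Tensor products over the ground field\<close>

abbreviation pscale :: "'k::field \<Rightarrow> ('x \<Rightarrow>\<^sub>0 'k) \<Rightarrow> ('x \<Rightarrow>\<^sub>0 'k)" where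
  "pscale c u \<equiv> Poly_Mapping.map ((*) c) u"

text \<open>
  The tensor product is the vector space with basis \<open>carrier A \<times> carrier B\<close>
  modulo the span of the bilinearity relations.
\<close>

definition free_tensor ::
    "('k::field, 'a, 'm) module_scheme \<Rightarrow> ('k, 'b, 'n) module_scheme \<Rightarrow>
     ('k, ('a \<times> 'b) \<Rightarrow>\<^sub>0 'k) module" where
  "free_tensor A B =
     \<lparr>carrier = {u. Poly_Mapping.keys u \<subseteq> carrier A \<times> carrier B},
      mult = \<lambda>u v. \<Sum>p\<in>Poly_Mapping.keys u. \<Sum>q\<in>Poly_Mapping.keys v.
        Poly_Mapping.single (fst p \<otimes>\<^bsub>A\<^esub> fst q, snd p \<otimes>\<^bsub>B\<^esub> snd q)
          (Poly_Mapping.lookup u p * Poly_Mapping.lookup v q),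
      one = Poly_Mapping.single (\<one>\<^bsub>A\<^esub>, \<one>\<^bsub>B\<^esub>) 1,
      zero = 0, add = (+), smult = pscale\<rparr>"

definition bilinear_relations ::
    "('k::field, 'a, 'm) module_scheme \<Rightarrow> ('k, 'b, 'n) module_scheme \<Rightarrow>
     (('a \<times> 'b) \<Rightarrow>\<^sub>0 'k) set" where
  "bilinear_relations A B =
     {Poly_Mapping.single (a \<oplus>\<^bsub>A\<^esub> a', b) 1
        - Poly_Mapping.single (a, b) 1 - Poly_Mapping.single (a', b) 1 | a a' b.
        a \<in> carrier A \<and> a' \<in> carrier A \<and> b \<in> carrier B} \<union>
     {Poly_Mapping.single (a, b \<oplus>\<^bsub>B\<^esub> b') 1
        - Poly_Mapping.single (a, b) 1 - Poly_Mapping.single (a, b') 1 | a b b'.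
        a \<in> carrier A \<and> b \<in> carrier B \<and> b' \<in> carrier B} \<union>
     {Poly_Mapping.single (c \<odot>\<^bsub>A\<^esub> a, b) 1 - Poly_Mapping.single (a, b) c | c a b.
        a \<in> carrier A \<and> b \<in> carrier B} \<union>
     {Poly_Mapping.single (a, c \<odot>\<^bsub>B\<^esub> b) 1 - Poly_Mapping.single (a, b) c | c a b.
        a \<in> carrier A \<and> b \<in> carrier B}"

definition tensor_kernel ::
    "('k::field, 'a, 'm) module_scheme \<Rightarrow> ('k, 'b, 'n) module_scheme \<Rightarrow>
     (('a \<times> 'b) \<Rightarrow>\<^sub>0 'k) set" where
  "tensor_kernel A B = Modules.module.span pscale (bilinear_relations A B)"

definition tensor ::
    "('k::field, 'a, 'm) module_scheme \<Rightarrow> ('k, 'b, 'n) module_scheme \<Rightarrow>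
     ('k, (('a \<times> 'b) \<Rightarrow>\<^sub>0 'k) set) module" where
  "tensor A B = quotient_alg (free_tensor A B) (tensor_kernel A B)"

definition pure_tensor ::
    "('k::field, 'a, 'm) module_scheme \<Rightarrow> ('k, 'b, 'n) module_scheme \<Rightarrow>
     'a \<Rightarrow> 'b \<Rightarrow> (('a \<times> 'b) \<Rightarrow>\<^sub>0 'k) set" where
  "pure_tensor A B a b =
     tensor_kernel A B +>\<^bsub>free_tensor A B\<^esub> Poly_Mapping.single (a, b) 1"

text \<open>
  \<open>tensor_lift T \<phi>\<close> is the linear map into \<open>T\<close> induced on a tensor product by a
  bilinear map \<open>\<phi>\<close>: the common value of the linear extension of \<open>\<phi>\<close> on all
  representatives of a coset. It is only meaningful for bilinear \<open>\<phi>\<close>.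
\<close>

definition tensor_lift ::
    "('k::field, 'c, 'm) module_scheme \<Rightarrow> ('a \<Rightarrow> 'b \<Rightarrow> 'c) \<Rightarrow> (('a \<times> 'b) \<Rightarrow>\<^sub>0 'k) set \<Rightarrow> 'c" where
  "tensor_lift T \<phi> X = the_elem
     ((\<lambda>u. \<Oplus>\<^bsub>T\<^esub> p\<in>Poly_Mapping.keys u.
         Poly_Mapping.lookup u p \<odot>\<^bsub>T\<^esub> \<phi> (fst p) (snd p)) ` X)"

definition tensor_map ::
    "('k::field, 'c, 'm) module_scheme \<Rightarrow> ('k, 'd, 'n) module_scheme \<Rightarrow>
     ('a \<Rightarrow> 'c) \<Rightarrow> ('b \<Rightarrow> 'd) \<Rightarrow> (('a \<times> 'b) \<Rightarrow>\<^sub>0 'k) set \<Rightarrow> (('c \<times> 'd) \<Rightarrow>\<^sub>0 'k) set" where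
  "tensor_map C D f g = tensor_lift (tensor C D) (\<lambda>a b. pure_tensor C D (f a) (g b))"

text \<open>The associativity isomorphism from \<open>(A \<otimes> B) \<otimes> C\<close> to \<open>A \<otimes> (B \<otimes> C)\<close>.\<close>

definition tensor_assoc ::
    "('k::field, 'a, 'l) module_scheme \<Rightarrow> ('k, 'b, 'm) module_scheme \<Rightarrow> ('k, 'c, 'n) module_scheme \<Rightarrow>
     (((('a \<times> 'b) \<Rightarrow>\<^sub>0 'k) set \<times> 'c) \<Rightarrow>\<^sub>0 'k) set \<Rightarrow>
     (('a \<times> (('b \<times> 'c) \<Rightarrow>\<^sub>0 'k) set) \<Rightarrow>\<^sub>0 'k) set" where
  "tensor_assoc A B C =
     (let T = tensor A (tensor B C) in
      tensor_lift T (\<lambda>t c. tensor_lift T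
        (\<lambda>a b. pure_tensor A (tensor B C) a (pure_tensor B C b c)) t))"


section \<open>Hopf algebras, comodule algebras and Galois objects\<close>

record (overloaded) ('k, 'h) hopf = "('k, 'h) module" +
  comult :: "'h \<Rightarrow> (('h \<times> 'h) \<Rightarrow>\<^sub>0 'k) set"
  counit :: "'h \<Rightarrow> 'k"
  antipode :: "'h \<Rightarrow> 'h"

definition hopf_algebra :: "('k::field, 'h) hopf \<Rightarrow> bool" where
  "hopf_algebra H \<longleftrightarrow>
     k_algebra H \<and>
     comult H \<in> alg_hom H (tensor H H) \<and>
     counit H \<in> alg_hom H ground_alg \<and>
     antipode H \<in> lin_hom H H \<and>
     (\<forall>x\<in>carrier H.
        tensor_assoc H H H (tensor_map (tensor H H) H (comult H) id (comult H x))
          = tensor_map H (tensor H H) id (comult H) (comult H x) \<and>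
        tensor_lift H (\<lambda>a b. counit H a \<odot>\<^bsub>H\<^esub> b) (comult H x) = x \<and>
        tensor_lift H (\<lambda>a b. counit H b \<odot>\<^bsub>H\<^esub> a) (comult H x) = x \<and>
        tensor_lift H (\<lambda>a b. antipode H a \<otimes>\<^bsub>H\<^esub> b) (comult H x) = counit H x \<odot>\<^bsub>H\<^esub> \<one>\<^bsub>H\<^esub> \<and>
        tensor_lift H (\<lambda>a b. a \<otimes>\<^bsub>H\<^esub> antipode H b) (comult H x) = counit H x \<odot>\<^bsub>H\<^esub> \<one>\<^bsub>H\<^esub>)"

record (overloaded) ('k, 'h, 'z) comod_alg = "('k, 'z) module" +
  coact :: "'z \<Rightarrow> (('h \<times> 'z) \<Rightarrow>\<^sub>0 'k) set"

definition comodule_algebra :: "('k::field, 'h) hopf \<Rightarrow> ('k, 'h, 'z) comod_alg \<Rightarrow> bool" where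
  "comodule_algebra H Z \<longleftrightarrow>
     k_algebra Z \<and>
     coact Z \<in> alg_hom Z (tensor H Z) \<and>
     (\<forall>z\<in>carrier Z.
        tensor_assoc H H Z (tensor_map (tensor H H) Z (comult H) id (coact Z z))
          = tensor_map H (tensor H Z) id (coact Z) (coact Z z) \<and>
        tensor_lift Z (\<lambda>h y. counit H h \<odot>\<^bsub>Z\<^esub> y) (coact Z z) = z)"

definition coinvariants :: "('k::field, 'h) hopf \<Rightarrow> ('k, 'h, 'z) comod_alg \<Rightarrow> 'z set" where
  "coinvariants H Z = {z \<in> carrier Z. coact Z z = pure_tensor H Z \<one>\<^bsub>H\<^esub> z}"

definition canonical_map ::
    "('k::field, 'h) hopf \<Rightarrow> ('k, 'h, 'z) comod_alg \<Rightarrow>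
     (('z \<times> 'z) \<Rightarrow>\<^sub>0 'k) set \<Rightarrow> (('h \<times> 'z) \<Rightarrow>\<^sub>0 'k) set" where
  "canonical_map H Z =
     tensor_lift (tensor H Z) (\<lambda>z z'. coact Z z \<otimes>\<^bsub>tensor H Z\<^esub> pure_tensor H Z \<one>\<^bsub>H\<^esub> z')"

text \<open>Over a field, faithful flatness of \<open>Z\<close> means that \<open>Z\<close> is nonzero.\<close>

definition galois_object :: "('k::field, 'h) hopf \<Rightarrow> ('k, 'h, 'z) comod_alg \<Rightarrow> bool" where
  "galois_object H Z \<longleftrightarrow>
     hopf_algebra H \<and> comodule_algebra H Z \<and>
     coinvariants H Z = range (\<lambda>c. c \<odot>\<^bsub>Z\<^esub> \<one>\<^bsub>Z\<^esub>) \<and>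
     bij_betw (canonical_map H Z) (carrier (tensor Z Z)) (carrier (tensor H Z)) \<and>
     carrier Z \<noteq> {\<zero>\<^bsub>Z\<^esub>}"

definition comod_alg_isomorphic ::
    "('k::field, 'h) hopf \<Rightarrow> ('k, 'h, 'y) comod_alg \<Rightarrow> ('k, 'h, 'z) comod_alg \<Rightarrow> bool" where
  "comod_alg_isomorphic H Y Z \<longleftrightarrow>
     (\<exists>f \<in> alg_hom Y Z. bij_betw f (carrier Y) (carrier Z) \<and>
        (\<forall>y\<in>carrier Y. coact Z (f y) = tensor_map H Z id f (coact Y y)))"

definition galois_iso_rel ::
    "('k::field, 'h) hopf \<Rightarrow> ('k, 'h, 'z) comod_alg rel" where
  "galois_iso_rel H =
     {(Y, Z). galois_object H Y \<and> galois_object H Z \<and> comod_alg_isomorphic H Y Z}"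

text \<open>
  Isomorphism classes of Galois objects whose elements are taken from the type \<open>'z\<close>;
  HOL has no set of all Galois objects over all types, so a statement about this set
  needs the additional information that every Galois object, over whatever type, is
  isomorphic to one over \<open>'z\<close>.
\<close>

definition Gal :: "('k::field, 'h) hopf \<Rightarrow> ('k, 'h, 'z) comod_alg set set" where
  "Gal H = {Z. galois_object H Z} // galois_iso_rel H"


section \<open>Free algebras\<close>

text \<open>
  Words form a noncommutative additive monoid under concatenation, so that
  \<open>'g word \<Rightarrow>\<^sub>0 'k\<close> with the convolution product is the free algebra on \<open>'g\<close>.
\<close>

datatype 'g word = Word (letters: "'g list")

instantiation word :: (type) monoid_add
begin

definition zero_word :: "'a word" where "0 = Word []"

definition plus_word :: "'a word \<Rightarrow> 'a word \<Rightarrow> 'a word" where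
  "u + v = Word (letters u @ letters v)"

instance by standard (simp_all add: zero_word_def plus_word_def)

end

definition gen :: "'g \<Rightarrow> 'g word \<Rightarrow>\<^sub>0 'k::field" where
  "gen g = Poly_Mapping.single (Word [g]) 1"

definition free_alg :: "'g set \<Rightarrow> ('k::field, 'g word \<Rightarrow>\<^sub>0 'k) module" where
  "free_alg G =
     \<lparr>carrier = {u. \<forall>w\<in>Poly_Mapping.keys u. set (letters w) \<subseteq> G},
      mult = (*), one = 1, zero = 0, add = (+), smult = pscale\<rparr>"

definition word_eval :: "('k::field, 'a, 'm) module_scheme \<Rightarrow> ('g \<Rightarrow> 'a) \<Rightarrow> 'g word \<Rightarrow> 'a" where
  "word_eval A \<phi> w = foldr (\<lambda>g y. \<phi> g \<otimes>\<^bsub>A\<^esub> y) (letters w) \<one>\<^bsub>A\<^esub>"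

definition free_eval ::
    "('k::field, 'a, 'm) module_scheme \<Rightarrow> ('g \<Rightarrow> 'a) \<Rightarrow> ('g word \<Rightarrow>\<^sub>0 'k) \<Rightarrow> 'a" where
  "free_eval A \<phi> u =
     (\<Oplus>\<^bsub>A\<^esub> w\<in>Poly_Mapping.keys u. Poly_Mapping.lookup u w \<odot>\<^bsub>A\<^esub> word_eval A \<phi> w)"

text \<open>
  The algebra map into \<open>A\<close> induced on a quotient of a free algebra by an assignment
  \<open>\<phi>\<close> of the generators; only meaningful if \<open>\<phi>\<close> respects the relations.
\<close>

definition alg_lift ::
    "('k::field, 'a, 'm) module_scheme \<Rightarrow> ('g \<Rightarrow> 'a) \<Rightarrow> ('g word \<Rightarrow>\<^sub>0 'k) set \<Rightarrow> 'a" where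
  "alg_lift A \<phi> X = the_elem (free_eval A \<phi> ` X)"


section \<open>The algebras B(E,F) and B(E)\<close>

text \<open>
  Rows and columns are numbered from 0, and a pair \<open>(i, j)\<close> stands for the generator
  in row \<open>i\<close> and column \<open>j\<close>.
\<close>

type_synonym 'k free_elt = "(nat \<times> nat) word \<Rightarrow>\<^sub>0 'k"

abbreviation mat_inv :: "'k::field mat \<Rightarrow> 'k mat" where
  "mat_inv A \<equiv> the (mat_inverse A)"

definition const_mat :: "'k::field mat \<Rightarrow> 'k free_elt mat" where
  "const_mat = map_mat (Poly_Mapping.single 0)"

definition gen_mat :: "nat \<Rightarrow> nat \<Rightarrow> 'k::field free_elt mat" where
  "gen_mat n m = mat n m gen"

definition BEF_relations :: "'k::field mat \<Rightarrow> 'k mat \<Rightarrow> 'k free_elt set" where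
  "BEF_relations E F =
     (let n = dim_row E; m = dim_row F; z = gen_mat n m;
          L = const_mat (mat_inv F) * z\<^sup>T * const_mat E * z;
          R = z * const_mat (mat_inv F) * z\<^sup>T * const_mat E
      in {L $$ (i, j) - 1\<^sub>m m $$ (i, j) | i j. i < m \<and> j < m} \<union>
         {R $$ (i, j) - 1\<^sub>m n $$ (i, j) | i j. i < n \<and> j < n})"

definition BEF_free :: "'k::field mat \<Rightarrow> 'k mat \<Rightarrow> ('k, 'k free_elt) module" where
  "BEF_free E F = free_alg ({..<dim_row E} \<times> {..<dim_row F})"

definition BEF_ideal :: "'k::field mat \<Rightarrow> 'k mat \<Rightarrow> 'k free_elt set" where
  "BEF_ideal E F = Idl\<^bsub>BEF_free E F\<^esub> (BEF_relations E F)"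

definition BEF_alg :: "'k::field mat \<Rightarrow> 'k mat \<Rightarrow> ('k, 'k free_elt set) module" where
  "BEF_alg E F = quotient_alg (BEF_free E F) (BEF_ideal E F)"

definition BEF_class :: "'k::field mat \<Rightarrow> 'k mat \<Rightarrow> 'k free_elt \<Rightarrow> 'k free_elt set" where
  "BEF_class E F u = BEF_ideal E F +>\<^bsub>BEF_free E F\<^esub> u"

abbreviation BEF_gen :: "'k::field mat \<Rightarrow> 'k mat \<Rightarrow> nat \<Rightarrow> nat \<Rightarrow> 'k free_elt set" where
  "BEF_gen E F i j \<equiv> BEF_class E F (gen (i, j))"

text \<open>
  The generators and relations of \<open>B(E)\<close> are those of \<open>B(E,E)\<close>. The antipode is
  the map into the opposite algebra with \<open>S(a) = E\<^sup>-\<^sup>1 a\<^sup>t E\<close>.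
\<close>

definition BE :: "'k::field mat \<Rightarrow> ('k, 'k free_elt set) hopf" where
  "BE E =
     (let A = BEF_alg E E; n = dim_row E; a = BEF_gen E E;
          Sa = const_mat (mat_inv E) * (gen_mat n n)\<^sup>T * const_mat E in
      module.extend A
        \<lparr>comult = alg_lift (tensor A A)
           (\<lambda>(i, j). \<Oplus>\<^bsub>tensor A A\<^esub> l\<in>{..<n}. pure_tensor A A (a i l) (a l j)),
         counit = alg_lift ground_alg (\<lambda>(i, j). if i = j then 1 else 0),
         antipode = alg_lift (opposite_alg A) (\<lambda>(i, j). BEF_class E E (Sa $$ (i, j)))\<rparr>)"

definition BEF :: "'k::field mat \<Rightarrow> 'k mat \<Rightarrow> ('k, 'k free_elt set, 'k free_elt set) comod_alg" where
  "BEF E F =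
     (let H = BE E; Z = BEF_alg E F; n = dim_row E in
      module.extend Z
        \<lparr>coact = alg_lift (tensor H Z)
           (\<lambda>(i, j). \<Oplus>\<^bsub>tensor H Z\<^esub> l\<in>{..<n}.
              pure_tensor H Z (BEF_gen E E i l) (BEF_gen E F l j))\<rparr>)"


section \<open>Congruence classes of matrices\<close>

definition mat_trace :: "'k::field mat \<Rightarrow> 'k" where
  "mat_trace A = (\<Sum>i<dim_row A. A $$ (i, i))"

definition X0_E :: "'k::field mat \<Rightarrow> 'k mat set" where
  "X0_E E = {F. \<exists>m\<ge>2. F \<in> carrier_mat m m \<and> invertible_mat F \<and>
     mat_trace (mat_inv F * F\<^sup>T) = mat_trace (mat_inv E * E\<^sup>T)}"

definition congruence_rel :: "'k::field mat \<Rightarrow> 'k mat rel" where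
  "congruence_rel E = {(F1, F2). F1 \<in> X0_E E \<and> F2 \<in> X0_E E \<and>
     (\<exists>m P. F1 \<in> carrier_mat m m \<and> F2 \<in> carrier_mat m m \<and>
        P \<in> carrier_mat m m \<and> invertible_mat P \<and> F1 = P * F2 * P\<^sup>T)}"

definition X_E :: "'k::field mat \<Rightarrow> 'k mat set set" where
  "X_E E = X0_E E // congruence_rel E"

end

theory Submission
  imports Defs "Jordan_Normal_Form.Determinant" "HOL-Algebra.Algebraic_Closure_Type"
begin

no_notation Polynomials.var (\<open>X\<index>\<close>)
no_notation fps_nth (infixl \<open>$\<close> 75)
hide_const (open) Multiset.mult Polynomial.smult Polynomial.order Modules.module

text \<open>
  Call a matrix \<open>z\<close> over an algebra \<open>A\<close> an \<open>(E,F)\<close>-point if \<open>z\<^sup>T E z = F\<close> and \<open>z F\<inverse> z\<^sup>T = E\<inverse>\<close>;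
  these are the algebra maps \<open>\<B>(E,F) \<rightarrow> A\<close>. Commuting points compose, and \<open>F\<inverse> z\<^sup>T E\<close> is an \<open>(F,E)\<close>-point
  over the opposite algebra. This yields the coproduct, the antipode and the inverse of the canonical map, so
  \<open>\<B>(E,F)\<close> is a Galois object as soon as it is nonzero.

  Conversely, let \<open>Z\<close> be a Galois object. Writing the elements \<open>can\<inverse>(a\<^sub>i\<^sub>j \<otimes> 1)\<close> as sums of tensors exhibits
  finitely many equivariant columns \<open>v\<close>, that is \<open>\<delta>(v\<^sub>i) = \<Sum> a\<^sub>i\<^sub>j \<otimes> v\<^sub>j\<close>, whose matrix \<open>z\<close> has a right inverse;
  with as few columns as possible \<open>z\<close> becomes a point, because \<open>z\<^sup>T E z\<close> is coinvariant and hence a scalar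
  matrix \<open>F\<close>. Other bases of equivariant columns replace \<open>F\<close> by a congruent matrix. The induced map
  \<open>\<B>(E,F) \<rightarrow> Z\<close> is equivariant, and an equivariant algebra map between Galois objects is bijective. The trace
  condition is necessary: evaluate \<open>\<Sum> E\<^sub>i\<^sub>j (F\<inverse>)\<^sub>\<alpha>\<^sub>\<beta> z\<^sub>i\<^sub>\<alpha> z\<^sub>j\<^sub>\<beta>\<close> in two ways.

  It is also sufficient for \<open>\<B>(E,F) \<noteq> 0\<close>. Over an algebraically closed field let \<open>q\<^sup>2 + Tr(E\<inverse>E\<^sup>T) q + 1 = 0\<close>.
  Both \<open>E\<close> and \<open>F\<close> have a point with values in a nonzero algebra and the same antidiagonal \<open>2 \<times> 2\<close> matrix on the
  other side; composing one with the inverse of the other gives an \<open>(E,F)\<close>-point over a nonzero algebra.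
\<close>

text \<open>The obstacle is that nothing visible in the presentation of \<open>\<B>(E,F)\<close>
  keeps its relations from collapsing to 1 = 0. The intermediate 2 x 2 matrix is the one whose
  algebra is the coordinate ring of quantum SL(2); its trace invariant is -q - 1/q, and the equation
  for q says that this equals the invariant of E and of F. With only two columns, a point for E
  consists of two families of operators, multiplications and twisted derivations, whose relations
  can be checked on one explicit module. The algebraic closure supplies the root q and an isotropic
  vector of the form E; a nonzero algebra over the closure is also a nonzero algebra over k.

  Faithful flatness over a field is used as a functional \<psi> with \<psi>(1) = 1. Applied to one
  tensor leg it turns z \<otimes> 1 = 1 \<otimes> z into z \<in> k, descends bijectivity from f
  \<otimes> id to f, and shows that a tensor product of nonzero algebras is nonzero.

  Having as few columns as possible makes them linearly independent over k, and together with the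
  right inverse of z this forces det F to be nonzero.\<close>

lemma k_algebraI:
  fixes A :: "('k::field, 'a, 'm) module_scheme"
  assumes "ring A"
    and "\<And>c x. x \<in> carrier A \<Longrightarrow> c \<odot>\<^bsub>A\<^esub> x \<in> carrier A"
    and "\<And>c d x. x \<in> carrier A \<Longrightarrow> (c + d) \<odot>\<^bsub>A\<^esub> x = c \<odot>\<^bsub>A\<^esub> x \<oplus>\<^bsub>A\<^esub> d \<odot>\<^bsub>A\<^esub> x"
    and "\<And>c x y. x \<in> carrier A \<Longrightarrow> y \<in> carrier A \<Longrightarrow> c \<odot>\<^bsub>A\<^esub> (x \<oplus>\<^bsub>A\<^esub> y) = c \<odot>\<^bsub>A\<^esub> x \<oplus>\<^bsub>A\<^esub> c \<odot>\<^bsub>A\<^esub> y"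
    and "\<And>c d x. x \<in> carrier A \<Longrightarrow> (c * d) \<odot>\<^bsub>A\<^esub> x = c \<odot>\<^bsub>A\<^esub> (d \<odot>\<^bsub>A\<^esub> x)"
    and "\<And>x. x \<in> carrier A \<Longrightarrow> 1 \<odot>\<^bsub>A\<^esub> x = x"
    and "\<And>c x y. x \<in> carrier A \<Longrightarrow> y \<in> carrier A \<Longrightarrow> (c \<odot>\<^bsub>A\<^esub> x) \<otimes>\<^bsub>A\<^esub> y = c \<odot>\<^bsub>A\<^esub> (x \<otimes>\<^bsub>A\<^esub> y)"
    and "\<And>c x y. x \<in> carrier A \<Longrightarrow> y \<in> carrier A \<Longrightarrow> x \<otimes>\<^bsub>A\<^esub> (c \<odot>\<^bsub>A\<^esub> y) = c \<odot>\<^bsub>A\<^esub> (x \<otimes>\<^bsub>A\<^esub> y)"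
  shows "k_algebra A"
proof -
  have "module (class_ring :: 'k ring) A"
    by (rule moduleI) (use assms in \<open>auto intro: class_cring.is_cring ring.is_abelian_group\<close>)
  then show ?thesis using assms by (simp add: k_algebra_def)
qed

section \<open>Scalars and finite sums in an algebra\<close>

locale kalg = fixes A :: "('k::field, 'a, 'm) module_scheme" (structure)
  assumes kalg: "k_algebra A"

sublocale kalg \<subseteq> ring A
  using kalg by (simp add: k_algebra_def)

lemma kalgI [intro]: "k_algebra A \<Longrightarrow> kalg A"
  by (rule kalg.intro)

context kalg
begin

lemma module_ax: "module (class_ring :: 'k ring) A"
  using kalg by (simp add: k_algebra_def)

lemma smult_closed [simp, intro]: "x \<in> carrier A \<Longrightarrow> c \<odot> x \<in> carrier A"
  using module.smult_closed[OF module_ax] by simp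

lemma smult_l_distr: "x \<in> carrier A \<Longrightarrow> (c + d) \<odot> x = c \<odot> x \<oplus> d \<odot> x"
  using module.smult_l_distr[OF module_ax] by simp

lemma smult_r_distr: "x \<in> carrier A \<Longrightarrow> y \<in> carrier A \<Longrightarrow> c \<odot> (x \<oplus> y) = c \<odot> x \<oplus> c \<odot> y"
  using module.smult_r_distr[OF module_ax] by simp

lemma smult_smult [simp]: "x \<in> carrier A \<Longrightarrow> c \<odot> (d \<odot> x) = (c * d) \<odot> x"
  using module.smult_assoc1[OF module_ax] by simp

lemma smult_one [simp]: "x \<in> carrier A \<Longrightarrow> 1 \<odot> x = x"
  using module.smult_one[OF module_ax] by simp

lemma smult_mult_l [simp]: "x \<in> carrier A \<Longrightarrow> y \<in> carrier A \<Longrightarrow> (c \<odot> x) \<otimes> y = c \<odot> (x \<otimes> y)"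
  using kalg by (simp add: k_algebra_def)

lemma smult_mult_r [simp]: "x \<in> carrier A \<Longrightarrow> y \<in> carrier A \<Longrightarrow> x \<otimes> (c \<odot> y) = c \<odot> (x \<otimes> y)"
  using kalg by (simp add: k_algebra_def)

lemma smult_l_null [simp]: "x \<in> carrier A \<Longrightarrow> 0 \<odot> x = \<zero>"
  using module.smult_l_null[OF module_ax] by simp

lemma smult_r_null [simp]: "c \<odot> \<zero> = \<zero>"
  using module.smult_r_null[OF module_ax] by simp

lemma smult_uminus: "x \<in> carrier A \<Longrightarrow> (- c) \<odot> x = \<ominus> (c \<odot> x)"
  by (metis add.inv_equality smult_closed smult_l_distr smult_l_null add.left_inverse)

lemma minus_conv_smult: "x \<in> carrier A \<Longrightarrow> \<ominus> x = (- 1) \<odot> x"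
  by (simp add: smult_uminus)

lemma diff_zero_iff: "x \<in> carrier A \<Longrightarrow> y \<in> carrier A \<Longrightarrow> x \<ominus> y = \<zero> \<longleftrightarrow> x = y"
  by (metis a_minus_def add.inv_closed minus_equality minus_minus r_neg)

lemma smult_cancel: "x \<in> carrier A \<Longrightarrow> c \<noteq> 0 \<Longrightarrow> c \<odot> x = \<zero> \<Longrightarrow> x = \<zero>"
  by (metis smult_smult smult_one smult_r_null left_inverse)

lemma smult_finsum:
  "f \<in> I \<rightarrow> carrier A \<Longrightarrow> c \<odot> (\<Oplus>i\<in>I. f i) = (\<Oplus>i\<in>I. c \<odot> f i)"
  by (induction I rule: infinite_finite_induct) (auto simp: Pi_def smult_r_distr)

lemma finsum_smult_l:
  "finite I \<Longrightarrow> x \<in> carrier A \<Longrightarrow> (\<Sum>i\<in>I. f i) \<odot> x = (\<Oplus>i\<in>I. f i \<odot> x)"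
  by (induction I rule: finite_induct) (auto simp: Pi_def smult_l_distr)

lemma finsum_swap:
  assumes "finite I" "finite J" "\<And>i j. i \<in> I \<Longrightarrow> j \<in> J \<Longrightarrow> f i j \<in> carrier A"
  shows "(\<Oplus>i\<in>I. \<Oplus>j\<in>J. f i j) = (\<Oplus>j\<in>J. \<Oplus>i\<in>I. f i j)"
  using assms(1,3)
proof (induction I rule: finite_induct)
  case empty
  then show ?case by (simp add: finsum_zero)
next
  case (insert a I)
  have "(\<Oplus>i\<in>insert a I. \<Oplus>j\<in>J. f i j) = (\<Oplus>j\<in>J. f a j) \<oplus> (\<Oplus>j\<in>J. \<Oplus>i\<in>I. f i j)"
    using insert by (subst finsum_insert) (auto simp: Pi_def intro!: finsum_closed)
  also have "\<dots> = (\<Oplus>j\<in>J. f a j \<oplus> (\<Oplus>i\<in>I. f i j))"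
    using insert by (subst finsum_addf) (auto simp: Pi_def intro!: finsum_closed)
  also have "\<dots> = (\<Oplus>j\<in>J. \<Oplus>i\<in>insert a I. f i j)"
    using insert by (intro finsum_cong') (auto simp: Pi_def intro!: finsum_closed)
  finally show ?case .
qed

lemma finsum_cartesian:
  assumes "finite I" "finite J" "\<And>i j. i \<in> I \<Longrightarrow> j \<in> J \<Longrightarrow> f i j \<in> carrier A"
  shows "(\<Oplus>p\<in>I \<times> J. f (fst p) (snd p)) = (\<Oplus>i\<in>I. \<Oplus>j\<in>J. f i j)"
  using assms(1,3)
proof (induction I rule: finite_induct)
  case (insert a I)
  have "(\<Oplus>p\<in>insert a I \<times> J. f (fst p) (snd p))
      = (\<Oplus>p\<in>Pair a ` J \<union> I \<times> J. f (fst p) (snd p))"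
    by (rule arg_cong[where f = "\<lambda>S. finsum A _ S"]) auto
  also have "\<dots> = (\<Oplus>p\<in>Pair a ` J. f (fst p) (snd p)) \<oplus> (\<Oplus>p\<in>I \<times> J. f (fst p) (snd p))"
    using insert assms(2) by (intro finsum_Un_disjoint) auto
  also have "(\<Oplus>p\<in>Pair a ` J. f (fst p) (snd p)) = (\<Oplus>j\<in>J. f a j)"
    using insert by (subst finsum_reindex) (auto simp: inj_on_def)
  finally show ?case
    using insert by (subst finsum_insert) (auto simp: Pi_def intro!: finsum_closed)
qed simp

lemma finsum_delta:
  assumes "finite I" "i \<in> I" "\<And>j. j \<in> I \<Longrightarrow> j \<noteq> i \<Longrightarrow> f j = \<zero>" "f i \<in> carrier A"
  shows "(\<Oplus>j\<in>I. f j) = f i"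
proof -
  have "(\<Oplus>j\<in>I. f j) = (\<Oplus>j\<in>I. if i = j then f j else \<zero>)"
    using assms by (intro finsum_cong') auto
  also have "\<dots> = f i"
    using assms finsum_singleton[of i I f] by (metis (no_types, lifting) Pi_I assms(3) zero_closed)
  finally show ?thesis .
qed

end

section \<open>Linear maps and algebra maps\<close>

lemma lin_homI:
  assumes "\<And>x. x \<in> carrier A \<Longrightarrow> f x \<in> carrier B"
    "\<And>x y. x \<in> carrier A \<Longrightarrow> y \<in> carrier A \<Longrightarrow> f (x \<oplus>\<^bsub>A\<^esub> y) = f x \<oplus>\<^bsub>B\<^esub> f y"
    "\<And>c x. x \<in> carrier A \<Longrightarrow> f (c \<odot>\<^bsub>A\<^esub> x) = c \<odot>\<^bsub>B\<^esub> f x"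
  shows "f \<in> lin_hom A B"
  using assms by (auto simp: lin_hom_def)

lemma
  assumes "f \<in> lin_hom A B" "x \<in> carrier A"
  shows lin_hom_closed: "f x \<in> carrier B"
    and lin_hom_add: "y \<in> carrier A \<Longrightarrow> f (x \<oplus>\<^bsub>A\<^esub> y) = f x \<oplus>\<^bsub>B\<^esub> f y"
    and lin_hom_smult: "f (c \<odot>\<^bsub>A\<^esub> x) = c \<odot>\<^bsub>B\<^esub> f x"
  using assms by (auto simp: lin_hom_def)

lemma lin_hom_comp: "f \<in> lin_hom A B \<Longrightarrow> g \<in> lin_hom B C \<Longrightarrow> (\<lambda>x. g (f x)) \<in> lin_hom A C"
  by (auto simp: lin_hom_def Pi_def)

lemma lin_hom_id: "(\<lambda>x. x) \<in> lin_hom A A"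
  by (auto simp: lin_hom_def)

lemma (in kalg) lin_hom_zero:
  assumes "kalg B" "f \<in> lin_hom A B"
  shows "f \<zero> = \<zero>\<^bsub>B\<^esub>"
proof -
  interpret B: kalg B by fact
  have "f (0 \<odot> \<zero>) = \<zero>\<^bsub>B\<^esub>"
    unfolding lin_hom_smult[OF assms(2) zero_closed] using lin_hom_closed[OF assms(2)] by simp
  then show ?thesis by simp
qed

lemma (in kalg) lin_hom_finsum:
  assumes "kalg B" "f \<in> lin_hom A B" "g \<in> I \<rightarrow> carrier A"
  shows "f (\<Oplus>i\<in>I. g i) = (\<Oplus>\<^bsub>B\<^esub>i\<in>I. f (g i))"
proof -
  interpret B: kalg B by fact
  show ?thesis using assms(3)
  proof (induction I rule: infinite_finite_induct)
    case (insert x F)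
    then show ?case
      by (subst finsum_insert, simp_all add: Pi_def)
        (subst B.finsum_insert, auto simp: Pi_def lin_hom_add[OF assms(2)] lin_hom_closed[OF assms(2)])
  qed (use lin_hom_zero[OF assms(1,2)] in auto)
qed

lemma (in kalg) lin_hom_minus:
  assumes "kalg B" "f \<in> lin_hom A B" "x \<in> carrier A" "y \<in> carrier A"
  shows "f (x \<ominus> y) = f x \<ominus>\<^bsub>B\<^esub> f y"
proof -
  interpret B: kalg B by fact
  show ?thesis using assms(3,4) lin_hom_closed[OF assms(2)]
    by (simp add: a_minus_def minus_conv_smult B.minus_conv_smult lin_hom_add[OF assms(2)] lin_hom_smult[OF assms(2)])
qed

lemma alg_homI:
  assumes "f \<in> lin_hom A B"
    "\<And>x y. x \<in> carrier A \<Longrightarrow> y \<in> carrier A \<Longrightarrow> f (x \<otimes>\<^bsub>A\<^esub> y) = f x \<otimes>\<^bsub>B\<^esub> f y"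
    "f \<one>\<^bsub>A\<^esub> = \<one>\<^bsub>B\<^esub>"
  shows "f \<in> alg_hom A B"
  using assms by (auto simp: alg_hom_def lin_hom_def Ring.ring_hom_def)

lemma
  assumes "f \<in> alg_hom A B"
  shows alg_hom_lin: "f \<in> lin_hom A B"
    and alg_hom_mult: "x \<in> carrier A \<Longrightarrow> y \<in> carrier A \<Longrightarrow> f (x \<otimes>\<^bsub>A\<^esub> y) = f x \<otimes>\<^bsub>B\<^esub> f y"
    and alg_hom_one: "f \<one>\<^bsub>A\<^esub> = \<one>\<^bsub>B\<^esub>"
  using assms by (auto simp: alg_hom_def Ring.ring_hom_def)

lemma alg_hom_comp: "f \<in> alg_hom A B \<Longrightarrow> g \<in> alg_hom B C \<Longrightarrow> (\<lambda>x. g (f x)) \<in> alg_hom A C"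
  by (rule alg_homI) (auto intro: lin_hom_comp alg_hom_lin
      simp: alg_hom_mult alg_hom_one lin_hom_closed[OF alg_hom_lin])

lemma alg_hom_id: "(\<lambda>x. x) \<in> alg_hom A A"
  by (rule alg_homI) (auto intro: lin_hom_id)

subsection \<open>Linear extension\<close>

lemma lookup_pscale [simp]: "Poly_Mapping.lookup (pscale c u) x = c * Poly_Mapping.lookup u x"
  by (simp add: map.rep_eq when_def)

lemma keys_pscale: "Poly_Mapping.keys (pscale c u) \<subseteq> Poly_Mapping.keys u"
  by (auto simp: in_keys_iff)

text \<open>The common core of \<open>tensor_lift\<close> and \<open>free_eval\<close>: both
  evaluate such an extension on representatives of a coset.\<close>

definition lin_ext :: "('k::field, 'c, 'm) module_scheme \<Rightarrow> ('x \<Rightarrow> 'c) \<Rightarrow> ('x \<Rightarrow>\<^sub>0 'k) \<Rightarrow> 'c" where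
  "lin_ext T \<phi> u = (\<Oplus>\<^bsub>T\<^esub> p\<in>Poly_Mapping.keys u. Poly_Mapping.lookup u p \<odot>\<^bsub>T\<^esub> \<phi> p)"

context kalg
begin

text \<open>Elements with different supports can be compared and added once both are summed over one
  larger finite set, where the extra coefficients vanish.\<close>

lemma lin_ext_superset:
  assumes "finite S" "Poly_Mapping.keys u \<subseteq> S" "\<phi> \<in> S \<rightarrow> carrier A"
  shows "lin_ext A \<phi> u = (\<Oplus> p\<in>S. Poly_Mapping.lookup u p \<odot> \<phi> p)"
  unfolding lin_ext_def
  by (rule add.finprod_mono_neutral_cong_left) (use assms in \<open>auto simp: in_keys_iff Pi_def\<close>)

lemma lin_ext_closed:
  "\<phi> \<in> S \<rightarrow> carrier A \<Longrightarrow> Poly_Mapping.keys u \<subseteq> S \<Longrightarrow> lin_ext A \<phi> u \<in> carrier A"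
  unfolding lin_ext_def by (intro finsum_closed) auto

lemma lin_ext_zero [simp]: "lin_ext A \<phi> 0 = \<zero>"
  by (simp add: lin_ext_def)

lemma lin_ext_single [simp]: "\<phi> x \<in> carrier A \<Longrightarrow> lin_ext A \<phi> (Poly_Mapping.single x c) = c \<odot> \<phi> x"
  by (subst lin_ext_superset[where S = "{x}"]) auto

lemma lin_ext_add:
  assumes "\<phi> \<in> S \<rightarrow> carrier A" "Poly_Mapping.keys u \<subseteq> S" "Poly_Mapping.keys v \<subseteq> S"
  shows "lin_ext A \<phi> (u + v) = lin_ext A \<phi> u \<oplus> lin_ext A \<phi> v"
proof -
  let ?S = "Poly_Mapping.keys u \<union> Poly_Mapping.keys v"
  have 1: "\<phi> \<in> ?S \<rightarrow> carrier A" using assms by auto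
  have "Poly_Mapping.keys (u + v) \<subseteq> ?S" by (rule Poly_Mapping.keys_add)
  then show ?thesis using 1
    by (simp add: lin_ext_superset[where S = ?S] lookup_add smult_l_distr Pi_def flip: finsum_addf cong: finsum_cong')
      (intro finsum_cong', auto simp: smult_l_distr lookup_add)
qed

lemma lin_ext_pscale:
  assumes "\<phi> \<in> S \<rightarrow> carrier A" "Poly_Mapping.keys u \<subseteq> S"
  shows "lin_ext A \<phi> (pscale c u) = c \<odot> lin_ext A \<phi> u"
proof -
  have "\<phi> \<in> Poly_Mapping.keys u \<rightarrow> carrier A" using assms by auto
  then show ?thesis
    by (subst (1 2) lin_ext_superset[where S = "Poly_Mapping.keys u"])
      (auto simp: keys_pscale smult_finsum Pi_def intro!: finsum_cong')
qed

lemma lin_ext_diff: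
  assumes "\<phi> \<in> S \<rightarrow> carrier A" "Poly_Mapping.keys u \<subseteq> S" "Poly_Mapping.keys v \<subseteq> S"
  shows "lin_ext A \<phi> (u - v) = lin_ext A \<phi> u \<ominus> lin_ext A \<phi> v"
proof -
  have "u - v = u + pscale (-1) v" by (rule poly_mapping_eqI) (simp add: lookup_add lookup_minus)
  moreover have "Poly_Mapping.keys (pscale (-1) v) \<subseteq> S"
    by (rule order_trans[OF keys_pscale assms(3)])
  ultimately show ?thesis
    using lin_ext_add[OF assms(1,2), of "pscale (-1) v"] lin_ext_pscale[OF assms(1,3), of "-1"]
      minus_conv_smult[OF lin_ext_closed[OF assms(1,3)]]
    by (simp only: a_minus_def)
qed

lemma lin_ext_sum:
  assumes "\<phi> \<in> S \<rightarrow> carrier A" "finite I" "\<And>i. i \<in> I \<Longrightarrow> Poly_Mapping.keys (u i) \<subseteq> S"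
  shows "lin_ext A \<phi> (\<Sum>i\<in>I. u i) = (\<Oplus>i\<in>I. lin_ext A \<phi> (u i))"
  using assms(2,3)
proof (induction I rule: finite_induct)
  case (insert a I)
  have "Poly_Mapping.keys (sum u I) \<subseteq> S"
    using keys_sum[of u I] insert.prems by blast
  then show ?case
    using insert lin_ext_closed[OF assms(1)]
    by (simp add: lin_ext_add[OF assms(1)] Pi_def)
qed simp

end

lemma poly_mapping_sum_single: "u = (\<Sum>p\<in>Poly_Mapping.keys u. Poly_Mapping.single p (Poly_Mapping.lookup u p))"
  by (rule poly_mapping_eqI) (auto simp: lookup_sum lookup_single when_def in_keys_iff)

subsection \<open>Quotient algebras\<close>

locale kalg_ideal = kalg A + ideal I A
  for A :: "('k::field, 'a) module" (structure) and I
begin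

text \<open>Since c x = (c 1) x, a ring ideal is automatically a subspace; this is what makes the
  quotient ring an algebra.\<close>

lemma smult_in_I: "x \<in> I \<Longrightarrow> c \<odot> x \<in> I"
  using I_l_closed[of x "c \<odot> \<one>"] a_subset by auto

lemma rcos_eq_iff: "x \<in> carrier A \<Longrightarrow> y \<in> carrier A \<Longrightarrow> I +> x = I +> y \<longleftrightarrow> x \<ominus> y \<in> I"
  using quotient_eq_iff_same_a_r_cos ideal_axioms by blast

lemma rcosE: "y \<in> I +> x \<Longrightarrow> \<exists>i\<in>I. y = i \<oplus> x"
  by (auto simp: a_r_coset_def')

lemma rcos_smult: "x \<in> carrier A \<Longrightarrow> (\<Union>y\<in>I +> x. I +> (c \<odot> y)) = I +> (c \<odot> x)"
proof -
  assume x: "x \<in> carrier A"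
  have "I +> (c \<odot> y) = I +> (c \<odot> x)" if "y \<in> I +> x" for y
  proof -
    have y: "y \<in> carrier A" using that x a_r_coset_subset_G[OF a_subset] by blast
    obtain i where i: "i \<in> I" "y = i \<oplus> x" using rcosE \<open>y \<in> I +> x\<close> by blast
    then have "i \<in> carrier A" using a_subset by auto
    then have "y \<ominus> x = i" using i x by (simp add: a_minus_def a_assoc r_neg)
    then have "y \<ominus> x \<in> I" using i by simp
    then have "c \<odot> (y \<ominus> x) \<in> I" by (rule smult_in_I)
    moreover have "c \<odot> (y \<ominus> x) = c \<odot> y \<ominus> c \<odot> x"
      using x y by (simp add: a_minus_def smult_r_distr minus_conv_smult)
    ultimately show ?thesis using x y by (simp add: rcos_eq_iff)
  qed
  moreover have "x \<in> I +> x" using x by (rule a_rcos_self)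
  ultimately show ?thesis by blast
qed

abbreviation "Q \<equiv> quotient_alg A I"

lemma quotient_alg_simps:
  "carrier Q = (+>) I ` carrier A"
  "x \<in> carrier A \<Longrightarrow> y \<in> carrier A \<Longrightarrow> (I +> x) \<otimes>\<^bsub>Q\<^esub> (I +> y) = I +> (x \<otimes> y)"
  "x \<in> carrier A \<Longrightarrow> y \<in> carrier A \<Longrightarrow> (I +> x) \<oplus>\<^bsub>Q\<^esub> (I +> y) = I +> (x \<oplus> y)"
  "\<one>\<^bsub>Q\<^esub> = I +> \<one>" "\<zero>\<^bsub>Q\<^esub> = I +> \<zero>"
  "x \<in> carrier A \<Longrightarrow> c \<odot>\<^bsub>Q\<^esub> (I +> x) = I +> (c \<odot> x)"
proof -
  have "I +> \<zero> = I" using a_rcos_zero[OF ideal_axioms] zero_closed additive_subgroup.zero_closed[OF additive_subgroup_axioms] by blast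
  then show "\<zero>\<^bsub>Q\<^esub> = I +> \<zero>" by (simp add: quotient_alg_def ring.defs FactRing_def)
qed (auto simp: quotient_alg_def ring.defs FactRing_def A_RCOSETS_def' rcoset_mult_add a_rcos_sum rcos_smult)

lemma quotient_kalg: "kalg Q"
proof -
  interpret R: ring "A Quot I" by (rule quotient_is_ring)
  have eqs: "carrier Q = carrier (A Quot I)" "mult Q = mult (A Quot I)" "add Q = add (A Quot I)"
    "one Q = one (A Quot I)" "zero Q = zero (A Quot I)"
    by (simp_all add: quotient_alg_def ring.defs)
  have "ring Q"
    by (intro ringI abelian_groupI monoidI)
      (auto simp: eqs R.a_ac R.m_assoc R.l_distr R.r_distr intro: R.add.l_inv_ex)
  then show ?thesis
    by (intro kalgI k_algebraI)
      (auto simp: quotient_alg_simps smult_l_distr smult_r_distr)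
qed

lemma proj_hom: "(+>) I \<in> alg_hom A Q"
  by (auto intro!: alg_homI lin_homI simp: quotient_alg_simps)

text \<open>A linear map that vanishes on I is constant on cosets, so its image of a coset is a
  singleton. This gives meaning to the \<open>the_elem\<close> in \<open>tensor_lift\<close> and
  \<open>alg_lift\<close>.\<close>

lemma the_elem_coset:
  assumes "kalg T" "x \<in> carrier A" "f \<in> lin_hom A T" "\<And>y. y \<in> I \<Longrightarrow> f y = \<zero>\<^bsub>T\<^esub>"
  shows "the_elem (f ` (I +> x)) = f x"
proof -
  interpret T: kalg T by fact
  have "f y = f x" if "y \<in> I +> x" for y
  proof -
    obtain i where i: "i \<in> I" "y = i \<oplus> x" using rcosE \<open>y \<in> I +> x\<close> by blast
    have "i \<in> carrier A" using i a_subset by auto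
    then show ?thesis using i assms lin_hom_closed[OF assms(3)]
      by (simp add: lin_hom_add[OF assms(3)])
  qed
  moreover have "x \<in> I +> x" using assms(2) by (rule a_rcos_self)
  ultimately have "f ` (I +> x) = {f x}" by blast
  then show ?thesis by simp
qed

lemma the_elem_lin_hom:
  assumes "kalg T" "f \<in> lin_hom A T" "\<And>y. y \<in> I \<Longrightarrow> f y = \<zero>\<^bsub>T\<^esub>"
  shows "(\<lambda>X. the_elem (f ` X)) \<in> lin_hom Q T"
proof -
  have E: "the_elem (f ` (I +> x)) = f x" if "x \<in> carrier A" for x
    by (rule the_elem_coset[OF assms(1) that assms(2,3)])
  show ?thesis
    by (rule lin_homI) (auto simp: E quotient_alg_simps lin_hom_add[OF assms(2)]
        lin_hom_smult[OF assms(2)] lin_hom_closed[OF assms(2)])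
qed

lemma the_elem_alg_hom:
  assumes "kalg T" "f \<in> alg_hom A T" "\<And>y. y \<in> I \<Longrightarrow> f y = \<zero>\<^bsub>T\<^esub>"
  shows "(\<lambda>X. the_elem (f ` X)) \<in> alg_hom Q T"
proof -
  have E: "the_elem (f ` (I +> x)) = f x" if "x \<in> carrier A" for x
    by (rule the_elem_coset[OF assms(1) that alg_hom_lin[OF assms(2)] assms(3)])
  show ?thesis
    by (rule alg_homI[OF the_elem_lin_hom[OF assms(1) alg_hom_lin[OF assms(2)] assms(3)]])
      (auto simp: E quotient_alg_simps alg_hom_mult[OF assms(2)] alg_hom_one[OF assms(2)])
qed

end

subsection \<open>Bilinear extension of a multiplication of basis elements\<close>

interpretation pm: vector_space "pscale :: 'k::field \<Rightarrow> ('x \<Rightarrow>\<^sub>0 'k) \<Rightarrow> ('x \<Rightarrow>\<^sub>0 'k)"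
  by unfold_locales (auto intro!: poly_mapping_eqI simp: lookup_add algebra_simps)

lemma pscale_single [simp]: "pscale c (Poly_Mapping.single x d) = Poly_Mapping.single x (c * d)"
  by (rule poly_mapping_eqI) (auto simp: lookup_single when_def)

lemma keys_induct [consumes 1, case_names zero single add]:
  fixes u :: "'x \<Rightarrow>\<^sub>0 'k::field"
  assumes "Poly_Mapping.keys u \<subseteq> S" "P 0"
    and single: "\<And>p c. p \<in> S \<Longrightarrow> P (Poly_Mapping.single p c)"
    and plus: "\<And>u v. Poly_Mapping.keys u \<subseteq> S \<Longrightarrow> Poly_Mapping.keys v \<subseteq> S \<Longrightarrow> P u \<Longrightarrow> P v \<Longrightarrow> P (u + v)"
  shows "P u"
proof -
  \<comment> \<open>The support bound is carried through the induction because the hypothesis on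
    sums asks for it.\<close>
  have "P (\<Sum>p\<in>K. Poly_Mapping.single p (Poly_Mapping.lookup u p)) \<and>
      Poly_Mapping.keys (\<Sum>p\<in>K. Poly_Mapping.single p (Poly_Mapping.lookup u p)) \<subseteq> S"
    if "finite K" "K \<subseteq> S" for K
    using that
  proof (induction K rule: finite_induct)
    case (insert p K)
    let ?r = "\<Sum>p\<in>K. Poly_Mapping.single p (Poly_Mapping.lookup u p)"
    have "Poly_Mapping.keys (Poly_Mapping.single p (Poly_Mapping.lookup u p)) \<subseteq> S"
      using insert by auto
    moreover have "Poly_Mapping.keys (Poly_Mapping.single p (Poly_Mapping.lookup u p) + ?r) \<subseteq> S"
      using insert calculation Poly_Mapping.keys_add[of "Poly_Mapping.single p (Poly_Mapping.lookup u p)" ?r]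
      by blast
    moreover have "P (Poly_Mapping.single p (Poly_Mapping.lookup u p))" using insert by (intro single) auto
    ultimately show ?case using insert plus[of "Poly_Mapping.single p (Poly_Mapping.lookup u p)" ?r] by simp
  qed (use assms in auto)
  from this[OF finite_keys assms(1)] show ?thesis
    by (subst poly_mapping_sum_single) simp
qed

text \<open>The bilinear extension of a product of basis elements. It covers both the multiplication
  of \<open>free_tensor\<close> and the convolution product on words (\<open>mult_eq_bil\<close>),
  so associativity and units are proved once.\<close>

definition bil :: "('x \<Rightarrow> 'y \<Rightarrow> 'z) \<Rightarrow> ('x \<Rightarrow>\<^sub>0 'k::field) \<Rightarrow> ('y \<Rightarrow>\<^sub>0 'k) \<Rightarrow> ('z \<Rightarrow>\<^sub>0 'k)" where
  "bil \<mu> u v = (\<Sum>p\<in>Poly_Mapping.keys u. \<Sum>q\<in>Poly_Mapping.keys v.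
     Poly_Mapping.single (\<mu> p q) (Poly_Mapping.lookup u p * Poly_Mapping.lookup v q))"

lemma bil_superset:
  assumes "finite S" "finite R" "Poly_Mapping.keys u \<subseteq> S" "Poly_Mapping.keys v \<subseteq> R"
  shows "bil \<mu> u v = (\<Sum>p\<in>S. \<Sum>q\<in>R. Poly_Mapping.single (\<mu> p q) (Poly_Mapping.lookup u p * Poly_Mapping.lookup v q))"
proof -
  have "bil \<mu> u v = (\<Sum>p\<in>Poly_Mapping.keys u. \<Sum>q\<in>R. Poly_Mapping.single (\<mu> p q) (Poly_Mapping.lookup u p * Poly_Mapping.lookup v q))"
    unfolding bil_def by (intro sum.cong refl sum.mono_neutral_left) (use assms in \<open>auto simp: in_keys_iff\<close>)
  also have "\<dots> = (\<Sum>p\<in>S. \<Sum>q\<in>R. Poly_Mapping.single (\<mu> p q) (Poly_Mapping.lookup u p * Poly_Mapping.lookup v q))"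
    by (intro sum.mono_neutral_left) (use assms in \<open>auto simp: in_keys_iff\<close>)
  finally show ?thesis .
qed

lemma bil_zero [simp]: "bil \<mu> 0 v = 0" "bil \<mu> u 0 = 0"
  by (simp_all add: bil_def)

lemma bil_single [simp]:
  "bil \<mu> (Poly_Mapping.single p a) (Poly_Mapping.single q b) = Poly_Mapping.single (\<mu> p q) (a * b)"
  by (subst bil_superset[where S = "{p}" and R = "{q}"]) auto

lemma bil_add_left: "bil \<mu> (u + u') v = bil \<mu> u v + bil \<mu> u' v"
proof -
  let ?S = "Poly_Mapping.keys u \<union> Poly_Mapping.keys u'"
  show ?thesis using Poly_Mapping.keys_add[of u u']
    by (simp add: bil_superset[where S = ?S and R = "Poly_Mapping.keys v"] lookup_add
        distrib_right single_add sum.distrib)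
qed

lemma bil_add_right: "bil \<mu> u (v + v') = bil \<mu> u v + bil \<mu> u v'"
proof -
  let ?S = "Poly_Mapping.keys v \<union> Poly_Mapping.keys v'"
  show ?thesis using Poly_Mapping.keys_add[of v v']
    by (simp add: bil_superset[where R = ?S and S = "Poly_Mapping.keys u"] lookup_add
        distrib_left single_add sum.distrib)
qed

lemma bil_pscale: "bil \<mu> (pscale c u) v = pscale c (bil \<mu> u v)" "bil \<mu> u (pscale c v) = pscale c (bil \<mu> u v)"
proof -
  show "bil \<mu> (pscale c u) v = pscale c (bil \<mu> u v)"
    using keys_pscale[of c u]
    by (simp add: bil_superset[where S = "Poly_Mapping.keys u" and R = "Poly_Mapping.keys v"]
        pm.scale_sum_right mult.assoc)
  show "bil \<mu> u (pscale c v) = pscale c (bil \<mu> u v)"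
    using keys_pscale[of c v]
    by (simp add: bil_superset[where S = "Poly_Mapping.keys u" and R = "Poly_Mapping.keys v"]
        pm.scale_sum_right mult.left_commute)
qed

lemma bil_uminus: "bil \<mu> (- u) v = - bil \<mu> u v" "bil \<mu> u (- v) = - bil \<mu> u v"
proof -
  have m: "- w = pscale (-1) w" for w :: "'x \<Rightarrow>\<^sub>0 'k::field" by simp
  show "bil \<mu> (- u) v = - bil \<mu> u v" "bil \<mu> u (- v) = - bil \<mu> u v"
    unfolding m bil_pscale by (rule refl)+
qed

lemma bil_diff: "bil \<mu> (u - u') v = bil \<mu> u v - bil \<mu> u' v" "bil \<mu> u (v - v') = bil \<mu> u v - bil \<mu> u v'"
  using bil_add_left[of \<mu> u "- u'" v] bil_add_right[of \<mu> u v "- v'"] by (simp_all add: bil_uminus)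

lemma keys_add_subset:
  "Poly_Mapping.keys u \<subseteq> S \<Longrightarrow> Poly_Mapping.keys v \<subseteq> S \<Longrightarrow> Poly_Mapping.keys (u + v) \<subseteq> S"
  using Poly_Mapping.keys_add[of u v] by blast

lemma keys_diffD: "p \<in> Poly_Mapping.keys (u - v) \<Longrightarrow> p \<in> Poly_Mapping.keys u \<or> p \<in> Poly_Mapping.keys v"
  by (auto simp: in_keys_iff lookup_minus)

lemma keys_bil:
  assumes "Poly_Mapping.keys u \<subseteq> S" "Poly_Mapping.keys v \<subseteq> R" "\<And>p q. p \<in> S \<Longrightarrow> q \<in> R \<Longrightarrow> \<mu> p q \<in> W"
  shows "Poly_Mapping.keys (bil \<mu> u v) \<subseteq> W"
  using assms(1)
proof (induction rule: keys_induct)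
  case (single p c)
  show ?case using assms(2)
    by (induction rule: keys_induct) (use single assms(3) in \<open>auto simp: bil_add_right keys_add_subset\<close>)
qed (auto simp: bil_add_left keys_add_subset)

lemma bil_assoc:
  assumes "Poly_Mapping.keys u \<subseteq> S" "Poly_Mapping.keys v \<subseteq> S" "Poly_Mapping.keys w \<subseteq> S"
    and "\<And>p q r. p \<in> S \<Longrightarrow> q \<in> S \<Longrightarrow> r \<in> S \<Longrightarrow> \<mu> (\<mu> p q) r = \<mu> p (\<mu> q r)"
  shows "bil \<mu> (bil \<mu> u v) w = bil \<mu> u (bil \<mu> v w)"
  using assms(1)
proof (induction rule: keys_induct)
  case u: (single p c)
  show ?case using assms(2)
  proof (induction rule: keys_induct)
    case v: (single q d)
    show ?case using assms(3)
      by (induction rule: keys_induct) (use u v assms(4) in \<open>auto simp: bil_add_right mult.assoc\<close>)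
  qed (auto simp: bil_add_left bil_add_right)
qed (auto simp: bil_add_left)

lemma bil_unit:
  assumes "Poly_Mapping.keys u \<subseteq> S"
  shows "(\<And>p. p \<in> S \<Longrightarrow> \<mu> e p = p) \<Longrightarrow> bil \<mu> (Poly_Mapping.single e 1) u = u"
    and "(\<And>p. p \<in> S \<Longrightarrow> \<mu> p e = p) \<Longrightarrow> bil \<mu> u (Poly_Mapping.single e 1) = u"
  using assms by (induction rule: keys_induct; simp add: bil_add_left bil_add_right)+

subsection \<open>Tensor products\<close>

locale kalg2 = A: kalg A + B: kalg B
  for A :: "('k::field, 'a, 'm) module_scheme" and B :: "('k, 'b, 'n) module_scheme"
begin

abbreviation "tmul \<equiv> \<lambda>p q. (fst p \<otimes>\<^bsub>A\<^esub> fst q, snd p \<otimes>\<^bsub>B\<^esub> snd q)"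

lemma free_tensor_simps:
  "carrier (free_tensor A B) = {u. Poly_Mapping.keys u \<subseteq> carrier A \<times> carrier B}"
  "mult (free_tensor A B) = bil tmul"
  "one (free_tensor A B) = Poly_Mapping.single (\<one>\<^bsub>A\<^esub>, \<one>\<^bsub>B\<^esub>) 1"
  "zero (free_tensor A B) = 0" "add (free_tensor A B) = (+)" "smult (free_tensor A B) = pscale"
  by (simp_all add: free_tensor_def bil_def fun_eq_iff)

lemma free_tensor_kalg: "kalg (free_tensor A B)"
proof (intro kalgI k_algebraI ringI abelian_groupI monoidI)
  fix x assume "x \<in> carrier (free_tensor A B)"
  then show "\<exists>y\<in>carrier (free_tensor A B). y \<oplus>\<^bsub>free_tensor A B\<^esub> x = \<zero>\<^bsub>free_tensor A B\<^esub>"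
    by (intro bexI[of _ "- x"]) (auto simp: free_tensor_simps)
next
  fix x y assume "x \<in> carrier (free_tensor A B)" "y \<in> carrier (free_tensor A B)"
  then show "x \<otimes>\<^bsub>free_tensor A B\<^esub> y \<in> carrier (free_tensor A B)"
    unfolding free_tensor_simps mem_Collect_eq by (rule keys_bil) auto
next
  fix x y z assume "x \<in> carrier (free_tensor A B)" "y \<in> carrier (free_tensor A B)" "z \<in> carrier (free_tensor A B)"
  then show "x \<otimes>\<^bsub>free_tensor A B\<^esub> y \<otimes>\<^bsub>free_tensor A B\<^esub> z = x \<otimes>\<^bsub>free_tensor A B\<^esub> (y \<otimes>\<^bsub>free_tensor A B\<^esub> z)"
    unfolding free_tensor_simps mem_Collect_eq
    by (rule bil_assoc) (auto simp: A.m_assoc B.m_assoc)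
next
  fix x assume "x \<in> carrier (free_tensor A B)"
  then show "\<one>\<^bsub>free_tensor A B\<^esub> \<otimes>\<^bsub>free_tensor A B\<^esub> x = x"
    unfolding free_tensor_simps mem_Collect_eq by (rule bil_unit) auto
next
  fix x assume "x \<in> carrier (free_tensor A B)"
  then show "x \<otimes>\<^bsub>free_tensor A B\<^esub> \<one>\<^bsub>free_tensor A B\<^esub> = x"
    unfolding free_tensor_simps mem_Collect_eq by (rule bil_unit) auto
qed (simp_all add: free_tensor_simps bil_add_left bil_add_right bil_pscale pm.scale_left_distrib
    pm.scale_right_distrib add_ac keys_add_subset order_trans[OF keys_pscale])

sublocale F: kalg "free_tensor A B" by (rule free_tensor_kalg)

lemma tensor_kernel_eq: "tensor_kernel A B = pm.span (bilinear_relations A B)"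
  by (simp add: tensor_kernel_def)

lemma kernel_subset: "tensor_kernel A B \<subseteq> carrier (free_tensor A B)"
  unfolding tensor_kernel_eq
proof (rule pm.span_minimal)
  show "bilinear_relations A B \<subseteq> carrier (free_tensor A B)"
    by (auto simp: bilinear_relations_def free_tensor_simps dest!: keys_diffD split: if_splits)
  show "pm.subspace (carrier (free_tensor A B))"
    by (rule pm.subspaceI) (simp_all add: free_tensor_simps keys_add_subset order_trans[OF keys_pscale])
qed

lemma
  assumes "a \<in> carrier A" "b \<in> carrier B"
  shows kernel_add_l: "a' \<in> carrier A \<Longrightarrow> Poly_Mapping.single (a \<oplus>\<^bsub>A\<^esub> a', b) c
      - Poly_Mapping.single (a, b) c - Poly_Mapping.single (a', b) c \<in> tensor_kernel A B"
    and kernel_add_r: "b' \<in> carrier B \<Longrightarrow> Poly_Mapping.single (a, b \<oplus>\<^bsub>B\<^esub> b') c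
      - Poly_Mapping.single (a, b) c - Poly_Mapping.single (a, b') c \<in> tensor_kernel A B"
    and kernel_smult_l: "Poly_Mapping.single (d \<odot>\<^bsub>A\<^esub> a, b) c - Poly_Mapping.single (a, b) (c * d) \<in> tensor_kernel A B"
    and kernel_smult_r: "Poly_Mapping.single (a, d \<odot>\<^bsub>B\<^esub> b) c - Poly_Mapping.single (a, b) (c * d) \<in> tensor_kernel A B"
proof -
  have sp: "pscale c s \<in> tensor_kernel A B" if "s \<in> bilinear_relations A B" for s
    unfolding tensor_kernel_eq by (intro pm.span_scale pm.span_base that)
  show "Poly_Mapping.single (a \<oplus>\<^bsub>A\<^esub> a', b) c
      - Poly_Mapping.single (a, b) c - Poly_Mapping.single (a', b) c \<in> tensor_kernel A B" if "a' \<in> carrier A"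
    using sp[of "Poly_Mapping.single (a \<oplus>\<^bsub>A\<^esub> a', b) 1 - Poly_Mapping.single (a, b) 1 - Poly_Mapping.single (a', b) 1"]
      assms that by (force simp: bilinear_relations_def pm.scale_right_diff_distrib)
  show "Poly_Mapping.single (a, b \<oplus>\<^bsub>B\<^esub> b') c
      - Poly_Mapping.single (a, b) c - Poly_Mapping.single (a, b') c \<in> tensor_kernel A B" if "b' \<in> carrier B"
    using sp[of "Poly_Mapping.single (a, b \<oplus>\<^bsub>B\<^esub> b') 1 - Poly_Mapping.single (a, b) 1 - Poly_Mapping.single (a, b') 1"]
      assms that by (force simp: bilinear_relations_def pm.scale_right_diff_distrib)
  show "Poly_Mapping.single (d \<odot>\<^bsub>A\<^esub> a, b) c - Poly_Mapping.single (a, b) (c * d) \<in> tensor_kernel A B"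
    using sp[of "Poly_Mapping.single (d \<odot>\<^bsub>A\<^esub> a, b) 1 - Poly_Mapping.single (a, b) d"]
      assms by (force simp: bilinear_relations_def pm.scale_right_diff_distrib)
  show "Poly_Mapping.single (a, d \<odot>\<^bsub>B\<^esub> b) c - Poly_Mapping.single (a, b) (c * d) \<in> tensor_kernel A B"
    using sp[of "Poly_Mapping.single (a, d \<odot>\<^bsub>B\<^esub> b) 1 - Poly_Mapping.single (a, b) d"]
      assms by (force simp: bilinear_relations_def pm.scale_right_diff_distrib)
qed

text \<open>By distributivity in A or B, a bilinearity relation times a single tensor is again a
  relation, up to a scalar. Hence the span of the relations is an ideal and the tensor product
  inherits a multiplication.\<close>

lemma relation_mult:
  assumes "r \<in> bilinear_relations A B" "x \<in> carrier A" "y \<in> carrier B"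
  shows "bil tmul r (Poly_Mapping.single (x, y) c) \<in> tensor_kernel A B"
    "bil tmul (Poly_Mapping.single (x, y) c) r \<in> tensor_kernel A B"
  using assms unfolding bilinear_relations_def
  by (auto simp: bil_diff A.l_distr A.r_distr B.l_distr B.r_distr
      intro!: kernel_add_l kernel_add_r kernel_smult_l kernel_smult_r[where d = d for d])
    (auto simp: mult.commute[of _ c] intro!: kernel_smult_l kernel_smult_r)

lemma kernel_add: "u \<in> tensor_kernel A B \<Longrightarrow> v \<in> tensor_kernel A B \<Longrightarrow> u + v \<in> tensor_kernel A B"
  unfolding tensor_kernel_eq by (rule pm.span_add)

lemma kernel_mult:
  assumes "Poly_Mapping.keys v \<subseteq> carrier A \<times> carrier B" "u \<in> tensor_kernel A B"
  shows "bil tmul u v \<in> tensor_kernel A B \<and> bil tmul v u \<in> tensor_kernel A B"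
  using assms(1)
proof (induction rule: keys_induct)
  case zero
  then show ?case by (simp add: tensor_kernel_eq pm.span_zero)
next
  case (single p c)
  obtain x y where p: "p = (x, y)" "x \<in> carrier A" "y \<in> carrier B" using single by auto
  show ?case using assms(2) unfolding tensor_kernel_eq
  proof (induction rule: pm.span_induct_alt)
    case base
    then show ?case by (simp add: pm.span_zero)
  next
    case (step d r u)
    then show ?case
      using relation_mult[of r x y c, folded tensor_kernel_eq] p
      by (simp add: bil_add_left bil_add_right bil_pscale pm.span_add pm.span_scale tensor_kernel_eq)
  qed
qed (auto simp: bil_add_left bil_add_right kernel_add)

lemma kernel_ideal: "ideal (tensor_kernel A B) (free_tensor A B)"
proof (rule idealI)
  show "subgroup (tensor_kernel A B) (add_monoid (free_tensor A B))"
  proof (rule F.add.subgroupI)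
    show "tensor_kernel A B \<noteq> {}" unfolding tensor_kernel_eq using pm.span_zero by blast
    fix u v assume uv: "u \<in> tensor_kernel A B" "v \<in> tensor_kernel A B"
    then show "u \<oplus>\<^bsub>free_tensor A B\<^esub> v \<in> tensor_kernel A B"
      by (simp add: free_tensor_simps kernel_add)
    have "\<ominus>\<^bsub>free_tensor A B\<^esub> u = pscale (-1) u"
      using uv kernel_subset by (subst F.minus_conv_smult) (auto simp: free_tensor_simps)
    then show "\<ominus>\<^bsub>free_tensor A B\<^esub> u \<in> tensor_kernel A B"
      using uv(1) unfolding tensor_kernel_eq by (simp add: pm.span_neg)
  qed (use kernel_subset in auto)
qed (use kernel_mult F.ring_axioms in \<open>auto simp: free_tensor_simps\<close>)

sublocale I: kalg_ideal "free_tensor A B" "tensor_kernel A B"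
  by (simp add: kalg_ideal_def kernel_ideal free_tensor_kalg)

lemma tensor_kalg: "kalg (tensor A B)"
  unfolding tensor_def by (rule I.quotient_kalg)

sublocale T: kalg "tensor A B" by (rule tensor_kalg)

lemma tensor_carrier_repr:
  "t \<in> carrier (tensor A B) \<longleftrightarrow>
     (\<exists>u. Poly_Mapping.keys u \<subseteq> carrier A \<times> carrier B \<and> t = tensor_kernel A B +>\<^bsub>free_tensor A B\<^esub> u)"
  by (auto simp: tensor_def I.quotient_alg_simps free_tensor_simps)

lemma coset_eq:
  assumes "u \<in> carrier (free_tensor A B)" "v \<in> carrier (free_tensor A B)" "u - v \<in> tensor_kernel A B"
  shows "tensor_kernel A B +>\<^bsub>free_tensor A B\<^esub> u = tensor_kernel A B +>\<^bsub>free_tensor A B\<^esub> v"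
proof -
  have "u \<ominus>\<^bsub>free_tensor A B\<^esub> v = u - v"
    using assms(2) F.minus_conv_smult[of v]
    by (simp add: a_minus_def free_tensor_simps)
  then show ?thesis using assms by (simp add: I.rcos_eq_iff)
qed

lemma coset_closed: "u \<in> carrier (free_tensor A B) \<Longrightarrow>
    tensor_kernel A B +>\<^bsub>free_tensor A B\<^esub> u \<in> carrier (tensor A B)"
  by (simp add: tensor_def I.quotient_alg_simps)

lemma single_closed:
  "a \<in> carrier A \<Longrightarrow> b \<in> carrier B \<Longrightarrow> Poly_Mapping.single (a, b) c \<in> carrier (free_tensor A B)"
  by (auto simp: free_tensor_simps)

lemma pure_closed [simp, intro]:
  "a \<in> carrier A \<Longrightarrow> b \<in> carrier B \<Longrightarrow> pure_tensor A B a b \<in> carrier (tensor A B)"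
  by (auto simp: tensor_carrier_repr pure_tensor_def intro!: exI[of _ "Poly_Mapping.single (a, b) 1"])

lemma tensor_coset_simps:
  "u \<in> carrier (free_tensor A B) \<Longrightarrow> v \<in> carrier (free_tensor A B) \<Longrightarrow>
    (tensor_kernel A B +>\<^bsub>free_tensor A B\<^esub> u) \<oplus>\<^bsub>tensor A B\<^esub> (tensor_kernel A B +>\<^bsub>free_tensor A B\<^esub> v)
      = tensor_kernel A B +>\<^bsub>free_tensor A B\<^esub> (u + v)"
  "u \<in> carrier (free_tensor A B) \<Longrightarrow>
    c \<odot>\<^bsub>tensor A B\<^esub> (tensor_kernel A B +>\<^bsub>free_tensor A B\<^esub> u)
      = tensor_kernel A B +>\<^bsub>free_tensor A B\<^esub> pscale c u"
  using I.quotient_alg_simps(3,6) by (simp_all add: tensor_def free_tensor_simps(5,6))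

lemma pure_smult_l:
  assumes "a \<in> carrier A" "b \<in> carrier B"
  shows "pure_tensor A B (c \<odot>\<^bsub>A\<^esub> a) b = c \<odot>\<^bsub>tensor A B\<^esub> pure_tensor A B a b"
  unfolding pure_tensor_def tensor_coset_simps(2)[OF single_closed[OF assms]]
  by (rule coset_eq) (use kernel_smult_l[OF assms, of c 1] assms in \<open>simp_all add: single_closed\<close>)

lemma pure_smult_r:
  assumes "a \<in> carrier A" "b \<in> carrier B"
  shows "pure_tensor A B a (c \<odot>\<^bsub>B\<^esub> b) = c \<odot>\<^bsub>tensor A B\<^esub> pure_tensor A B a b"
  unfolding pure_tensor_def tensor_coset_simps(2)[OF single_closed[OF assms]]
  by (rule coset_eq) (use kernel_smult_r[OF assms, of c 1] assms in \<open>simp_all add: single_closed\<close>)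

lemma pure_add_l:
  assumes "a \<in> carrier A" "a' \<in> carrier A" "b \<in> carrier B"
  shows "pure_tensor A B (a \<oplus>\<^bsub>A\<^esub> a') b = pure_tensor A B a b \<oplus>\<^bsub>tensor A B\<^esub> pure_tensor A B a' b"
  unfolding pure_tensor_def tensor_coset_simps(1)[OF single_closed[OF assms(1,3)] single_closed[OF assms(2,3)]]
  by (rule coset_eq) (use kernel_add_l[OF assms(1,3,2), of 1] assms in
    \<open>simp_all add: single_closed diff_diff_eq F.a_closed[unfolded free_tensor_simps(5)]\<close>)

lemma pure_add_r:
  assumes "a \<in> carrier A" "b \<in> carrier B" "b' \<in> carrier B"
  shows "pure_tensor A B a (b \<oplus>\<^bsub>B\<^esub> b') = pure_tensor A B a b \<oplus>\<^bsub>tensor A B\<^esub> pure_tensor A B a b'"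
  unfolding pure_tensor_def tensor_coset_simps(1)[OF single_closed[OF assms(1,2)] single_closed[OF assms(1,3)]]
  by (rule coset_eq) (use kernel_add_r[OF assms(1,2,3), of 1] assms in
    \<open>simp_all add: single_closed diff_diff_eq F.a_closed[unfolded free_tensor_simps(5)]\<close>)

lemma pure_zero_l [simp]: "b \<in> carrier B \<Longrightarrow> pure_tensor A B \<zero>\<^bsub>A\<^esub> b = \<zero>\<^bsub>tensor A B\<^esub>"
  using pure_smult_l[of "\<zero>\<^bsub>A\<^esub>" b 0] by simp

lemma pure_zero_r [simp]: "a \<in> carrier A \<Longrightarrow> pure_tensor A B a \<zero>\<^bsub>B\<^esub> = \<zero>\<^bsub>tensor A B\<^esub>"
  using pure_smult_r[of a "\<zero>\<^bsub>B\<^esub>" 0] by simp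

lemma pure_mult [simp]:
  assumes "a \<in> carrier A" "b \<in> carrier B" "a' \<in> carrier A" "b' \<in> carrier B"
  shows "pure_tensor A B a b \<otimes>\<^bsub>tensor A B\<^esub> pure_tensor A B a' b'
    = pure_tensor A B (a \<otimes>\<^bsub>A\<^esub> a') (b \<otimes>\<^bsub>B\<^esub> b')"
  unfolding pure_tensor_def tensor_def
  by (subst I.quotient_alg_simps) (use assms in \<open>simp_all add: single_closed free_tensor_simps(2)\<close>)

lemma tensor_one: "\<one>\<^bsub>tensor A B\<^esub> = pure_tensor A B \<one>\<^bsub>A\<^esub> \<one>\<^bsub>B\<^esub>"
  by (simp add: tensor_def I.quotient_alg_simps pure_tensor_def free_tensor_simps(3))

text \<open>Coefficients are absorbed into the left factor, so no case for scalar multiples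
  arises.\<close>

lemma tensor_induct [consumes 1, case_names pure add]:
  assumes "t \<in> carrier (tensor A B)"
    and pure: "\<And>a b. a \<in> carrier A \<Longrightarrow> b \<in> carrier B \<Longrightarrow> P (pure_tensor A B a b)"
    and plus: "\<And>s t. s \<in> carrier (tensor A B) \<Longrightarrow> t \<in> carrier (tensor A B) \<Longrightarrow> P s \<Longrightarrow> P t \<Longrightarrow> P (s \<oplus>\<^bsub>tensor A B\<^esub> t)"
  shows "P t"
proof -
  obtain u where u: "Poly_Mapping.keys u \<subseteq> carrier A \<times> carrier B" "t = tensor_kernel A B +>\<^bsub>free_tensor A B\<^esub> u"
    using assms(1) by (auto simp: tensor_carrier_repr)
  have sgl: "P (tensor_kernel A B +>\<^bsub>free_tensor A B\<^esub> Poly_Mapping.single (a, b) c)"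
    if "a \<in> carrier A" "b \<in> carrier B" for a b c
  proof -
    have "tensor_kernel A B +>\<^bsub>free_tensor A B\<^esub> Poly_Mapping.single (a, b) c = pure_tensor A B (c \<odot>\<^bsub>A\<^esub> a) b"
      using that tensor_coset_simps(2)[OF single_closed[OF that, of 1], of c]
      by (subst pure_smult_l) (simp_all add: pure_tensor_def)
    then show ?thesis using that pure by simp
  qed
  show ?thesis unfolding u(2) using u(1)
  proof (induction rule: keys_induct)
    case zero
    then show ?case using sgl[OF A.zero_closed B.zero_closed, of 0] by simp
  next
    case (single p c)
    then show ?case using sgl[of "fst p" "snd p" c] by auto
  next
    case (add u v)
    then show ?case
      by (subst tensor_coset_simps(1)[symmetric]) (auto intro!: plus coset_closed simp: free_tensor_simps)
  qed
qed

end

definition bilin :: "('k::field, 'a, 'm) module_scheme \<Rightarrow> ('k, 'b, 'n) module_scheme \<Rightarrow>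
    ('k, 'c, 'l) module_scheme \<Rightarrow> ('a \<Rightarrow> 'b \<Rightarrow> 'c) \<Rightarrow> bool" where
  "bilin A B T \<phi> \<longleftrightarrow> (\<forall>a\<in>carrier A. (\<lambda>b. \<phi> a b) \<in> lin_hom B T) \<and> (\<forall>b\<in>carrier B. (\<lambda>a. \<phi> a b) \<in> lin_hom A T)"

lemma
  assumes "bilin A B T \<phi>" "a \<in> carrier A" "b \<in> carrier B"
  shows bilin_closed: "\<phi> a b \<in> carrier T"
    and bilin_add_l: "a' \<in> carrier A \<Longrightarrow> \<phi> (a \<oplus>\<^bsub>A\<^esub> a') b = \<phi> a b \<oplus>\<^bsub>T\<^esub> \<phi> a' b"
    and bilin_add_r: "b' \<in> carrier B \<Longrightarrow> \<phi> a (b \<oplus>\<^bsub>B\<^esub> b') = \<phi> a b \<oplus>\<^bsub>T\<^esub> \<phi> a b'"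
    and bilin_smult_l: "\<phi> (c \<odot>\<^bsub>A\<^esub> a) b = c \<odot>\<^bsub>T\<^esub> \<phi> a b"
    and bilin_smult_r: "\<phi> a (c \<odot>\<^bsub>B\<^esub> b) = c \<odot>\<^bsub>T\<^esub> \<phi> a b"
  using assms by (auto simp: bilin_def lin_hom_def)

lemma bilinI:
  assumes "\<And>a b. a \<in> carrier A \<Longrightarrow> b \<in> carrier B \<Longrightarrow> \<phi> a b \<in> carrier T"
    "\<And>a a' b. a \<in> carrier A \<Longrightarrow> a' \<in> carrier A \<Longrightarrow> b \<in> carrier B \<Longrightarrow> \<phi> (a \<oplus>\<^bsub>A\<^esub> a') b = \<phi> a b \<oplus>\<^bsub>T\<^esub> \<phi> a' b"
    "\<And>a b b'. a \<in> carrier A \<Longrightarrow> b \<in> carrier B \<Longrightarrow> b' \<in> carrier B \<Longrightarrow> \<phi> a (b \<oplus>\<^bsub>B\<^esub> b') = \<phi> a b \<oplus>\<^bsub>T\<^esub> \<phi> a b'"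
    "\<And>a b c. a \<in> carrier A \<Longrightarrow> b \<in> carrier B \<Longrightarrow> \<phi> (c \<odot>\<^bsub>A\<^esub> a) b = c \<odot>\<^bsub>T\<^esub> \<phi> a b"
    "\<And>a b c. a \<in> carrier A \<Longrightarrow> b \<in> carrier B \<Longrightarrow> \<phi> a (c \<odot>\<^bsub>B\<^esub> b) = c \<odot>\<^bsub>T\<^esub> \<phi> a b"
  shows "bilin A B T \<phi>"
  using assms by (auto simp: bilin_def intro!: lin_homI)

context kalg2
begin

lemma bilin_pure: "bilin A B (tensor A B) (pure_tensor A B)"
  by (rule bilinI) (auto simp: pure_add_l pure_add_r pure_smult_l pure_smult_r)

lemma pure_lin_l: "b \<in> carrier B \<Longrightarrow> (\<lambda>a. pure_tensor A B a b) \<in> lin_hom A (tensor A B)"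
  using bilin_pure by (auto simp: bilin_def)

lemma pure_lin_r: "a \<in> carrier A \<Longrightarrow> (\<lambda>b. pure_tensor A B a b) \<in> lin_hom B (tensor A B)"
  using bilin_pure by (auto simp: bilin_def)

text \<open>The universal property of the tensor product: the linear extension of a bilinear map
  kills every bilinearity relation, hence their span.\<close>

lemma
  assumes "kalg T" "bilin A B T \<phi>"
  shows tensor_lift_lin: "tensor_lift T \<phi> \<in> lin_hom (tensor A B) T"
    and tensor_lift_pure: "a \<in> carrier A \<Longrightarrow> b \<in> carrier B \<Longrightarrow> tensor_lift T \<phi> (pure_tensor A B a b) = \<phi> a b"
proof -
  interpret X: kalg T by fact
  let ?\<phi> = "\<lambda>p. \<phi> (fst p) (snd p)"
  have \<phi>: "?\<phi> \<in> carrier A \<times> carrier B \<rightarrow> carrier T"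
    using bilin_closed[OF assms(2)] by auto
  have eq: "tensor_lift T \<phi> = (\<lambda>X. the_elem (lin_ext T ?\<phi> ` X))"
    by (simp add: fun_eq_iff tensor_lift_def lin_ext_def[abs_def])
  have lin: "lin_ext T ?\<phi> \<in> lin_hom (free_tensor A B) T"
    using X.lin_ext_closed[OF \<phi>] X.lin_ext_add[OF \<phi>] X.lin_ext_pscale[OF \<phi>]
    by (intro lin_homI) (auto simp: free_tensor_simps)
  have ker: "lin_ext T ?\<phi> u = \<zero>\<^bsub>T\<^esub>" if "u \<in> tensor_kernel A B" for u
  proof -
    have "tensor_kernel A B \<subseteq> {u. Poly_Mapping.keys u \<subseteq> carrier A \<times> carrier B \<and> lin_ext T ?\<phi> u = \<zero>\<^bsub>T\<^esub>}"
      unfolding tensor_kernel_eq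
    proof (rule pm.span_minimal)
      have d: "lin_ext T ?\<phi> (u - v) = lin_ext T ?\<phi> u \<ominus>\<^bsub>T\<^esub> lin_ext T ?\<phi> v"
        if "Poly_Mapping.keys u \<subseteq> carrier A \<times> carrier B" "Poly_Mapping.keys v \<subseteq> carrier A \<times> carrier B" for u v
        by (rule X.lin_ext_diff[OF \<phi> that])
      have kd: "Poly_Mapping.keys (u - v) \<subseteq> S" if "Poly_Mapping.keys u \<subseteq> S" "Poly_Mapping.keys v \<subseteq> S"
        for u v :: "('a \<times> 'b) \<Rightarrow>\<^sub>0 'k" and S using that by (auto dest!: keys_diffD)
      have minus2: "x \<oplus>\<^bsub>T\<^esub> y \<ominus>\<^bsub>T\<^esub> x \<ominus>\<^bsub>T\<^esub> y = \<zero>\<^bsub>T\<^esub>" if "x \<in> carrier T" "y \<in> carrier T" for x y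
      proof -
        have "x \<oplus>\<^bsub>T\<^esub> y \<oplus>\<^bsub>T\<^esub> \<ominus>\<^bsub>T\<^esub> x = y"
          using that by (simp add: X.a_assoc X.a_comm[of y "\<ominus>\<^bsub>T\<^esub> x"] X.r_neg2)
        then show ?thesis using that by (simp add: a_minus_def X.r_neg)
      qed
      have "lin_ext T ?\<phi> r = \<zero>\<^bsub>T\<^esub>" if "r \<in> bilinear_relations A B" for r
        using that bilin_closed[OF assms(2)] unfolding bilinear_relations_def
        by (auto simp: d kd bilin_add_l[OF assms(2)] bilin_add_r[OF assms(2)]
            bilin_smult_l[OF assms(2)] bilin_smult_r[OF assms(2)] minus2 X.diff_zero_iff)
      moreover have "bilinear_relations A B \<subseteq> tensor_kernel A B"
        unfolding tensor_kernel_eq by (rule pm.span_superset)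
      ultimately show "bilinear_relations A B \<subseteq> {u. Poly_Mapping.keys u \<subseteq> carrier A \<times> carrier B \<and> lin_ext T ?\<phi> u = \<zero>\<^bsub>T\<^esub>}"
        using kernel_subset unfolding free_tensor_simps by blast
      show "pm.subspace {u. Poly_Mapping.keys u \<subseteq> carrier A \<times> carrier B \<and> lin_ext T ?\<phi> u = \<zero>\<^bsub>T\<^esub>}"
        by (rule pm.subspaceI)
          (auto simp: X.lin_ext_add[OF \<phi>] X.lin_ext_pscale[OF \<phi>] keys_add_subset order_trans[OF keys_pscale]
            simp del: split_paired_All subset_iff)
    qed
    then show ?thesis using that by auto
  qed
  show "tensor_lift T \<phi> \<in> lin_hom (tensor A B) T"
    unfolding eq tensor_def by (rule I.the_elem_lin_hom[OF assms(1) lin ker])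
  show "tensor_lift T \<phi> (pure_tensor A B a b) = \<phi> a b" if "a \<in> carrier A" "b \<in> carrier B"
    unfolding eq pure_tensor_def
    using that bilin_closed[OF assms(2) that]
    by (subst I.the_elem_coset[OF assms(1) single_closed lin ker]) auto
qed

lemma tensor_lin_eq:
  assumes "kalg T" "f \<in> lin_hom (tensor A B) T" "g \<in> lin_hom (tensor A B) T"
    "\<And>a b. a \<in> carrier A \<Longrightarrow> b \<in> carrier B \<Longrightarrow> f (pure_tensor A B a b) = g (pure_tensor A B a b)"
    "t \<in> carrier (tensor A B)"
  shows "f t = g t"
  using assms(5) by (induction rule: tensor_induct)
    (auto simp: assms(4) lin_hom_add[OF assms(2)] lin_hom_add[OF assms(3)])

lemma tensor_alg_homI:
  assumes "kalg T" "f \<in> lin_hom (tensor A B) T"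
    and mult: "\<And>a b a' b'. a \<in> carrier A \<Longrightarrow> b \<in> carrier B \<Longrightarrow> a' \<in> carrier A \<Longrightarrow> b' \<in> carrier B \<Longrightarrow>
      f (pure_tensor A B (a \<otimes>\<^bsub>A\<^esub> a') (b \<otimes>\<^bsub>B\<^esub> b')) = f (pure_tensor A B a b) \<otimes>\<^bsub>T\<^esub> f (pure_tensor A B a' b')"
    and "f (pure_tensor A B \<one>\<^bsub>A\<^esub> \<one>\<^bsub>B\<^esub>) = \<one>\<^bsub>T\<^esub>"
  shows "f \<in> alg_hom (tensor A B) T"
proof (rule alg_homI[OF assms(2)])
  interpret X: kalg T by fact
  note cl = lin_hom_closed[OF assms(2)] and ad = lin_hom_add[OF assms(2)]
  fix s t assume "s \<in> carrier (tensor A B)" and t: "t \<in> carrier (tensor A B)"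
  then show "f (s \<otimes>\<^bsub>tensor A B\<^esub> t) = f s \<otimes>\<^bsub>T\<^esub> f t"
  proof (induction rule: tensor_induct)
    case (pure a b)
    show ?case using t
      by (induction rule: tensor_induct) (use pure in \<open>auto simp: mult T.r_distr X.r_distr ad cl\<close>)
  qed (use t in \<open>auto simp: T.l_distr X.l_distr ad cl\<close>)
qed (simp add: tensor_one assms(4))

end

lemma kalg2I: "kalg A \<Longrightarrow> kalg B \<Longrightarrow> kalg2 A B"
  by (simp add: kalg2_def)

context
  fixes A :: "('k::field, 'a, 'm) module_scheme" and B :: "('k, 'b, 'n) module_scheme"
    and C :: "('k, 'c, 'o) module_scheme" and D :: "('k, 'd, 'p) module_scheme"
    and f :: "'a \<Rightarrow> 'c" and g :: "'b \<Rightarrow> 'd"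
  assumes kA: "kalg A" and kB: "kalg B" and kC: "kalg C" and kD: "kalg D"
begin

interpretation AB: kalg2 A B by (rule kalg2I[OF kA kB])
interpretation CD: kalg2 C D by (rule kalg2I[OF kC kD])

context
  assumes f: "f \<in> lin_hom A C" and g: "g \<in> lin_hom B D"
begin

lemma tensor_map_bilin: "bilin A B (tensor C D) (\<lambda>a b. pure_tensor C D (f a) (g b))"
  using lin_hom_closed[OF f] lin_hom_closed[OF g]
  by (intro bilinI) (auto simp: lin_hom_add[OF f] lin_hom_smult[OF f] lin_hom_add[OF g] lin_hom_smult[OF g]
      CD.pure_add_l CD.pure_add_r CD.pure_smult_l CD.pure_smult_r)

lemma tensor_map_lin: "tensor_map C D f g \<in> lin_hom (tensor A B) (tensor C D)"
  unfolding tensor_map_def by (rule AB.tensor_lift_lin[OF CD.tensor_kalg tensor_map_bilin])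

lemma tensor_map_pure:
  "a \<in> carrier A \<Longrightarrow> b \<in> carrier B \<Longrightarrow> tensor_map C D f g (pure_tensor A B a b) = pure_tensor C D (f a) (g b)"
  unfolding tensor_map_def by (rule AB.tensor_lift_pure[OF CD.tensor_kalg tensor_map_bilin])

end

lemma tensor_map_alg:
  assumes f: "f \<in> alg_hom A C" and g: "g \<in> alg_hom B D"
  shows "tensor_map C D f g \<in> alg_hom (tensor A B) (tensor C D)"
  using lin_hom_closed[OF alg_hom_lin[OF f]] lin_hom_closed[OF alg_hom_lin[OF g]]
  by (intro AB.tensor_alg_homI CD.tensor_kalg tensor_map_lin alg_hom_lin f g)
    (auto simp: tensor_map_pure[OF alg_hom_lin[OF f] alg_hom_lin[OF g]] alg_hom_mult[OF f] alg_hom_mult[OF g]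
      alg_hom_one[OF f] alg_hom_one[OF g] CD.tensor_one)

end

context
  fixes A :: "('k::field, 'a, 'm) module_scheme" and B :: "('k, 'b, 'n) module_scheme"
    and C :: "('k, 'c, 'o) module_scheme"
  assumes kA: "kalg A" and kB: "kalg B" and kC: "kalg C"
begin

interpretation AB: kalg2 A B by (rule kalg2I[OF kA kB])
interpretation BC: kalg2 B C by (rule kalg2I[OF kB kC])
interpretation L: kalg2 "tensor A B" C by (rule kalg2I[OF AB.tensor_kalg kC])
interpretation R: kalg2 A "tensor B C" by (rule kalg2I[OF kA BC.tensor_kalg])

lemma tensor_assoc_inner_bilin:
  "c \<in> carrier C \<Longrightarrow> bilin A B (tensor A (tensor B C)) (\<lambda>a b. pure_tensor A (tensor B C) a (pure_tensor B C b c))"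
  by (intro bilinI) (auto simp: R.pure_add_l R.pure_add_r R.pure_smult_l R.pure_smult_r BC.pure_add_l BC.pure_smult_l)

text \<open>Linearity in t is that of the inner lift. Linearity in c is not, because c sits inside
  the map being lifted; it is obtained by induction on t.\<close>

lemma tensor_assoc_bilin:
  "bilin (tensor A B) C (tensor A (tensor B C)) (\<lambda>t c. tensor_lift (tensor A (tensor B C))
        (\<lambda>a b. pure_tensor A (tensor B C) a (pure_tensor B C b c)) t)"
proof -
  note l = AB.tensor_lift_lin[OF R.tensor_kalg tensor_assoc_inner_bilin]
    and p = AB.tensor_lift_pure[OF R.tensor_kalg tensor_assoc_inner_bilin]
  have 1: "tensor_lift (tensor A (tensor B C)) (\<lambda>a b. pure_tensor A (tensor B C) a (pure_tensor B C b (c \<oplus>\<^bsub>C\<^esub> c'))) t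
    = tensor_lift (tensor A (tensor B C)) (\<lambda>a b. pure_tensor A (tensor B C) a (pure_tensor B C b c)) t
     \<oplus>\<^bsub>tensor A (tensor B C)\<^esub>
      tensor_lift (tensor A (tensor B C)) (\<lambda>a b. pure_tensor A (tensor B C) a (pure_tensor B C b c')) t"
    if "t \<in> carrier (tensor A B)" "c \<in> carrier C" "c' \<in> carrier C" for t c c'
    using that(1)
  proof (induction rule: AB.tensor_induct)
    case (pure a b)
    then show ?case using that by (simp add: p BC.pure_add_r R.pure_add_r)
  next
    case (add s t)
    then show ?case using that lin_hom_closed[OF l]
      by (simp add: lin_hom_add[OF l] R.T.a_ac)
  qed
  have 2: "tensor_lift (tensor A (tensor B C)) (\<lambda>a b. pure_tensor A (tensor B C) a (pure_tensor B C b (d \<odot>\<^bsub>C\<^esub> c))) t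
    = d \<odot>\<^bsub>tensor A (tensor B C)\<^esub>
      tensor_lift (tensor A (tensor B C)) (\<lambda>a b. pure_tensor A (tensor B C) a (pure_tensor B C b c)) t"
    if "t \<in> carrier (tensor A B)" "c \<in> carrier C" for t c d
    using that(1)
  proof (induction rule: AB.tensor_induct)
    case (pure a b)
    then show ?case using that by (simp add: p BC.pure_smult_r R.pure_smult_r)
  next
    case (add s t)
    then show ?case using that lin_hom_closed[OF l]
      by (simp add: lin_hom_add[OF l] R.T.smult_r_distr)
  qed
  show ?thesis
    using lin_hom_closed[OF l] 1 2 by (intro bilinI) (auto simp: lin_hom_add[OF l] lin_hom_smult[OF l])
qed

lemma tensor_assoc_lin: "tensor_assoc A B C \<in> lin_hom (tensor (tensor A B) C) (tensor A (tensor B C))"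
  unfolding tensor_assoc_def Let_def by (rule L.tensor_lift_lin[OF R.tensor_kalg tensor_assoc_bilin])

lemma tensor_assoc_pure:
  assumes "a \<in> carrier A" "b \<in> carrier B" "c \<in> carrier C"
  shows "tensor_assoc A B C (pure_tensor (tensor A B) C (pure_tensor A B a b) c)
     = pure_tensor A (tensor B C) a (pure_tensor B C b c)"
  unfolding tensor_assoc_def Let_def
  by (subst L.tensor_lift_pure[OF R.tensor_kalg tensor_assoc_bilin])
    (use assms in \<open>auto simp: AB.tensor_lift_pure[OF R.tensor_kalg tensor_assoc_inner_bilin]\<close>)

lemma tensor_assoc_alg: "tensor_assoc A B C \<in> alg_hom (tensor (tensor A B) C) (tensor A (tensor B C))"
proof (rule L.tensor_alg_homI[OF R.tensor_kalg tensor_assoc_lin])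
  show "tensor_assoc A B C (pure_tensor (tensor A B) C \<one>\<^bsub>tensor A B\<^esub> \<one>\<^bsub>C\<^esub>) = \<one>\<^bsub>tensor A (tensor B C)\<^esub>"
    by (simp add: AB.tensor_one R.tensor_one BC.tensor_one tensor_assoc_pure)
  fix s c t d
  assume s: "s \<in> carrier (tensor A B)" and c: "c \<in> carrier C" and t: "t \<in> carrier (tensor A B)" and d: "d \<in> carrier C"
  note ad = lin_hom_add[OF tensor_assoc_lin] and cl = lin_hom_closed[OF tensor_assoc_lin]
  show "tensor_assoc A B C (pure_tensor (tensor A B) C (s \<otimes>\<^bsub>tensor A B\<^esub> t) (c \<otimes>\<^bsub>C\<^esub> d)) =
      tensor_assoc A B C (pure_tensor (tensor A B) C s c) \<otimes>\<^bsub>tensor A (tensor B C)\<^esub>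
      tensor_assoc A B C (pure_tensor (tensor A B) C t d)"
    using s
  proof (induction rule: AB.tensor_induct)
    case (pure a b)
    show ?case using t
      by (induction rule: AB.tensor_induct)
        (use pure c d in \<open>auto simp: tensor_assoc_pure AB.T.r_distr L.pure_add_l R.T.r_distr ad cl\<close>)
  qed (use t c d in \<open>auto simp: AB.T.l_distr L.pure_add_l R.T.l_distr ad cl\<close>)
qed

end

subsection \<open>Algebras with the same underlying structure\<close>

text \<open>Tensor products read only the fields of \<open>module\<close>, so the Hopf and comodule
  fields added to a record do not change them.\<close>

lemma tensor_extend [simp]:
  "tensor (module.extend A x) B = tensor A B" "tensor B (module.extend A x) = tensor B A"
  "pure_tensor (module.extend A x) B = pure_tensor A B" "pure_tensor B (module.extend A x) = pure_tensor B A"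
  by (simp_all add: fun_eq_iff module.defs tensor_def pure_tensor_def free_tensor_def tensor_kernel_def bilinear_relations_def)

lemma opposite_alg_simps [simp]:
  "carrier (opposite_alg A) = carrier A" "add (opposite_alg A) = add A" "zero (opposite_alg A) = zero A"
  "one (opposite_alg A) = one A" "smult (opposite_alg A) = smult A" "x \<otimes>\<^bsub>opposite_alg A\<^esub> y = y \<otimes>\<^bsub>A\<^esub> x"
  by (simp_all add: opposite_alg_def)

lemma opposite_kalg: "kalg A \<Longrightarrow> kalg (opposite_alg A)"
proof -
  assume "kalg A"
  then interpret kalg A .
  show ?thesis
    by (intro kalgI k_algebraI ringI abelian_groupI monoidI)
      (auto simp: a_ac m_assoc l_distr r_distr smult_l_distr smult_r_distr intro: add.l_inv_ex)
qed

lemma finsum_opposite [simp]: "finsum (opposite_alg A) = finsum A"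
  by (simp add: fun_eq_iff finsum_def opposite_alg_def)

text \<open>Passing to the opposite algebra changes only the product. Hence an algebra map into A
  \<otimes> \<open>B\<^sup>o\<^sup>p\<close> may be read as a linear map into A \<otimes> B, which
  is how the translation map is built.\<close>

lemma tensor_opposite_simps:
  "carrier (tensor A (opposite_alg B)) = carrier (tensor A B)"
  "add (tensor A (opposite_alg B)) = add (tensor A B)"
  "zero (tensor A (opposite_alg B)) = zero (tensor A B)"
  "smult (tensor A (opposite_alg B)) = smult (tensor A B)"
  "pure_tensor A (opposite_alg B) = pure_tensor A B"
proof -
  have k: "tensor_kernel A (opposite_alg B) = tensor_kernel A B"
    by (simp add: tensor_kernel_def bilinear_relations_def)
  have f: "carrier (free_tensor A (opposite_alg B)) = carrier (free_tensor A B)"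
    "add (free_tensor A (opposite_alg B)) = add (free_tensor A B)"
    "smult (free_tensor A (opposite_alg B)) = smult (free_tensor A B)"
    by (simp_all add: free_tensor_def)
  have c: "a_r_coset (free_tensor A (opposite_alg B)) = a_r_coset (free_tensor A B)"
    by (simp add: fun_eq_iff a_r_coset_def' f)
  show "carrier (tensor A (opposite_alg B)) = carrier (tensor A B)"
    "add (tensor A (opposite_alg B)) = add (tensor A B)"
    "zero (tensor A (opposite_alg B)) = zero (tensor A B)"
    "smult (tensor A (opposite_alg B)) = smult (tensor A B)"
    by (simp_all add: tensor_def quotient_alg_def ring.defs FactRing_def A_RCOSETS_def' set_add_def' fun_eq_iff k f c)
  show "pure_tensor A (opposite_alg B) = pure_tensor A B"
    by (simp add: fun_eq_iff pure_tensor_def k c)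
qed

subsection \<open>Linear functionals and slices\<close>

lemma ground_alg_simps [simp]:
  "carrier ground_alg = UNIV" "x \<oplus>\<^bsub>ground_alg\<^esub> y = x + y" "x \<otimes>\<^bsub>ground_alg\<^esub> y = x * y"
  "\<one>\<^bsub>ground_alg\<^esub> = 1" "\<zero>\<^bsub>ground_alg\<^esub> = 0" "c \<odot>\<^bsub>ground_alg\<^esub> x = c * x"
  by (simp_all add: ground_alg_def)

lemma ground_kalg: "kalg (ground_alg :: ('k::field, 'k) module)"
  by (intro kalgI k_algebraI ringI abelian_groupI monoidI) (auto simp: algebra_simps intro: exI[of _ "- x" for x])

interpretation ground: kalg ground_alg by (rule ground_kalg)

lemma finsum_ground [simp]: "finite I \<Longrightarrow> finsum ground_alg f I = sum f I"
  by (induction I rule: finite_induct) (simp_all add: ground.finsum_insert)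

text \<open>A is the free vector space on its carrier modulo the kernel K of evaluation. A basis of
  K is extended by singletons to a basis of the span of all singletons; the added singletons name a
  basis of A, and their coordinates are functionals on A. The expansion is asserted for every large
  enough finite set, so that several elements can be expanded over a common one.\<close>

lemma (in kalg) exists_coordinates:
  obtains \<BB> and \<psi> :: "'a \<Rightarrow> 'a \<Rightarrow> 'k"
  where "\<BB> \<subseteq> carrier A" "\<And>b. b \<in> \<BB> \<Longrightarrow> \<psi> b \<in> lin_hom A ground_alg"
    "\<And>x. x \<in> carrier A \<Longrightarrow> \<exists>S. finite S \<and> S \<subseteq> \<BB> \<and>
       (\<forall>S'. finite S' \<longrightarrow> S \<subseteq> S' \<longrightarrow> S' \<subseteq> \<BB> \<longrightarrow> x = (\<Oplus>b\<in>S'. \<psi> b x \<odot> b))"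
proof -
  let ?e = "lin_ext A (\<lambda>x. x)"
  define K where "K = {u. Poly_Mapping.keys u \<subseteq> carrier A \<and> ?e u = \<zero>}"
  define sgl where "sgl x = Poly_Mapping.single x (1::'k)" for x :: 'a
  have id: "(\<lambda>x. x) \<in> carrier A \<rightarrow> carrier A" by simp
  have K: "pm.subspace K"
    unfolding K_def by (rule pm.subspaceI)
      (auto simp: lin_ext_add[OF id] lin_ext_pscale[OF id] keys_add_subset order_trans[OF keys_pscale]
        simp del: subset_iff)
  obtain C0 where C0: "C0 \<subseteq> K" "pm.independent C0" "K \<subseteq> pm.span C0"
    using pm.maximal_independent_subset[of K] by blast
  obtain C1 where C1: "C0 \<subseteq> C1" "C1 \<subseteq> C0 \<union> sgl ` carrier A" "pm.independent C1" "C0 \<union> sgl ` carrier A \<subseteq> pm.span C1"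
    using pm.maximal_independent_subset_extend[of C0 "C0 \<union> sgl ` carrier A"] C0(2) by blast
  define \<BB> where "\<BB> = {x \<in> carrier A. sgl x \<in> C1 - C0}"
  define \<psi> where "\<psi> b x = pm.representation C1 (sgl x) (sgl b)" for b x
  have span: "sgl x \<in> pm.span C1" if "x \<in> carrier A" for x using C1(4) that by auto
  have Kspan: "u \<in> pm.span C1" if "u \<in> K" for u using that C0(3) C1(1) pm.span_mono by blast
  \<comment> \<open>K is spanned by \<open>C0\<close>, so the coordinates at the added singletons
    vanish on K and therefore depend only on the evaluated element.\<close>
  have rep0: "pm.representation C1 u (sgl b) = 0" if "u \<in> K" "b \<in> \<BB>" for u b
  proof -
    have "u \<in> pm.span C0" using that C0 by auto
    then have "pm.representation C1 u = pm.representation C0 u"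
      using pm.representation_extend[OF C1(3) _ C1(1)] by blast
    then show ?thesis using pm.representation_ne_zero[of C0 u "sgl b"] that(2) by (auto simp: \<BB>_def)
  qed
  have repK: "pm.representation C1 u (sgl b) = pm.representation C1 v (sgl b)"
    if "u - v \<in> K" "v \<in> pm.span C1" "b \<in> \<BB>" for u v b
    using pm.representation_add[OF C1(3) Kspan[OF that(1)] that(2)] rep0[OF that(1,3)] by simp
  have lin: "\<psi> b \<in> lin_hom A ground_alg" if b: "b \<in> \<BB>" for b
  proof (rule lin_homI)
    fix x y assume xy: "x \<in> carrier A" "y \<in> carrier A"
    let ?u = "sgl (x \<oplus> y) - (sgl x + sgl y)"
    have kk: "Poly_Mapping.keys (sgl x + sgl y) \<subseteq> carrier A" using xy by (intro keys_add_subset) (auto simp: sgl_def)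
    have "?u \<in> K"
      using xy kk lin_ext_diff[OF id, of "sgl (x \<oplus> y)" "sgl x + sgl y"] lin_ext_add[OF id, of "sgl x" "sgl y"]
      by (auto simp: K_def sgl_def a_minus_def r_neg dest!: keys_diffD)
    then have "\<psi> b (x \<oplus> y) = pm.representation C1 (sgl x + sgl y) (sgl b)"
      unfolding \<psi>_def using xy b by (intro repK pm.span_add span)
    then show "\<psi> b (x \<oplus> y) = \<psi> b x \<oplus>\<^bsub>ground_alg\<^esub> \<psi> b y"
      using xy by (simp add: \<psi>_def pm.representation_add[OF C1(3)] span)
  next
    fix c x assume x: "x \<in> carrier A"
    let ?u = "sgl (c \<odot> x) - pscale c (sgl x)"
    have kk: "Poly_Mapping.keys (pscale c (sgl x)) \<subseteq> carrier A" using x by (auto simp: sgl_def)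
    have "?u \<in> K"
      using x kk lin_ext_diff[OF id, of "sgl (c \<odot> x)" "pscale c (sgl x)"]
      by (auto simp: K_def sgl_def a_minus_def r_neg dest!: keys_diffD split: if_splits)
    then have "\<psi> b (c \<odot> x) = pm.representation C1 (pscale c (sgl x)) (sgl b)"
      unfolding \<psi>_def using x b by (intro repK pm.span_scale span)
    then show "\<psi> b (c \<odot> x) = c \<odot>\<^bsub>ground_alg\<^esub> \<psi> b x"
      using x by (simp add: \<psi>_def pm.representation_scale[OF C1(3)] span)
  qed simp
  have exp: "\<exists>S. finite S \<and> S \<subseteq> \<BB> \<and>
       (\<forall>S'. finite S' \<longrightarrow> S \<subseteq> S' \<longrightarrow> S' \<subseteq> \<BB> \<longrightarrow> x = (\<Oplus>b\<in>S'. \<psi> b x \<odot> b))" if x: "x \<in> carrier A" for x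
  proof -
    let ?r = "pm.representation C1 (sgl x)"
    define R where "R = {c. ?r c \<noteq> 0}"
    have finR: "finite R" unfolding R_def by (rule pm.finite_representation)
    have inj: "inj_on sgl X" for X by (auto simp: sgl_def inj_on_def dest: arg_cong[where f = Poly_Mapping.keys])
    have RC: "R \<subseteq> C1" unfolding R_def using pm.representation_ne_zero by blast
    have kC: "Poly_Mapping.keys c \<subseteq> carrier A" if "c \<in> C1" for c
    proof -
      have "c \<in> K \<or> c \<in> sgl ` carrier A" using that C1(2) C0(1) by blast
      then show ?thesis by (auto simp: K_def sgl_def)
    qed
    have ecl: "?e c \<in> carrier A" if "c \<in> C1" for c using lin_ext_closed[OF id kC[OF that]] .
    have "?e (\<Sum>c\<in>R. pscale (?r c) c) = (\<Oplus>c\<in>R. ?e (pscale (?r c) c))"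
      by (rule lin_ext_sum[OF id finR], rule order_trans[OF keys_pscale kC]) (use RC in blast)
    also have "(\<Sum>c\<in>R. pscale (?r c) c) = sgl x"
      unfolding R_def by (rule pm.sum_nonzero_representation_eq[OF C1(3) span[OF x]])
    also have "?e (sgl x) = x" using x by (simp add: sgl_def)
    also have "(\<Oplus>c\<in>R. ?e (pscale (?r c) c)) = (\<Oplus>c\<in>R. ?r c \<odot> ?e c)"
    proof (rule finsum_cong')
      show "?e (pscale (?r c) c) = ?r c \<odot> ?e c" if "c \<in> R" for c
        using that RC by (intro lin_ext_pscale[OF id] kC) blast
    qed (use RC ecl in \<open>auto simp: subset_iff\<close>)
    finally have xe: "x = (\<Oplus>c\<in>R. ?r c \<odot> ?e c)" .
    define S where "S = {b \<in> \<BB>. sgl b \<in> R}"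
    have "finite (sgl ` S)" by (rule finite_subset[OF _ finR]) (auto simp: S_def)
    then have finS: "finite S" using finite_imageD[OF _ inj] by blast
    have "x = (\<Oplus>b\<in>S'. \<psi> b x \<odot> b)" if S': "finite S'" "S \<subseteq> S'" "S' \<subseteq> \<BB>" for S'
    proof -
      have imC: "sgl ` S' \<subseteq> C1" using S' by (auto simp: \<BB>_def)
      \<comment> \<open>The sum is first enlarged to contain all of \<open>S'\<close>; the terms
        outside \<open>S'\<close> then disappear because they belong to \<open>C0\<close>, where
        evaluation is zero.\<close>
      have "(\<Oplus>c\<in>R. ?r c \<odot> ?e c) = (\<Oplus>c\<in>R \<union> sgl ` S'. ?r c \<odot> ?e c)"
        using finR S'(1) RC imC ecl
        by (intro add.finprod_mono_neutral_cong_left) (auto simp: R_def subset_eq)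
      also have "\<dots> = (\<Oplus>c\<in>sgl ` S'. ?r c \<odot> ?e c)"
      proof (rule add.finprod_mono_neutral_cong_right)
        show "?r c \<odot> ?e c = \<zero>" if "c \<in> R \<union> sgl ` S' - sgl ` S'" for c
        proof -
          have c: "c \<in> R" "c \<notin> sgl ` S'" using that by auto
          have "c \<in> C0"
          proof (rule ccontr)
            assume "c \<notin> C0"
            then obtain b where b: "b \<in> carrier A" "c = sgl b" using c(1) RC C1(2) by blast
            then have "b \<in> S" using c(1) RC \<open>c \<notin> C0\<close> by (auto simp: S_def \<BB>_def)
            then show False using b c(2) S'(2) by auto
          qed
          then have "?e c = \<zero>" using C0(1) by (auto simp: K_def)
          then show ?thesis by simp
        qed
      qed (use finR S'(1) RC imC ecl in auto)
      also have "\<dots> = (\<Oplus>b\<in>S'. ?r (sgl b) \<odot> ?e (sgl b))"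
        using imC ecl by (intro finsum_reindex inj) auto
      also have "\<dots> = (\<Oplus>b\<in>S'. \<psi> b x \<odot> b)"
        using S'(3) by (intro finsum_cong') (auto simp: \<psi>_def \<BB>_def sgl_def)
      finally show ?thesis using xe by simp
    qed
    then show ?thesis using finS by (intro exI[of _ S]) (auto simp: S_def)
  qed
  show thesis by (rule that[OF _ lin exp]) (auto simp: \<BB>_def)
qed

text \<open>Some coordinate of 1 is nonzero, and it is rescaled. This is the form in which faithful
  flatness over a field is used.\<close>

lemma (in kalg) functional_one:
  assumes "\<one> \<noteq> \<zero>"
  obtains \<psi> where "\<psi> \<in> lin_hom A (ground_alg :: ('k, 'k) module)" "\<psi> \<one> = 1"
proof -
  obtain \<BB> \<psi> where B: "\<BB> \<subseteq> carrier A" "\<And>b. b \<in> \<BB> \<Longrightarrow> \<psi> b \<in> lin_hom A ground_alg"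
    "\<And>x. x \<in> carrier A \<Longrightarrow> \<exists>S. finite S \<and> S \<subseteq> \<BB> \<and>
       (\<forall>S'. finite S' \<longrightarrow> S \<subseteq> S' \<longrightarrow> S' \<subseteq> \<BB> \<longrightarrow> x = (\<Oplus>b\<in>S'. \<psi> b x \<odot> b))"
    using exists_coordinates by blast
  obtain S where S: "finite S" "S \<subseteq> \<BB>" "\<one> = (\<Oplus>b\<in>S. \<psi> b \<one> \<odot> b)"
    using B(3)[OF one_closed] by blast
  have "\<exists>b\<in>S. \<psi> b \<one> \<noteq> 0"
  proof (rule ccontr)
    assume "\<not> (\<exists>b\<in>S. \<psi> b \<one> \<noteq> 0)"
    then have "(\<Oplus>b\<in>S. \<psi> b \<one> \<odot> b) = (\<Oplus>b\<in>S. \<zero>)" using S B(1) by (intro finsum_cong') auto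
    then show False using assms S(3) by (simp add: finsum_zero)
  qed
  then obtain b where b: "b \<in> \<BB>" "\<psi> b \<one> \<noteq> 0" using S by auto
  show thesis
    by (rule that[of "\<lambda>x. inverse (\<psi> b \<one>) * \<psi> b x"])
      (use b lin_hom_add[OF B(2)] lin_hom_smult[OF B(2)] in \<open>auto intro!: lin_homI simp: algebra_simps\<close>)
qed

text \<open>The map id \<otimes> \<psi> followed by the identification of A \<otimes> k with
  A.\<close>

definition slice :: "('k::field, 'a, 'm) module_scheme \<Rightarrow> ('b \<Rightarrow> 'k) \<Rightarrow> (('a \<times> 'b) \<Rightarrow>\<^sub>0 'k) set \<Rightarrow> 'a" where
  "slice A \<psi> = tensor_lift A (\<lambda>a b. \<psi> b \<odot>\<^bsub>A\<^esub> a)"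

context kalg2
begin

lemma slice_bilin:
  assumes "\<psi> \<in> lin_hom B ground_alg"
  shows "bilin A B A (\<lambda>a b. \<psi> b \<odot>\<^bsub>A\<^esub> a)"
  by (rule bilinI) (auto simp: lin_hom_add[OF assms] lin_hom_smult[OF assms] A.smult_r_distr A.smult_l_distr mult.commute)

lemma slice_lin: "\<psi> \<in> lin_hom B ground_alg \<Longrightarrow> slice A \<psi> \<in> lin_hom (tensor A B) A"
  unfolding slice_def by (rule tensor_lift_lin[OF A.kalg_axioms slice_bilin])

lemma slice_pure: "\<psi> \<in> lin_hom B ground_alg \<Longrightarrow> a \<in> carrier A \<Longrightarrow> b \<in> carrier B \<Longrightarrow>
    slice A \<psi> (pure_tensor A B a b) = \<psi> b \<odot>\<^bsub>A\<^esub> a"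
  unfolding slice_def by (rule tensor_lift_pure[OF A.kalg_axioms slice_bilin])

lemma pure_finsum_r:
  assumes "f \<in> I \<rightarrow> carrier B" "a \<in> carrier A"
  shows "pure_tensor A B a (\<Oplus>\<^bsub>B\<^esub>i\<in>I. f i) = (\<Oplus>\<^bsub>tensor A B\<^esub>i\<in>I. pure_tensor A B a (f i))"
  by (rule B.lin_hom_finsum[OF tensor_kalg pure_lin_r[OF assms(2)] assms(1)])

text \<open>Finitely many tensors are written over one common finite set of right factors. That the
  left factors are slices matters later: slicing commutes with a coaction on the left leg, so they
  inherit equivariance.\<close>

lemma tensor_family_slices:
  assumes "finite I" "\<And>i. i \<in> I \<Longrightarrow> t i \<in> carrier (tensor A B)"
  obtains S and \<psi> :: "'b \<Rightarrow> 'b \<Rightarrow> 'k" where "finite S" "S \<subseteq> carrier B"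
    "\<And>b. b \<in> S \<Longrightarrow> \<psi> b \<in> lin_hom B ground_alg"
    "\<And>i. i \<in> I \<Longrightarrow> t i = (\<Oplus>\<^bsub>tensor A B\<^esub>b\<in>S. pure_tensor A B (slice A (\<psi> b) (t i)) b)"
proof -
  obtain \<BB> \<psi> where B: "\<BB> \<subseteq> carrier B" "\<And>b. b \<in> \<BB> \<Longrightarrow> \<psi> b \<in> lin_hom B ground_alg"
    "\<And>x. x \<in> carrier B \<Longrightarrow> \<exists>S. finite S \<and> S \<subseteq> \<BB> \<and>
       (\<forall>S'. finite S' \<longrightarrow> S \<subseteq> S' \<longrightarrow> S' \<subseteq> \<BB> \<longrightarrow> x = (\<Oplus>\<^bsub>B\<^esub>b\<in>S'. \<psi> b x \<odot>\<^bsub>B\<^esub> b))"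
    using B.exists_coordinates by blast
  have ex: "\<exists>S. finite S \<and> S \<subseteq> \<BB> \<and> (\<forall>S'. finite S' \<longrightarrow> S \<subseteq> S' \<longrightarrow> S' \<subseteq> \<BB> \<longrightarrow>
      t = (\<Oplus>\<^bsub>tensor A B\<^esub>b\<in>S'. pure_tensor A B (slice A (\<psi> b) t) b))"
    if "t \<in> carrier (tensor A B)" for t
    using that
  proof (induction rule: tensor_induct)
    case (pure a x)
    obtain S where S: "finite S" "S \<subseteq> \<BB>"
      "\<And>S'. finite S' \<Longrightarrow> S \<subseteq> S' \<Longrightarrow> S' \<subseteq> \<BB> \<Longrightarrow> x = (\<Oplus>\<^bsub>B\<^esub>b\<in>S'. \<psi> b x \<odot>\<^bsub>B\<^esub> b)"
      using B(3)[OF pure(2)] by blast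
    have main: "pure_tensor A B a x = (\<Oplus>\<^bsub>tensor A B\<^esub>b\<in>S'. pure_tensor A B (slice A (\<psi> b) (pure_tensor A B a x)) b)"
      if S': "finite S'" "S \<subseteq> S'" "S' \<subseteq> \<BB>" for S'
    proof -
      have "pure_tensor A B a x = pure_tensor A B a (\<Oplus>\<^bsub>B\<^esub>b\<in>S'. \<psi> b x \<odot>\<^bsub>B\<^esub> b)"
        by (subst S(3)[OF S']) (rule refl)
      also have "\<dots> = (\<Oplus>\<^bsub>tensor A B\<^esub>b\<in>S'. pure_tensor A B a (\<psi> b x \<odot>\<^bsub>B\<^esub> b))"
        using S' B(1) pure by (intro pure_finsum_r) auto
      also have "\<dots> = (\<Oplus>\<^bsub>tensor A B\<^esub>b\<in>S'. pure_tensor A B (slice A (\<psi> b) (pure_tensor A B a x)) b)"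
        using S' B(1) pure by (intro T.finsum_cong') (auto simp: slice_pure[OF B(2)] pure_smult_l pure_smult_r subset_eq)
      finally show ?thesis .
    qed
    show ?case by (intro exI[of _ S] conjI allI impI S(1,2) main)
  next
    case (add s t)
    obtain S1 where S1: "finite S1" "S1 \<subseteq> \<BB>" "\<And>S'. finite S' \<Longrightarrow> S1 \<subseteq> S' \<Longrightarrow> S' \<subseteq> \<BB> \<Longrightarrow>
      s = (\<Oplus>\<^bsub>tensor A B\<^esub>b\<in>S'. pure_tensor A B (slice A (\<psi> b) s) b)" using add.IH(1) by meson
    obtain S2 where S2: "finite S2" "S2 \<subseteq> \<BB>" "\<And>S'. finite S' \<Longrightarrow> S2 \<subseteq> S' \<Longrightarrow> S' \<subseteq> \<BB> \<Longrightarrow>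
      t = (\<Oplus>\<^bsub>tensor A B\<^esub>b\<in>S'. pure_tensor A B (slice A (\<psi> b) t) b)" using add.IH(2) by meson
    have main: "s \<oplus>\<^bsub>tensor A B\<^esub> t = (\<Oplus>\<^bsub>tensor A B\<^esub>b\<in>S'. pure_tensor A B (slice A (\<psi> b) (s \<oplus>\<^bsub>tensor A B\<^esub> t)) b)"
      if S': "finite S'" "S1 \<union> S2 \<subseteq> S'" "S' \<subseteq> \<BB>" for S'
    proof -
      have cl: "b \<in> carrier B" "slice A (\<psi> b) s \<in> carrier A" "slice A (\<psi> b) t \<in> carrier A" if "b \<in> S'" for b
        using that S' B(1) add lin_hom_closed[OF slice_lin[OF B(2)]] by auto
      have "(\<Oplus>\<^bsub>tensor A B\<^esub>b\<in>S'. pure_tensor A B (slice A (\<psi> b) (s \<oplus>\<^bsub>tensor A B\<^esub> t)) b)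
        = (\<Oplus>\<^bsub>tensor A B\<^esub>b\<in>S'. pure_tensor A B (slice A (\<psi> b) s) b \<oplus>\<^bsub>tensor A B\<^esub> pure_tensor A B (slice A (\<psi> b) t) b)"
        using S' add cl by (intro T.finsum_cong')
          (auto simp: lin_hom_add[OF slice_lin[OF B(2)]] pure_add_l subset_eq)
      also have "\<dots> = (\<Oplus>\<^bsub>tensor A B\<^esub>b\<in>S'. pure_tensor A B (slice A (\<psi> b) s) b)
          \<oplus>\<^bsub>tensor A B\<^esub> (\<Oplus>\<^bsub>tensor A B\<^esub>b\<in>S'. pure_tensor A B (slice A (\<psi> b) t) b)"
        using cl by (intro T.finsum_addf) auto
      also have "\<dots> = s \<oplus>\<^bsub>tensor A B\<^esub> t"
        using S1(3)[of S'] S2(3)[of S'] S' by simp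
      finally show ?thesis by simp
    qed
    show ?case
      by (intro exI[of _ "S1 \<union> S2"] conjI allI impI main) (use S1(1,2) S2(1,2) in simp_all)
  qed
  define Q where "Q i S \<longleftrightarrow> finite S \<and> S \<subseteq> \<BB> \<and> (\<forall>S'. finite S' \<longrightarrow> S \<subseteq> S' \<longrightarrow> S' \<subseteq> \<BB> \<longrightarrow>
      t i = (\<Oplus>\<^bsub>tensor A B\<^esub>b\<in>S'. pure_tensor A B (slice A (\<psi> b) (t i)) b))" for i S
  have "\<forall>i\<in>I. \<exists>S. Q i S" unfolding Q_def by (intro ballI ex assms(2))
  from bchoice[OF this] obtain S where S: "\<And>i. i \<in> I \<Longrightarrow> Q i (S i)" by blast
  have fin: "finite (\<Union>i\<in>I. S i)" using S assms(1) by (auto simp: Q_def)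
  have sub: "(\<Union>i\<in>I. S i) \<subseteq> \<BB>" using S by (auto simp: Q_def)
  show thesis
  proof (rule that[of "\<Union>i\<in>I. S i" \<psi>])
    show "t i = (\<Oplus>\<^bsub>tensor A B\<^esub>b\<in>(\<Union>i\<in>I. S i). pure_tensor A B (slice A (\<psi> b) (t i)) b)" if i: "i \<in> I" for i
      using S[OF i] fin sub UN_upper[OF i, of S] unfolding Q_def by blast
    show "(\<Union>i\<in>I. S i) \<subseteq> carrier B" using sub B(1) by (rule subset_trans)
    show "\<psi> b \<in> lin_hom B ground_alg" if "b \<in> (\<Union>i\<in>I. S i)" for b using that sub B(2) by blast
  qed (rule fin)
qed

text \<open>Slicing with a functional normalised at 1 sends 1 \<otimes> 1 to 1.\<close>

lemma tensor_nontrivial: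
  assumes "\<one>\<^bsub>A\<^esub> \<noteq> \<zero>\<^bsub>A\<^esub>" "\<one>\<^bsub>B\<^esub> \<noteq> \<zero>\<^bsub>B\<^esub>"
  shows "\<one>\<^bsub>tensor A B\<^esub> \<noteq> \<zero>\<^bsub>tensor A B\<^esub>"
proof
  assume 0: "\<one>\<^bsub>tensor A B\<^esub> = \<zero>\<^bsub>tensor A B\<^esub>"
  obtain \<psi> where \<psi>: "\<psi> \<in> lin_hom B (ground_alg :: ('k, 'k) module)" "\<psi> \<one>\<^bsub>B\<^esub> = 1"
    using B.functional_one[OF assms(2)] by blast
  have "slice A \<psi> \<one>\<^bsub>tensor A B\<^esub> = \<one>\<^bsub>A\<^esub>" using \<psi> by (simp add: tensor_one slice_pure)
  moreover have "slice A \<psi> \<zero>\<^bsub>tensor A B\<^esub> = \<zero>\<^bsub>A\<^esub>"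
    by (rule T.lin_hom_zero[OF A.kalg_axioms slice_lin[OF \<psi>(1)]])
  ultimately show False using 0 assms(1) by simp
qed

end

subsection \<open>Matrices over an algebra\<close>

text \<open>Entries multiply in the record algebra A in the written order; A need not be
  commutative, so transposing a product requires \<open>mcomm\<close>.\<close>

definition mm :: "('k::field, 'a, 'm) module_scheme \<Rightarrow> 'a mat \<Rightarrow> 'a mat \<Rightarrow> 'a mat" where
  "mm A X Y = mat (dim_row X) (dim_col Y) (\<lambda>(i, j). \<Oplus>\<^bsub>A\<^esub>k\<in>{..<dim_col X}. X $$ (i, k) \<otimes>\<^bsub>A\<^esub> Y $$ (k, j))"

definition sc :: "('k::field, 'a, 'm) module_scheme \<Rightarrow> 'k mat \<Rightarrow> 'a mat" where
  "sc A M = map_mat (\<lambda>c. c \<odot>\<^bsub>A\<^esub> \<one>\<^bsub>A\<^esub>) M"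

definition mcar :: "('k::field, 'a, 'm) module_scheme \<Rightarrow> 'a mat \<Rightarrow> bool" where
  "mcar A X \<longleftrightarrow> (\<forall>i<dim_row X. \<forall>j<dim_col X. X $$ (i, j) \<in> carrier A)"

definition mcomm :: "('k::field, 'a, 'm) module_scheme \<Rightarrow> 'a mat \<Rightarrow> 'a mat \<Rightarrow> bool" where
  "mcomm A X Y \<longleftrightarrow> (\<forall>i<dim_row X. \<forall>j<dim_col X. \<forall>k<dim_row Y. \<forall>l<dim_col Y.
     X $$ (i, j) \<otimes>\<^bsub>A\<^esub> Y $$ (k, l) = Y $$ (k, l) \<otimes>\<^bsub>A\<^esub> X $$ (i, j))"

lemma mm_dim [simp]: "dim_row (mm A X Y) = dim_row X" "dim_col (mm A X Y) = dim_col Y"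
  by (simp_all add: mm_def)

lemma sc_dim [simp]: "dim_row (sc A M) = dim_row M" "dim_col (sc A M) = dim_col M"
  by (simp_all add: sc_def)

lemma mm_index [simp]: "i < dim_row X \<Longrightarrow> j < dim_col Y \<Longrightarrow>
    mm A X Y $$ (i, j) = (\<Oplus>\<^bsub>A\<^esub>k\<in>{..<dim_col X}. X $$ (i, k) \<otimes>\<^bsub>A\<^esub> Y $$ (k, j))"
  by (simp add: mm_def)

lemma sc_index [simp]: "i < dim_row M \<Longrightarrow> j < dim_col M \<Longrightarrow> sc A M $$ (i, j) = M $$ (i, j) \<odot>\<^bsub>A\<^esub> \<one>\<^bsub>A\<^esub>"
  by (simp add: sc_def)

lemma mcarD: "mcar A X \<Longrightarrow> i < dim_row X \<Longrightarrow> j < dim_col X \<Longrightarrow> X $$ (i, j) \<in> carrier A"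
  by (simp add: mcar_def)

lemma mcar_transpose [simp]: "mcar A X\<^sup>T = mcar A X"
  by (auto simp: mcar_def)

lemma sc_transpose: "(sc A M)\<^sup>T = sc A M\<^sup>T"
  by (intro eq_matI) auto

context kalg
begin

lemma mcar_mm [simp]: "mcar A X \<Longrightarrow> mcar A Y \<Longrightarrow> dim_col X = dim_row Y \<Longrightarrow> mcar A (mm A X Y)"
  by (auto simp: mcar_def intro!: finsum_closed)

lemma mcar_sc [simp]: "mcar A (sc A M)"
  by (auto simp: mcar_def)

lemma mm_assoc:
  assumes "mcar A X" "mcar A Y" "mcar A W" "dim_col X = dim_row Y" "dim_col Y = dim_row W"
  shows "mm A (mm A X Y) W = mm A X (mm A Y W)"
proof (rule eq_matI; simp)
  fix i j assume ij: "i < dim_row X" "j < dim_col W"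
  note c = mcarD[OF assms(1)] mcarD[OF assms(2)] mcarD[OF assms(3)]
  have "(\<Oplus>l\<in>{..<dim_col Y}. (\<Oplus>k\<in>{..<dim_col X}. X $$ (i, k) \<otimes> Y $$ (k, l)) \<otimes> W $$ (l, j))
      = (\<Oplus>l\<in>{..<dim_col Y}. \<Oplus>k\<in>{..<dim_col X}. X $$ (i, k) \<otimes> (Y $$ (k, l) \<otimes> W $$ (l, j)))"
  proof (rule finsum_cong')
    fix l assume l: "l \<in> {..<dim_col Y}"
    have "(\<Oplus>k\<in>{..<dim_col X}. X $$ (i, k) \<otimes> Y $$ (k, l)) \<otimes> W $$ (l, j)
      = (\<Oplus>k\<in>{..<dim_col X}. X $$ (i, k) \<otimes> Y $$ (k, l) \<otimes> W $$ (l, j))"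
      by (rule finsum_ldistr) (use ij l c assms(4,5) in auto)
    also have "\<dots> = (\<Oplus>k\<in>{..<dim_col X}. X $$ (i, k) \<otimes> (Y $$ (k, l) \<otimes> W $$ (l, j)))"
      by (rule finsum_cong') (use ij l c assms(4,5) in \<open>auto simp: m_assoc\<close>)
    finally show "(\<Oplus>k\<in>{..<dim_col X}. X $$ (i, k) \<otimes> Y $$ (k, l)) \<otimes> W $$ (l, j)
      = (\<Oplus>k\<in>{..<dim_col X}. X $$ (i, k) \<otimes> (Y $$ (k, l) \<otimes> W $$ (l, j)))" .
  qed (use ij c assms(4,5) in \<open>auto intro!: finsum_closed\<close>)
  also have "\<dots> = (\<Oplus>k\<in>{..<dim_col X}. \<Oplus>l\<in>{..<dim_col Y}. X $$ (i, k) \<otimes> (Y $$ (k, l) \<otimes> W $$ (l, j)))"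
    by (rule finsum_swap) (use ij c assms(4,5) in auto)
  also have "\<dots> = (\<Oplus>k\<in>{..<dim_col X}. X $$ (i, k) \<otimes> (\<Oplus>l\<in>{..<dim_col Y}. Y $$ (k, l) \<otimes> W $$ (l, j)))"
    by (rule finsum_cong', simp, use ij c assms(4,5) in \<open>auto intro!: finsum_closed\<close>)
      (rule finsum_rdistr[symmetric], use ij c assms(4,5) in auto)
  also have "\<dots> = (\<Oplus>k\<in>{..<dim_col X}. X $$ (i, k) \<otimes> mm A Y W $$ (k, j))"
    by (rule finsum_cong', simp) (use ij c assms(4,5) in \<open>auto intro!: finsum_closed\<close>)
  finally have "(\<Oplus>l\<in>{..<dim_col Y}. (\<Oplus>k\<in>{..<dim_col X}. X $$ (i, k) \<otimes> Y $$ (k, l)) \<otimes> W $$ (l, j))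
      = (\<Oplus>k\<in>{..<dim_col X}. X $$ (i, k) \<otimes> mm A Y W $$ (k, j))" .
  moreover have "(\<Oplus>l\<in>{..<dim_col Y}. mm A X Y $$ (i, l) \<otimes> W $$ (l, j))
      = (\<Oplus>l\<in>{..<dim_col Y}. (\<Oplus>k\<in>{..<dim_col X}. X $$ (i, k) \<otimes> Y $$ (k, l)) \<otimes> W $$ (l, j))"
    by (rule finsum_cong', simp) (use ij c assms(4,5) in \<open>auto intro!: finsum_closed\<close>)
  ultimately show "(\<Oplus>l\<in>{..<dim_col Y}. mm A X Y $$ (i, l) \<otimes> W $$ (l, j))
      = (\<Oplus>k\<in>{..<dim_col X}. X $$ (i, k) \<otimes> mm A Y W $$ (k, j))" by simp
qed

lemma mm_sc_index:
  assumes "mcar A Y" "dim_col M = dim_row Y" "i < dim_row M" "j < dim_col Y"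
  shows "mm A (sc A M) Y $$ (i, j) = (\<Oplus>k\<in>{..<dim_row Y}. M $$ (i, k) \<odot> Y $$ (k, j))"
  using assms by (auto intro!: finsum_cong' simp: mcarD)

lemma mm_one [simp]: "mcar A X \<Longrightarrow> dim_row X = n \<Longrightarrow> mm A (sc A (1\<^sub>m n)) X = X"
proof (rule eq_matI; simp add: mm_sc_index del: mm_index)
  fix i j assume "mcar A X" "dim_row X = n" "i < n" "j < dim_col X"
  then show "(\<Oplus>k\<in>{..<n}. 1\<^sub>m n $$ (i, k) \<odot> X $$ (k, j)) = X $$ (i, j)"
    by (subst finsum_delta[where i = i]) (auto simp: mcarD)
qed

lemma mm_one_right [simp]: "mcar A X \<Longrightarrow> dim_col X = n \<Longrightarrow> mm A X (sc A (1\<^sub>m n)) = X"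
proof (rule eq_matI; simp)
  fix i j assume "mcar A X" "dim_col X = n" "i < dim_row X" "j < n"
  then show "(\<Oplus>k\<in>{..<n}. X $$ (i, k) \<otimes> sc A (1\<^sub>m n) $$ (k, j)) = X $$ (i, j)"
    by (subst finsum_delta[where i = j]) (auto simp: mcarD)
qed

lemma sc_mult: "dim_col M = dim_row N \<Longrightarrow> sc A (M * N) = mm A (sc A M) (sc A N)"
  by (rule eq_matI)
    (auto simp: mm_sc_index scalar_prod_def finsum_smult_l lessThan_atLeast0 simp del: mm_index intro!: finsum_cong')

text \<open>Transposition reverses the order of the entries in each product, so it is compatible
  with the matrix product only if entries of X commute with entries of Y. Entries of X need not
  commute among themselves.\<close>

lemma mm_transpose:
  assumes "mcar A X" "mcar A Y" "mcomm A X Y" "dim_col X = dim_row Y"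
  shows "(mm A X Y)\<^sup>T = mm A Y\<^sup>T X\<^sup>T"
  using assms by (intro eq_matI) (auto simp: mcomm_def mcarD intro!: finsum_cong')

lemma mcomm_sc [simp]: "mcar A Y \<Longrightarrow> mcomm A (sc A M) Y" "mcar A Y \<Longrightarrow> mcomm A Y (sc A M)"
  by (auto simp: mcomm_def mcarD)

lemma mm_hom:
  assumes "kalg B" "f \<in> alg_hom A B" "mcar A X" "mcar A Y" "dim_col X = dim_row Y"
  shows "map_mat f (mm A X Y) = mm B (map_mat f X) (map_mat f Y)"
proof (rule eq_matI; simp)
  fix i j assume ij: "i < dim_row X" "j < dim_col Y"
  interpret B: kalg B by fact
  note cl = lin_hom_closed[OF alg_hom_lin[OF assms(2)]]
  show "f (\<Oplus>k\<in>{..<dim_col X}. X $$ (i, k) \<otimes> Y $$ (k, j))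
      = (\<Oplus>\<^bsub>B\<^esub>k\<in>{..<dim_col X}. map_mat f X $$ (i, k) \<otimes>\<^bsub>B\<^esub> map_mat f Y $$ (k, j))"
    using ij assms(5) mcarD[OF assms(3)] mcarD[OF assms(4)]
    by (subst lin_hom_finsum[OF assms(1) alg_hom_lin[OF assms(2)]])
      (auto simp: alg_hom_mult[OF assms(2)] cl intro!: B.finsum_cong')
qed

lemma sc_hom: "f \<in> alg_hom A B \<Longrightarrow> map_mat f (sc A M) = sc B M"
  by (rule eq_matI) (auto simp: alg_hom_one lin_hom_smult[OF alg_hom_lin])

lemma sc_inj:
  assumes "\<one> \<noteq> \<zero>" "sc A M = sc A N"
  shows "M = N"
proof (rule eq_matI)
  show d: "dim_row M = dim_row N" "dim_col M = dim_col N" using assms(2) sc_dim by metis+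
  fix i j assume ij: "i < dim_row N" "j < dim_col N"
  have "M $$ (i, j) \<odot> \<one> = N $$ (i, j) \<odot> \<one>" using arg_cong[OF assms(2), of "\<lambda>X. X $$ (i, j)"] ij d by simp
  then have "(M $$ (i, j) - N $$ (i, j)) \<odot> \<one> = \<zero>"
    using smult_l_distr[of \<one> "M $$ (i, j)" "- N $$ (i, j)"] by (simp add: smult_uminus r_neg)
  then show "M $$ (i, j) = N $$ (i, j)"
    using smult_cancel[OF one_closed, of "M $$ (i, j) - N $$ (i, j)"] assms(1) by fastforce
qed

end

subsection \<open>Points: algebra elements satisfying the relations\<close>

definition inv_mat :: "nat \<Rightarrow> 'k::field mat \<Rightarrow> bool" where
  "inv_mat n F \<longleftrightarrow> F \<in> carrier_mat n n \<and> invertible_mat F"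

text \<open>The sizes of the abstract inverse are read off from its products with F, which are
  identity matrices. F is then a unit of the matrix ring, so \<open>mat_inverse\<close> cannot
  return \<open>None\<close>.\<close>

lemma inv_mat_inverse:
  assumes "inv_mat n F"
  shows "mat_inv F \<in> carrier_mat n n" "F * mat_inv F = 1\<^sub>m n" "mat_inv F * F = 1\<^sub>m n" "F \<in> carrier_mat n n"
proof -
  have F: "F \<in> carrier_mat n n" using assms by (simp add: inv_mat_def)
  obtain B where B: "F * B = 1\<^sub>m n" "B * F = 1\<^sub>m (dim_row B)"
    using assms by (auto simp: inv_mat_def invertible_mat_def inverts_mat_def)
  have "dim_col (F * B) = n" "dim_col (B * F) = dim_row B" unfolding B by simp_all
  then have "dim_col B = n" "dim_row B = n" using F by auto
  then have "F \<in> Units (ring_mat TYPE('a) n undefined)"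
    using F B by (auto simp: Units_def ring_mat_def intro!: bexI[of _ B])
  then obtain C where C: "mat_inverse F = Some C"
    using mat_inverse(1)[OF F, of undefined] by (cases "mat_inverse F") auto
  from mat_inverse(2)[OF F C] show "mat_inv F \<in> carrier_mat n n" "F * mat_inv F = 1\<^sub>m n" "mat_inv F * F = 1\<^sub>m n"
    using C by auto
  show "F \<in> carrier_mat n n" by fact
qed

lemma inv_mat_dim [simp]:
  "inv_mat n F \<Longrightarrow> dim_row F = n" "inv_mat n F \<Longrightarrow> dim_col F = n"
  "inv_mat n F \<Longrightarrow> dim_row (mat_inv F) = n" "inv_mat n F \<Longrightarrow> dim_col (mat_inv F) = n"
  using inv_mat_inverse[of n F] by auto

lemma mat_inv_unique:
  assumes "inv_mat n F" "G \<in> carrier_mat n n" "F * G = 1\<^sub>m n"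
  shows "mat_inv F = G"
proof -
  note F = inv_mat_inverse[OF assms(1)]
  have "mat_inv F = mat_inv F * (F * G)" using F assms by simp
  also have "\<dots> = (mat_inv F * F) * G" by (rule assoc_mult_mat[OF F(1,4) assms(2), symmetric])
  also have "\<dots> = G" using F assms by simp
  finally show ?thesis .
qed

lemma inv_matI:
  assumes "F \<in> carrier_mat n n" "G \<in> carrier_mat n n" "F * G = 1\<^sub>m n"
  shows "inv_mat n F"
proof -
  have "inverts_mat F G" "inverts_mat G F"
    using assms mat_mult_left_right_inverse[OF assms] by (simp_all add: inverts_mat_def)
  then show ?thesis using assms(1) unfolding inv_mat_def invertible_mat_def by auto
qed

lemma transpose_inverse:
  assumes "inv_mat n F"
  shows "F\<^sup>T * (mat_inv F)\<^sup>T = 1\<^sub>m n" "(mat_inv F)\<^sup>T * F\<^sup>T = 1\<^sub>m n"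
  unfolding transpose_mult[OF inv_mat_inverse(1,4)[OF assms], symmetric]
    transpose_mult[OF inv_mat_inverse(4,1)[OF assms], symmetric]
  by (simp_all only: inv_mat_inverse[OF assms] transpose_one)

text \<open>The defining relations multiplied out so that a scalar matrix stands in the middle;
  \<open>point_iff_pinv\<close> recovers the original form. In this shape the middle of a composite
  collapses.\<close>

definition point :: "('k::field, 'a, 'm) module_scheme \<Rightarrow> nat \<Rightarrow> 'k mat \<Rightarrow> nat \<Rightarrow> 'k mat \<Rightarrow> 'a mat \<Rightarrow> bool" where
  "point A n E m F z \<longleftrightarrow> z \<in> carrier_mat n m \<and> mcar A z \<and>
     mm A z\<^sup>T (mm A (sc A E) z) = sc A F \<and> mm A z (mm A (sc A (mat_inv F)) z\<^sup>T) = sc A (mat_inv E)"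

text \<open>The matrix F^-1 z^T E, which is the two-sided inverse of a point z. For E = F and z = a
  it is the antipode on generators.\<close>

definition pinv :: "('k::field, 'a, 'm) module_scheme \<Rightarrow> 'k mat \<Rightarrow> 'k mat \<Rightarrow> 'a mat \<Rightarrow> 'a mat" where
  "pinv A E F z = mm A (sc A (mat_inv F)) (mm A z\<^sup>T (sc A E))"

lemma pinv_dim [simp]: "dim_row (pinv A E F z) = dim_row (mat_inv F)" "dim_col (pinv A E F z) = dim_col E"
  by (simp_all add: pinv_def)

context kalg
begin

context
  fixes n m :: nat and E F :: "'k mat" and z :: "'a mat"
  assumes E: "inv_mat n E" and F: "inv_mat m F" and z: "z \<in> carrier_mat n m" "mcar A z"
begin

lemma dz: "dim_row z = n" "dim_col z = m"
  using z by auto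

lemma mcar_pinv [simp]: "mcar A (pinv A E F z)"
  using E F z by (simp add: pinv_def)

lemma pinv_left_iff: "mm A (pinv A E F z) z = sc A (1\<^sub>m m) \<longleftrightarrow> mm A z\<^sup>T (mm A (sc A E) z) = sc A F"
proof
  note i = inv_mat_inverse[OF F]
  assume "mm A (pinv A E F z) z = sc A (1\<^sub>m m)"
  then have "mm A (sc A F) (mm A (sc A (mat_inv F)) (mm A z\<^sup>T (mm A (sc A E) z))) = mm A (sc A F) (sc A (1\<^sub>m m))"
    using E F z dz by (simp add: pinv_def mm_assoc del: mm_one_right)
  moreover have "mm A (sc A F) (mm A (sc A (mat_inv F)) (mm A z\<^sup>T (mm A (sc A E) z)))
      = mm A (mm A (sc A F) (sc A (mat_inv F))) (mm A z\<^sup>T (mm A (sc A E) z))"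
    using E F z dz by (simp add: mm_assoc)
  ultimately show "mm A z\<^sup>T (mm A (sc A E) z) = sc A F"
    using E F z dz i by (simp add: sc_mult[symmetric])
next
  note i = inv_mat_inverse[OF F]
  assume "mm A z\<^sup>T (mm A (sc A E) z) = sc A F"
  then show "mm A (pinv A E F z) z = sc A (1\<^sub>m m)"
    using E F z dz i by (simp add: pinv_def mm_assoc sc_mult[symmetric])
qed

lemma pinv_right_iff: "mm A z (pinv A E F z) = sc A (1\<^sub>m n) \<longleftrightarrow> mm A z (mm A (sc A (mat_inv F)) z\<^sup>T) = sc A (mat_inv E)"
proof
  note i = inv_mat_inverse[OF E]
  assume "mm A z (pinv A E F z) = sc A (1\<^sub>m n)"
  then have "mm A (mm A z (pinv A E F z)) (sc A (mat_inv E)) = sc A (mat_inv E)"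
    using E by simp
  moreover have "mm A (mm A z (pinv A E F z)) (sc A (mat_inv E))
      = mm A (mm A z (mm A (sc A (mat_inv F)) z\<^sup>T)) (mm A (sc A E) (sc A (mat_inv E)))"
    using E F z dz by (simp add: mm_assoc pinv_def)
  ultimately show "mm A z (mm A (sc A (mat_inv F)) z\<^sup>T) = sc A (mat_inv E)"
    using E F z dz i by (simp add: sc_mult[symmetric])
next
  note i = inv_mat_inverse[OF E]
  assume "mm A z (mm A (sc A (mat_inv F)) z\<^sup>T) = sc A (mat_inv E)"
  then have "mm A (mm A z (mm A (sc A (mat_inv F)) z\<^sup>T)) (sc A E) = sc A (1\<^sub>m n)"
    using E i by (simp add: sc_mult[symmetric])
  then show "mm A z (pinv A E F z) = sc A (1\<^sub>m n)"
    using E F z dz by (simp add: pinv_def mm_assoc)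
qed

lemma point_iff_pinv: "point A n E m F z \<longleftrightarrow>
    mm A (pinv A E F z) z = sc A (1\<^sub>m m) \<and> mm A z (pinv A E F z) = sc A (1\<^sub>m n)"
  using z by (simp add: pinv_left_iff pinv_right_iff point_def)

end

text \<open>(zw)^T E (zw) = w^T (z^T E z) w = w^T G w = F, and likewise on the other side. Only the
  transposition of zw uses that z and w commute.\<close>

lemma point_compose:
  assumes E: "inv_mat n E" and G: "inv_mat l G" and F: "inv_mat m F"
    and z: "point A n E l G z" and w: "point A l G m F w" and c: "mcomm A z w"
  shows "point A n E m F (mm A z w)"
proof -
  have zc: "z \<in> carrier_mat n l" "mcar A z" "dim_row z = n" "dim_col z = l" using z by (auto simp: point_def)
  have wc: "w \<in> carrier_mat l m" "mcar A w" "dim_row w = l" "dim_col w = m" using w by (auto simp: point_def)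
  have T: "(mm A z w)\<^sup>T = mm A w\<^sup>T z\<^sup>T" using zc wc c by (intro mm_transpose) auto
  have z1: "mm A z\<^sup>T (mm A (sc A E) z) = sc A G" and z2: "mm A z (mm A (sc A (mat_inv G)) z\<^sup>T) = sc A (mat_inv E)"
    using z by (auto simp: point_def)
  have w1: "mm A w\<^sup>T (mm A (sc A G) w) = sc A F" and w2: "mm A w (mm A (sc A (mat_inv F)) w\<^sup>T) = sc A (mat_inv G)"
    using w by (auto simp: point_def)
  have "mm A (mm A z w)\<^sup>T (mm A (sc A E) (mm A z w)) = mm A w\<^sup>T (mm A (mm A z\<^sup>T (mm A (sc A E) z)) w)"
    unfolding T using E zc wc by (simp add: mm_assoc)
  also have "\<dots> = sc A F" by (simp add: z1 w1)
  finally have 1: "mm A (mm A z w)\<^sup>T (mm A (sc A E) (mm A z w)) = sc A F" .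
  have "mm A (mm A z w) (mm A (sc A (mat_inv F)) (mm A z w)\<^sup>T)
      = mm A z (mm A (mm A w (mm A (sc A (mat_inv F)) w\<^sup>T)) z\<^sup>T)"
    unfolding T using F zc wc by (simp add: mm_assoc)
  also have "\<dots> = sc A (mat_inv E)" by (simp add: z2 w2)
  finally show ?thesis using 1 zc wc by (auto simp: point_def)
qed

lemma point_hom:
  assumes "kalg B" "f \<in> alg_hom A B" "inv_mat n E" "inv_mat m F" "point A n E m F z"
  shows "point B n E m F (map_mat f z)"
proof -
  have zc: "z \<in> carrier_mat n m" "mcar A z" "dim_row z = n" "dim_col z = m" using assms(5) by (auto simp: point_def)
  have tr: "map_mat f z\<^sup>T = (map_mat f z)\<^sup>T" by (rule eq_matI) auto
  have "map_mat f (mm A z\<^sup>T (mm A (sc A E) z)) = map_mat f (sc A F)"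
    "map_mat f (mm A z (mm A (sc A (mat_inv F)) z\<^sup>T)) = map_mat f (sc A (mat_inv E))"
    using assms(5) by (simp_all add: point_def)
  then show ?thesis using zc assms(3,4)
    by (auto simp: point_def mm_hom[OF assms(1,2)] sc_hom[OF assms(2)] tr mcar_def
        lin_hom_closed[OF alg_hom_lin[OF assms(2)]])
qed

end

lemma mm_opposite:
  fixes A :: "('k::field, 'a) module"
  assumes "kalg A" "mcar A X" "mcar A Y" "dim_col X = dim_row Y"
  shows "mm (opposite_alg A) X Y = (mm A Y\<^sup>T X\<^sup>T)\<^sup>T"
proof -
  interpret kalg A by fact
  show ?thesis using assms by (intro eq_matI) (auto simp: mcarD intro!: finsum_cong')
qed

text \<open>Over the opposite algebra a product XY is the transpose of the old product of Y^T and
  X^T. The relation for w = F^-1 z^T E thus becomes the transpose of a product containing w^T F^T w,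
  and there wz = 1 and zw = 1 cancel everything except a scalar matrix.\<close>

lemma point_opposite:
  fixes A :: "('k::field, 'a) module"
  assumes A: "kalg A" and E: "inv_mat n E" and F: "inv_mat m F" and z: "point A n E m F z"
  shows "point (opposite_alg A) m F n E (pinv A E F z)"
proof -
  interpret kalg A by fact
  note iE = inv_mat_inverse[OF E] and iF = inv_mat_inverse[OF F]
  let ?w = "pinv A E F z"
  have zc: "z \<in> carrier_mat n m" "mcar A z" "dim_row z = n" "dim_col z = m" using z by (auto simp: point_def)
  have p: "mm A ?w z = sc A (1\<^sub>m m)" "mm A z ?w = sc A (1\<^sub>m n)"
    using z point_iff_pinv[OF E F zc(1,2)] by auto
  have wc: "mcar A ?w" "dim_row ?w = m" "dim_col ?w = n" using E F zc by (auto intro: mcar_pinv)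
  have sco: "sc (opposite_alg A) M = sc A M" for M by (simp add: sc_def)
  have wT: "?w\<^sup>T = mm A (sc A E\<^sup>T) (mm A z (sc A (mat_inv F)\<^sup>T))"
    unfolding pinv_def using E F zc by (simp add: mm_transpose sc_transpose mm_assoc)
  have "mm (opposite_alg A) ?w\<^sup>T (mm (opposite_alg A) (sc A F) ?w) = (mm A (mm A ?w\<^sup>T (sc A F\<^sup>T)) ?w)\<^sup>T"
    using E F zc wc by (simp add: mm_opposite[OF A] sc_transpose)
  also have "mm A (mm A ?w\<^sup>T (sc A F\<^sup>T)) ?w
      = mm A (sc A E\<^sup>T) (mm A z (mm A (mm A (sc A (mat_inv F)\<^sup>T) (sc A F\<^sup>T)) ?w))"
    unfolding wT using E F zc wc by (simp add: mm_assoc)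
  also have "\<dots> = sc A E\<^sup>T"
    using E F wc p by (simp add: sc_mult[symmetric] transpose_inverse[OF F])
  finally have 1: "mm (opposite_alg A) ?w\<^sup>T (mm (opposite_alg A) (sc A F) ?w) = sc A E"
    by (simp add: sc_transpose)
  have "mm (opposite_alg A) ?w (mm (opposite_alg A) (sc A (mat_inv E)) ?w\<^sup>T)
      = (mm A (mm A ?w (sc A (mat_inv E)\<^sup>T)) ?w\<^sup>T)\<^sup>T"
    using E F zc wc by (simp add: mm_opposite[OF A] sc_transpose)
  also have "mm A (mm A ?w (sc A (mat_inv E)\<^sup>T)) ?w\<^sup>T
      = mm A ?w (mm A (mm A (sc A (mat_inv E)\<^sup>T) (sc A E\<^sup>T)) (mm A z (sc A (mat_inv F)\<^sup>T)))"
    unfolding wT using E F zc wc by (simp add: mm_assoc)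
  also have "\<dots> = mm A (mm A ?w z) (sc A (mat_inv F)\<^sup>T)"
    using E F wc zc by (simp add: sc_mult[symmetric] transpose_inverse[OF E] mm_assoc)
  also have "\<dots> = sc A (mat_inv F)\<^sup>T" using F by (simp add: p)
  finally have 2: "mm (opposite_alg A) ?w (mm (opposite_alg A) (sc A (mat_inv E)) ?w\<^sup>T) = sc A (mat_inv F)"
    by (simp add: sc_transpose)
  show ?thesis using 1 2 wc by (auto simp: point_def sco mcar_def)
qed

subsection \<open>Free algebras\<close>

lemma mult_eq_bil: "(u :: 'g word \<Rightarrow>\<^sub>0 'k::field) * v = bil (+) u v"
proof -
  have "Poly_Mapping.keys u \<subseteq> UNIV" by simp
  then show ?thesis
  proof (induction rule: keys_induct)
    case (single p c)
    have "Poly_Mapping.keys v \<subseteq> UNIV" by simp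
    then show ?case
      by (induction rule: keys_induct) (simp_all add: mult_single bil_add_right distrib_left)
  qed (simp_all add: bil_add_left distrib_right)
qed

lemma pscale_mult: "pscale c u * (v :: 'g word \<Rightarrow>\<^sub>0 'k::field) = pscale c (u * v)"
  "(u :: 'g word \<Rightarrow>\<^sub>0 'k::field) * pscale c v = pscale c (u * v)"
  by (simp_all add: mult_eq_bil bil_pscale)

lemma letters_simps [simp]: "letters 0 = []" "letters (u + v) = letters u @ letters v"
  by (simp_all add: zero_word_def plus_word_def)

lemma free_alg_simps:
  "carrier (free_alg G) = {u. Poly_Mapping.keys u \<subseteq> {w. set (letters w) \<subseteq> G}}"
  "mult (free_alg G) = (*)" "one (free_alg G) = 1" "zero (free_alg G) = 0"
  "add (free_alg G) = (+)" "smult (free_alg G) = pscale"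
  by (auto simp: free_alg_def)

lemma free_alg_kalg: "kalg (free_alg G :: ('k::field, 'g word \<Rightarrow>\<^sub>0 'k) module)"
proof (intro kalgI k_algebraI ringI abelian_groupI monoidI)
  fix x :: "'g word \<Rightarrow>\<^sub>0 'k" assume "x \<in> carrier (free_alg G)"
  then show "\<exists>y\<in>carrier (free_alg G :: ('k, 'g word \<Rightarrow>\<^sub>0 'k) module). y \<oplus>\<^bsub>free_alg G\<^esub> x = \<zero>\<^bsub>free_alg G\<^esub>"
    by (intro bexI[of _ "- x"]) (auto simp: free_alg_simps)
next
  fix x y :: "'g word \<Rightarrow>\<^sub>0 'k" assume "x \<in> carrier (free_alg G)" "y \<in> carrier (free_alg G)"
  then show "x \<otimes>\<^bsub>free_alg G\<^esub> y \<in> carrier (free_alg G)"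
    unfolding free_alg_simps mem_Collect_eq mult_eq_bil by (rule keys_bil) auto
next
  show "\<one>\<^bsub>free_alg G\<^esub> \<in> carrier (free_alg G :: ('k, 'g word \<Rightarrow>\<^sub>0 'k) module)"
    by (auto simp: free_alg_simps simp flip: single_one)
qed (simp_all add: free_alg_simps distrib_left distrib_right mult.assoc pm.scale_left_distrib
    pm.scale_right_distrib add_ac keys_add_subset order_trans[OF keys_pscale] pscale_mult)

lemma free_eval_lin_ext: "free_eval A \<phi> = lin_ext A (word_eval A \<phi>)"
  by (simp add: fun_eq_iff free_eval_def lin_ext_def)

lemma (in kalg) word_eval_closed: "\<phi> \<in> G \<rightarrow> carrier A \<Longrightarrow> set (letters w) \<subseteq> G \<Longrightarrow> word_eval A \<phi> w \<in> carrier A"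
proof (induction "letters w" arbitrary: w)
  case (Cons g l)
  have "word_eval A \<phi> (Word l) \<in> carrier A" using Cons(1)[of "Word l"] Cons.prems Cons(2)[symmetric] by auto
  then show ?case using Cons by (auto simp: word_eval_def simp flip: Cons(2))
qed (simp add: word_eval_def)

lemma (in kalg) word_eval_add:
  assumes "\<phi> \<in> G \<rightarrow> carrier A" "set (letters u) \<subseteq> G" "set (letters v) \<subseteq> G"
  shows "word_eval A \<phi> (u + v) = word_eval A \<phi> u \<otimes> word_eval A \<phi> v"
  using assms(2)
proof (induction "letters u" arbitrary: u)
  case Nil
  then show ?case using word_eval_closed[OF assms(1,3)] by (simp add: word_eval_def)
next
  case (Cons g l)
  have "word_eval A \<phi> (Word l + v) = word_eval A \<phi> (Word l) \<otimes> word_eval A \<phi> v"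
    using Cons(1)[of "Word l"] Cons.prems Cons(2)[symmetric] by auto
  then show ?case
    using Cons assms(1) word_eval_closed[OF assms(1), of "Word l"] word_eval_closed[OF assms(1,3)]
    by (simp add: word_eval_def m_assoc Pi_def flip: Cons(2))
qed

context kalg
begin

context
  fixes \<phi> :: "'g \<Rightarrow> 'a" and G
  assumes \<phi>: "\<phi> \<in> G \<rightarrow> carrier A"
begin

lemma word_eval_Pi: "word_eval A \<phi> \<in> {w. set (letters w) \<subseteq> G} \<rightarrow> carrier A"
  using word_eval_closed[OF \<phi>] by auto

lemma free_eval_hom: "free_eval A \<phi> \<in> alg_hom (free_alg G) A"
proof (rule alg_homI)
  note wp = word_eval_Pi
  show "free_eval A \<phi> \<in> lin_hom (free_alg G) A"
    by (rule lin_homI)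
      (simp_all add: free_alg_simps free_eval_lin_ext lin_ext_closed[OF wp] lin_ext_add[OF wp] lin_ext_pscale[OF wp])
  show "free_eval A \<phi> \<one>\<^bsub>free_alg G\<^esub> = \<one>"
    by (simp add: free_alg_simps free_eval_lin_ext word_eval_def flip: single_one)
  fix u v assume u: "u \<in> carrier (free_alg G :: ('k, _) module)" and v: "v \<in> carrier (free_alg G :: ('k, _) module)"
  let ?W = "{w. set (letters w) \<subseteq> G}"
  have u': "Poly_Mapping.keys u \<subseteq> ?W" and v': "Poly_Mapping.keys v \<subseteq> ?W" using u v by (auto simp: free_alg_simps)
  have kb: "Poly_Mapping.keys (bil (+) u v) \<subseteq> ?W" if "Poly_Mapping.keys u \<subseteq> ?W" "Poly_Mapping.keys v \<subseteq> ?W"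
    for u v :: "'g word \<Rightarrow>\<^sub>0 'k" using that by (rule keys_bil) auto
  note ad = lin_ext_add[OF wp] and cl = lin_ext_closed[OF wp]
  have "lin_ext A (word_eval A \<phi>) (bil (+) u v) = lin_ext A (word_eval A \<phi>) u \<otimes> lin_ext A (word_eval A \<phi>) v"
    using u'
  proof (induction rule: keys_induct)
    case zero
    then show ?case using cl[OF v'] by simp
  next
    case p: (single p c)
    have sp: "Poly_Mapping.keys (Poly_Mapping.single p c) \<subseteq> ?W" using p by auto
    show ?case using v'
    proof (induction rule: keys_induct)
      case zero
      then show ?case using cl[OF sp] by simp
    next
      case (single q d)
      then show ?case using p word_eval_closed[OF \<phi>]
        by (simp add: word_eval_add[OF \<phi>] mult.commute)
    next
      case (add v1 v2)
      have "lin_ext A (word_eval A \<phi>) (bil (+) (Poly_Mapping.single p c) (v1 + v2))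
          = lin_ext A (word_eval A \<phi>) (bil (+) (Poly_Mapping.single p c) v1) \<oplus> lin_ext A (word_eval A \<phi>) (bil (+) (Poly_Mapping.single p c) v2)"
        using ad[OF kb[OF sp add.hyps(1)] kb[OF sp add.hyps(2)]] by (simp add: bil_add_right)
      then show ?case
        using add ad[OF add.hyps] cl[OF sp] cl[OF add.hyps(1)] cl[OF add.hyps(2)] by (simp add: r_distr)
    qed
  next
    case (add u1 u2)
    have "lin_ext A (word_eval A \<phi>) (bil (+) (u1 + u2) v)
          = lin_ext A (word_eval A \<phi>) (bil (+) u1 v) \<oplus> lin_ext A (word_eval A \<phi>) (bil (+) u2 v)"
      using ad[OF kb[OF add.hyps(1) v'] kb[OF add.hyps(2) v']] by (simp add: bil_add_left)
    then show ?case
      using add ad[OF add.hyps] cl[OF v'] cl[OF add.hyps(1)] cl[OF add.hyps(2)] by (simp add: l_distr)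
  qed
  then show "free_eval A \<phi> (u \<otimes>\<^bsub>free_alg G\<^esub> v) = free_eval A \<phi> u \<otimes> free_eval A \<phi> v"
    by (simp add: free_eval_lin_ext free_alg_simps mult_eq_bil)
qed

lemma free_eval_gen: "g \<in> G \<Longrightarrow> free_eval A \<phi> (gen g) = \<phi> g"
  using \<phi> by (auto simp: free_eval_lin_ext gen_def word_eval_def Pi_def)

end

end

lemma gen_closed: "g \<in> G \<Longrightarrow> gen g \<in> carrier (free_alg G :: ('k::field, 'g word \<Rightarrow>\<^sub>0 'k) module)"
  by (auto simp: gen_def free_alg_simps)

lemma free_alg_induct [consumes 1, case_names one gen mult add smult]:
  fixes u :: "'g word \<Rightarrow>\<^sub>0 'k::field"
  assumes "u \<in> carrier (free_alg G :: ('k, 'g word \<Rightarrow>\<^sub>0 'k) module)" "P 1"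
    and gen: "\<And>g. g \<in> G \<Longrightarrow> P (gen g)"
    and mult: "\<And>u v. u \<in> carrier (free_alg G :: ('k, 'g word \<Rightarrow>\<^sub>0 'k) module) \<Longrightarrow>
      v \<in> carrier (free_alg G :: ('k, 'g word \<Rightarrow>\<^sub>0 'k) module) \<Longrightarrow> P u \<Longrightarrow> P v \<Longrightarrow> P (u * v)"
    and plus: "\<And>u v. u \<in> carrier (free_alg G :: ('k, 'g word \<Rightarrow>\<^sub>0 'k) module) \<Longrightarrow>
      v \<in> carrier (free_alg G :: ('k, 'g word \<Rightarrow>\<^sub>0 'k) module) \<Longrightarrow> P u \<Longrightarrow> P v \<Longrightarrow> P (u + v)"
    and smult: "\<And>c u. u \<in> carrier (free_alg G :: ('k, 'g word \<Rightarrow>\<^sub>0 'k) module) \<Longrightarrow> P u \<Longrightarrow> P (pscale c u)"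
  shows "P u"
proof -
  interpret F: kalg "free_alg G :: ('k, 'g word \<Rightarrow>\<^sub>0 'k) module" by (rule free_alg_kalg)
  have word: "P (Poly_Mapping.single (Word l) 1) \<and>
      Poly_Mapping.single (Word l) 1 \<in> carrier (free_alg G :: ('k, 'g word \<Rightarrow>\<^sub>0 'k) module)" if "set l \<subseteq> G" for l
    using that
  proof (induction l)
    case Nil
    then show ?case using assms(2) F.one_closed by (simp add: free_alg_simps(3) flip: single_one zero_word_def)
  next
    case (Cons g l)
    have "Poly_Mapping.single (Word (g # l)) (1::'k) = gen g * Poly_Mapping.single (Word l) 1"
      by (simp add: gen_def mult_single plus_word_def)
    then show ?case
      using Cons mult[OF gen_closed[of g G]] gen F.m_closed[OF gen_closed[of g G]]
      by (simp add: free_alg_simps(2))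
  qed
  have "Poly_Mapping.keys u \<subseteq> {w. set (letters w) \<subseteq> G}" using assms(1) by (auto simp: free_alg_simps)
  then show ?thesis
  proof (induction rule: keys_induct)
    case zero
    show ?case using smult[of 1 0] F.one_closed assms(2) by (simp add: free_alg_simps(3))
  next
    case (single p c)
    have "Poly_Mapping.single p c = pscale c (Poly_Mapping.single (Word (letters p)) 1)" by simp
    then show ?case using word[of "letters p"] smult single by (metis mem_Collect_eq)
  next
    case (add u v)
    then show ?case by (intro plus) (auto simp: free_alg_simps)
  qed
qed

subsection \<open>The algebras \<open>\<B>(E,F)\<close>\<close>

lemma finsum_free_alg:
  "f \<in> I \<rightarrow> carrier (free_alg G) \<Longrightarrow> finite I \<Longrightarrow> finsum (free_alg G :: ('k::field, 'g word \<Rightarrow>\<^sub>0 'k) module) f I = sum f I"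
proof -
  interpret F: kalg "free_alg G :: ('k, 'g word \<Rightarrow>\<^sub>0 'k) module" by (rule free_alg_kalg)
  show "f \<in> I \<rightarrow> carrier (free_alg G) \<Longrightarrow> finite I \<Longrightarrow> finsum (free_alg G) f I = sum f I"
    by (rotate_tac, induction I rule: finite_induct) (auto simp: free_alg_simps(4,5) F.finsum_insert Pi_def)
qed

locale bef =
  fixes n :: nat and E :: "'k::field mat" and m :: nat and F :: "'k mat"
  assumes E: "inv_mat n E" and F: "inv_mat m F"
begin

abbreviation "Fr \<equiv> BEF_free E F"
abbreviation "z0 \<equiv> gen_mat n m :: 'k free_elt mat"

lemma Fr_def: "Fr = free_alg ({..<n} \<times> {..<m})"
  using E F by (simp add: BEF_free_def)

sublocale Fr: kalg "BEF_free E F"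
  unfolding Fr_def by (rule free_alg_kalg)

lemma Fr_simps: "mult Fr = (*)" "one Fr = 1" "zero Fr = 0" "add Fr = (+)" "smult Fr = pscale"
  by (simp_all add: Fr_def free_alg_simps)

lemma Fr_minus: "x \<in> carrier Fr \<Longrightarrow> y \<in> carrier Fr \<Longrightarrow> x \<ominus>\<^bsub>Fr\<^esub> y = x - y"
  using Fr.minus_conv_smult[of y] by (simp add: a_minus_def Fr_simps)

lemma z0: "z0 \<in> carrier_mat n m" "mcar Fr z0" "dim_row z0 = n" "dim_col z0 = m"
  by (auto simp: gen_mat_def mcar_def Fr_def intro!: gen_closed)

lemma finsum_Fr: "f \<in> I \<rightarrow> carrier Fr \<Longrightarrow> finite I \<Longrightarrow> finsum Fr f I = sum f I"
  unfolding Fr_def by (rule finsum_free_alg)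

text \<open>The relations are stated with the matrix product over a type of polynomials; on entries
  from the carrier this agrees with \<open>mm\<close>, which is the product that algebra maps
  transport.\<close>

lemma free_mm: "mcar Fr X \<Longrightarrow> mcar Fr Y \<Longrightarrow> dim_col X = dim_row Y \<Longrightarrow> X * Y = mm Fr X Y"
proof (rule eq_matI; simp)
  fix i j assume "mcar Fr X" "mcar Fr Y" "dim_col X = dim_row Y" "i < dim_row X" "j < dim_col Y"
  moreover from this have "X $$ (i, k) * Y $$ (k, j) \<in> carrier Fr" if "k < dim_row Y" for k
    using that Fr.m_closed[unfolded Fr_simps] by (simp add: mcarD)
  ultimately show "row X i \<bullet> col Y j = (\<Oplus>\<^bsub>Fr\<^esub>k\<in>{..<dim_row Y}. X $$ (i, k) \<otimes>\<^bsub>Fr\<^esub> Y $$ (k, j))"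
    unfolding Fr_simps by (subst finsum_Fr) (auto simp: scalar_prod_def lessThan_atLeast0)
qed

lemma const_mat_sc: "const_mat M = sc Fr M"
  by (rule eq_matI) (auto simp: const_mat_def Fr_simps simp flip: single_one)

lemma one_mat_sc: "1\<^sub>m l = sc Fr (1\<^sub>m l)"
  by (rule eq_matI) (auto simp: Fr_simps simp flip: single_one)

text \<open>In this form the relations say that \<open>z0\<close> and \<open>pinv\<close> are
  inverse to each other, which any algebra map carries over entrywise.\<close>

lemma relations_eq:
  "BEF_relations E F =
     {mm Fr (pinv Fr E F z0) z0 $$ (i, j) \<ominus>\<^bsub>Fr\<^esub> sc Fr (1\<^sub>m m) $$ (i, j) | i j. i < m \<and> j < m} \<union>
     {mm Fr z0 (pinv Fr E F z0) $$ (i, j) \<ominus>\<^bsub>Fr\<^esub> sc Fr (1\<^sub>m n) $$ (i, j) | i j. i < n \<and> j < n}"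
proof -
  have L: "const_mat (mat_inv F) * z0\<^sup>T * const_mat E * z0 = mm Fr (pinv Fr E F z0) z0"
    using E F z0 by (simp add: const_mat_sc free_mm pinv_def Fr.mm_assoc)
  have R: "z0 * const_mat (mat_inv F) * z0\<^sup>T * const_mat E = mm Fr z0 (pinv Fr E F z0)"
    using E F z0 by (simp add: const_mat_sc free_mm pinv_def Fr.mm_assoc)
  have p: "mcar Fr (pinv Fr E F z0)" "mcar Fr z0" using Fr.mcar_pinv[OF E F z0(1,2)] z0 by auto
  have c: "mcar Fr (mm Fr (pinv Fr E F z0) z0)" "mcar Fr (mm Fr z0 (pinv Fr E F z0))"
    using p E F z0 by auto
  have c1: "mm Fr (pinv Fr E F z0) z0 $$ (i, j) \<ominus>\<^bsub>Fr\<^esub> sc Fr (1\<^sub>m m) $$ (i, j) =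
      mm Fr (pinv Fr E F z0) z0 $$ (i, j) - sc Fr (1\<^sub>m m) $$ (i, j)" if "i < m" "j < m" for i j
    by (rule Fr_minus) (use that c F z0 in \<open>auto simp: mcar_def simp del: mm_index\<close>)
  have c2: "mm Fr z0 (pinv Fr E F z0) $$ (i, j) \<ominus>\<^bsub>Fr\<^esub> sc Fr (1\<^sub>m n) $$ (i, j) =
      mm Fr z0 (pinv Fr E F z0) $$ (i, j) - sc Fr (1\<^sub>m n) $$ (i, j)" if "i < n" "j < n" for i j
    by (rule Fr_minus) (use that c E z0 in \<open>auto simp: mcar_def simp del: mm_index\<close>)
  show ?thesis
    unfolding BEF_relations_def Let_def inv_mat_dim(1)[OF E] inv_mat_dim(1)[OF F] L R
    unfolding one_mat_sc
    by (intro arg_cong2[where f = "(\<union>)"] Collect_cong iff_exI) (auto simp: c1 c2 simp del: sc_index mm_index)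
qed

lemma relations_closed: "BEF_relations E F \<subseteq> carrier Fr"
proof -
  have p: "mcar Fr (pinv Fr E F z0)" "mcar Fr z0" using Fr.mcar_pinv[OF E F z0(1,2)] z0 by auto
  have c: "mcar Fr (mm Fr (pinv Fr E F z0) z0)" "mcar Fr (mm Fr z0 (pinv Fr E F z0))"
    using p E F z0 by auto
  show ?thesis unfolding relations_eq
    using c E F z0 by (auto simp: mcar_def simp del: mm_index)
qed

sublocale I: kalg_ideal "BEF_free E F" "BEF_ideal E F"
  unfolding kalg_ideal_def BEF_ideal_def
  by (simp add: Fr.kalg_axioms Fr.genideal_ideal relations_closed)

lemma alg_kalg: "kalg (BEF_alg E F)"
  unfolding BEF_alg_def by (rule I.quotient_kalg)

sublocale B: kalg "BEF_alg E F" by (rule alg_kalg)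

lemma class_hom: "BEF_class E F \<in> alg_hom Fr (BEF_alg E F)"
  unfolding BEF_class_def[abs_def] BEF_alg_def by (rule I.proj_hom)

definition "gens = map_mat (BEF_class E F) z0"

lemma gens_dim [simp]: "dim_row gens = n" "dim_col gens = m"
  by (simp_all add: gens_def z0)

lemma gens_index [simp]: "i < n \<Longrightarrow> j < m \<Longrightarrow> gens $$ (i, j) = BEF_gen E F i j"
  by (simp add: gens_def gen_mat_def)

lemma pinv_class: "map_mat (BEF_class E F) (pinv Fr E F z0) = pinv (BEF_alg E F) E F gens"
proof -
  have "map_mat (BEF_class E F) z0\<^sup>T = gens\<^sup>T" by (rule eq_matI) (auto simp: gens_def z0)
  then show ?thesis using E F z0 unfolding pinv_def
    by (simp add: Fr.mm_hom[OF alg_kalg class_hom] Fr.sc_hom[OF class_hom])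
qed

lemma BEF_class_eqI: "x \<in> carrier Fr \<Longrightarrow> y \<in> carrier Fr \<Longrightarrow> x \<ominus>\<^bsub>Fr\<^esub> y \<in> BEF_relations E F \<Longrightarrow>
    BEF_class E F x = BEF_class E F y"
  unfolding BEF_class_def using Fr.genideal_self[OF relations_closed]
  by (subst I.rcos_eq_iff) (auto simp: BEF_ideal_def)

text \<open>This is the universal point: every (E,F)-point is its image under an algebra map
  (\<open>alg_lift_hom\<close>), and that map is unique (\<open>alg_hom_eq\<close>).\<close>

lemma gens_point: "point (BEF_alg E F) n E m F gens"
proof -
  have gc: "gens \<in> carrier_mat n m" "mcar (BEF_alg E F) gens"
    using mcarD[OF z0(2)] lin_hom_closed[OF alg_hom_lin[OF class_hom]] z0 by (auto simp: mcar_def gens_def)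
  have p: "mcar Fr (pinv Fr E F z0)" "mcar Fr z0" using Fr.mcar_pinv[OF E F z0(1,2)] z0 by auto
  have c: "mcar Fr (mm Fr (pinv Fr E F z0) z0)" "mcar Fr (mm Fr z0 (pinv Fr E F z0))"
    using p E F z0 by auto
  have "map_mat (BEF_class E F) (mm Fr (pinv Fr E F z0) z0) = map_mat (BEF_class E F) (sc Fr (1\<^sub>m m))"
  proof -
    have "BEF_class E F (mm Fr (pinv Fr E F z0) z0 $$ (i, j)) = BEF_class E F (sc Fr (1\<^sub>m m) $$ (i, j))"
      if "i < m" "j < m" for i j
      using that c F z0 by (intro BEF_class_eqI)
        (auto simp: mcar_def relations_eq simp del: mm_index sc_index intro: Fr.mcar_sc[THEN mcarD])
    then show ?thesis using F z0 by (intro eq_matI) (simp_all del: mm_index sc_index)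
  qed
  moreover have "map_mat (BEF_class E F) (mm Fr z0 (pinv Fr E F z0)) = map_mat (BEF_class E F) (sc Fr (1\<^sub>m n))"
  proof -
    have "BEF_class E F (mm Fr z0 (pinv Fr E F z0) $$ (i, j)) = BEF_class E F (sc Fr (1\<^sub>m n) $$ (i, j))"
      if "i < n" "j < n" for i j
      using that c E z0 by (intro BEF_class_eqI)
        (auto simp: mcar_def relations_eq simp del: mm_index sc_index intro: Fr.mcar_sc[THEN mcarD])
    then show ?thesis using E z0 by (intro eq_matI) (simp_all del: mm_index sc_index)
  qed
  ultimately show ?thesis
    using p E F z0 unfolding B.point_iff_pinv[OF E F gc] gens_def[symmetric]
    by (simp add: Fr.mm_hom[OF alg_kalg class_hom] Fr.sc_hom[OF class_hom] pinv_class gens_def[symmetric])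
qed

lemma gens_closed [simp]: "mcar (BEF_alg E F) gens" "gens \<in> carrier_mat n m"
  using gens_point by (auto simp: point_def)

lemma gen_in_alg [simp]: "i < n \<Longrightarrow> j < m \<Longrightarrow> BEF_gen E F i j \<in> carrier (BEF_alg E F)"
  using mcarD[OF gens_closed(1), of i j] by simp

lemma alg_induct [consumes 1, case_names one gen mult add smult]:
  assumes "x \<in> carrier (BEF_alg E F)" "P \<one>\<^bsub>BEF_alg E F\<^esub>"
    and gen: "\<And>i j. i < n \<Longrightarrow> j < m \<Longrightarrow> P (BEF_gen E F i j)"
    and mult: "\<And>x y. x \<in> carrier (BEF_alg E F) \<Longrightarrow> y \<in> carrier (BEF_alg E F) \<Longrightarrow> P x \<Longrightarrow> P y \<Longrightarrow> P (x \<otimes>\<^bsub>BEF_alg E F\<^esub> y)"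
    and plus: "\<And>x y. x \<in> carrier (BEF_alg E F) \<Longrightarrow> y \<in> carrier (BEF_alg E F) \<Longrightarrow> P x \<Longrightarrow> P y \<Longrightarrow> P (x \<oplus>\<^bsub>BEF_alg E F\<^esub> y)"
    and smult: "\<And>c x. x \<in> carrier (BEF_alg E F) \<Longrightarrow> P x \<Longrightarrow> P (c \<odot>\<^bsub>BEF_alg E F\<^esub> x)"
  shows "P x"
proof -
  obtain u where u: "u \<in> carrier Fr" "x = BEF_class E F u"
    using assms(1) by (auto simp: BEF_alg_def I.quotient_alg_simps BEF_class_def)
  note h = alg_hom_mult[OF class_hom, unfolded Fr_simps] alg_hom_one[OF class_hom, unfolded Fr_simps]
    lin_hom_add[OF alg_hom_lin[OF class_hom], unfolded Fr_simps] lin_hom_smult[OF alg_hom_lin[OF class_hom], unfolded Fr_simps]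
    lin_hom_closed[OF alg_hom_lin[OF class_hom]]
  show ?thesis unfolding u(2) using u(1) unfolding Fr_def
    by (induction rule: free_alg_induct, fold Fr_def) (auto simp: h assms(2) gen mult plus smult)
qed

lemma alg_hom_eq:
  assumes "f \<in> alg_hom (BEF_alg E F) T" "g \<in> alg_hom (BEF_alg E F) T"
    "\<And>i j. i < n \<Longrightarrow> j < m \<Longrightarrow> f (BEF_gen E F i j) = g (BEF_gen E F i j)"
    "x \<in> carrier (BEF_alg E F)"
  shows "f x = g x"
  using assms(4)
  by (induction rule: alg_induct)
    (simp_all add: assms(3) alg_hom_one[OF assms(1)] alg_hom_one[OF assms(2)]
      alg_hom_mult[OF assms(1)] alg_hom_mult[OF assms(2)]
      lin_hom_add[OF alg_hom_lin[OF assms(1)]] lin_hom_add[OF alg_hom_lin[OF assms(2)]]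
      lin_hom_smult[OF alg_hom_lin[OF assms(1)]] lin_hom_smult[OF alg_hom_lin[OF assms(2)]])

text \<open>The universal property of \<open>\<B>(E,F)\<close>. The kernel of evaluation on the free
  algebra is an ideal, and it contains the relations exactly because z is a point; so it contains
  the ideal they generate.\<close>

lemma
  assumes "kalg A" "point A n E m F z" and \<phi>: "\<And>i j. i < n \<Longrightarrow> j < m \<Longrightarrow> \<phi> (i, j) = z $$ (i, j)"
  shows alg_lift_hom: "alg_lift A \<phi> \<in> alg_hom (BEF_alg E F) A"
    and alg_lift_gen: "i < n \<Longrightarrow> j < m \<Longrightarrow> alg_lift A \<phi> (BEF_gen E F i j) = z $$ (i, j)"
proof -
  interpret A: kalg A by fact
  have zc: "z \<in> carrier_mat n m" "mcar A z" "dim_row z = n" "dim_col z = m" using assms(2) by (auto simp: point_def)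
  have \<phi>G: "\<phi> \<in> {..<n} \<times> {..<m} \<rightarrow> carrier A" using zc mcarD[OF zc(2)] by (auto simp: \<phi>)
  have hom: "free_eval A \<phi> \<in> alg_hom Fr A" unfolding Fr_def by (rule A.free_eval_hom[OF \<phi>G])
  have mz: "map_mat (free_eval A \<phi>) z0 = z" "map_mat (free_eval A \<phi>) z0\<^sup>T = z\<^sup>T"
    using zc by (auto intro!: eq_matI simp: gen_mat_def A.free_eval_gen[OF \<phi>G] \<phi>)
  have mp: "map_mat (free_eval A \<phi>) (pinv Fr E F z0) = pinv A E F z"
    using E F z0 mz unfolding pinv_def by (simp add: Fr.mm_hom[OF assms(1) hom] Fr.sc_hom[OF hom])
  have p: "mcar Fr (pinv Fr E F z0)" "mcar Fr z0" using Fr.mcar_pinv[OF E F z0(1,2)] z0 by auto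
  have c: "mcar Fr (mm Fr (pinv Fr E F z0) z0)" "mcar Fr (mm Fr z0 (pinv Fr E F z0))"
    using p E F z0 by auto
  have e: "map_mat (free_eval A \<phi>) (mm Fr (pinv Fr E F z0) z0) = map_mat (free_eval A \<phi>) (sc Fr (1\<^sub>m m))"
    "map_mat (free_eval A \<phi>) (mm Fr z0 (pinv Fr E F z0)) = map_mat (free_eval A \<phi>) (sc Fr (1\<^sub>m n))"
    using assms(2) p E F z0 unfolding A.point_iff_pinv[OF E F zc(1,2)]
    by (simp_all add: Fr.mm_hom[OF assms(1) hom] Fr.sc_hom[OF hom] mz mp)
  have e1: "free_eval A \<phi> (mm Fr (pinv Fr E F z0) z0 $$ (i, j)) = free_eval A \<phi> (sc Fr (1\<^sub>m m) $$ (i, j))"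
    if "i < m" "j < m" for i j
    using arg_cong[OF e(1), of "\<lambda>X. X $$ (i, j)"] that F z0 by (simp del: mm_index sc_index)
  have e2: "free_eval A \<phi> (mm Fr z0 (pinv Fr E F z0) $$ (i, j)) = free_eval A \<phi> (sc Fr (1\<^sub>m n) $$ (i, j))"
    if "i < n" "j < n" for i j
    using arg_cong[OF e(2), of "\<lambda>X. X $$ (i, j)"] that E z0 by (simp del: mm_index sc_index)
  have "ring_hom_ring Fr A (free_eval A \<phi>)"
    by (rule ring_hom_ringI2) (use hom Fr.ring_axioms A.ring_axioms in \<open>auto simp: alg_hom_def\<close>)
  then have kid: "ideal (a_kernel Fr A (free_eval A \<phi>)) Fr" by (rule ring_hom_ring.kernel_is_ideal)
  have "BEF_relations E F \<subseteq> a_kernel Fr A (free_eval A \<phi>)"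
  proof
    fix r assume r: "r \<in> BEF_relations E F"
    have cl: "x \<in> carrier Fr \<Longrightarrow> free_eval A \<phi> x \<in> carrier A" for x by (rule lin_hom_closed[OF alg_hom_lin[OF hom]])
    have s: "sc Fr (1\<^sub>m l) $$ (i, j) \<in> carrier Fr" if "i < l" "j < l" for i j l using that by simp
    have "free_eval A \<phi> r = \<zero>\<^bsub>A\<^esub>"
      using r c z0 E F unfolding relations_eq
      by (auto simp: Fr.lin_hom_minus[OF assms(1) alg_hom_lin[OF hom]] s e1 e2 mcarD cl A.r_neg a_minus_def[of A]
          simp del: mm_index sc_index)
    then show "r \<in> a_kernel Fr A (free_eval A \<phi>)" using r relations_closed by (auto simp: a_kernel_def')
  qed
  then have sub: "BEF_ideal E F \<subseteq> a_kernel Fr A (free_eval A \<phi>)"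
    unfolding BEF_ideal_def by (rule Fr.genideal_minimal[OF kid])
  have ker: "free_eval A \<phi> u = \<zero>\<^bsub>A\<^esub>" if "u \<in> BEF_ideal E F" for u
    using that sub by (auto simp: a_kernel_def')
  show "alg_lift A \<phi> \<in> alg_hom (BEF_alg E F) A"
    unfolding alg_lift_def[abs_def] BEF_alg_def by (rule I.the_elem_alg_hom[OF assms(1) hom ker])
  show "alg_lift A \<phi> (BEF_gen E F i j) = z $$ (i, j)" if "i < n" "j < m"
  proof -
    have g: "gen (i, j) \<in> carrier Fr" unfolding Fr_def using that by (intro gen_closed) auto
    show ?thesis
      using I.the_elem_coset[OF assms(1) g alg_hom_lin[OF hom] ker] that
      by (simp add: alg_lift_def BEF_class_def A.free_eval_gen[OF \<phi>G] \<phi>)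
  qed
qed

end

subsection \<open>Record extensions\<close>

lemma extend_simps [simp]:
  "carrier (module.extend A x) = carrier A" "mult (module.extend A x) = mult A"
  "one (module.extend A x) = one A" "zero (module.extend A x) = zero A"
  "add (module.extend A x) = add A" "smult (module.extend A x) = smult A"
  by (simp_all add: module.defs)

lemma finsum_extend [simp]: "finsum (module.extend A x) = finsum A"
  by (simp add: fun_eq_iff finsum_def finprod_def)

lemma hom_extend [simp]:
  "lin_hom (module.extend A x) B = lin_hom A B" "lin_hom B (module.extend A x) = lin_hom B A"
  "alg_hom (module.extend A x) B = alg_hom A B" "alg_hom B (module.extend A x) = alg_hom B A"
  by (simp_all add: lin_hom_def alg_hom_def Ring.ring_hom_def)

lemma tensor_lift_extend [simp]: "tensor_lift (module.extend A x) \<phi> = tensor_lift A \<phi>"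
  by (simp add: fun_eq_iff tensor_lift_def)

lemma tensor_map_extend [simp]:
  "tensor_map (module.extend A x) B = tensor_map A B" "tensor_map B (module.extend A x) = tensor_map B A"
  by (simp_all add: fun_eq_iff tensor_map_def)

lemma tensor_assoc_extend [simp]:
  "tensor_assoc (module.extend A x) B C = tensor_assoc A B C"
  "tensor_assoc B (module.extend A x) C = tensor_assoc B A C"
  "tensor_assoc B C (module.extend A x) = tensor_assoc B C A"
  by (simp_all add: tensor_assoc_def)

lemma kalg_extend: "kalg A \<Longrightarrow> kalg (module.extend A x)"
proof -
  assume "kalg A"
  then interpret kalg A .
  show ?thesis
    by (intro kalgI k_algebraI ringI abelian_groupI monoidI)
      (auto simp: a_ac m_assoc l_distr r_distr smult_l_distr smult_r_distr intro: add.l_inv_ex)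
qed

lemma opposite_hom [simp]: "lin_hom A (opposite_alg B) = lin_hom A B"
  by (simp add: lin_hom_def)

lemma alg_hom_id': "id \<in> alg_hom A A"
  using alg_hom_id by (simp add: id_def)

lemma lin_hom_id': "id \<in> lin_hom A A"
  using lin_hom_id by (simp add: id_def)

subsection \<open>Points of tensor products\<close>

text \<open>A matrix product with tensor signs. It equals (X \<otimes> 1)(1 \<otimes> Y) by
  \<open>tmm_eq_mm\<close>, a product of two matrices whose entries commute with each other.\<close>

definition tmm :: "('k::field, 'a, 'm) module_scheme \<Rightarrow> ('k, 'b, 'n) module_scheme \<Rightarrow> 'a mat \<Rightarrow> 'b mat \<Rightarrow>
    (('a \<times> 'b) \<Rightarrow>\<^sub>0 'k) set mat" where
  "tmm A B X Y = mat (dim_row X) (dim_col Y)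
     (\<lambda>(i, j). \<Oplus>\<^bsub>tensor A B\<^esub>k\<in>{..<dim_col X}. pure_tensor A B (X $$ (i, k)) (Y $$ (k, j)))"

context kalg2
begin

lemma inl_hom: "(\<lambda>a. pure_tensor A B a \<one>\<^bsub>B\<^esub>) \<in> alg_hom A (tensor A B)"
  by (rule alg_homI) (simp_all add: pure_lin_l tensor_one)

lemma inr_hom: "(\<lambda>b. pure_tensor A B \<one>\<^bsub>A\<^esub> b) \<in> alg_hom B (tensor A B)"
  by (rule alg_homI) (simp_all add: pure_lin_r tensor_one)

lemma tmm_eq_mm:
  assumes "mcar A X" "mcar B Y" "dim_col X = dim_row Y"
  shows "tmm A B X Y = mm (tensor A B) (map_mat (\<lambda>a. pure_tensor A B a \<one>\<^bsub>B\<^esub>) X) (map_mat (\<lambda>b. pure_tensor A B \<one>\<^bsub>A\<^esub> b) Y)"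
  using assms by (intro eq_matI) (auto simp: tmm_def mcarD intro!: T.finsum_cong' del: equalityI)

text \<open>Entries from different tensor factors commute, so points over A and B always compose
  over A \<otimes> B. Coproduct, coaction, translation map and the nonvanishing argument are all
  instances.\<close>

lemma point_tensor:
  assumes "inv_mat n E" "inv_mat l G" "inv_mat m F" "point A n E l G z" "point B l G m F w"
  shows "point (tensor A B) n E m F (tmm A B z w)"
proof -
  have z: "mcar A z" "dim_row z = n" "dim_col z = l" and w: "mcar B w" "dim_row w = l" "dim_col w = m"
    using assms by (auto simp: point_def)
  have "mcomm (tensor A B) (map_mat (\<lambda>a. pure_tensor A B a \<one>\<^bsub>B\<^esub>) z) (map_mat (\<lambda>b. pure_tensor A B \<one>\<^bsub>A\<^esub> b) w)"
    using mcarD[OF z(1)] mcarD[OF w(1)] by (auto simp: mcomm_def)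
  then show ?thesis
    using z w T.point_compose[OF assms(1-3) A.point_hom[OF tensor_kalg inl_hom assms(1,2,4)]
      B.point_hom[OF tensor_kalg inr_hom assms(2,3,5)]]
    by (simp add: tmm_eq_mm)
qed

end

lemma (in kalg) point_one: "inv_mat n E \<Longrightarrow> point A n E n E (sc A (1\<^sub>m n))"
  by (auto simp: point_def sc_transpose)

subsection \<open>The Hopf algebra \<open>\<B>(E)\<close> and the comodule algebra \<open>\<B>(E,F)\<close>\<close>

text \<open>The coaction of \<open>\<B>(E,F)\<close>, and for F = E the coproduct of
  \<open>\<B>(E)\<close>; statements about it are proved for general F and specialised through the
  interpretations named \<open>H\<close>.\<close>

abbreviation "coprod E F \<equiv> alg_lift (tensor (BEF_alg E E) (BEF_alg E F))
  (\<lambda>(i, j). \<Oplus>\<^bsub>tensor (BEF_alg E E) (BEF_alg E F)\<^esub>l\<in>{..<dim_row E}.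
     pure_tensor (BEF_alg E E) (BEF_alg E F) (BEF_gen E E i l) (BEF_gen E F l j))"

lemma BE_eq: "BE E = module.extend (BEF_alg E E)
   \<lparr>comult = coprod E E, counit = alg_lift ground_alg (\<lambda>(i, j). if i = j then 1 else 0),
    antipode = alg_lift (opposite_alg (BEF_alg E E)) (\<lambda>(i, j). BEF_class E E
       ((const_mat (mat_inv E) * (gen_mat (dim_row E) (dim_row E))\<^sup>T * const_mat E) $$ (i, j)))\<rparr>"
  by (simp add: BE_def Let_def)

lemma BE_extend: "\<exists>x. BE E = module.extend (BEF_alg E E) x"
  using BE_eq by blast

lemma BE_simps [simp]:
  "carrier (BE E) = carrier (BEF_alg E E)" "mult (BE E) = mult (BEF_alg E E)"
  "one (BE E) = one (BEF_alg E E)" "zero (BE E) = zero (BEF_alg E E)"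
  "add (BE E) = add (BEF_alg E E)" "smult (BE E) = smult (BEF_alg E E)"
  "finsum (BE E) = finsum (BEF_alg E E)"
  "lin_hom (BE E) X = lin_hom (BEF_alg E E) X" "lin_hom X (BE E) = lin_hom X (BEF_alg E E)"
  "alg_hom (BE E) X = alg_hom (BEF_alg E E) X" "alg_hom X (BE E) = alg_hom X (BEF_alg E E)"
  "tensor (BE E) X = tensor (BEF_alg E E) X" "tensor X (BE E) = tensor X (BEF_alg E E)"
  "pure_tensor (BE E) X = pure_tensor (BEF_alg E E) X" "pure_tensor X (BE E) = pure_tensor X (BEF_alg E E)"
  "tensor_lift (BE E) = tensor_lift (BEF_alg E E)"
  "tensor_map (BE E) X = tensor_map (BEF_alg E E) X" "tensor_map X (BE E) = tensor_map X (BEF_alg E E)"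
  "tensor_assoc (BE E) X Y = tensor_assoc (BEF_alg E E) X Y"
  "tensor_assoc X (BE E) Y = tensor_assoc X (BEF_alg E E) Y"
  "tensor_assoc X Y (BE E) = tensor_assoc X Y (BEF_alg E E)"
  using BE_extend[of E] by (auto simp: fun_eq_iff)

lemma BE_comult [simp]: "comult (BE E) = coprod E E"
  and BE_counit: "counit (BE E) = alg_lift ground_alg (\<lambda>(i, j). if i = j then 1 else 0)"
  and BE_antipode: "antipode (BE E) = alg_lift (opposite_alg (BEF_alg E E)) (\<lambda>(i, j). BEF_class E E
       ((const_mat (mat_inv E) * (gen_mat (dim_row E) (dim_row E))\<^sup>T * const_mat E) $$ (i, j)))"
  by (simp_all add: BE_eq module.defs)

lemma BEF_eq: "BEF E F = module.extend (BEF_alg E F) \<lparr>coact = coprod E F\<rparr>"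
  by (simp add: BEF_def Let_def)

lemma BEF_coact [simp]: "coact (BEF E F) = coprod E F"
  by (simp add: BEF_eq module.defs)

context bef
begin

interpretation H: bef n E n E by unfold_locales (rule E E)+

lemma dimE: "dim_row E = n" using E by simp

sublocale HZ: kalg2 "BEF_alg E E" "BEF_alg E F"
  by (rule kalg2I[OF H.alg_kalg alg_kalg])

lemma coprod_point: "point (tensor (BEF_alg E E) (BEF_alg E F)) n E m F (tmm (BEF_alg E E) (BEF_alg E F) H.gens gens)"
  by (rule HZ.point_tensor[OF E E F H.gens_point gens_point])

lemma coprod_hom: "coprod E F \<in> alg_hom (BEF_alg E F) (tensor (BEF_alg E E) (BEF_alg E F))"
  by (rule alg_lift_hom[OF HZ.tensor_kalg coprod_point])
    (auto simp: tmm_def dimE H.gens_index intro!: HZ.T.finsum_cong' del: equalityI)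

lemma coprod_gen: "i < n \<Longrightarrow> j < m \<Longrightarrow> coprod E F (BEF_gen E F i j) =
  (\<Oplus>\<^bsub>tensor (BEF_alg E E) (BEF_alg E F)\<^esub>l\<in>{..<n}.
     pure_tensor (BEF_alg E E) (BEF_alg E F) (BEF_gen E E i l) (BEF_gen E F l j))"
  by (subst alg_lift_gen[OF HZ.tensor_kalg coprod_point])
    (auto simp: tmm_def dimE H.gens_index intro!: HZ.T.finsum_cong' del: equalityI)

lemma counit_point: "point ground_alg n E n E (1\<^sub>m n)"
proof -
  have "sc ground_alg (1\<^sub>m n) = (1\<^sub>m n :: 'k mat)" by (rule eq_matI) auto
  then show ?thesis using ground.point_one[OF E] by simp
qed

lemma counit_hom: "counit (BE E) \<in> alg_hom (BEF_alg E E) ground_alg"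
  unfolding BE_counit by (rule H.alg_lift_hom[OF ground_kalg counit_point]) auto

lemma counit_gen: "i < n \<Longrightarrow> j < n \<Longrightarrow> counit (BE E) (BEF_gen E E i j) = (if i = j then 1 else 0)"
  unfolding BE_counit by (subst H.alg_lift_gen[OF ground_kalg counit_point]) auto

lemma antipode_entry:
  assumes "i < n" "j < n"
  shows "BEF_class E E ((const_mat (mat_inv E) * (gen_mat (dim_row E) (dim_row E))\<^sup>T * const_mat E) $$ (i, j))
    = pinv (BEF_alg E E) E E H.gens $$ (i, j)"
proof -
  have "const_mat (mat_inv E) * (gen_mat (dim_row E) (dim_row E))\<^sup>T * const_mat E = pinv H.Fr E E H.z0"
    using E H.z0 by (simp add: H.const_mat_sc H.free_mm pinv_def H.Fr.mm_assoc)
  then show ?thesis using assms E H.z0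
    by (simp add: H.pinv_class[symmetric])
qed

lemma antipode_hom: "antipode (BE E) \<in> alg_hom (BEF_alg E E) (opposite_alg (BEF_alg E E))"
  unfolding BE_antipode
  by (rule H.alg_lift_hom[OF opposite_kalg[OF H.alg_kalg] point_opposite[OF H.alg_kalg E E H.gens_point]])
    (simp add: antipode_entry)

lemma antipode_gen: "i < n \<Longrightarrow> j < n \<Longrightarrow> antipode (BE E) (BEF_gen E E i j) = pinv (BEF_alg E E) E E H.gens $$ (i, j)"
  unfolding BE_antipode
  by (subst H.alg_lift_gen[OF opposite_kalg[OF H.alg_kalg] point_opposite[OF H.alg_kalg E E H.gens_point]])
    (simp_all add: antipode_entry)

end

context bef
begin

interpretation H: bef n E n E by unfold_locales (rule E E)+

sublocale HHZ: kalg2 "BEF_alg E E" "tensor (BEF_alg E E) (BEF_alg E F)"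
  by (rule kalg2I[OF H.alg_kalg HZ.tensor_kalg])

text \<open>Both sides are algebra maps, so generators suffice; there the two sides are the same
  double sum taken in different orders.\<close>

lemma coprod_coassoc:
  assumes "z \<in> carrier (BEF_alg E F)"
  shows "tensor_assoc (BEF_alg E E) (BEF_alg E E) (BEF_alg E F)
      (tensor_map (tensor (BEF_alg E E) (BEF_alg E E)) (BEF_alg E F) (coprod E E) id (coprod E F z))
    = tensor_map (BEF_alg E E) (tensor (BEF_alg E E) (BEF_alg E F)) id (coprod E F) (coprod E F z)"
proof (rule alg_hom_eq[OF _ _ _ assms])
  let ?A = "BEF_alg E E" and ?Z = "BEF_alg E F"
  note kA = H.alg_kalg and kZ = alg_kalg
  have m1: "tensor_map (tensor ?A ?A) ?Z (coprod E E) id \<in> alg_hom (tensor ?A ?Z) (tensor (tensor ?A ?A) ?Z)"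
    by (rule tensor_map_alg[OF kA kZ H.HZ.tensor_kalg kZ H.coprod_hom alg_hom_id'])
  have m2: "tensor_map ?A (tensor ?A ?Z) id (coprod E F) \<in> alg_hom (tensor ?A ?Z) (tensor ?A (tensor ?A ?Z))"
    by (rule tensor_map_alg[OF kA kZ kA HZ.tensor_kalg alg_hom_id' coprod_hom])
  have as: "tensor_assoc ?A ?A ?Z \<in> alg_hom (tensor (tensor ?A ?A) ?Z) (tensor ?A (tensor ?A ?Z))"
    by (rule tensor_assoc_alg[OF kA kA kZ])
  interpret AAZ: kalg2 "tensor ?A ?A" ?Z by (rule kalg2I[OF H.HZ.tensor_kalg kZ])
  show "(\<lambda>z. tensor_assoc ?A ?A ?Z (tensor_map (tensor ?A ?A) ?Z (coprod E E) id (coprod E F z)))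
      \<in> alg_hom ?Z (tensor ?A (tensor ?A ?Z))"
    by (rule alg_hom_comp[OF alg_hom_comp[OF coprod_hom m1] as])
  show "(\<lambda>z. tensor_map ?A (tensor ?A ?Z) id (coprod E F) (coprod E F z)) \<in> alg_hom ?Z (tensor ?A (tensor ?A ?Z))"
    by (rule alg_hom_comp[OF coprod_hom m2])
  fix i j assume ij: "i < n" "j < m"
  let ?T = "tensor ?A (tensor ?A ?Z)"
  note A = alg_hom_lin[OF H.coprod_hom] and C = alg_hom_lin[OF coprod_hom]
  have g: "\<And>k l. k < n \<Longrightarrow> l < n \<Longrightarrow> BEF_gen E E k l \<in> carrier ?A" "\<And>k l. k < n \<Longrightarrow> l < m \<Longrightarrow> BEF_gen E F k l \<in> carrier ?Z"
    by simp_all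
  have "tensor_assoc ?A ?A ?Z (tensor_map (tensor ?A ?A) ?Z (coprod E E) id (coprod E F (BEF_gen E F i j)))
    = (\<Oplus>\<^bsub>?T\<^esub>l\<in>{..<n}. tensor_assoc ?A ?A ?Z (tensor_map (tensor ?A ?A) ?Z (coprod E E) id
         (pure_tensor ?A ?Z (BEF_gen E E i l) (BEF_gen E F l j))))"
    unfolding coprod_gen[OF ij]
    by (rule HZ.T.lin_hom_finsum[OF HHZ.tensor_kalg lin_hom_comp[OF alg_hom_lin[OF m1] alg_hom_lin[OF as]]])
      (use ij in auto)
  also have "\<dots> = (\<Oplus>\<^bsub>?T\<^esub>l\<in>{..<n}. \<Oplus>\<^bsub>?T\<^esub>k\<in>{..<n}.
      pure_tensor ?A (tensor ?A ?Z) (BEF_gen E E i k) (pure_tensor ?A ?Z (BEF_gen E E k l) (BEF_gen E F l j)))"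
  proof (rule HHZ.T.finsum_cong', simp)
    fix l assume l: "l \<in> {..<n}"
    then have "tensor_assoc ?A ?A ?Z (tensor_map (tensor ?A ?A) ?Z (coprod E E) id
         (pure_tensor ?A ?Z (BEF_gen E E i l) (BEF_gen E F l j)))
      = tensor_assoc ?A ?A ?Z (pure_tensor (tensor ?A ?A) ?Z (coprod E E (BEF_gen E E i l)) (BEF_gen E F l j))"
      using ij by (subst tensor_map_pure[OF kA kZ H.HZ.tensor_kalg kZ A lin_hom_id']) auto
    also have "\<dots> = (\<Oplus>\<^bsub>?T\<^esub>k\<in>{..<n}. tensor_assoc ?A ?A ?Z
        (pure_tensor (tensor ?A ?A) ?Z (pure_tensor ?A ?A (BEF_gen E E i k) (BEF_gen E E k l)) (BEF_gen E F l j)))"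
      using ij l by (subst H.coprod_gen, simp, simp)
        (rule H.HZ.T.lin_hom_finsum[OF HHZ.tensor_kalg lin_hom_comp[OF AAZ.pure_lin_l alg_hom_lin[OF as]]], auto)
    also have "\<dots> = (\<Oplus>\<^bsub>?T\<^esub>k\<in>{..<n}. pure_tensor ?A (tensor ?A ?Z) (BEF_gen E E i k)
        (pure_tensor ?A ?Z (BEF_gen E E k l) (BEF_gen E F l j)))"
      using ij l by (intro HHZ.T.finsum_cong') (auto simp: tensor_assoc_pure[OF kA kA kZ])
    finally show "tensor_assoc ?A ?A ?Z (tensor_map (tensor ?A ?A) ?Z (coprod E E) id
         (pure_tensor ?A ?Z (BEF_gen E E i l) (BEF_gen E F l j))) = \<dots>" .
  qed (use ij in \<open>auto intro!: HHZ.T.finsum_closed\<close>)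
  also have "\<dots> = (\<Oplus>\<^bsub>?T\<^esub>k\<in>{..<n}. \<Oplus>\<^bsub>?T\<^esub>l\<in>{..<n}.
      pure_tensor ?A (tensor ?A ?Z) (BEF_gen E E i k) (pure_tensor ?A ?Z (BEF_gen E E k l) (BEF_gen E F l j)))"
    by (rule HHZ.T.finsum_swap) (use ij in auto)
  also have "\<dots> = (\<Oplus>\<^bsub>?T\<^esub>k\<in>{..<n}. tensor_map ?A (tensor ?A ?Z) id (coprod E F)
      (pure_tensor ?A ?Z (BEF_gen E E i k) (BEF_gen E F k j)))"
  proof (rule HHZ.T.finsum_cong', simp)
    fix k assume k: "k \<in> {..<n}"
    have "tensor_map ?A (tensor ?A ?Z) id (coprod E F) (pure_tensor ?A ?Z (BEF_gen E E i k) (BEF_gen E F k j))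
      = pure_tensor ?A (tensor ?A ?Z) (BEF_gen E E i k) (coprod E F (BEF_gen E F k j))"
      using ij k by (subst tensor_map_pure[OF kA kZ kA HZ.tensor_kalg lin_hom_id' C]) auto
    also have "\<dots> = (\<Oplus>\<^bsub>?T\<^esub>l\<in>{..<n}.
      pure_tensor ?A (tensor ?A ?Z) (BEF_gen E E i k) (pure_tensor ?A ?Z (BEF_gen E E k l) (BEF_gen E F l j)))"
      using ij k by (subst coprod_gen, simp, simp) (rule HHZ.pure_finsum_r, auto)
    finally show "(\<Oplus>\<^bsub>?T\<^esub>l\<in>{..<n}.
      pure_tensor ?A (tensor ?A ?Z) (BEF_gen E E i k) (pure_tensor ?A ?Z (BEF_gen E E k l) (BEF_gen E F l j)))
      = tensor_map ?A (tensor ?A ?Z) id (coprod E F) (pure_tensor ?A ?Z (BEF_gen E E i k) (BEF_gen E F k j))" by simp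
  qed (use ij lin_hom_closed[OF alg_hom_lin[OF m2]] in auto)
  also have "\<dots> = tensor_map ?A (tensor ?A ?Z) id (coprod E F) (coprod E F (BEF_gen E F i j))"
    unfolding coprod_gen[OF ij]
    by (rule HZ.T.lin_hom_finsum[OF HHZ.tensor_kalg alg_hom_lin[OF m2], symmetric]) (use ij in auto)
  finally show "tensor_assoc ?A ?A ?Z (tensor_map (tensor ?A ?A) ?Z (coprod E E) id (coprod E F (BEF_gen E F i j)))
    = tensor_map ?A (tensor ?A ?Z) id (coprod E F) (coprod E F (BEF_gen E F i j))" .
qed

lemma counit_bilin: "bilin (BEF_alg E E) (BEF_alg E F) (BEF_alg E F) (\<lambda>h y. counit (BE E) h \<odot>\<^bsub>BEF_alg E F\<^esub> y)"
  using lin_hom_add[OF alg_hom_lin[OF counit_hom]] lin_hom_smult[OF alg_hom_lin[OF counit_hom]]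
  by (intro bilinI) (auto simp: B.smult_l_distr B.smult_r_distr mult.commute)

lemma coprod_counit_left:
  assumes "z \<in> carrier (BEF_alg E F)"
  shows "tensor_lift (BEF_alg E F) (\<lambda>h y. counit (BE E) h \<odot>\<^bsub>BEF_alg E F\<^esub> y) (coprod E F z) = z"
proof (rule alg_hom_eq[OF _ alg_hom_id _ assms])
  let ?\<phi> = "\<lambda>h y. counit (BE E) h \<odot>\<^bsub>BEF_alg E F\<^esub> y"
  note l = HZ.tensor_lift_lin[OF alg_kalg counit_bilin] and p = HZ.tensor_lift_pure[OF alg_kalg counit_bilin]
  have "tensor_lift (BEF_alg E F) ?\<phi> \<in> alg_hom (tensor (BEF_alg E E) (BEF_alg E F)) (BEF_alg E F)"
    by (rule HZ.tensor_alg_homI[OF alg_kalg l])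
      (auto simp: p alg_hom_mult[OF counit_hom] alg_hom_one[OF counit_hom] mult.commute del: equalityI)
  from alg_hom_comp[OF coprod_hom this]
  show "(\<lambda>z. tensor_lift (BEF_alg E F) ?\<phi> (coprod E F z)) \<in> alg_hom (BEF_alg E F) (BEF_alg E F)" .
  fix i j assume ij: "i < n" "j < m"
  have "tensor_lift (BEF_alg E F) ?\<phi> (coprod E F (BEF_gen E F i j))
    = (\<Oplus>\<^bsub>BEF_alg E F\<^esub>l\<in>{..<n}. tensor_lift (BEF_alg E F) ?\<phi>
        (pure_tensor (BEF_alg E E) (BEF_alg E F) (BEF_gen E E i l) (BEF_gen E F l j)))"
    unfolding coprod_gen[OF ij] by (rule HZ.T.lin_hom_finsum[OF alg_kalg l]) (use ij in auto)
  also have "\<dots> = (\<Oplus>\<^bsub>BEF_alg E F\<^esub>l\<in>{..<n}. (if i = l then 1 else 0) \<odot>\<^bsub>BEF_alg E F\<^esub> BEF_gen E F l j)"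
    by (rule B.finsum_cong', simp) (use ij in \<open>auto simp: p counit_gen\<close>)
  also have "\<dots> = BEF_gen E F i j"
    using ij by (subst B.finsum_delta[where i = i]) auto
  finally show "tensor_lift (BEF_alg E F) ?\<phi> (coprod E F (BEF_gen E F i j)) = BEF_gen E F i j" .
qed

end

section \<open>Right counit law, antipode, and the Hopf algebra axioms\<close>

context bef
begin

interpretation H: bef n E n E by unfold_locales (rule E E)+

lemma counit_bilin_right:
  "bilin (BEF_alg E E) (BEF_alg E E) (BEF_alg E E) (\<lambda>a b. counit (BE E) b \<odot>\<^bsub>BEF_alg E E\<^esub> a)"
  using lin_hom_add[OF alg_hom_lin[OF counit_hom]] lin_hom_smult[OF alg_hom_lin[OF counit_hom]]
  by (intro bilinI) (auto simp: HZ.A.smult_l_distr HZ.A.smult_r_distr mult.commute)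

lemma coprod_counit_right:
  assumes "x \<in> carrier (BEF_alg E E)"
  shows "tensor_lift (BEF_alg E E) (\<lambda>a b. counit (BE E) b \<odot>\<^bsub>BEF_alg E E\<^esub> a) (coprod E E x) = x"
proof (rule H.alg_hom_eq[OF _ alg_hom_id _ assms])
  let ?\<phi> = "\<lambda>a b. counit (BE E) b \<odot>\<^bsub>BEF_alg E E\<^esub> a"
  note l = H.HZ.tensor_lift_lin[OF H.alg_kalg counit_bilin_right]
    and p = H.HZ.tensor_lift_pure[OF H.alg_kalg counit_bilin_right]
  have "tensor_lift (BEF_alg E E) ?\<phi> \<in> alg_hom (tensor (BEF_alg E E) (BEF_alg E E)) (BEF_alg E E)"
    by (rule H.HZ.tensor_alg_homI[OF H.alg_kalg l])
      (auto simp: p alg_hom_mult[OF counit_hom] alg_hom_one[OF counit_hom] mult.commute del: equalityI)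
  from alg_hom_comp[OF H.coprod_hom this]
  show "(\<lambda>z. tensor_lift (BEF_alg E E) ?\<phi> (coprod E E z)) \<in> alg_hom (BEF_alg E E) (BEF_alg E E)" .
  fix i j assume ij: "i < n" "j < n"
  have "tensor_lift (BEF_alg E E) ?\<phi> (coprod E E (BEF_gen E E i j))
    = (\<Oplus>\<^bsub>BEF_alg E E\<^esub>l\<in>{..<n}. tensor_lift (BEF_alg E E) ?\<phi>
        (pure_tensor (BEF_alg E E) (BEF_alg E E) (BEF_gen E E i l) (BEF_gen E E l j)))"
    unfolding H.coprod_gen[OF ij] by (rule H.HZ.T.lin_hom_finsum[OF H.alg_kalg l]) (use ij in auto)
  also have "\<dots> = (\<Oplus>\<^bsub>BEF_alg E E\<^esub>l\<in>{..<n}. (if l = j then 1 else 0) \<odot>\<^bsub>BEF_alg E E\<^esub> BEF_gen E E i l)"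
    by (rule HZ.A.finsum_cong', simp) (use ij in \<open>auto simp: p counit_gen\<close>)
  also have "\<dots> = BEF_gen E E i j"
    using ij by (subst HZ.A.finsum_delta[where i = j]) auto
  finally show "tensor_lift (BEF_alg E E) ?\<phi> (coprod E E (BEF_gen E E i j)) = BEF_gen E E i j" .
qed

abbreviation "HA \<equiv> BEF_alg E E"
abbreviation "S \<equiv> antipode (BE E)"

lemma S_closed [simp]: "x \<in> carrier HA \<Longrightarrow> S x \<in> carrier HA"
  using lin_hom_closed[OF alg_hom_lin[OF antipode_hom]] by simp

lemma S_simps:
  "x \<in> carrier HA \<Longrightarrow> y \<in> carrier HA \<Longrightarrow> S (x \<otimes>\<^bsub>HA\<^esub> y) = S y \<otimes>\<^bsub>HA\<^esub> S x"
  "x \<in> carrier HA \<Longrightarrow> y \<in> carrier HA \<Longrightarrow> S (x \<oplus>\<^bsub>HA\<^esub> y) = S x \<oplus>\<^bsub>HA\<^esub> S y"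
  "x \<in> carrier HA \<Longrightarrow> S (c \<odot>\<^bsub>HA\<^esub> x) = c \<odot>\<^bsub>HA\<^esub> S x"
  "S \<one>\<^bsub>HA\<^esub> = \<one>\<^bsub>HA\<^esub>"
  using alg_hom_mult[OF antipode_hom] lin_hom_add[OF alg_hom_lin[OF antipode_hom]]
    lin_hom_smult[OF alg_hom_lin[OF antipode_hom]] alg_hom_one[OF antipode_hom] by simp_all

lemma eps_closed_simps:
  "x \<in> carrier HA \<Longrightarrow> y \<in> carrier HA \<Longrightarrow> counit (BE E) (x \<otimes>\<^bsub>HA\<^esub> y) = counit (BE E) x * counit (BE E) y"
  "x \<in> carrier HA \<Longrightarrow> y \<in> carrier HA \<Longrightarrow> counit (BE E) (x \<oplus>\<^bsub>HA\<^esub> y) = counit (BE E) x + counit (BE E) y"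
  "x \<in> carrier HA \<Longrightarrow> counit (BE E) (c \<odot>\<^bsub>HA\<^esub> x) = c * counit (BE E) x"
  "counit (BE E) \<one>\<^bsub>HA\<^esub> = 1"
  using alg_hom_mult[OF counit_hom] lin_hom_add[OF alg_hom_lin[OF counit_hom]]
    lin_hom_smult[OF alg_hom_lin[OF counit_hom]] alg_hom_one[OF counit_hom] by simp_all

lemma antipode_bilin:
  "bilin HA HA HA (\<lambda>a b. S a \<otimes>\<^bsub>HA\<^esub> b)" "bilin HA HA HA (\<lambda>a b. a \<otimes>\<^bsub>HA\<^esub> S b)"
  by (intro bilinI; simp add: S_simps HZ.A.l_distr HZ.A.r_distr)+

text \<open>Multiplication after S \<otimes> id is not an algebra map, because S reverses products,
  so checking generators is not enough by itself. It suffices that the elements satisfying the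
  identity are closed under products: \<mu>((x \<otimes> y)(a \<otimes> b)) = S(a) \<mu>(x \<otimes>
  y) b, and when the inner value is a scalar it can be pulled out.\<close>

lemma antipode_left:
  assumes "x \<in> carrier HA"
  shows "tensor_lift HA (\<lambda>a b. S a \<otimes>\<^bsub>HA\<^esub> b) (coprod E E x) = counit (BE E) x \<odot>\<^bsub>HA\<^esub> \<one>\<^bsub>HA\<^esub>"
proof -
  let ?T = "tensor HA HA"
  let ?\<mu> = "tensor_lift HA (\<lambda>a b. S a \<otimes>\<^bsub>HA\<^esub> b)"
  note l = H.HZ.tensor_lift_lin[OF H.alg_kalg antipode_bilin(1)]
    and p = H.HZ.tensor_lift_pure[OF H.alg_kalg antipode_bilin(1)]
  note ad = lin_hom_add[OF l] and sm = lin_hom_smult[OF l] and cl = lin_hom_closed[OF l]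
  have k1: "?\<mu> (s \<otimes>\<^bsub>?T\<^esub> pure_tensor HA HA a b) = S a \<otimes>\<^bsub>HA\<^esub> (?\<mu> s \<otimes>\<^bsub>HA\<^esub> b)"
    if "s \<in> carrier ?T" "a \<in> carrier HA" "b \<in> carrier HA" for s a b
    using that(1)
    by (induction rule: H.HZ.tensor_induct)
      (use that in \<open>auto simp: p S_simps HZ.A.m_assoc H.HZ.T.l_distr HZ.A.l_distr HZ.A.r_distr ad cl del: equalityI\<close>)
  \<comment> \<open>In the product case s is the coproduct of the left factor, whose value under
    \<mu> is a scalar by the induction hypothesis.\<close>
  have k2: "?\<mu> (s \<otimes>\<^bsub>?T\<^esub> t) = c \<odot>\<^bsub>HA\<^esub> ?\<mu> t"
    if "s \<in> carrier ?T" "t \<in> carrier ?T" "?\<mu> s = c \<odot>\<^bsub>HA\<^esub> \<one>\<^bsub>HA\<^esub>" for s t c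
    using that(2)
    by (induction rule: H.HZ.tensor_induct)
      (use that in \<open>auto simp: k1 p H.HZ.T.r_distr HZ.A.smult_r_distr ad cl del: equalityI\<close>)
  note D = lin_hom_closed[OF alg_hom_lin[OF H.coprod_hom]]
  show ?thesis using assms
  proof (induction rule: H.alg_induct)
    case one
    then show ?case by (simp add: alg_hom_one[OF H.coprod_hom] H.HZ.tensor_one p S_simps eps_closed_simps)
  next
    case (gen i j)
    have "?\<mu> (coprod E E (BEF_gen E E i j)) = (\<Oplus>\<^bsub>HA\<^esub>k\<in>{..<n}. ?\<mu> (pure_tensor HA HA (BEF_gen E E i k) (BEF_gen E E k j)))"
      unfolding H.coprod_gen[OF gen] by (rule H.HZ.T.lin_hom_finsum[OF H.alg_kalg l]) (use gen in auto)
    also have "\<dots> = (\<Oplus>\<^bsub>HA\<^esub>k\<in>{..<n}. pinv HA E E H.gens $$ (i, k) \<otimes>\<^bsub>HA\<^esub> H.gens $$ (k, j))"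
      using gen mcarD[OF HZ.A.mcar_pinv[OF E E H.gens_closed(2,1)]] E
      by (intro HZ.A.finsum_cong') (auto simp: p antipode_gen H.gens_index del: equalityI)
    also have "\<dots> = mm HA (pinv HA E E H.gens) H.gens $$ (i, j)" using gen E by simp
    also have "mm HA (pinv HA E E H.gens) H.gens = sc HA (1\<^sub>m n)"
      using H.gens_point HZ.A.point_iff_pinv[OF E E H.gens_closed(2,1)] by simp
    finally show ?case using gen by (simp add: counit_gen)
  next
    case (mult x y)
    then show ?case using k2[OF D[OF mult.hyps(1)] D[OF mult.hyps(2)] mult.IH(1)]
      by (simp add: alg_hom_mult[OF H.coprod_hom] eps_closed_simps)
  qed (simp_all add: lin_hom_add[OF alg_hom_lin[OF H.coprod_hom]] lin_hom_smult[OF alg_hom_lin[OF H.coprod_hom]]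
      ad sm D eps_closed_simps HZ.A.smult_l_distr)
qed

text \<open>The mirror image of \<open>antipode_left\<close>: now the right factor of a product ends
  up innermost, so its scalar value is the one pulled out.\<close>

lemma antipode_right:
  assumes "x \<in> carrier HA"
  shows "tensor_lift HA (\<lambda>a b. a \<otimes>\<^bsub>HA\<^esub> S b) (coprod E E x) = counit (BE E) x \<odot>\<^bsub>HA\<^esub> \<one>\<^bsub>HA\<^esub>"
proof -
  let ?T = "tensor HA HA"
  let ?\<mu> = "tensor_lift HA (\<lambda>a b. a \<otimes>\<^bsub>HA\<^esub> S b)"
  note l = H.HZ.tensor_lift_lin[OF H.alg_kalg antipode_bilin(2)]
    and p = H.HZ.tensor_lift_pure[OF H.alg_kalg antipode_bilin(2)]
  note ad = lin_hom_add[OF l] and sm = lin_hom_smult[OF l] and cl = lin_hom_closed[OF l]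
  have k1: "?\<mu> (pure_tensor HA HA a b \<otimes>\<^bsub>?T\<^esub> s) = a \<otimes>\<^bsub>HA\<^esub> (?\<mu> s \<otimes>\<^bsub>HA\<^esub> S b)"
    if "s \<in> carrier ?T" "a \<in> carrier HA" "b \<in> carrier HA" for s a b
    using that(1)
    by (induction rule: H.HZ.tensor_induct)
      (use that in \<open>auto simp: p S_simps HZ.A.m_assoc H.HZ.T.r_distr HZ.A.l_distr HZ.A.r_distr ad cl del: equalityI\<close>)
  have k2: "?\<mu> (t \<otimes>\<^bsub>?T\<^esub> s) = c \<odot>\<^bsub>HA\<^esub> ?\<mu> t"
    if "s \<in> carrier ?T" "t \<in> carrier ?T" "?\<mu> s = c \<odot>\<^bsub>HA\<^esub> \<one>\<^bsub>HA\<^esub>" for s t c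
    using that(2)
    by (induction rule: H.HZ.tensor_induct)
      (use that in \<open>auto simp: k1 p H.HZ.T.l_distr HZ.A.smult_r_distr ad cl del: equalityI\<close>)
  note D = lin_hom_closed[OF alg_hom_lin[OF H.coprod_hom]]
  show ?thesis using assms
  proof (induction rule: H.alg_induct)
    case one
    then show ?case by (simp add: alg_hom_one[OF H.coprod_hom] H.HZ.tensor_one p S_simps eps_closed_simps)
  next
    case (gen i j)
    have "?\<mu> (coprod E E (BEF_gen E E i j)) = (\<Oplus>\<^bsub>HA\<^esub>k\<in>{..<n}. ?\<mu> (pure_tensor HA HA (BEF_gen E E i k) (BEF_gen E E k j)))"
      unfolding H.coprod_gen[OF gen] by (rule H.HZ.T.lin_hom_finsum[OF H.alg_kalg l]) (use gen in auto)
    also have "\<dots> = (\<Oplus>\<^bsub>HA\<^esub>k\<in>{..<n}. H.gens $$ (i, k) \<otimes>\<^bsub>HA\<^esub> pinv HA E E H.gens $$ (k, j))"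
      using gen mcarD[OF HZ.A.mcar_pinv[OF E E H.gens_closed(2,1)]] E
      by (intro HZ.A.finsum_cong') (auto simp: p antipode_gen H.gens_index del: equalityI)
    also have "\<dots> = mm HA H.gens (pinv HA E E H.gens) $$ (i, j)" using gen E by simp
    also have "mm HA H.gens (pinv HA E E H.gens) = sc HA (1\<^sub>m n)"
      using H.gens_point HZ.A.point_iff_pinv[OF E E H.gens_closed(2,1)] by simp
    finally show ?case using gen by (simp add: counit_gen)
  next
    case (mult x y)
    then show ?case using k2[OF D[OF mult.hyps(2)] D[OF mult.hyps(1)] mult.IH(2)]
      by (simp add: alg_hom_mult[OF H.coprod_hom] eps_closed_simps ac_simps)
  qed (simp_all add: lin_hom_add[OF alg_hom_lin[OF H.coprod_hom]] lin_hom_smult[OF alg_hom_lin[OF H.coprod_hom]]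
      ad sm D eps_closed_simps HZ.A.smult_l_distr)
qed

lemma BE_kalg: "kalg (BE E)"
  using BE_extend[of E] kalg_extend[OF H.alg_kalg] by metis

lemma hopf_algebra_BE: "hopf_algebra (BE E)"
  unfolding hopf_algebra_def
  using BE_kalg H.coprod_hom counit_hom alg_hom_lin[OF antipode_hom] H.coprod_coassoc H.coprod_counit_left
    coprod_counit_right antipode_left antipode_right
  by (simp add: kalg_def)

lemma BEF_extend: "\<exists>x. BEF E F = module.extend (BEF_alg E F) x"
  using BEF_eq by blast

lemma BEF_kalg: "kalg (BEF E F)"
  using BEF_extend kalg_extend[OF alg_kalg] by metis

end

lemma BEF_simps [simp]:
  "carrier (BEF E F) = carrier (BEF_alg E F)" "mult (BEF E F) = mult (BEF_alg E F)"
  "one (BEF E F) = one (BEF_alg E F)" "zero (BEF E F) = zero (BEF_alg E F)"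
  "add (BEF E F) = add (BEF_alg E F)" "smult (BEF E F) = smult (BEF_alg E F)"
  "finsum (BEF E F) = finsum (BEF_alg E F)"
  "lin_hom (BEF E F) X = lin_hom (BEF_alg E F) X" "lin_hom X (BEF E F) = lin_hom X (BEF_alg E F)"
  "alg_hom (BEF E F) X = alg_hom (BEF_alg E F) X" "alg_hom X (BEF E F) = alg_hom X (BEF_alg E F)"
  "tensor (BEF E F) X = tensor (BEF_alg E F) X" "tensor X (BEF E F) = tensor X (BEF_alg E F)"
  "pure_tensor (BEF E F) X = pure_tensor (BEF_alg E F) X" "pure_tensor X (BEF E F) = pure_tensor X (BEF_alg E F)"
  "tensor_lift (BEF E F) = tensor_lift (BEF_alg E F)"
  "tensor_map (BEF E F) X = tensor_map (BEF_alg E F) X" "tensor_map X (BEF E F) = tensor_map X (BEF_alg E F)"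
  "tensor_assoc X Y (BEF E F) = tensor_assoc X Y (BEF_alg E F)"
  unfolding BEF_eq by (simp_all add: fun_eq_iff)

lemma (in bef) comodule_algebra_BEF: "comodule_algebra (BE E) (BEF E F)"
  unfolding comodule_algebra_def
  using BEF_kalg coprod_hom coprod_coassoc coprod_counit_left
  by (simp add: kalg_def)

subsection \<open>The canonical map\<close>

locale comod = kalg2 H Z
  for H :: "('k::field, 'h, 'm) module_scheme" and Z :: "('k, 'z, 'n) module_scheme" +
  fixes \<delta> :: "'z \<Rightarrow> (('h \<times> 'z) \<Rightarrow>\<^sub>0 'k) set"
  assumes \<delta>: "\<delta> \<in> alg_hom Z (tensor H Z)"
begin

sublocale ZZ: kalg2 Z Z by (rule kalg2I) unfold_locales

definition "can = tensor_lift (tensor H Z) (\<lambda>z z'. \<delta> z \<otimes>\<^bsub>tensor H Z\<^esub> pure_tensor H Z \<one>\<^bsub>H\<^esub> z')"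

lemma \<delta>_closed [simp]: "z \<in> carrier Z \<Longrightarrow> \<delta> z \<in> carrier (tensor H Z)"
  by (rule lin_hom_closed[OF alg_hom_lin[OF \<delta>]])

lemmas \<delta>_mult = alg_hom_mult[OF \<delta>] and \<delta>_one = alg_hom_one[OF \<delta>]
  and \<delta>_add = lin_hom_add[OF alg_hom_lin[OF \<delta>]] and \<delta>_smult = lin_hom_smult[OF alg_hom_lin[OF \<delta>]]

lemma can_bilin: "bilin Z Z (tensor H Z) (\<lambda>z z'. \<delta> z \<otimes>\<^bsub>tensor H Z\<^esub> pure_tensor H Z \<one>\<^bsub>H\<^esub> z')"
  by (intro bilinI; simp add: \<delta>_add \<delta>_smult pure_add_r pure_smult_r T.l_distr T.r_distr)

lemma can_lin: "can \<in> lin_hom (tensor Z Z) (tensor H Z)"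
  unfolding can_def by (rule ZZ.tensor_lift_lin[OF tensor_kalg can_bilin])

lemma can_pure: "z \<in> carrier Z \<Longrightarrow> z' \<in> carrier Z \<Longrightarrow>
    can (pure_tensor Z Z z z') = \<delta> z \<otimes>\<^bsub>tensor H Z\<^esub> pure_tensor H Z \<one>\<^bsub>H\<^esub> z'"
  unfolding can_def by (rule ZZ.tensor_lift_pure[OF tensor_kalg can_bilin])

lemmas can_closed = lin_hom_closed[OF can_lin] and can_add = lin_hom_add[OF can_lin]
  and can_smult = lin_hom_smult[OF can_lin]

lemma can_right:
  assumes "t \<in> carrier (tensor Z Z)" "z \<in> carrier Z"
  shows "can (t \<otimes>\<^bsub>tensor Z Z\<^esub> pure_tensor Z Z \<one>\<^bsub>Z\<^esub> z) = can t \<otimes>\<^bsub>tensor H Z\<^esub> pure_tensor H Z \<one>\<^bsub>H\<^esub> z"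
  using assms(1)
  by (induction rule: ZZ.tensor_induct)
    (use assms(2) in \<open>auto simp: can_pure T.m_assoc ZZ.T.l_distr T.l_distr can_add can_closed del: equalityI\<close>)

text \<open>For coinvariant z the canonical map takes equal values on z \<otimes> 1 and 1 \<otimes>
  z. Injectivity gives z \<otimes> 1 = 1 \<otimes> z, and slicing with \<psi>(1) = 1 gives z =
  \<psi>(z) 1.\<close>

lemma coinvariants_eq:
  assumes "inj_on can (carrier (tensor Z Z))" "\<one>\<^bsub>Z\<^esub> \<noteq> \<zero>\<^bsub>Z\<^esub>"
  shows "{z \<in> carrier Z. \<delta> z = pure_tensor H Z \<one>\<^bsub>H\<^esub> z} = range (\<lambda>c. c \<odot>\<^bsub>Z\<^esub> \<one>\<^bsub>Z\<^esub>)"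
proof (rule equalityI; rule subsetI)
  fix z assume "z \<in> range (\<lambda>c. c \<odot>\<^bsub>Z\<^esub> \<one>\<^bsub>Z\<^esub>)"
  then show "z \<in> {z \<in> carrier Z. \<delta> z = pure_tensor H Z \<one>\<^bsub>H\<^esub> z}"
    by (auto simp: \<delta>_smult \<delta>_one tensor_one pure_smult_r del: equalityI)
next
  fix z assume "z \<in> {z \<in> carrier Z. \<delta> z = pure_tensor H Z \<one>\<^bsub>H\<^esub> z}"
  then have z: "z \<in> carrier Z" "\<delta> z = pure_tensor H Z \<one>\<^bsub>H\<^esub> z" by auto
  obtain \<psi> where \<psi>: "\<psi> \<in> lin_hom Z (ground_alg :: ('k, 'k) module)" "\<psi> \<one>\<^bsub>Z\<^esub> = 1"
    using B.functional_one[OF assms(2)] by blast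
  have "can (pure_tensor Z Z z \<one>\<^bsub>Z\<^esub>) = can (pure_tensor Z Z \<one>\<^bsub>Z\<^esub> z)"
    using z by (simp add: can_pure \<delta>_one tensor_one)
  then have "pure_tensor Z Z z \<one>\<^bsub>Z\<^esub> = pure_tensor Z Z \<one>\<^bsub>Z\<^esub> z"
    using z by (intro inj_onD[OF assms(1)]) auto
  from arg_cong[OF this, of "slice Z \<psi>"] have "z = \<psi> z \<odot>\<^bsub>Z\<^esub> \<one>\<^bsub>Z\<^esub>"
    using z \<psi> by (simp add: ZZ.slice_pure)
  then show "z \<in> range (\<lambda>c. c \<odot>\<^bsub>Z\<^esub> \<one>\<^bsub>Z\<^esub>)" by auto
qed

end

context bef
begin

interpretation H: bef n E n E by unfold_locales (rule E E)+

abbreviation "Z \<equiv> BEF_alg E F"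

sublocale C: comod HA Z "coprod E F"
  by unfold_locales (rule coprod_hom)

lemma ZO: "kalg2 Z (opposite_alg Z)"
  by (rule kalg2I[OF alg_kalg opposite_kalg[OF alg_kalg]])

abbreviation "w \<equiv> pinv Z E F gens"

lemma w_closed [simp]: "mcar Z w" by (rule B.mcar_pinv[OF E F gens_closed(2,1)])

lemma w_entry [simp]: "i < m \<Longrightarrow> j < n \<Longrightarrow> w $$ (i, j) \<in> carrier Z"
  using mcarD[OF w_closed] E F by simp

lemma w_gens: "mm Z w gens = sc Z (1\<^sub>m m)" "mm Z gens w = sc Z (1\<^sub>m n)"
  using gens_point B.point_iff_pinv[OF E F gens_closed(2,1)] by auto

text \<open>The translation map \<open>h \<mapsto> can\<inverse>(h \<otimes> 1)\<close>: it is an algebra map into \<open>Z \<otimes> Z\<^sup>o\<^sup>p\<close>.\<close>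

definition "\<tau> = alg_lift (tensor Z (opposite_alg Z)) (\<lambda>p. tmm Z (opposite_alg Z) gens w $$ p)"

lemma \<tau>_point: "point (tensor Z (opposite_alg Z)) n E n E (tmm Z (opposite_alg Z) gens w)"
  by (rule kalg2.point_tensor[OF ZO E F E gens_point point_opposite[OF alg_kalg E F gens_point]])

lemma \<tau>_hom: "\<tau> \<in> alg_hom HA (tensor Z (opposite_alg Z))"
  unfolding \<tau>_def by (rule H.alg_lift_hom[OF kalg2.tensor_kalg[OF ZO] \<tau>_point]) (rule refl)

lemma finsum_tensor_opposite: "finsum (tensor Z (opposite_alg Z)) = finsum (tensor Z Z)"
  by (simp add: fun_eq_iff finsum_def finprod_def tensor_opposite_simps)

lemma \<tau>_gen: "i < n \<Longrightarrow> j < n \<Longrightarrow> \<tau> (BEF_gen E E i j) =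
    (\<Oplus>\<^bsub>tensor Z Z\<^esub>k\<in>{..<m}. pure_tensor Z Z (BEF_gen E F i k) (w $$ (k, j)))"
  unfolding \<tau>_def using E
  by (subst H.alg_lift_gen[OF kalg2.tensor_kalg[OF ZO] \<tau>_point])
    (auto simp: tmm_def finsum_tensor_opposite tensor_opposite_simps intro!: C.ZZ.T.finsum_cong' del: equalityI)

lemma \<tau>_lin: "\<tau> \<in> lin_hom HA (tensor Z Z)"
  using alg_hom_lin[OF \<tau>_hom] by (simp add: lin_hom_def tensor_opposite_simps)

lemmas \<tau>_closed [simp] = lin_hom_closed[OF \<tau>_lin]

lemma \<tau>_one: "\<tau> \<one>\<^bsub>HA\<^esub> = pure_tensor Z Z \<one>\<^bsub>Z\<^esub> \<one>\<^bsub>Z\<^esub>"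
  using alg_hom_one[OF \<tau>_hom] kalg2.tensor_one[OF ZO] by (simp add: tensor_opposite_simps)

abbreviation opmul where "opmul \<equiv> mult (tensor Z (opposite_alg Z))"

lemma \<tau>_mult: "x \<in> carrier HA \<Longrightarrow> y \<in> carrier HA \<Longrightarrow> \<tau> (x \<otimes>\<^bsub>HA\<^esub> y) = opmul (\<tau> x) (\<tau> y)"
  by (rule alg_hom_mult[OF \<tau>_hom])

lemma opmul_pure: "a \<in> carrier Z \<Longrightarrow> b \<in> carrier Z \<Longrightarrow> c \<in> carrier Z \<Longrightarrow> d \<in> carrier Z \<Longrightarrow>
    opmul (pure_tensor Z Z a b) (pure_tensor Z Z c d) = pure_tensor Z Z (a \<otimes>\<^bsub>Z\<^esub> c) (d \<otimes>\<^bsub>Z\<^esub> b)"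
  using kalg2.pure_mult[OF ZO, of a b c d] by (simp add: tensor_opposite_simps)

lemma opmul_simps:
  "s \<in> carrier (tensor Z Z) \<Longrightarrow> t \<in> carrier (tensor Z Z) \<Longrightarrow> opmul s t \<in> carrier (tensor Z Z)"
  "s \<in> carrier (tensor Z Z) \<Longrightarrow> t \<in> carrier (tensor Z Z) \<Longrightarrow> u \<in> carrier (tensor Z Z) \<Longrightarrow>
    opmul (s \<oplus>\<^bsub>tensor Z Z\<^esub> t) u = opmul s u \<oplus>\<^bsub>tensor Z Z\<^esub> opmul t u"
  "s \<in> carrier (tensor Z Z) \<Longrightarrow> t \<in> carrier (tensor Z Z) \<Longrightarrow> u \<in> carrier (tensor Z Z) \<Longrightarrow>
    opmul u (s \<oplus>\<^bsub>tensor Z Z\<^esub> t) = opmul u s \<oplus>\<^bsub>tensor Z Z\<^esub> opmul u t"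
proof -
  interpret O: kalg "tensor Z (opposite_alg Z)" by (rule kalg2.tensor_kalg[OF ZO])
  show "s \<in> carrier (tensor Z Z) \<Longrightarrow> t \<in> carrier (tensor Z Z) \<Longrightarrow> opmul s t \<in> carrier (tensor Z Z)"
    "s \<in> carrier (tensor Z Z) \<Longrightarrow> t \<in> carrier (tensor Z Z) \<Longrightarrow> u \<in> carrier (tensor Z Z) \<Longrightarrow>
      opmul (s \<oplus>\<^bsub>tensor Z Z\<^esub> t) u = opmul s u \<oplus>\<^bsub>tensor Z Z\<^esub> opmul t u"
    "s \<in> carrier (tensor Z Z) \<Longrightarrow> t \<in> carrier (tensor Z Z) \<Longrightarrow> u \<in> carrier (tensor Z Z) \<Longrightarrow>
      opmul u (s \<oplus>\<^bsub>tensor Z Z\<^esub> t) = opmul u s \<oplus>\<^bsub>tensor Z Z\<^esub> opmul u t"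
    using O.m_closed[of s t] O.l_distr[of s t u] O.r_distr[of s t u] by (simp_all add: tensor_opposite_simps)
qed

text \<open>In Z \<otimes> \<open>Z\<^sup>o\<^sup>p\<close> the product of x \<otimes> y with t
  encloses t, so \<open>can\<close> turns it into \<delta>(x) can(t) (1 \<otimes> y). If can(t) = h
  \<otimes> 1, this commutes past 1 \<otimes> y. The consequence is that h \<mapsto> can(\<tau>(h))
  is multiplicative.\<close>

lemma can_opmul:
  assumes "s \<in> carrier (tensor Z Z)" "t \<in> carrier (tensor Z Z)" "h \<in> carrier HA"
    and t: "C.can t = pure_tensor HA Z h \<one>\<^bsub>Z\<^esub>"
  shows "C.can (opmul s t) = C.can s \<otimes>\<^bsub>tensor HA Z\<^esub> pure_tensor HA Z h \<one>\<^bsub>Z\<^esub>"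
proof -
  have 1: "C.can (opmul (pure_tensor Z Z x y) t)
      = coprod E F x \<otimes>\<^bsub>tensor HA Z\<^esub> (C.can t \<otimes>\<^bsub>tensor HA Z\<^esub> pure_tensor HA Z \<one>\<^bsub>HA\<^esub> y)"
    if "t \<in> carrier (tensor Z Z)" "x \<in> carrier Z" "y \<in> carrier Z" for t x y
    using that(1)
    by (induction rule: C.ZZ.tensor_induct)
      (use that in \<open>auto simp: opmul_pure opmul_simps C.can_pure C.\<delta>_mult HZ.T.m_assoc HZ.T.r_distr HZ.T.l_distr
        C.can_add C.can_closed del: equalityI\<close>)
  show ?thesis using assms(1)
  proof (induction rule: C.ZZ.tensor_induct)
    case (pure x y)
    then show ?case using assms(2,3) by (simp add: 1 t C.can_pure HZ.T.m_assoc)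
  qed (use assms in \<open>auto simp: opmul_simps C.can_add C.can_closed HZ.T.l_distr del: equalityI\<close>)
qed

text \<open>On generators, \<open>can\<close> of the sum of \<open>z\<^sub>i\<^sub>k\<close>
  \<otimes> \<open>w\<^sub>k\<^sub>j\<close> is the sum of \<open>a\<^sub>i\<^sub>l\<close>
  \<otimes> \<open>(zw)\<^sub>l\<^sub>j\<close>, and zw = 1. Products are handled by
  \<open>can_opmul\<close>.\<close>

lemma can_\<tau>: "h \<in> carrier HA \<Longrightarrow> C.can (\<tau> h) = pure_tensor HA Z h \<one>\<^bsub>Z\<^esub>"
proof (induction rule: H.alg_induct)
  case one
  then show ?case by (simp add: \<tau>_one C.can_pure C.\<delta>_one HZ.tensor_one)
next
  case (gen i j)
  have "C.can (\<tau> (BEF_gen E E i j)) = (\<Oplus>\<^bsub>tensor HA Z\<^esub>k\<in>{..<m}. C.can (pure_tensor Z Z (BEF_gen E F i k) (w $$ (k, j))))"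
    unfolding \<tau>_gen[OF gen] by (rule C.ZZ.T.lin_hom_finsum[OF HZ.tensor_kalg C.can_lin]) (use gen in auto)
  also have "\<dots> = (\<Oplus>\<^bsub>tensor HA Z\<^esub>k\<in>{..<m}. \<Oplus>\<^bsub>tensor HA Z\<^esub>l\<in>{..<n}.
      pure_tensor HA Z (BEF_gen E E i l) (BEF_gen E F l k \<otimes>\<^bsub>Z\<^esub> w $$ (k, j)))"
  proof (rule HZ.T.finsum_cong', simp)
    fix k assume k: "k \<in> {..<m}"
    have "C.can (pure_tensor Z Z (BEF_gen E F i k) (w $$ (k, j)))
      = (\<Oplus>\<^bsub>tensor HA Z\<^esub>l\<in>{..<n}. pure_tensor HA Z (BEF_gen E E i l) (BEF_gen E F l k)) \<otimes>\<^bsub>tensor HA Z\<^esub> pure_tensor HA Z \<one>\<^bsub>HA\<^esub> (w $$ (k, j))"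
      using gen k by (simp add: C.can_pure coprod_gen)
    also have "\<dots> = (\<Oplus>\<^bsub>tensor HA Z\<^esub>l\<in>{..<n}. pure_tensor HA Z (BEF_gen E E i l) (BEF_gen E F l k) \<otimes>\<^bsub>tensor HA Z\<^esub> pure_tensor HA Z \<one>\<^bsub>HA\<^esub> (w $$ (k, j)))"
      using gen k by (intro HZ.T.finsum_ldistr) auto
    also have "\<dots> = (\<Oplus>\<^bsub>tensor HA Z\<^esub>l\<in>{..<n}. pure_tensor HA Z (BEF_gen E E i l) (BEF_gen E F l k \<otimes>\<^bsub>Z\<^esub> w $$ (k, j)))"
      using gen k by (intro HZ.T.finsum_cong') (auto del: equalityI)
    finally show "C.can (pure_tensor Z Z (BEF_gen E F i k) (w $$ (k, j))) = \<dots>" .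
  qed (use gen in \<open>auto intro!: HZ.T.finsum_closed\<close>)
  also have "\<dots> = (\<Oplus>\<^bsub>tensor HA Z\<^esub>l\<in>{..<n}. \<Oplus>\<^bsub>tensor HA Z\<^esub>k\<in>{..<m}.
      pure_tensor HA Z (BEF_gen E E i l) (BEF_gen E F l k \<otimes>\<^bsub>Z\<^esub> w $$ (k, j)))"
    by (rule HZ.T.finsum_swap) (use gen in auto)
  also have "\<dots> = (\<Oplus>\<^bsub>tensor HA Z\<^esub>l\<in>{..<n}. pure_tensor HA Z (BEF_gen E E i l) (mm Z gens w $$ (l, j)))"
  proof (rule HZ.T.finsum_cong', simp)
    fix l assume l: "l \<in> {..<n}"
    have "mm Z gens w $$ (l, j) = (\<Oplus>\<^bsub>Z\<^esub>k\<in>{..<m}. BEF_gen E F l k \<otimes>\<^bsub>Z\<^esub> w $$ (k, j))"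
      using l gen E by (auto intro!: B.finsum_cong' del: equalityI)
    then show "(\<Oplus>\<^bsub>tensor HA Z\<^esub>k\<in>{..<m}. pure_tensor HA Z (BEF_gen E E i l) (BEF_gen E F l k \<otimes>\<^bsub>Z\<^esub> w $$ (k, j)))
      = pure_tensor HA Z (BEF_gen E E i l) (mm Z gens w $$ (l, j))"
      using l gen by (subst HZ.pure_finsum_r[symmetric]) auto
  qed (use gen E in \<open>auto simp: w_gens simp del: mm_index intro!: HZ.T.finsum_closed\<close>)
  also have "\<dots> = pure_tensor HA Z (BEF_gen E E i j) \<one>\<^bsub>Z\<^esub>"
    unfolding w_gens using gen by (subst HZ.T.finsum_delta[where i = j]) auto
  finally show ?case .
next
  case (mult x y)
  then show ?case by (simp add: \<tau>_mult can_opmul)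
qed (simp_all add: lin_hom_add[OF \<tau>_lin] lin_hom_smult[OF \<tau>_lin] C.can_add C.can_smult HZ.pure_add_l HZ.pure_smult_l)

text \<open>The extension of \<tau> that is right linear over Z; as \<open>can\<close> is right
  linear too, this is the only candidate for its inverse.\<close>

definition "cinv = tensor_lift (tensor Z Z) (\<lambda>h z. \<tau> h \<otimes>\<^bsub>tensor Z Z\<^esub> pure_tensor Z Z \<one>\<^bsub>Z\<^esub> z)"

lemma cinv_bilin: "bilin HA Z (tensor Z Z) (\<lambda>h z. \<tau> h \<otimes>\<^bsub>tensor Z Z\<^esub> pure_tensor Z Z \<one>\<^bsub>Z\<^esub> z)"
  by (intro bilinI; simp add: lin_hom_add[OF \<tau>_lin] lin_hom_smult[OF \<tau>_lin] C.ZZ.pure_add_r C.ZZ.pure_smult_r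
      C.ZZ.T.l_distr C.ZZ.T.r_distr)

lemma cinv_lin: "cinv \<in> lin_hom (tensor HA Z) (tensor Z Z)"
  unfolding cinv_def by (rule HZ.tensor_lift_lin[OF C.ZZ.tensor_kalg cinv_bilin])

lemma cinv_pure: "h \<in> carrier HA \<Longrightarrow> z \<in> carrier Z \<Longrightarrow>
    cinv (pure_tensor HA Z h z) = \<tau> h \<otimes>\<^bsub>tensor Z Z\<^esub> pure_tensor Z Z \<one>\<^bsub>Z\<^esub> z"
  unfolding cinv_def by (rule HZ.tensor_lift_pure[OF C.ZZ.tensor_kalg cinv_bilin])

lemmas cinv_closed = lin_hom_closed[OF cinv_lin] and cinv_add = lin_hom_add[OF cinv_lin]
  and cinv_smult = lin_hom_smult[OF cinv_lin]

lemma can_cinv: "t \<in> carrier (tensor HA Z) \<Longrightarrow> C.can (cinv t) = t"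
  by (induction rule: HZ.tensor_induct)
    (simp_all add: cinv_pure C.can_right can_\<tau> cinv_add C.can_add cinv_closed)

lemma cinv_right:
  assumes "t \<in> carrier (tensor HA Z)" "z \<in> carrier Z"
  shows "cinv (t \<otimes>\<^bsub>tensor HA Z\<^esub> pure_tensor HA Z \<one>\<^bsub>HA\<^esub> z) = cinv t \<otimes>\<^bsub>tensor Z Z\<^esub> pure_tensor Z Z \<one>\<^bsub>Z\<^esub> z"
  using assms(1)
  by (induction rule: HZ.tensor_induct)
    (use assms(2) in \<open>simp_all add: cinv_pure C.ZZ.T.m_assoc C.ZZ.T.l_distr HZ.T.l_distr cinv_add cinv_closed\<close>)

text \<open>Needed to prove cinv(\<delta>(z)) = z \<otimes> 1 by induction on products in z: a
  factor v with cinv(v) = x \<otimes> 1 acts by left multiplication with x \<otimes> 1.\<close>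

lemma cinv_mult:
  assumes v: "v \<in> carrier (tensor HA Z)" and u: "u \<in> carrier (tensor HA Z)" and x: "x \<in> carrier Z"
    and cv: "cinv v = pure_tensor Z Z x \<one>\<^bsub>Z\<^esub>"
  shows "cinv (v \<otimes>\<^bsub>tensor HA Z\<^esub> u) = pure_tensor Z Z x \<one>\<^bsub>Z\<^esub> \<otimes>\<^bsub>tensor Z Z\<^esub> cinv u"
proof -
  let ?ZZ = "tensor Z Z"
  \<comment> \<open>For p \<otimes> r this inserts t between the two legs and z' at the far right:
    it is (p \<otimes> 1) t (1 \<otimes> r z').\<close>
  let ?\<phi> = "\<lambda>t z' p r. (pure_tensor Z Z p \<one>\<^bsub>Z\<^esub> \<otimes>\<^bsub>?ZZ\<^esub> t) \<otimes>\<^bsub>?ZZ\<^esub> pure_tensor Z Z \<one>\<^bsub>Z\<^esub> (r \<otimes>\<^bsub>Z\<^esub> z')"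
  have bil: "bilin Z Z ?ZZ (?\<phi> t z')" if "t \<in> carrier ?ZZ" "z' \<in> carrier Z" for t z'
    by (intro bilinI; simp add: that C.ZZ.pure_add_l C.ZZ.pure_add_r C.ZZ.pure_smult_l C.ZZ.pure_smult_r
        C.ZZ.T.l_distr C.ZZ.T.r_distr B.l_distr B.r_distr)
  note l = C.ZZ.tensor_lift_lin[OF C.ZZ.tensor_kalg bil] and p = C.ZZ.tensor_lift_pure[OF C.ZZ.tensor_kalg bil]
  have 0: "opmul (pure_tensor Z Z a b) t \<otimes>\<^bsub>?ZZ\<^esub> pure_tensor Z Z \<one>\<^bsub>Z\<^esub> (y \<otimes>\<^bsub>Z\<^esub> z') = ?\<phi> t z' a (b \<otimes>\<^bsub>Z\<^esub> y)"
    if "t \<in> carrier ?ZZ" "a \<in> carrier Z" "b \<in> carrier Z" "y \<in> carrier Z" "z' \<in> carrier Z" for t a b y z'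
    using that(1)
    by (induction rule: C.ZZ.tensor_induct)
      (use that in \<open>simp_all add: opmul_pure opmul_simps B.m_assoc C.ZZ.T.l_distr C.ZZ.T.r_distr\<close>)
  have 1: "opmul s t \<otimes>\<^bsub>?ZZ\<^esub> pure_tensor Z Z \<one>\<^bsub>Z\<^esub> (y \<otimes>\<^bsub>Z\<^esub> z')
      = tensor_lift ?ZZ (?\<phi> t z') (s \<otimes>\<^bsub>?ZZ\<^esub> pure_tensor Z Z \<one>\<^bsub>Z\<^esub> y)"
    if "s \<in> carrier ?ZZ" "t \<in> carrier ?ZZ" "y \<in> carrier Z" "z' \<in> carrier Z" for s t y z'
    using that(1)
    by (induction rule: C.ZZ.tensor_induct)
      (use that in \<open>simp_all add: 0 p opmul_simps C.ZZ.T.l_distr lin_hom_add[OF l]\<close>)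
  \<comment> \<open>The right-hand side depends on v only through cinv(v), so the value x \<otimes>
    1 can be substituted.\<close>
  have 2: "cinv (v \<otimes>\<^bsub>tensor HA Z\<^esub> pure_tensor HA Z h z') = tensor_lift ?ZZ (?\<phi> (\<tau> h) z') (cinv v)"
    if "v \<in> carrier (tensor HA Z)" "h \<in> carrier HA" "z' \<in> carrier Z" for v h z'
    using that(1)
    by (induction rule: HZ.tensor_induct)
      (use that in \<open>simp_all add: cinv_pure \<tau>_mult 1 HZ.T.l_distr cinv_add lin_hom_add[OF l] cinv_closed\<close>)
  show ?thesis using u
    by (induction rule: HZ.tensor_induct)
      (use v x in \<open>simp_all add: 2 cv p cinv_pure C.ZZ.T.m_assoc HZ.T.r_distr C.ZZ.T.r_distr cinv_add cinv_closed\<close>)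
qed

lemma cinv_coprod: "z \<in> carrier Z \<Longrightarrow> cinv (coprod E F z) = pure_tensor Z Z z \<one>\<^bsub>Z\<^esub>"
proof (induction rule: alg_induct)
  case one
  then show ?case by (simp add: C.\<delta>_one HZ.tensor_one cinv_pure \<tau>_one)
next
  case (gen i j)
  have "cinv (coprod E F (BEF_gen E F i j)) = (\<Oplus>\<^bsub>tensor Z Z\<^esub>l\<in>{..<n}. cinv (pure_tensor HA Z (BEF_gen E E i l) (BEF_gen E F l j)))"
    unfolding coprod_gen[OF gen] by (rule HZ.T.lin_hom_finsum[OF C.ZZ.tensor_kalg cinv_lin]) (use gen in auto)
  also have "\<dots> = (\<Oplus>\<^bsub>tensor Z Z\<^esub>l\<in>{..<n}. \<Oplus>\<^bsub>tensor Z Z\<^esub>k\<in>{..<m}.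
      pure_tensor Z Z (BEF_gen E F i k) (w $$ (k, l) \<otimes>\<^bsub>Z\<^esub> BEF_gen E F l j))"
  proof (rule C.ZZ.T.finsum_cong', simp)
    fix l assume l: "l \<in> {..<n}"
    have "cinv (pure_tensor HA Z (BEF_gen E E i l) (BEF_gen E F l j))
      = (\<Oplus>\<^bsub>tensor Z Z\<^esub>k\<in>{..<m}. pure_tensor Z Z (BEF_gen E F i k) (w $$ (k, l))) \<otimes>\<^bsub>tensor Z Z\<^esub> pure_tensor Z Z \<one>\<^bsub>Z\<^esub> (BEF_gen E F l j)"
      using gen l by (simp add: cinv_pure \<tau>_gen)
    also have "\<dots> = (\<Oplus>\<^bsub>tensor Z Z\<^esub>k\<in>{..<m}. pure_tensor Z Z (BEF_gen E F i k) (w $$ (k, l)) \<otimes>\<^bsub>tensor Z Z\<^esub> pure_tensor Z Z \<one>\<^bsub>Z\<^esub> (BEF_gen E F l j))"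
      using gen l by (intro C.ZZ.T.finsum_ldistr) auto
    also have "\<dots> = (\<Oplus>\<^bsub>tensor Z Z\<^esub>k\<in>{..<m}. pure_tensor Z Z (BEF_gen E F i k) (w $$ (k, l) \<otimes>\<^bsub>Z\<^esub> BEF_gen E F l j))"
      using gen l by (intro C.ZZ.T.finsum_cong') (auto del: equalityI)
    finally show "cinv (pure_tensor HA Z (BEF_gen E E i l) (BEF_gen E F l j)) = \<dots>" .
  qed (use gen in \<open>auto intro!: C.ZZ.T.finsum_closed\<close>)
  also have "\<dots> = (\<Oplus>\<^bsub>tensor Z Z\<^esub>k\<in>{..<m}. \<Oplus>\<^bsub>tensor Z Z\<^esub>l\<in>{..<n}.
      pure_tensor Z Z (BEF_gen E F i k) (w $$ (k, l) \<otimes>\<^bsub>Z\<^esub> BEF_gen E F l j))"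
    by (rule C.ZZ.T.finsum_swap) (use gen in auto)
  also have "\<dots> = (\<Oplus>\<^bsub>tensor Z Z\<^esub>k\<in>{..<m}. pure_tensor Z Z (BEF_gen E F i k) (mm Z w gens $$ (k, j)))"
  proof (rule C.ZZ.T.finsum_cong', simp)
    fix k assume k: "k \<in> {..<m}"
    have "mm Z w gens $$ (k, j) = (\<Oplus>\<^bsub>Z\<^esub>l\<in>{..<n}. w $$ (k, l) \<otimes>\<^bsub>Z\<^esub> BEF_gen E F l j)"
      using k gen E F by (auto intro!: B.finsum_cong' del: equalityI)
    then show "(\<Oplus>\<^bsub>tensor Z Z\<^esub>l\<in>{..<n}. pure_tensor Z Z (BEF_gen E F i k) (w $$ (k, l) \<otimes>\<^bsub>Z\<^esub> BEF_gen E F l j))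
      = pure_tensor Z Z (BEF_gen E F i k) (mm Z w gens $$ (k, j))"
      using k gen by (subst C.ZZ.pure_finsum_r[symmetric]) auto
  qed (use gen E in \<open>auto simp: w_gens simp del: mm_index intro!: C.ZZ.T.finsum_closed\<close>)
  also have "\<dots> = pure_tensor Z Z (BEF_gen E F i j) \<one>\<^bsub>Z\<^esub>"
    unfolding w_gens using gen by (subst C.ZZ.T.finsum_delta[where i = j]) auto
  finally show ?case .
next
  case (mult x y)
  then show ?case by (simp add: C.\<delta>_mult cinv_mult)
qed (simp_all add: C.\<delta>_add C.\<delta>_smult cinv_add cinv_smult C.ZZ.pure_add_l C.ZZ.pure_smult_l)

lemma cinv_can: "t \<in> carrier (tensor Z Z) \<Longrightarrow> cinv (C.can t) = t"
  by (induction rule: C.ZZ.tensor_induct)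
    (simp_all add: C.can_pure cinv_right cinv_coprod C.can_add cinv_add C.can_closed)

lemma can_bij: "bij_betw C.can (carrier (tensor Z Z)) (carrier (tensor HA Z))"
  by (rule bij_betwI[where g = cinv]) (auto simp: cinv_can can_cinv C.can_closed cinv_closed)

theorem galois_object_BEF:
  assumes "\<one>\<^bsub>Z\<^esub> \<noteq> \<zero>\<^bsub>Z\<^esub>"
  shows "galois_object (BE E) (BEF E F)"
proof -
  have "canonical_map (BE E) (BEF E F) = C.can"
    by (simp add: canonical_map_def C.can_def)
  moreover have "coinvariants (BE E) (BEF E F) = range (\<lambda>c. c \<odot>\<^bsub>Z\<^esub> \<one>\<^bsub>Z\<^esub>)"
    using C.coinvariants_eq[OF bij_betw_imp_inj_on[OF can_bij] assms] by (simp add: coinvariants_def)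
  ultimately show ?thesis
    using hopf_algebra_BE comodule_algebra_BEF can_bij assms B.one_closed unfolding galois_object_def by auto
qed

end

subsection \<open>Morphisms of Galois objects\<close>

lemma lin_hom_inverse:
  assumes "kalg A" "f \<in> lin_hom A B" "bij_betw f (carrier A) (carrier B)"
  shows "inv_into (carrier A) f \<in> lin_hom B A"
proof (rule lin_homI)
  interpret A: kalg A by fact
  note inj = bij_betw_imp_inj_on[OF assms(3)] and im = bij_betw_imp_surj_on[OF assms(3)]
  show cl: "inv_into (carrier A) f y \<in> carrier A" if "y \<in> carrier B" for y
    using that im by (metis inv_into_into)
  have fi: "f (inv_into (carrier A) f y) = y" if "y \<in> carrier B" for y
    using that im by (metis f_inv_into_f)
  show "inv_into (carrier A) f (x \<oplus>\<^bsub>B\<^esub> y) = inv_into (carrier A) f x \<oplus>\<^bsub>A\<^esub> inv_into (carrier A) f y"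
    if "x \<in> carrier B" "y \<in> carrier B" for x y
    by (rule inv_into_f_eq[OF inj]) (use that cl fi in \<open>simp_all add: lin_hom_add[OF assms(2)]\<close>)
  show "inv_into (carrier A) f (c \<odot>\<^bsub>B\<^esub> x) = c \<odot>\<^bsub>A\<^esub> inv_into (carrier A) f x" if "x \<in> carrier B" for c x
    by (rule inv_into_f_eq[OF inj]) (use that cl fi in \<open>simp_all add: lin_hom_smult[OF assms(2)]\<close>)
qed

locale comod_morphism = Y: comod H Y \<delta>Y + Z: comod H Z \<delta>Z
  for H :: "('k::field, 'h, 'm) module_scheme" and Y :: "('k, 'y, 'n) module_scheme"
    and \<delta>Y and Z :: "('k, 'z, 'o) module_scheme" and \<delta>Z +
  fixes f :: "'y \<Rightarrow> 'z"
  assumes f: "f \<in> alg_hom Y Z"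
    and f_coact: "\<And>y. y \<in> carrier Y \<Longrightarrow> \<delta>Z (f y) = tensor_map H Z id f (\<delta>Y y)"
    and Y_bij: "bij_betw Y.can (carrier (tensor Y Y)) (carrier (tensor H Y))"
    and Z_inj: "inj_on Z.can (carrier (tensor Z Z))"
    and nontrivial: "\<one>\<^bsub>Z\<^esub> \<noteq> \<zero>\<^bsub>Z\<^esub>"
begin

interpretation YZ: kalg2 Y Z by (rule kalg2I) unfold_locales

abbreviation "g \<equiv> inv_into (carrier (tensor Y Y)) Y.can"
definition "ff = tensor_map H Z id f"
definition "jf = tensor_map Y Z id f"
definition "fj = tensor_map Z Z f id"

lemmas kk = Y.A.kalg_axioms Y.B.kalg_axioms Z.B.kalg_axioms

lemma g_lin: "g \<in> lin_hom (tensor H Y) (tensor Y Y)"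
  by (rule lin_hom_inverse[OF Y.ZZ.tensor_kalg Y.can_lin Y_bij])

lemma g_closed: "t \<in> carrier (tensor H Y) \<Longrightarrow> g t \<in> carrier (tensor Y Y)"
  by (rule lin_hom_closed[OF g_lin])

lemma can_g: "t \<in> carrier (tensor H Y) \<Longrightarrow> Y.can (g t) = t"
  by (rule bij_betw_inv_into_right[OF Y_bij])

lemma g_can: "t \<in> carrier (tensor Y Y) \<Longrightarrow> g (Y.can t) = t"
  by (rule bij_betw_inv_into_left[OF Y_bij])

lemma g_right:
  assumes "t \<in> carrier (tensor H Y)" "y \<in> carrier Y"
  shows "g (t \<otimes>\<^bsub>tensor H Y\<^esub> pure_tensor H Y \<one>\<^bsub>H\<^esub> y) = g t \<otimes>\<^bsub>tensor Y Y\<^esub> pure_tensor Y Y \<one>\<^bsub>Y\<^esub> y"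
  using Y.can_right[OF g_closed[OF assms(1)] assms(2)] can_g[OF assms(1)]
    g_can[of "g t \<otimes>\<^bsub>tensor Y Y\<^esub> pure_tensor Y Y \<one>\<^bsub>Y\<^esub> y"] g_closed[OF assms(1)] assms by simp

lemma f_closed [simp]: "y \<in> carrier Y \<Longrightarrow> f y \<in> carrier Z"
  by (rule lin_hom_closed[OF alg_hom_lin[OF f]])

lemma f_simps: "y \<in> carrier Y \<Longrightarrow> y' \<in> carrier Y \<Longrightarrow> f (y \<otimes>\<^bsub>Y\<^esub> y') = f y \<otimes>\<^bsub>Z\<^esub> f y'" "f \<one>\<^bsub>Y\<^esub> = \<one>\<^bsub>Z\<^esub>"
  "y \<in> carrier Y \<Longrightarrow> f (c \<odot>\<^bsub>Y\<^esub> y) = c \<odot>\<^bsub>Z\<^esub> f y"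
  using alg_hom_mult[OF f] alg_hom_one[OF f] lin_hom_smult[OF alg_hom_lin[OF f]] by auto

lemma ff_hom: "ff \<in> alg_hom (tensor H Y) (tensor H Z)"
  unfolding ff_def by (rule tensor_map_alg[OF kk(1,2,1,3) alg_hom_id' f])

lemma jf_hom: "jf \<in> alg_hom (tensor Y Y) (tensor Y Z)"
  unfolding jf_def by (rule tensor_map_alg[OF kk(2,2,2,3) alg_hom_id' f])

lemma fj_hom: "fj \<in> alg_hom (tensor Y Z) (tensor Z Z)"
  unfolding fj_def by (rule tensor_map_alg[OF kk(2,3,3,3) f alg_hom_id'])

lemmas ff_pure = tensor_map_pure[OF kk(1,2,1,3) lin_hom_id' alg_hom_lin[OF f], folded ff_def, unfolded id_apply]
  and jf_pure = tensor_map_pure[OF kk(2,2,2,3) lin_hom_id' alg_hom_lin[OF f], folded jf_def, unfolded id_apply]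
  and fj_pure = tensor_map_pure[OF kk(2,3,3,3) alg_hom_lin[OF f] lin_hom_id', folded fj_def, unfolded id_apply]

lemmas f_coact' = f_coact[folded ff_def]

lemmas hom_simps = alg_hom_mult[OF ff_hom] alg_hom_mult[OF jf_hom] alg_hom_mult[OF fj_hom]
  lin_hom_add[OF alg_hom_lin[OF ff_hom]] lin_hom_add[OF alg_hom_lin[OF jf_hom]] lin_hom_add[OF alg_hom_lin[OF fj_hom]]
  lin_hom_smult[OF alg_hom_lin[OF ff_hom]] lin_hom_smult[OF alg_hom_lin[OF jf_hom]] lin_hom_smult[OF alg_hom_lin[OF fj_hom]]
  lin_hom_closed[OF alg_hom_lin[OF ff_hom]] lin_hom_closed[OF alg_hom_lin[OF jf_hom]] lin_hom_closed[OF alg_hom_lin[OF fj_hom]]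
  lin_hom_add[OF g_lin] lin_hom_smult[OF g_lin] g_closed

text \<open>The inverse of the canonical map of Y after base change along f: it goes from H
  \<otimes> Z to Y \<otimes> Z. The two facts used about it are G(\<delta>(f y)) = y \<otimes> 1 and
  that f \<otimes> id after G is a right inverse of the canonical map of Z.\<close>

definition "G = tensor_lift (tensor Y Z)
  (\<lambda>h z. jf (g (pure_tensor H Y h \<one>\<^bsub>Y\<^esub>)) \<otimes>\<^bsub>tensor Y Z\<^esub> pure_tensor Y Z \<one>\<^bsub>Y\<^esub> z)"

lemma G_bilin: "bilin H Z (tensor Y Z)
    (\<lambda>h z. jf (g (pure_tensor H Y h \<one>\<^bsub>Y\<^esub>)) \<otimes>\<^bsub>tensor Y Z\<^esub> pure_tensor Y Z \<one>\<^bsub>Y\<^esub> z)"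
  by (intro bilinI; simp add: hom_simps Y.pure_add_l Y.pure_smult_l YZ.pure_add_r YZ.pure_smult_r
      YZ.T.l_distr YZ.T.r_distr)

lemma G_lin: "G \<in> lin_hom (tensor H Z) (tensor Y Z)"
  unfolding G_def by (rule Z.tensor_lift_lin[OF YZ.tensor_kalg G_bilin])

lemma G_pure: "h \<in> carrier H \<Longrightarrow> z \<in> carrier Z \<Longrightarrow> G (pure_tensor H Z h z)
    = jf (g (pure_tensor H Y h \<one>\<^bsub>Y\<^esub>)) \<otimes>\<^bsub>tensor Y Z\<^esub> pure_tensor Y Z \<one>\<^bsub>Y\<^esub> z"
  unfolding G_def by (rule Z.tensor_lift_pure[OF YZ.tensor_kalg G_bilin])

lemmas G_closed = lin_hom_closed[OF G_lin] and G_add = lin_hom_add[OF G_lin]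

lemma G_ff: "t \<in> carrier (tensor H Y) \<Longrightarrow> G (ff t) = jf (g t)"
proof (induction rule: Y.tensor_induct)
  case (pure h y)
  have "jf (g (pure_tensor H Y h \<one>\<^bsub>Y\<^esub> \<otimes>\<^bsub>tensor H Y\<^esub> pure_tensor H Y \<one>\<^bsub>H\<^esub> y)) = G (ff (pure_tensor H Y h y))"
    using pure by (subst g_right) (simp_all add: hom_simps ff_pure jf_pure G_pure)
  then show ?case using pure by simp
qed (simp add: hom_simps G_add)

lemma can_fj_jf: "t \<in> carrier (tensor Y Y) \<Longrightarrow> Z.can (fj (jf t)) = ff (Y.can t)"
proof (induction rule: Y.ZZ.tensor_induct)
  case (pure y y')
  then show ?case
    by (simp add: jf_pure fj_pure Z.can_pure Y.can_pure f_coact' hom_simps ff_pure)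
qed (simp add: hom_simps Z.can_add Y.can_add Y.can_closed)

lemma can_fj_G: "t \<in> carrier (tensor H Z) \<Longrightarrow> Z.can (fj (G t)) = t"
proof (induction rule: Z.tensor_induct)
  case (pure h z)
  have "fj (G (pure_tensor H Z h z)) = fj (jf (g (pure_tensor H Y h \<one>\<^bsub>Y\<^esub>))) \<otimes>\<^bsub>tensor Z Z\<^esub> pure_tensor Z Z \<one>\<^bsub>Z\<^esub> z"
    using pure by (simp add: G_pure hom_simps fj_pure f_simps)
  then show ?case using pure
    by (simp add: Z.can_right hom_simps can_fj_jf can_g ff_pure f_simps)
qed (simp add: G_add hom_simps Z.can_add G_closed)

text \<open>If f y = 0 then y \<otimes> 1 = G(\<delta>(f y)) = 0, and slicing gives y = 0.
  Conversely z \<otimes> 1 = (f \<otimes> id)(G(\<delta> z)) because both sides have the same image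
  under the injective canonical map of Z; slicing exhibits a preimage of z.\<close>

theorem bij: "bij_betw f (carrier Y) (carrier Z)"
proof -
  obtain \<psi> where \<psi>: "\<psi> \<in> lin_hom Z (ground_alg :: ('k, 'k) module)" "\<psi> \<one>\<^bsub>Z\<^esub> = 1"
    using Z.B.functional_one[OF nontrivial] by blast
  note f0 = Y.B.lin_hom_zero[OF kk(3) alg_hom_lin[OF f]]
  have ker: "y = \<zero>\<^bsub>Y\<^esub>" if y: "y \<in> carrier Y" "f y = \<zero>\<^bsub>Z\<^esub>" for y
  proof -
    have "pure_tensor Y Z y \<one>\<^bsub>Z\<^esub> = jf (pure_tensor Y Y y \<one>\<^bsub>Y\<^esub>)"
      using y by (simp add: jf_pure f_simps)
    also have "pure_tensor Y Y y \<one>\<^bsub>Y\<^esub> = g (\<delta>Y y)"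
      using y g_can[of "pure_tensor Y Y y \<one>\<^bsub>Y\<^esub>"] by (simp add: Y.can_pure flip: Y.tensor_one)
    also have "jf (g (\<delta>Y y)) = G (\<delta>Z (f y))"
      using y G_ff[of "\<delta>Y y"] f_coact'[OF y(1)] by simp
    also have "\<delta>Z (f y) = \<zero>\<^bsub>tensor H Z\<^esub>"
      using Z.B.lin_hom_zero[OF Z.tensor_kalg alg_hom_lin[OF Z.\<delta>]] y by simp
    also have "G \<zero>\<^bsub>tensor H Z\<^esub> = \<zero>\<^bsub>tensor Y Z\<^esub>"
      by (rule Z.T.lin_hom_zero[OF YZ.tensor_kalg G_lin])
    finally have "slice Y \<psi> (pure_tensor Y Z y \<one>\<^bsub>Z\<^esub>) = slice Y \<psi> \<zero>\<^bsub>tensor Y Z\<^esub>" by simp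
    then show ?thesis
      using y \<psi> YZ.T.lin_hom_zero[OF kk(2) YZ.slice_lin[OF \<psi>(1)]] by (simp add: YZ.slice_pure)
  qed
  have "inj_on f (carrier Y)"
  proof (rule inj_onI)
    fix x y assume xy: "x \<in> carrier Y" "y \<in> carrier Y" "f x = f y"
    then have "f (x \<ominus>\<^bsub>Y\<^esub> y) = \<zero>\<^bsub>Z\<^esub>"
      by (simp add: Y.B.lin_hom_minus[OF kk(3) alg_hom_lin[OF f]] Z.B.diff_zero_iff)
    then show "x = y" using ker[of "x \<ominus>\<^bsub>Y\<^esub> y"] xy by (simp add: Y.B.diff_zero_iff)
  qed
  moreover have "z \<in> f ` carrier Y" if z: "z \<in> carrier Z" for z
  proof -
    have "Z.can (fj (G (\<delta>Z z))) = Z.can (pure_tensor Z Z z \<one>\<^bsub>Z\<^esub>)"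
      using z by (simp add: can_fj_G Z.can_pure flip: Z.tensor_one)
    then have e: "fj (G (\<delta>Z z)) = pure_tensor Z Z z \<one>\<^bsub>Z\<^esub>"
      using z by (intro inj_onD[OF Z_inj]) (auto simp: hom_simps G_closed)
    \<comment> \<open>The slice is taken in the second leg and f acts in the first, so they
      commute.\<close>
    have sl: "slice Z \<psi> (fj t) = f (slice Y \<psi> t)" if "t \<in> carrier (tensor Y Z)" for t
      by (rule YZ.tensor_lin_eq[OF kk(3) lin_hom_comp[OF alg_hom_lin[OF fj_hom] Z.ZZ.slice_lin[OF \<psi>(1)]]
            lin_hom_comp[OF YZ.slice_lin[OF \<psi>(1)] alg_hom_lin[OF f]] _ that])
        (simp add: fj_pure Z.ZZ.slice_pure[OF \<psi>(1)] YZ.slice_pure[OF \<psi>(1)] f_simps)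
    have "z = slice Z \<psi> (pure_tensor Z Z z \<one>\<^bsub>Z\<^esub>)" using z \<psi> by (simp add: Z.ZZ.slice_pure)
    also have "\<dots> = f (slice Y \<psi> (G (\<delta>Z z)))" unfolding e[symmetric] using z by (intro sl G_closed) simp
    finally have "z = f (slice Y \<psi> (G (\<delta>Z z)))" .
    moreover have "slice Y \<psi> (G (\<delta>Z z)) \<in> carrier Y"
      using z by (intro lin_hom_closed[OF YZ.slice_lin[OF \<psi>(1)]] G_closed) simp
    ultimately show ?thesis by (rule image_eqI)
  qed
  ultimately show ?thesis unfolding bij_betw_def by auto
qed

end

subsection \<open>Equivariant columns\<close>

text \<open>The Galois object axioms over the underlying algebra of \<open>BE E\<close>, with the
  coaction as a parameter instead of a record field. That the coinvariants are the scalars is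
  recovered from \<open>C.coinvariants_eq\<close>.\<close>

locale gal = HE: bef n E n E + C: comod "BEF_alg E E" Z \<delta>
  for n :: nat and E :: "'k::field mat" and Z :: "('k, 'z, 'o) module_scheme" and \<delta> +
  assumes coassoc: "\<And>z. z \<in> carrier Z \<Longrightarrow>
      tensor_assoc (BEF_alg E E) (BEF_alg E E) Z
        (tensor_map (tensor (BEF_alg E E) (BEF_alg E E)) Z (coprod E E) id (\<delta> z))
      = tensor_map (BEF_alg E E) (tensor (BEF_alg E E) Z) id \<delta> (\<delta> z)"
    and counit: "\<And>z. z \<in> carrier Z \<Longrightarrow> tensor_lift Z (\<lambda>h y. counit (BE E) h \<odot>\<^bsub>Z\<^esub> y) (\<delta> z) = z"
    and can_bij: "bij_betw C.can (carrier (tensor Z Z)) (carrier (tensor (BEF_alg E E) Z))"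
    and nontrivial: "\<one>\<^bsub>Z\<^esub> \<noteq> \<zero>\<^bsub>Z\<^esub>"
begin

abbreviation "A \<equiv> BEF_alg E E"
abbreviation "a \<equiv> BEF_gen E E"

lemmas E = HE.E

interpretation AAZ: kalg2 "tensor A A" Z by (rule kalg2I) unfold_locales
interpretation AZZ: kalg2 "tensor A Z" Z by (rule kalg2I) unfold_locales
interpretation A_AZ: kalg2 A "tensor A Z" by (rule kalg2I) unfold_locales
interpretation A_ZZ: kalg2 A "tensor Z Z" by (rule kalg2I) unfold_locales

lemmas kA = HE.B.kalg_axioms and kZ = C.B.kalg_axioms and kAZ = C.tensor_kalg and kZZ = C.ZZ.tensor_kalg
  and kAA = HE.HZ.tensor_kalg

lemma a_closed [simp]: "i < n \<Longrightarrow> j < n \<Longrightarrow> a i j \<in> carrier A"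
  by (rule HE.gen_in_alg)

definition "g = inv_into (carrier (tensor Z Z)) C.can"

lemma g_lin: "g \<in> lin_hom (tensor A Z) (tensor Z Z)"
  unfolding g_def by (rule lin_hom_inverse[OF kZZ C.can_lin can_bij])

lemmas g_closed = lin_hom_closed[OF g_lin]

lemma can_g: "t \<in> carrier (tensor A Z) \<Longrightarrow> C.can (g t) = t"
  unfolding g_def by (rule bij_betw_inv_into_right[OF can_bij])

lemma g_can: "t \<in> carrier (tensor Z Z) \<Longrightarrow> g (C.can t) = t"
  unfolding g_def by (rule bij_betw_inv_into_left[OF can_bij])

lemma coinvariant_scalar:
  assumes "z \<in> carrier Z" "\<delta> z = pure_tensor A Z \<one>\<^bsub>A\<^esub> z"
  obtains c where "z = c \<odot>\<^bsub>Z\<^esub> \<one>\<^bsub>Z\<^esub>"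
  using C.coinvariants_eq[OF bij_betw_imp_inj_on[OF can_bij] nontrivial] assms by blast

text \<open>The comodule structure of \<open>Z \<otimes> Z\<close> carried by its left factor.\<close>

definition "D t = tensor_assoc A Z Z (tensor_map (tensor A Z) Z \<delta> id t)"
text \<open>The counterpart of \<open>D\<close> on H \<otimes> Z, where the left factor coacts
  through its coproduct; \<open>can\<close> intertwines the two.\<close>

definition "K t = tensor_assoc A A Z (tensor_map (tensor A A) Z (coprod E E) id t)"
definition "idcan = tensor_map A (tensor A Z) id C.can"
definition "idg = tensor_map A (tensor Z Z) id g"
definition "idd = tensor_map A (tensor A Z) id \<delta>"

lemmas dmap_pure = tensor_map_pure[OF kZ kZ kAZ kZ alg_hom_lin[OF C.\<delta>] lin_hom_id']
  and dmap_hom = tensor_map_alg[OF kZ kZ kAZ kZ C.\<delta> alg_hom_id']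
  and as1_hom = tensor_assoc_alg[OF kA kZ kZ]
  and as1_pure = tensor_assoc_pure[OF kA kZ kZ]
  and kmap_pure = tensor_map_pure[OF kA kZ kAA kZ alg_hom_lin[OF HE.coprod_hom] lin_hom_id']
  and kmap_hom = tensor_map_alg[OF kA kZ kAA kZ HE.coprod_hom alg_hom_id']
  and as2_hom = tensor_assoc_alg[OF kA kA kZ]
  and as2_pure = tensor_assoc_pure[OF kA kA kZ]

lemma D_hom: "D \<in> alg_hom (tensor Z Z) (tensor A (tensor Z Z))"
  unfolding D_def[abs_def] by (rule alg_hom_comp[OF dmap_hom as1_hom])

lemma K_hom: "K \<in> alg_hom (tensor A Z) (tensor A (tensor A Z))"
  unfolding K_def[abs_def] by (rule alg_hom_comp[OF kmap_hom as2_hom])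

lemma idcan_lin: "idcan \<in> lin_hom (tensor A (tensor Z Z)) (tensor A (tensor A Z))"
  unfolding idcan_def by (rule tensor_map_lin[OF kA kZZ kA kAZ lin_hom_id' C.can_lin])

lemma idg_lin: "idg \<in> lin_hom (tensor A (tensor A Z)) (tensor A (tensor Z Z))"
  unfolding idg_def by (rule tensor_map_lin[OF kA kAZ kA kZZ lin_hom_id' g_lin])

lemma idd_hom: "idd \<in> alg_hom (tensor A Z) (tensor A (tensor A Z))"
  unfolding idd_def by (rule tensor_map_alg[OF kA kZ kA kAZ alg_hom_id' C.\<delta>])

lemma idcan_pure: "h \<in> carrier A \<Longrightarrow> t \<in> carrier (tensor Z Z) \<Longrightarrow>
    idcan (pure_tensor A (tensor Z Z) h t) = pure_tensor A (tensor A Z) h (C.can t)"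
  unfolding idcan_def by (simp add: tensor_map_pure[OF kA kZZ kA kAZ lin_hom_id' C.can_lin])

lemma idg_pure: "h \<in> carrier A \<Longrightarrow> t \<in> carrier (tensor A Z) \<Longrightarrow>
    idg (pure_tensor A (tensor A Z) h t) = pure_tensor A (tensor Z Z) h (g t)"
  unfolding idg_def by (simp add: tensor_map_pure[OF kA kAZ kA kZZ lin_hom_id' g_lin])

lemma idd_pure: "h \<in> carrier A \<Longrightarrow> z \<in> carrier Z \<Longrightarrow>
    idd (pure_tensor A Z h z) = pure_tensor A (tensor A Z) h (\<delta> z)"
  unfolding idd_def by (simp add: tensor_map_pure[OF kA kZ kA kAZ lin_hom_id' alg_hom_lin[OF C.\<delta>]])

lemma idg_idcan: "t \<in> carrier (tensor A (tensor Z Z)) \<Longrightarrow> idg (idcan t) = t"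
  by (induction rule: A_ZZ.tensor_induct)
    (simp_all add: idcan_pure idg_pure g_can C.can_closed lin_hom_add[OF idcan_lin] lin_hom_add[OF idg_lin]
      lin_hom_closed[OF idcan_lin])

lemma assoc_can:
  assumes "u \<in> carrier (tensor A Z)" "z \<in> carrier Z"
  shows "idcan (tensor_assoc A Z Z (pure_tensor (tensor A Z) Z u z))
    = idd u \<otimes>\<^bsub>tensor A (tensor A Z)\<^esub> pure_tensor A (tensor A Z) \<one>\<^bsub>A\<^esub> (pure_tensor A Z \<one>\<^bsub>A\<^esub> z)"
  using assms(1)
proof (induction rule: C.tensor_induct)
  case (pure h x)
  then show ?case using assms(2) by (simp add: as1_pure idcan_pure idd_pure C.can_pure)
next
  case (add s t)
  note c = lin_hom_closed[OF alg_hom_lin[OF as1_hom]]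
  show ?case using add assms(2)
    by (simp add: AZZ.pure_add_l lin_hom_add[OF alg_hom_lin[OF as1_hom]] lin_hom_add[OF idcan_lin] c
        lin_hom_add[OF alg_hom_lin[OF idd_hom]] A_AZ.T.l_distr lin_hom_closed[OF alg_hom_lin[OF idd_hom]])
qed

lemma K_pure: "h \<in> carrier A \<Longrightarrow> z \<in> carrier Z \<Longrightarrow> K (pure_tensor A Z h z)
    = tensor_assoc A A Z (pure_tensor (tensor A A) Z (coprod E E h) z)"
  unfolding K_def by (simp add: kmap_pure)

text \<open>\<open>can\<close> is a comodule map for the coactions carried by the left factors.
  \<open>K\<close> is an algebra map, coassociativity gives K(\<delta> z) = (id \<otimes>
  \<delta>)(\<delta> z), and 1 \<otimes> z' only acquires another factor 1.\<close>

lemma idcan_D: "t \<in> carrier (tensor Z Z) \<Longrightarrow> idcan (D t) = K (C.can t)"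
proof (induction rule: C.ZZ.tensor_induct)
  case (pure z z')
  have K1: "K (pure_tensor A Z \<one>\<^bsub>A\<^esub> z') = pure_tensor A (tensor A Z) \<one>\<^bsub>A\<^esub> (pure_tensor A Z \<one>\<^bsub>A\<^esub> z')"
    using pure by (simp add: K_pure alg_hom_one[OF HE.coprod_hom] HE.HZ.tensor_one as2_pure)
  have "K (\<delta> z) = idd (\<delta> z)" using pure coassoc[of z] by (simp add: K_def idd_def)
  then have "K (C.can (pure_tensor Z Z z z'))
     = idd (\<delta> z) \<otimes>\<^bsub>tensor A (tensor A Z)\<^esub> pure_tensor A (tensor A Z) \<one>\<^bsub>A\<^esub> (pure_tensor A Z \<one>\<^bsub>A\<^esub> z')"
    using pure by (simp add: C.can_pure alg_hom_mult[OF K_hom] K1)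
  then show ?case using pure by (simp add: D_def dmap_pure assoc_can)
next
  case (add s t)
  then show ?case
    by (simp add: lin_hom_add[OF alg_hom_lin[OF D_hom]] lin_hom_add[OF idcan_lin] lin_hom_closed[OF alg_hom_lin[OF D_hom]]
        C.can_add lin_hom_add[OF alg_hom_lin[OF K_hom]] C.can_closed)
qed

definition "\<tau> i l = g (pure_tensor A Z (a i l) \<one>\<^bsub>Z\<^esub>)"

lemma \<tau>_closed [simp]: "i < n \<Longrightarrow> l < n \<Longrightarrow> \<tau> i l \<in> carrier (tensor Z Z)"
  unfolding \<tau>_def by (intro g_closed) simp

text \<open>The inverse of \<open>can\<close> is a comodule map as well, so it carries the coproduct
  formula for \<open>a\<^sub>i\<^sub>l\<close> over to \<tau>. For fixed l the family \<tau> i l is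
  therefore an equivariant column with values in Z \<otimes> Z.\<close>

lemma D_\<tau>:
  assumes "i < n" "l < n"
  shows "D (\<tau> i l) = (\<Oplus>\<^bsub>tensor A (tensor Z Z)\<^esub>p\<in>{..<n}. pure_tensor A (tensor Z Z) (a i p) (\<tau> p l))"
proof -
  have c: "pure_tensor A Z (a i l) \<one>\<^bsub>Z\<^esub> \<in> carrier (tensor A Z)" using assms by simp
  have "D (\<tau> i l) = idg (idcan (D (\<tau> i l)))"
    using assms lin_hom_closed[OF alg_hom_lin[OF D_hom]] by (simp add: idg_idcan)
  also have "idcan (D (\<tau> i l)) = K (pure_tensor A Z (a i l) \<one>\<^bsub>Z\<^esub>)"
    using assms c by (simp add: idcan_D, simp add: \<tau>_def can_g)
  also have "\<dots> = tensor_assoc A A Z (pure_tensor (tensor A A) Z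
      (\<Oplus>\<^bsub>tensor A A\<^esub>p\<in>{..<n}. pure_tensor A A (a i p) (a p l)) \<one>\<^bsub>Z\<^esub>)"
    using assms by (simp add: K_pure HE.coprod_gen)
  also have "\<dots> = (\<Oplus>\<^bsub>tensor A (tensor A Z)\<^esub>p\<in>{..<n}. tensor_assoc A A Z
      (pure_tensor (tensor A A) Z (pure_tensor A A (a i p) (a p l)) \<one>\<^bsub>Z\<^esub>))"
    by (rule HE.HZ.T.lin_hom_finsum[OF A_AZ.tensor_kalg lin_hom_comp[OF AAZ.pure_lin_l alg_hom_lin[OF as2_hom]]])
      (use assms in auto)
  also have "\<dots> = (\<Oplus>\<^bsub>tensor A (tensor A Z)\<^esub>p\<in>{..<n}. pure_tensor A (tensor A Z) (a i p) (pure_tensor A Z (a p l) \<one>\<^bsub>Z\<^esub>))"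
    by (rule A_AZ.T.finsum_cong', simp) (use assms in \<open>auto simp: as2_pure del: equalityI\<close>)
  also have "idg \<dots> = (\<Oplus>\<^bsub>tensor A (tensor Z Z)\<^esub>p\<in>{..<n}. idg (pure_tensor A (tensor A Z) (a i p) (pure_tensor A Z (a p l) \<one>\<^bsub>Z\<^esub>)))"
    by (rule A_AZ.T.lin_hom_finsum[OF A_ZZ.tensor_kalg idg_lin]) (use assms in auto)
  also have "\<dots> = (\<Oplus>\<^bsub>tensor A (tensor Z Z)\<^esub>p\<in>{..<n}. pure_tensor A (tensor Z Z) (a i p) (\<tau> p l))"
    by (rule A_ZZ.T.finsum_cong', simp) (use assms in \<open>auto simp: idg_pure \<tau>_def g_closed del: equalityI\<close>)
  finally show ?thesis .
qed

definition "idsl \<psi> = tensor_map A Z id (slice Z \<psi>)"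

context
  fixes \<psi> assumes \<psi>: "\<psi> \<in> lin_hom Z (ground_alg :: ('k, 'k) module)"
begin

lemmas sl_lin = C.ZZ.slice_lin[OF \<psi>]

text \<open>\<open>D\<close> coacts on the left leg and \<psi> is applied to the right leg, so they
  commute; slicing turns equivariant columns in Z \<otimes> Z into equivariant columns in Z.\<close>

lemma slice_coact:
  assumes "t \<in> carrier (tensor Z Z)"
  shows "idsl \<psi> (D t) = \<delta> (slice Z \<psi> t)"
proof -
  note ml = tensor_map_lin[OF kA kZZ kA kZ lin_hom_id' sl_lin, folded idsl_def]
    and mp = tensor_map_pure[OF kA kZZ kA kZ lin_hom_id' sl_lin, folded idsl_def]
  note as = alg_hom_lin[OF as1_hom]
  have 1: "idsl \<psi> (tensor_assoc A Z Z (pure_tensor (tensor A Z) Z u z)) = \<psi> z \<odot>\<^bsub>tensor A Z\<^esub> u"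
    if "u \<in> carrier (tensor A Z)" "z \<in> carrier Z" for u z
    using that(1)
  proof (induction rule: C.tensor_induct)
    case (pure h x)
    then show ?case using that(2) by (simp add: as1_pure mp C.ZZ.slice_pure[OF \<psi>] C.pure_smult_r)
  next
    case (add s t)
    then show ?case using that(2)
      by (simp add: AZZ.pure_add_l lin_hom_add[OF as] lin_hom_closed[OF as] lin_hom_add[OF ml] C.T.smult_r_distr)
  qed
  show ?thesis using assms
  proof (induction rule: C.ZZ.tensor_induct)
    case (pure z z')
    then show ?case by (simp add: D_def dmap_pure 1 C.ZZ.slice_pure[OF \<psi>] C.\<delta>_smult)
  next
    case (add s t)
    then show ?case
      by (simp add: lin_hom_add[OF alg_hom_lin[OF D_hom]] lin_hom_closed[OF alg_hom_lin[OF D_hom]] lin_hom_add[OF ml]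
          lin_hom_add[OF sl_lin] lin_hom_closed[OF sl_lin] C.\<delta>_add)
  qed
qed

lemma slice_\<tau>:
  assumes "i < n" "l < n"
  shows "\<delta> (slice Z \<psi> (\<tau> i l)) = (\<Oplus>\<^bsub>tensor A Z\<^esub>p\<in>{..<n}. pure_tensor A Z (a i p) (slice Z \<psi> (\<tau> p l)))"
proof -
  note ml = tensor_map_lin[OF kA kZZ kA kZ lin_hom_id' sl_lin, folded idsl_def]
    and mp = tensor_map_pure[OF kA kZZ kA kZ lin_hom_id' sl_lin, folded idsl_def]
  have "\<delta> (slice Z \<psi> (\<tau> i l)) = idsl \<psi>
     (\<Oplus>\<^bsub>tensor A (tensor Z Z)\<^esub>p\<in>{..<n}. pure_tensor A (tensor Z Z) (a i p) (\<tau> p l))"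
    using assms by (simp add: slice_coact[symmetric] D_\<tau>)
  also have "\<dots> = (\<Oplus>\<^bsub>tensor A Z\<^esub>p\<in>{..<n}. idsl \<psi> (pure_tensor A (tensor Z Z) (a i p) (\<tau> p l)))"
    by (rule A_ZZ.T.lin_hom_finsum[OF kAZ ml]) (use assms in auto)
  also have "\<dots> = (\<Oplus>\<^bsub>tensor A Z\<^esub>p\<in>{..<n}. pure_tensor A Z (a i p) (slice Z \<psi> (\<tau> p l)))"
    by (rule C.T.finsum_cong', simp) (use assms lin_hom_closed[OF sl_lin] in \<open>auto simp: mp del: equalityI\<close>)
  finally show ?thesis .
qed

end

lemma mult_bilin: "bilin Z Z Z (\<lambda>x y. x \<otimes>\<^bsub>Z\<^esub> y)"
  by (intro bilinI) (auto simp: C.B.l_distr C.B.r_distr del: equalityI)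

text \<open>The multiplication of Z is (\<epsilon> \<otimes> id) after \<open>can\<close>, so
  multiplying the two legs of \<tau> i l yields
  \<epsilon>(\<open>a\<^sub>i\<^sub>l\<close>).\<close>

lemma mult_\<tau>:
  assumes "i < n" "l < n"
  shows "tensor_lift Z (\<lambda>x y. x \<otimes>\<^bsub>Z\<^esub> y) (\<tau> i l) = (if i = l then \<one>\<^bsub>Z\<^esub> else \<zero>\<^bsub>Z\<^esub>)"
proof -
  let ?\<phi> = "\<lambda>h y. counit (BE E) h \<odot>\<^bsub>Z\<^esub> y"
  have bil: "bilin A Z Z ?\<phi>"
    by (intro bilinI) (auto simp: HE.eps_closed_simps C.B.smult_l_distr C.B.smult_r_distr mult.commute del: equalityI)
  note l = C.tensor_lift_lin[OF kZ bil] and p = C.tensor_lift_pure[OF kZ bil]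
  have hom: "tensor_lift Z ?\<phi> \<in> alg_hom (tensor A Z) Z"
    by (rule C.tensor_alg_homI[OF kZ l]) (auto simp: p HE.eps_closed_simps mult.commute del: equalityI)
  note ml = C.ZZ.tensor_lift_lin[OF kZ mult_bilin] and mp = C.ZZ.tensor_lift_pure[OF kZ mult_bilin]
  have e: "tensor_lift Z (\<lambda>x y. x \<otimes>\<^bsub>Z\<^esub> y) t = tensor_lift Z ?\<phi> (C.can t)" if "t \<in> carrier (tensor Z Z)" for t
    by (rule C.ZZ.tensor_lin_eq[OF kZ ml lin_hom_comp[OF C.can_lin l] _ that])
      (simp add: mp C.can_pure alg_hom_mult[OF hom] counit p HE.eps_closed_simps)
  have "tensor_lift Z (\<lambda>x y. x \<otimes>\<^bsub>Z\<^esub> y) (\<tau> i l) = tensor_lift Z ?\<phi> (pure_tensor A Z (a i l) \<one>\<^bsub>Z\<^esub>)"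
    using assms by (simp add: e, simp add: \<tau>_def can_g)
  then show ?thesis using assms by (simp add: p HE.counit_gen)
qed

text \<open>Such a v is a comodule map to Z from the n-dimensional comodule with coefficient matrix
  a.\<close>

definition equi :: "(nat \<Rightarrow> 'z) \<Rightarrow> bool" where
  "equi v \<longleftrightarrow> (\<forall>i<n. v i \<in> carrier Z \<and> \<delta> (v i) = (\<Oplus>\<^bsub>tensor A Z\<^esub>p\<in>{..<n}. pure_tensor A Z (a i p) (v p)))"

text \<open>Finitely many equivariant columns \<open>v s\<close> together with a right inverse of
  the matrix they form. The entries of \<open>y\<close> are arbitrary elements of Z.\<close>

definition frame :: "'i set \<Rightarrow> ('i \<Rightarrow> nat \<Rightarrow> 'z) \<Rightarrow> ('i \<Rightarrow> nat \<Rightarrow> 'z) \<Rightarrow> bool" where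
  "frame J v y \<longleftrightarrow> finite J \<and> (\<forall>s\<in>J. equi (v s) \<and> (\<forall>j<n. y s j \<in> carrier Z)) \<and>
     (\<forall>i<n. \<forall>j<n. (\<Oplus>\<^bsub>Z\<^esub>s\<in>J. v s i \<otimes>\<^bsub>Z\<^esub> y s j) = (if i = j then \<one>\<^bsub>Z\<^esub> else \<zero>\<^bsub>Z\<^esub>))"

text \<open>All \<tau> i l are expanded over one finite set of right factors b. Slices in the left
  leg are equivariant, and multiplying the legs back together gives the identity matrix.\<close>

lemma frame_exists: "\<exists>(J :: (nat \<times> 'z) set) v y. frame J v y"
proof -
  have fin: "finite ({..<n} \<times> {..<n})" by simp
  obtain S and \<psi> :: "'z \<Rightarrow> 'z \<Rightarrow> 'k" where S: "finite S" "S \<subseteq> carrier Z" "\<And>b. b \<in> S \<Longrightarrow> \<psi> b \<in> lin_hom Z ground_alg"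
    "\<And>q. q \<in> {..<n} \<times> {..<n} \<Longrightarrow> \<tau> (fst q) (snd q)
        = (\<Oplus>\<^bsub>tensor Z Z\<^esub>b\<in>S. pure_tensor Z Z (slice Z (\<psi> b) (\<tau> (fst q) (snd q))) b)"
    by (rule C.ZZ.tensor_family_slices[OF fin, of "\<lambda>q. \<tau> (fst q) (snd q)"]) auto
  \<comment> \<open>Indices are pairs (l, b): the column is the b-slice of \<tau> i l, and the row
    entry is b in position l and zero elsewhere. Their product at (i, j) is then the product of the
    legs of \<tau> i j.\<close>
  define v where "v s i = slice Z (\<psi> (snd s)) (\<tau> i (fst s))" for s :: "nat \<times> 'z" and i
  define y where "y s j = (if fst s = j then snd s else \<zero>\<^bsub>Z\<^esub>)" for s :: "nat \<times> 'z" and j :: nat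
  note ml = C.ZZ.tensor_lift_lin[OF kZ mult_bilin] and mp = C.ZZ.tensor_lift_pure[OF kZ mult_bilin]
  have sc: "slice Z (\<psi> b) (\<tau> i l) \<in> carrier Z" if "b \<in> S" "i < n" "l < n" for b i l
    using lin_hom_closed[OF C.ZZ.slice_lin[OF S(3)[OF that(1)]]] that by simp
  have "frame ({..<n} \<times> S) v y"
    unfolding frame_def
  proof (intro conjI ballI allI impI)
    show "finite ({..<n} \<times> S)" using S(1) by simp
    fix s assume s: "s \<in> {..<n} \<times> S"
    then show "equi (v s)" unfolding equi_def v_def
      using slice_\<tau>[OF S(3)] sc by auto
    show "y s j \<in> carrier Z" if "j < n" for j using s S(2) by (auto simp: y_def)
  next
    fix i j assume ij: "i < n" "j < n"
    have "(\<Oplus>\<^bsub>Z\<^esub>s\<in>{..<n} \<times> S. v s i \<otimes>\<^bsub>Z\<^esub> y s j) = (\<Oplus>\<^bsub>Z\<^esub>l\<in>{..<n}. \<Oplus>\<^bsub>Z\<^esub>b\<in>S. slice Z (\<psi> b) (\<tau> i l) \<otimes>\<^bsub>Z\<^esub> (if l = j then b else \<zero>\<^bsub>Z\<^esub>))"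
      unfolding v_def y_def
      by (rule C.B.finsum_cartesian[of "{..<n}" S "\<lambda>l b. slice Z (\<psi> b) (\<tau> i l) \<otimes>\<^bsub>Z\<^esub> (if l = j then b else \<zero>\<^bsub>Z\<^esub>)"])
        (use S(1,2) sc ij in auto)
    also have "\<dots> = (\<Oplus>\<^bsub>Z\<^esub>b\<in>S. slice Z (\<psi> b) (\<tau> i j) \<otimes>\<^bsub>Z\<^esub> b)"
    proof -
      have z: "(\<Oplus>\<^bsub>Z\<^esub>b\<in>S. slice Z (\<psi> b) (\<tau> i l) \<otimes>\<^bsub>Z\<^esub> (if l = j then b else \<zero>\<^bsub>Z\<^esub>)) = \<zero>\<^bsub>Z\<^esub>" if "l < n" "l \<noteq> j" for l
      proof -
        have "(\<Oplus>\<^bsub>Z\<^esub>b\<in>S. slice Z (\<psi> b) (\<tau> i l) \<otimes>\<^bsub>Z\<^esub> (if l = j then b else \<zero>\<^bsub>Z\<^esub>)) = (\<Oplus>\<^bsub>Z\<^esub>b\<in>S. \<zero>\<^bsub>Z\<^esub>)"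
          by (rule C.B.finsum_cong', simp) (use that sc ij in \<open>auto del: equalityI\<close>)
        then show ?thesis by (simp add: C.B.finsum_zero)
      qed
      show ?thesis
        by (subst C.B.finsum_delta[where i = j])
          (use ij z sc S(2) in \<open>auto intro!: C.B.finsum_closed del: equalityI\<close>)
    qed
    also have "\<dots> = (\<Oplus>\<^bsub>Z\<^esub>b\<in>S. tensor_lift Z (\<lambda>x y. x \<otimes>\<^bsub>Z\<^esub> y) (pure_tensor Z Z (slice Z (\<psi> b) (\<tau> i j)) b))"
      by (rule C.B.finsum_cong', simp) (use ij sc S(2) in \<open>auto simp: mp subset_iff del: equalityI\<close>)
    also have "\<dots> = tensor_lift Z (\<lambda>x y. x \<otimes>\<^bsub>Z\<^esub> y) (\<Oplus>\<^bsub>tensor Z Z\<^esub>b\<in>S. pure_tensor Z Z (slice Z (\<psi> b) (\<tau> i j)) b)"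
      by (rule C.ZZ.T.lin_hom_finsum[OF kZ ml, symmetric]) (use ij sc S(2) in auto)
    also have "(\<Oplus>\<^bsub>tensor Z Z\<^esub>b\<in>S. pure_tensor Z Z (slice Z (\<psi> b) (\<tau> i j)) b) = \<tau> i j"
      using S(4)[of "(i, j)"] ij by simp
    finally show "(\<Oplus>\<^bsub>Z\<^esub>s\<in>{..<n} \<times> S. v s i \<otimes>\<^bsub>Z\<^esub> y s j) = (if i = j then \<one>\<^bsub>Z\<^esub> else \<zero>\<^bsub>Z\<^esub>)"
      using mult_\<tau> ij by simp
  qed
  then show ?thesis by blast
qed

text \<open>A linear relation expresses column s0 through the others, and its contribution to the
  right inverse is redistributed to their rows in \<open>y'\<close>. So a frame of least size has
  linearly independent columns.\<close>

lemma frame_remove: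
  assumes fr: "frame J v y" and s0: "s0 \<in> J" and c0: "c s0 \<noteq> 0"
    and rel: "\<And>i. i < n \<Longrightarrow> (\<Oplus>\<^bsub>Z\<^esub>s\<in>J. c s \<odot>\<^bsub>Z\<^esub> v s i) = \<zero>\<^bsub>Z\<^esub>"
  shows "\<exists>y'. frame (J - {s0}) v y'"
proof -
  have J: "finite J" and v: "\<And>s i. s \<in> J \<Longrightarrow> i < n \<Longrightarrow> v s i \<in> carrier Z"
    and y: "\<And>s j. s \<in> J \<Longrightarrow> j < n \<Longrightarrow> y s j \<in> carrier Z"
    using fr by (auto simp: frame_def equi_def)
  define y' where "y' s j = y s j \<oplus>\<^bsub>Z\<^esub> (- c s / c s0) \<odot>\<^bsub>Z\<^esub> y s0 j" for s j
  have "(\<Oplus>\<^bsub>Z\<^esub>s\<in>J - {s0}. v s i \<otimes>\<^bsub>Z\<^esub> y' s j) = (\<Oplus>\<^bsub>Z\<^esub>s\<in>J. v s i \<otimes>\<^bsub>Z\<^esub> y s j)" if ij: "i < n" "j < n" for i j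
  proof -
    have y0: "y s0 j \<in> carrier Z" using y s0 ij by simp
    have "\<zero>\<^bsub>Z\<^esub> = (\<Oplus>\<^bsub>Z\<^esub>s\<in>insert s0 (J - {s0}). c s \<odot>\<^bsub>Z\<^esub> v s i)" using rel[OF ij(1)] s0 by (simp add: insert_absorb)
    also have "\<dots> = c s0 \<odot>\<^bsub>Z\<^esub> v s0 i \<oplus>\<^bsub>Z\<^esub> (\<Oplus>\<^bsub>Z\<^esub>s\<in>J - {s0}. c s \<odot>\<^bsub>Z\<^esub> v s i)"
      using J v s0 ij by (subst C.B.finsum_insert) auto
    finally have 0: "\<zero>\<^bsub>Z\<^esub> = c s0 \<odot>\<^bsub>Z\<^esub> v s0 i \<oplus>\<^bsub>Z\<^esub> (\<Oplus>\<^bsub>Z\<^esub>s\<in>J - {s0}. c s \<odot>\<^bsub>Z\<^esub> v s i)" .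
    have sumc: "(\<Oplus>\<^bsub>Z\<^esub>s\<in>J - {s0}. c s \<odot>\<^bsub>Z\<^esub> v s i) \<in> carrier Z" using v ij by (intro C.B.finsum_closed) auto
    have "(- 1 / c s0) \<odot>\<^bsub>Z\<^esub> \<zero>\<^bsub>Z\<^esub> = (- 1) \<odot>\<^bsub>Z\<^esub> v s0 i \<oplus>\<^bsub>Z\<^esub> (- 1 / c s0) \<odot>\<^bsub>Z\<^esub> (\<Oplus>\<^bsub>Z\<^esub>s\<in>J - {s0}. c s \<odot>\<^bsub>Z\<^esub> v s i)"
      unfolding 0 using c0 v s0 ij sumc by (simp add: C.B.smult_r_distr)
    also have "(- 1 / c s0) \<odot>\<^bsub>Z\<^esub> (\<Oplus>\<^bsub>Z\<^esub>s\<in>J - {s0}. c s \<odot>\<^bsub>Z\<^esub> v s i) = (\<Oplus>\<^bsub>Z\<^esub>s\<in>J - {s0}. (- c s / c s0) \<odot>\<^bsub>Z\<^esub> v s i)"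
      using v ij by (subst C.B.smult_finsum) (auto intro!: C.B.finsum_cong' del: equalityI)
    finally have q: "\<ominus>\<^bsub>Z\<^esub> v s0 i \<oplus>\<^bsub>Z\<^esub> (\<Oplus>\<^bsub>Z\<^esub>s\<in>J - {s0}. (- c s / c s0) \<odot>\<^bsub>Z\<^esub> v s i) = \<zero>\<^bsub>Z\<^esub>"
      using v s0 ij by (simp add: C.B.smult_uminus)
    have "(\<Oplus>\<^bsub>Z\<^esub>s\<in>J - {s0}. (- c s / c s0) \<odot>\<^bsub>Z\<^esub> v s i) \<in> carrier Z" using v ij by (intro C.B.finsum_closed) auto
    from C.B.r_neg2[OF v[OF s0 ij(1)] this] have 1: "(\<Oplus>\<^bsub>Z\<^esub>s\<in>J - {s0}. (- c s / c s0) \<odot>\<^bsub>Z\<^esub> v s i) = v s0 i"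
      unfolding q using v s0 ij by simp
    have "(\<Oplus>\<^bsub>Z\<^esub>s\<in>J - {s0}. v s i \<otimes>\<^bsub>Z\<^esub> y' s j)
      = (\<Oplus>\<^bsub>Z\<^esub>s\<in>J - {s0}. v s i \<otimes>\<^bsub>Z\<^esub> y s j \<oplus>\<^bsub>Z\<^esub> ((- c s / c s0) \<odot>\<^bsub>Z\<^esub> v s i) \<otimes>\<^bsub>Z\<^esub> y s0 j)"
      unfolding y'_def using v y ij s0 by (intro C.B.finsum_cong') (auto simp: C.B.r_distr del: equalityI)
    also have "\<dots> = (\<Oplus>\<^bsub>Z\<^esub>s\<in>J - {s0}. v s i \<otimes>\<^bsub>Z\<^esub> y s j) \<oplus>\<^bsub>Z\<^esub> (\<Oplus>\<^bsub>Z\<^esub>s\<in>J - {s0}. ((- c s / c s0) \<odot>\<^bsub>Z\<^esub> v s i) \<otimes>\<^bsub>Z\<^esub> y s0 j)"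
      using v y ij s0 by (intro C.B.finsum_addf) (auto del: equalityI)
    also have "(\<Oplus>\<^bsub>Z\<^esub>s\<in>J - {s0}. ((- c s / c s0) \<odot>\<^bsub>Z\<^esub> v s i) \<otimes>\<^bsub>Z\<^esub> y s0 j) = v s0 i \<otimes>\<^bsub>Z\<^esub> y s0 j"
      unfolding 1[symmetric] using J v y0 ij by (intro C.B.finsum_ldistr[symmetric]) auto
    also have "(\<Oplus>\<^bsub>Z\<^esub>s\<in>J - {s0}. v s i \<otimes>\<^bsub>Z\<^esub> y s j) \<oplus>\<^bsub>Z\<^esub> v s0 i \<otimes>\<^bsub>Z\<^esub> y s0 j
      = (\<Oplus>\<^bsub>Z\<^esub>s\<in>insert s0 (J - {s0}). v s i \<otimes>\<^bsub>Z\<^esub> y s j)"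
      using J v y ij s0 by (subst C.B.finsum_insert) (auto intro!: C.B.a_comm C.B.finsum_closed del: equalityI)
    also have "insert s0 (J - {s0}) = J" using s0 by auto
    finally show ?thesis .
  qed
  then have "frame (J - {s0}) v y'"
    using fr s0 by (auto simp: frame_def y'_def)
  then show ?thesis by blast
qed

end

section \<open>Trace and size constraints on points\<close>

context kalg
begin

lemma mm_quad_entry:
  assumes "mcar A X" "mcar A Y" "dim_col X = dim_row M" "dim_col M = dim_row Y" "i < dim_row X" "j < dim_col Y"
  shows "mm A X (mm A (sc A M) Y) $$ (i, j)
    = (\<Oplus>p\<in>{..<dim_row M} \<times> {..<dim_col M}. M $$ p \<odot> (X $$ (i, fst p) \<otimes> Y $$ (snd p, j)))"
proof -
  note c = mcarD[OF assms(1)] mcarD[OF assms(2)]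
  have "mm A X (mm A (sc A M) Y) $$ (i, j)
      = (\<Oplus>k\<in>{..<dim_row M}. \<Oplus>l\<in>{..<dim_col M}. M $$ (k, l) \<odot> (X $$ (i, k) \<otimes> Y $$ (l, j)))"
  proof -
    have "X $$ (i, k) \<otimes> mm A (sc A M) Y $$ (k, j) = (\<Oplus>l\<in>{..<dim_col M}. M $$ (k, l) \<odot> (X $$ (i, k) \<otimes> Y $$ (l, j)))"
      if "k < dim_row M" for k
    proof -
      have "X $$ (i, k) \<otimes> mm A (sc A M) Y $$ (k, j) = X $$ (i, k) \<otimes> (\<Oplus>l\<in>{..<dim_col M}. M $$ (k, l) \<odot> Y $$ (l, j))"
        using assms that by (subst mm_sc_index) auto
      also have "\<dots> = (\<Oplus>l\<in>{..<dim_col M}. X $$ (i, k) \<otimes> (M $$ (k, l) \<odot> Y $$ (l, j)))"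
        using assms that c by (intro finsum_rdistr) auto
      also have "\<dots> = (\<Oplus>l\<in>{..<dim_col M}. M $$ (k, l) \<odot> (X $$ (i, k) \<otimes> Y $$ (l, j)))"
        using assms that c by (intro finsum_cong') (auto del: equalityI)
      finally show ?thesis .
    qed
    then show ?thesis using assms c
      by (subst mm_index) (auto intro!: finsum_cong' finsum_closed del: equalityI)
  qed
  also have "\<dots> = (\<Oplus>p\<in>{..<dim_row M} \<times> {..<dim_col M}. M $$ (fst p, snd p) \<odot> (X $$ (i, fst p) \<otimes> Y $$ (snd p, j)))"
    using assms c by (intro finsum_cartesian[symmetric]) auto
  finally show ?thesis by simp
qed

lemma mm_zero: "mcar A Y \<Longrightarrow> dim_row Y = l \<Longrightarrow> mm A (sc A (0\<^sub>m r l)) Y = sc A (0\<^sub>m r (dim_col Y))"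
proof (rule eq_matI; simp)
  fix i j assume "mcar A Y" "dim_row Y = l" "i < r" "j < dim_col Y"
  then have "(\<Oplus>k\<in>{..<l}. sc A (0\<^sub>m r l) $$ (i, k) \<otimes> Y $$ (k, j)) = (\<Oplus>k\<in>{..<l}. \<zero>)"
    by (intro finsum_cong') (auto simp: mcarD del: equalityI)
  then show "(\<Oplus>k\<in>{..<l}. sc A (0\<^sub>m r l) $$ (i, k) \<otimes> Y $$ (k, j)) = \<zero>" by (simp add: finsum_zero)
qed

lemma finsum_smult_pairs:
  assumes "finite I" "finite J" "\<And>p q. p \<in> I \<Longrightarrow> q \<in> J \<Longrightarrow> t p q \<in> carrier A"
  shows "(\<Oplus>p\<in>I. e p \<odot> (\<Oplus>q\<in>J. d q \<odot> t p q)) = (\<Oplus>q\<in>J. d q \<odot> (\<Oplus>p\<in>I. e p \<odot> t p q))"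
proof -
  have "(\<Oplus>p\<in>I. e p \<odot> (\<Oplus>q\<in>J. d q \<odot> t p q)) = (\<Oplus>p\<in>I. \<Oplus>q\<in>J. (e p * d q) \<odot> t p q)"
  proof (rule finsum_cong', simp)
    fix p assume p: "p \<in> I"
    show "e p \<odot> (\<Oplus>q\<in>J. d q \<odot> t p q) = (\<Oplus>q\<in>J. (e p * d q) \<odot> t p q)"
      using assms p by (subst smult_finsum) (auto intro!: finsum_cong' del: equalityI)
  qed (use assms in \<open>auto intro!: finsum_closed\<close>)
  also have "\<dots> = (\<Oplus>q\<in>J. \<Oplus>p\<in>I. (e p * d q) \<odot> t p q)"
    using assms by (intro finsum_swap) auto
  also have "\<dots> = (\<Oplus>q\<in>J. d q \<odot> (\<Oplus>p\<in>I. e p \<odot> t p q))"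
  proof (rule finsum_cong', simp)
    fix q assume q: "q \<in> J"
    show "(\<Oplus>p\<in>I. (e p * d q) \<odot> t p q) = d q \<odot> (\<Oplus>p\<in>I. e p \<odot> t p q)"
      using assms q by (subst smult_finsum) (auto simp: mult.commute intro!: finsum_cong' del: equalityI)
  qed (use assms in \<open>auto intro!: finsum_closed\<close>)
  finally show ?thesis .
qed

end

lemma mat_trace_transpose:
  assumes "M \<in> carrier_mat n n" "N \<in> carrier_mat n n"
  shows "mat_trace (M * N\<^sup>T) = (\<Sum>p\<in>{..<n} \<times> {..<n}. M $$ p * N $$ p)"
  using assms by (auto simp: mat_trace_def scalar_prod_def lessThan_atLeast0 sum.cartesian_product intro!: sum.cong)

context kalg
begin

text \<open>Both traces times \<open>1\<close> equal \<open>\<Sum> E\<^sub>i\<^sub>j (F\<inverse>)\<^sub>\<alpha>\<^sub>\<beta> z\<^sub>i\<^sub>\<alpha> z\<^sub>j\<^sub>\<beta>\<close>.\<close>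

lemma point_trace:
  assumes E: "inv_mat n E" and F: "inv_mat m F" and z: "point A n E m F z" and nz: "\<one> \<noteq> \<zero>"
  shows "mat_trace (mat_inv F * F\<^sup>T) = mat_trace (mat_inv E * E\<^sup>T)"
proof -
  note iE = inv_mat_inverse[OF E] and iF = inv_mat_inverse[OF F]
  have zc: "mcar A z" "dim_row z = n" "dim_col z = m" using z by (auto simp: point_def)
  define t where "t p q = z $$ (fst p, fst q) \<otimes> z $$ (snd p, snd q)" for p q :: "nat \<times> nat"
  let ?I = "{..<n} \<times> {..<n}" and ?J = "{..<m} \<times> {..<m}"
  have tc: "t p q \<in> carrier A" if "p \<in> ?I" "q \<in> ?J" for p q
    using that zc by (auto simp: t_def mcarD)
  have 1: "(\<Oplus>p\<in>?I. E $$ p \<odot> t p q) = F $$ q \<odot> \<one>" if "q \<in> ?J" for q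
  proof -
    have "mm A z\<^sup>T (mm A (sc A E) z) $$ (fst q, snd q) = (\<Oplus>p\<in>?I. E $$ p \<odot> t p q)"
      using that zc E by (subst mm_quad_entry) (auto simp: t_def mcarD intro!: finsum_cong' del: equalityI)
    then show ?thesis using z that F by (auto simp: point_def)
  qed
  have 2: "(\<Oplus>q\<in>?J. mat_inv F $$ q \<odot> t p q) = mat_inv E $$ p \<odot> \<one>" if "p \<in> ?I" for p
  proof -
    have "mm A z (mm A (sc A (mat_inv F)) z\<^sup>T) $$ (fst p, snd p) = (\<Oplus>q\<in>?J. mat_inv F $$ q \<odot> t p q)"
      using that zc F by (subst mm_quad_entry) (auto simp: t_def mcarD intro!: finsum_cong' del: equalityI)
    then show ?thesis using z that E by (auto simp: point_def)
  qed
  have "mat_trace (mat_inv E * E\<^sup>T) \<odot> \<one> = (\<Oplus>p\<in>?I. (E $$ p * mat_inv E $$ p) \<odot> \<one>)"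
    by (simp add: mat_trace_transpose[OF iE(1,4)] finsum_smult_l mult.commute)
  also have "\<dots> = (\<Oplus>p\<in>?I. E $$ p \<odot> (\<Oplus>q\<in>?J. mat_inv F $$ q \<odot> t p q))"
    by (rule finsum_cong', simp) (auto simp: 2 intro!: finsum_closed tc del: equalityI)
  also have "\<dots> = (\<Oplus>q\<in>?J. mat_inv F $$ q \<odot> (\<Oplus>p\<in>?I. E $$ p \<odot> t p q))"
    by (rule finsum_smult_pairs) (auto intro: tc)
  also have "\<dots> = (\<Oplus>q\<in>?J. (mat_inv F $$ q * F $$ q) \<odot> \<one>)"
    by (rule finsum_cong', simp) (auto simp: 1 del: equalityI)
  also have "\<dots> = mat_trace (mat_inv F * F\<^sup>T) \<odot> \<one>"
    by (simp add: mat_trace_transpose[OF iF(1,4)] finsum_smult_l)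
  finally have "sc A (mat 1 1 (\<lambda>_. mat_trace (mat_inv E * E\<^sup>T))) = sc A (mat 1 1 (\<lambda>_. mat_trace (mat_inv F * F\<^sup>T)))"
    by (intro eq_matI) auto
  from arg_cong[OF sc_inj[OF nz this], of "\<lambda>M. M $$ (0, 0)"] show ?thesis by simp
qed

text \<open>For m = 0 an empty sum would equal 1. For m = 1 the column x satisfies c x_i x_j = d_ij
  with d = E^-1, and associativity of x_i x_j x_k gives d_ij x_k = d_jk x_i. Contracting with E
  forces x_1 = 0, so that row 1 of E^-1 vanishes.\<close>

lemma point_size:
  assumes E: "inv_mat n E" and F: "inv_mat m F" and z: "point A n E m F z" and nz: "\<one> \<noteq> \<zero>" and n: "n \<ge> 2"
  shows "m \<ge> 2"
proof (rule ccontr)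
  assume "\<not> m \<ge> 2"
  then have m: "m = 0 \<or> m = 1" by auto
  note iE = inv_mat_inverse[OF E] and iF = inv_mat_inverse[OF F]
  have zc: "z \<in> carrier_mat n m" "mcar A z" "dim_row z = n" "dim_col z = m" using z by (auto simp: point_def)
  show False
  proof (cases "m = 0")
    case True
    have "mm A z (pinv A E F z) = sc A (1\<^sub>m n)" using z point_iff_pinv[OF E F zc(1,2)] by simp
    from arg_cong[OF this, of "\<lambda>X. X $$ (0, 0)"] show False using zc n True E nz by simp
  next
    case False
    then have m1: "m = 1" using m by simp
    define x where "x i = z $$ (i, 0)" for i
    have x: "x i \<in> carrier A" if "i < n" for i using that zc m1 by (auto simp: x_def mcarD)
    let ?d = "\<lambda>i j. mat_inv E $$ (i, j)"
    let ?e = "\<lambda>i j. E $$ (i, j)"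
    define c where "c = mat_inv F $$ (0, 0)"
    have prod: "c \<odot> (x i \<otimes> x j) = ?d i j \<odot> \<one>" if "i < n" "j < n" for i j
    proof -
      have "mm A z (mm A (sc A (mat_inv F)) z\<^sup>T) $$ (i, j) = (\<Oplus>p\<in>{(0, 0)}. mat_inv F $$ p \<odot> (z $$ (i, fst p) \<otimes> z\<^sup>T $$ (snd p, j)))"
        using that zc F m1 by (subst mm_quad_entry) (auto intro!: arg_cong[where f = "finsum A _"])
      also have "\<dots> = c \<odot> (x i \<otimes> x j)"
        using that zc m1 x by (subst finsum_delta[where i = "(0, 0)"]) (auto simp: c_def x_def)
      finally show ?thesis using z that E by (auto simp: point_def)
    qed
    have "c \<noteq> 0"
    proof
      assume "c = 0"
      then have "(mat_inv F * F) $$ (0, 0) = 0" using F m1 by (simp add: scalar_prod_def c_def)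
      then show False using iF m1 by simp
    qed
    have cyc: "?d i j \<odot> x k = ?d j k \<odot> x i" if "i < n" "j < n" "k < n" for i j k
    proof -
      have "(c \<odot> (x i \<otimes> x j)) \<otimes> x k = x i \<otimes> (c \<odot> (x j \<otimes> x k))"
        using that x by (simp add: m_assoc)
      then show ?thesis using that x by (simp add: prod)
    qed
    define s where "s q k = (\<Sum>j<n. ?e j q * ?d j k)" for q k
    have de: "(\<Sum>j<n. ?d i j * ?e j q) = (if i = q then 1 else 0)" if "i < n" "q < n" for i q
      using arg_cong[OF iE(3), of "\<lambda>M. M $$ (i, q)"] that E by (simp add: scalar_prod_def lessThan_atLeast0)
    have rel: "(if i = q then 1 else 0) \<odot> x k = s q k \<odot> x i" if "i < n" "q < n" "k < n" for i q k
    proof -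
      have "(if i = q then 1 else 0) \<odot> x k = (\<Oplus>j\<in>{..<n}. (?d i j * ?e j q) \<odot> x k)"
        using that x by (simp add: finsum_smult_l[symmetric] de)
      also have "\<dots> = (\<Oplus>j\<in>{..<n}. ?e j q \<odot> (?d i j \<odot> x k))"
        using that x by (intro finsum_cong') (auto simp: mult.commute del: equalityI)
      also have "\<dots> = (\<Oplus>j\<in>{..<n}. (?e j q * ?d j k) \<odot> x i)"
        using that x by (intro finsum_cong') (auto simp: cyc del: equalityI)
      finally show ?thesis using that x by (simp add: finsum_smult_l[symmetric] s_def)
    qed
    \<comment> \<open>The instance i = 1, q = 0, k = 1 of \<open>rel\<close> reads 0 = s x_1 and the
      instance i = q = 0, k = 1 reads x_1 = s x_0, with the same coefficient s =
      \<open>s 0 1\<close>.\<close>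
    have "x 1 = \<zero>"
    proof (rule ccontr)
      assume x1: "x 1 \<noteq> \<zero>"
      have "s 0 1 \<odot> x 1 = \<zero>" using rel[of 1 0 1] n x by simp
      then have "s 0 1 = 0" using x1 smult_cancel[of "x 1"] x n by auto
      then show False using rel[of 0 0 1] n x x1 by simp
    qed
    then have "?d 1 j = 0" if "j < n" for j
    proof -
      have "?d 1 j \<odot> \<one> = \<zero>" using prod[of 1 j] \<open>x 1 = \<zero>\<close> n that x by simp
      then show ?thesis using smult_cancel[OF one_closed] nz by blast
    qed
    then show False using de[of 1 1] n by simp
  qed
qed

end

text \<open>If s < r, padding both matrices with zeros to size r keeps their product equal to 1,
  while the padded Q kills the unit vector of index s and has determinant zero.\<close>

lemma two_sided_inverse_square:
  fixes Q :: "'k::field mat"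
  assumes Q: "Q \<in> carrier_mat r s" and Q': "Q' \<in> carrier_mat s r" and e: "Q * Q' = 1\<^sub>m r"
  shows "r \<le> s"
proof (rule ccontr)
  assume "\<not> r \<le> s"
  then have rs: "s < r" by simp
  define P where "P = mat r r (\<lambda>(i, j). if j < s then Q $$ (i, j) else 0)"
  define P' where "P' = mat r r (\<lambda>(i, j). if i < s then Q' $$ (i, j) else 0)"
  have P: "P \<in> carrier_mat r r" "P' \<in> carrier_mat r r" by (auto simp: P_def P'_def)
  have "P * P' = Q * Q'"
  proof (rule eq_matI)
    fix i j assume "i < dim_row (Q * Q')" "j < dim_col (Q * Q')"
    then have ij: "i < r" "j < r" using Q Q' by auto
    have "(P * P') $$ (i, j) = (\<Sum>k\<in>{0..<r}. if k < s then Q $$ (i, k) * Q' $$ (k, j) else 0)"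
      using ij by (auto simp: P_def P'_def scalar_prod_def intro!: sum.cong)
    also have "\<dots> = (\<Sum>k\<in>{0..<s}. Q $$ (i, k) * Q' $$ (k, j))"
      using rs by (intro sum.mono_neutral_cong_right) auto
    finally show "(P * P') $$ (i, j) = (Q * Q') $$ (i, j)" using ij Q Q' by (simp add: scalar_prod_def)
  qed (use Q Q' P in auto)
  then have "det P * det P' = 1" using det_mult[OF P] e by simp
  moreover have "P *\<^sub>v unit_vec r s = 0\<^sub>v r"
    using rs by (intro eq_vecI) (auto simp: P_def)
  then have "det P = 0" using det_0_iff_vec_prod_zero_field[OF P(1)] rs
    by (metis unit_vec_carrier unit_vec_nonzero)
  ultimately show False by simp
qed

lemma inv_mat_det:
  assumes "F \<in> carrier_mat m m" "det F \<noteq> (0 :: 'k::field)"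
  shows "inv_mat m F"
proof -
  from det_non_zero_imp_unit[OF assms, of undefined] obtain G where "G \<in> carrier_mat m m" "F * G = 1\<^sub>m m"
    by (auto simp: Units_def ring_mat_def)
  then show ?thesis using inv_matI[OF assms(1)] by blast
qed

section \<open>Matrices of equivariant columns and the extraction of F\<close>

context gal
begin

text \<open>All columns are equivariant, written as the single matrix identity \<delta>(z) = (a
  \<otimes> 1)(1 \<otimes> z), so that \<delta> of a product of matrices can be computed by matrix
  algebra.\<close>

definition equimat :: "'z mat \<Rightarrow> bool" where
  "equimat z \<longleftrightarrow> dim_row z = n \<and> mcar Z z \<and> map_mat \<delta> z = tmm A Z HE.gens z"

lemma equimat_entry:
  assumes "equimat z" "i < n" "j < dim_col z"
  shows "\<delta> (z $$ (i, j)) = (\<Oplus>\<^bsub>tensor A Z\<^esub>p\<in>{..<n}. pure_tensor A Z (a i p) (z $$ (p, j)))"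
proof -
  have z: "dim_row z = n" "mcar Z z" "map_mat \<delta> z = tmm A Z HE.gens z" using assms by (auto simp: equimat_def)
  have "\<delta> (z $$ (i, j)) = tmm A Z HE.gens z $$ (i, j)" using z assms by (simp flip: z(3))
  also have "\<dots> = (\<Oplus>\<^bsub>tensor A Z\<^esub>p\<in>{..<n}. pure_tensor A Z (a i p) (z $$ (p, j)))"
    using assms(2,3) by (auto simp: tmm_def mcarD[OF z(2)] z(1) intro!: C.T.finsum_cong' del: equalityI)
  finally show ?thesis .
qed

lemma equimatI:
  assumes "dim_row z = n" "\<And>j. j < dim_col z \<Longrightarrow> equi (\<lambda>i. z $$ (i, j))"
  shows "equimat z"
proof -
  have c: "mcar Z z" using assms by (auto simp: equi_def mcar_def)
  have "map_mat \<delta> z = tmm A Z HE.gens z"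
  proof (rule eq_matI)
    fix i j assume "i < dim_row (tmm A Z HE.gens z)" "j < dim_col (tmm A Z HE.gens z)"
    then have ij: "i < n" "j < dim_col z" by (auto simp: tmm_def)
    have "\<delta> (z $$ (i, j)) = (\<Oplus>\<^bsub>tensor A Z\<^esub>p\<in>{..<n}. pure_tensor A Z (a i p) (z $$ (p, j)))"
      using assms(2)[OF ij(2)] ij by (auto simp: equi_def)
    also have "\<dots> = tmm A Z HE.gens z $$ (i, j)"
      using ij by (auto simp: tmm_def mcarD[OF c] assms(1) intro!: C.T.finsum_cong' del: equalityI)
    finally show "map_mat \<delta> z $$ (i, j) = tmm A Z HE.gens z $$ (i, j)" using ij assms by simp
  qed (use assms in \<open>auto simp: tmm_def\<close>)
  then show ?thesis using c assms by (simp add: equimat_def)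
qed

text \<open>With X = a \<otimes> 1 one has \<delta>(z^T E u) = (1 \<otimes> z)^T (X^T E X)(1
  \<otimes> u). As X is an (E,E)-point the middle factor is E, so every entry of z^T E u is
  coinvariant.\<close>

lemma equimat_scalar:
  assumes z: "equimat z" and u: "equimat u"
  obtains M where "M \<in> carrier_mat (dim_col z) (dim_col u)" "mm Z z\<^sup>T (mm Z (sc Z E) u) = sc Z M"
proof -
  let ?T = "tensor A Z"
  let ?X = "map_mat (\<lambda>h. pure_tensor A Z h \<one>\<^bsub>Z\<^esub>) HE.gens"
  let ?r = "map_mat (\<lambda>y. pure_tensor A Z \<one>\<^bsub>A\<^esub> y)"
  let ?V = "mm Z z\<^sup>T (mm Z (sc Z E) u)"
  have dz: "dim_row z = n" "mcar Z z" and du: "dim_row u = n" "mcar Z u" using z u by (auto simp: equimat_def)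
  have X: "point ?T n E n E ?X" by (rule HE.B.point_hom[OF kAZ C.inl_hom E E HE.gens_point])
  have Xc: "mcar ?T ?X" "dim_row ?X = n" "dim_col ?X = n" using X by (auto simp: point_def)
  have rc: "mcar ?T (?r z)" "mcar ?T (?r u)" using dz du by (auto simp: mcar_def)
  have mz: "map_mat \<delta> z = mm ?T ?X (?r z)" and mu: "map_mat \<delta> u = mm ?T ?X (?r u)"
    using z u dz du by (simp_all add: equimat_def C.tmm_eq_mm)
  have cm: "mcomm ?T ?X (?r z)" using dz by (auto simp: mcomm_def mcarD del: equalityI)
  have tr: "map_mat f z\<^sup>T = (map_mat f z)\<^sup>T" for f :: "'z \<Rightarrow> (('k free_elt set \<times> 'z) \<Rightarrow>\<^sub>0 'k) set" by (rule eq_matI) auto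
  have V: "mcar Z ?V" "dim_row ?V = dim_col z" "dim_col ?V = dim_col u" using dz du E by auto
  have "map_mat \<delta> ?V = mm ?T (map_mat \<delta> z)\<^sup>T (mm ?T (sc ?T E) (map_mat \<delta> u))"
    using dz du E by (simp add: C.B.mm_hom[OF kAZ C.\<delta>] C.B.sc_hom[OF C.\<delta>] tr)
  also have "\<dots> = mm ?T (?r z)\<^sup>T (mm ?T (mm ?T ?X\<^sup>T (mm ?T (sc ?T E) ?X)) (?r u))"
    unfolding mz mu using Xc rc cm dz du E by (simp add: C.T.mm_transpose C.T.mm_assoc)
  also have "mm ?T ?X\<^sup>T (mm ?T (sc ?T E) ?X) = sc ?T E" using X by (simp add: point_def)
  also have "mm ?T (?r z)\<^sup>T (mm ?T (sc ?T E) (?r u)) = ?r ?V"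
    using dz du E by (simp add: C.B.mm_hom[OF kAZ C.inr_hom] C.B.sc_hom[OF C.inr_hom] tr)
  finally have inv: "map_mat \<delta> ?V = ?r ?V" .
  have ex: "\<exists>c. ?V $$ (i, j) = c \<odot>\<^bsub>Z\<^esub> \<one>\<^bsub>Z\<^esub>" if ij: "i < dim_col z" "j < dim_col u" for i j
  proof -
    have "?V $$ (i, j) \<in> carrier Z" using V ij by (intro mcarD) auto
    moreover have "\<delta> (?V $$ (i, j)) = pure_tensor A Z \<one>\<^bsub>A\<^esub> (?V $$ (i, j))"
      using arg_cong[OF inv, of "\<lambda>X. X $$ (i, j)"] ij by (simp del: mm_index)
    ultimately show ?thesis using coinvariant_scalar by metis
  qed
  define M where "M = mat (dim_col z) (dim_col u) (\<lambda>(i, j). SOME c. ?V $$ (i, j) = c \<odot>\<^bsub>Z\<^esub> \<one>\<^bsub>Z\<^esub>)"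
  have "?V = sc Z M"
    using someI_ex[OF ex] by (intro eq_matI) (simp_all add: M_def del: mm_index)
  then show thesis by (intro that[of M]) (auto simp: M_def)
qed

lemma equimat_sc: "equimat z \<Longrightarrow> dim_row M = dim_col z \<Longrightarrow> equimat (mm Z z (sc Z M))"
proof -
  assume z: "equimat z" and d: "dim_row M = dim_col z"
  have dz: "dim_row z = n" "mcar Z z" "map_mat \<delta> z = tmm A Z HE.gens z" using z by (auto simp: equimat_def)
  let ?X = "map_mat (\<lambda>h. pure_tensor A Z h \<one>\<^bsub>Z\<^esub>) HE.gens"
  let ?r = "map_mat (\<lambda>y. pure_tensor A Z \<one>\<^bsub>A\<^esub> y)"
  have X: "mcar (tensor A Z) ?X" by (auto simp: mcar_def)
  have rc: "mcar (tensor A Z) (?r z)" using dz by (auto simp: mcar_def)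
  have "map_mat \<delta> (mm Z z (sc Z M)) = mm (tensor A Z) (mm (tensor A Z) ?X (?r z)) (sc (tensor A Z) M)"
    using dz d by (simp add: C.B.mm_hom[OF kAZ C.\<delta>] C.B.sc_hom[OF C.\<delta>] C.tmm_eq_mm)
  also have "\<dots> = mm (tensor A Z) ?X (?r (mm Z z (sc Z M)))"
    using dz d X rc by (simp add: C.T.mm_assoc C.B.mm_hom[OF kAZ C.inr_hom] C.B.sc_hom[OF C.inr_hom])
  finally show ?thesis using dz d by (simp add: equimat_def C.tmm_eq_mm)
qed

text \<open>The last conjunct is linear independence of the columns over k; minimality is recorded
  only through this consequence.\<close>

definition minframe :: "nat \<Rightarrow> 'z mat \<Rightarrow> 'z mat \<Rightarrow> bool" where
  "minframe m z y \<longleftrightarrow> z \<in> carrier_mat n m \<and> y \<in> carrier_mat m n \<and> equimat z \<and> mcar Z y \<and>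
    mm Z z y = sc Z (1\<^sub>m n) \<and>
    (\<forall>v\<in>carrier_vec m. (\<forall>i<n. (\<Oplus>\<^bsub>Z\<^esub>j\<in>{..<m}. v $ j \<odot>\<^bsub>Z\<^esub> z $$ (i, j)) = \<zero>\<^bsub>Z\<^esub>) \<longrightarrow> v = 0\<^sub>v m)"

lemma minimal_frame: "\<exists>m z y. minframe m z y"
proof -
  define P where "P k \<longleftrightarrow> (\<exists>(J :: (nat \<times> 'z) set) v y. frame J v y \<and> card J = k)" for k
  have "\<exists>k. P k" using frame_exists unfolding P_def by blast
  then obtain m where m: "P m" "\<And>k. k < m \<Longrightarrow> \<not> P k" using exists_least_iff[of P] by blast
  then obtain J :: "(nat \<times> 'z) set" and v y where fr: "frame J v y" and card: "card J = m" by (auto simp: P_def)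
  have J: "finite J" and v: "\<And>s. s \<in> J \<Longrightarrow> equi (v s)" and vc: "\<And>s i. s \<in> J \<Longrightarrow> i < n \<Longrightarrow> v s i \<in> carrier Z"
    and yc: "\<And>s j. s \<in> J \<Longrightarrow> j < n \<Longrightarrow> y s j \<in> carrier Z"
    and vy: "\<And>i j. i < n \<Longrightarrow> j < n \<Longrightarrow> (\<Oplus>\<^bsub>Z\<^esub>s\<in>J. v s i \<otimes>\<^bsub>Z\<^esub> y s j) = (if i = j then \<one>\<^bsub>Z\<^esub> else \<zero>\<^bsub>Z\<^esub>)"
    using fr by (auto simp: frame_def equi_def)
  obtain h where h: "bij_betw h {0..<m} J" using ex_bij_betw_nat_finite[OF J] card by auto
  have hb: "h ` {..<m} = J" "inj_on h {..<m}" using h by (auto simp: bij_betw_def lessThan_atLeast0)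
  have hJ: "h k \<in> J" if "k < m" for k using hb that by auto
  have vh: "v (h k) i \<in> carrier Z" and yh: "y (h k) i \<in> carrier Z" if "k < m" "i < n" for k i
    using that vc yc hJ by blast+
  define zm where "zm = mat n m (\<lambda>(i, k). v (h k) i)"
  define ym where "ym = mat m n (\<lambda>(k, j). y (h k) j)"
  have re: "(\<Oplus>\<^bsub>Z\<^esub>s\<in>J. f s) = (\<Oplus>\<^bsub>Z\<^esub>k\<in>{..<m}. f (h k))" if "f \<in> J \<rightarrow> carrier Z" for f
    unfolding hb(1)[symmetric] using that hb by (intro C.B.finsum_reindex) auto
  have "minframe m zm ym"
    unfolding minframe_def
  proof (intro conjI)
    show "zm \<in> carrier_mat n m" "ym \<in> carrier_mat m n" by (auto simp: zm_def ym_def)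
    show "equimat zm"
    proof (rule equimatI)
      show "equi (\<lambda>i. zm $$ (i, j))" if "j < dim_col zm" for j
        using v[OF hJ[of j]] that unfolding equi_def zm_def
        by (auto intro!: C.T.finsum_cong' del: equalityI)
    qed (simp add: zm_def)
    show "mcar Z ym" using yh by (auto simp: mcar_def ym_def)
    show "mm Z zm ym = sc Z (1\<^sub>m n)"
    proof (rule eq_matI)
      fix i j assume "i < dim_row (sc Z (1\<^sub>m n :: 'k mat))" "j < dim_col (sc Z (1\<^sub>m n :: 'k mat))"
      then have ij: "i < n" "j < n" by auto
      have "mm Z zm ym $$ (i, j) = (\<Oplus>\<^bsub>Z\<^esub>k\<in>{..<m}. v (h k) i \<otimes>\<^bsub>Z\<^esub> y (h k) j)"
        using ij vh yh by (auto simp: zm_def ym_def intro!: C.B.finsum_cong' del: equalityI)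
      also have "\<dots> = (\<Oplus>\<^bsub>Z\<^esub>s\<in>J. v s i \<otimes>\<^bsub>Z\<^esub> y s j)"
        using ij vc yc by (intro re[symmetric]) auto
      finally show "mm Z zm ym $$ (i, j) = sc Z (1\<^sub>m n) $$ (i, j)" using ij vy by simp
    qed (auto simp: zm_def ym_def)
    show "\<forall>v\<in>carrier_vec m. (\<forall>i<n. (\<Oplus>\<^bsub>Z\<^esub>j\<in>{..<m}. v $ j \<odot>\<^bsub>Z\<^esub> zm $$ (i, j)) = \<zero>\<^bsub>Z\<^esub>) \<longrightarrow> v = 0\<^sub>v m"
    proof (intro ballI impI)
    \<comment> \<open>A nontrivial relation w would allow \<open>frame_remove\<close> to produce a
      frame of smaller cardinality.\<close>
    fix w :: "'k vec" assume w: "w \<in> carrier_vec m"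
      and rel: "\<forall>i<n. (\<Oplus>\<^bsub>Z\<^esub>j\<in>{..<m}. w $ j \<odot>\<^bsub>Z\<^esub> zm $$ (i, j)) = \<zero>\<^bsub>Z\<^esub>"
    define c where "c s = w $ (inv_into {..<m} h s)" for s
    have ch: "c (h k) = w $ k" if "k < m" for k using that hb by (simp add: c_def)
    have rel': "(\<Oplus>\<^bsub>Z\<^esub>s\<in>J. c s \<odot>\<^bsub>Z\<^esub> v s i) = \<zero>\<^bsub>Z\<^esub>" if i: "i < n" for i
    proof -
      have "(\<Oplus>\<^bsub>Z\<^esub>s\<in>J. c s \<odot>\<^bsub>Z\<^esub> v s i) = (\<Oplus>\<^bsub>Z\<^esub>k\<in>{..<m}. c (h k) \<odot>\<^bsub>Z\<^esub> v (h k) i)"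
        using i vc by (intro re) auto
      also have "\<dots> = (\<Oplus>\<^bsub>Z\<^esub>k\<in>{..<m}. w $ k \<odot>\<^bsub>Z\<^esub> zm $$ (i, k))"
        using i vh by (intro C.B.finsum_cong') (auto simp: ch zm_def del: equalityI)
      finally show ?thesis using rel i by simp
    qed
    show "w = 0\<^sub>v m"
    proof (rule eq_vecI)
      fix k assume "k < dim_vec (0\<^sub>v m :: 'k vec)"
      then have k: "k < m" by simp
      show "w $ k = 0\<^sub>v m $ k"
      proof (rule ccontr)
        assume "w $ k \<noteq> 0\<^sub>v m $ k"
        then have "c (h k) \<noteq> 0" using k ch by simp
        from frame_remove[OF fr hJ[OF k] this rel'] obtain y' where "frame (J - {h k}) v y'" by blast
        then have "P (card (J - {h k}))" unfolding P_def by blast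
        moreover have "card (J - {h k}) < m" using card_Diff1_less[OF J hJ[OF k]] card by simp
        ultimately show False using m(2) by blast
      qed
    qed (use w in auto)
    qed
  qed
  then show ?thesis by blast
qed

text \<open>F is the scalar matrix z^T E z. Its invertibility is the essential step: a kernel vector
  of F^T would be a linear relation between the columns of z.\<close>

lemma exists_point:
  obtains m F z where "inv_mat m F" "point Z n E m F z" "equimat z"
proof -
  obtain m z y where mf: "minframe m z y" using minimal_frame by blast
  then have z: "z \<in> carrier_mat n m" "y \<in> carrier_mat m n" "equimat z" "mcar Z y"
    "mm Z z y = sc Z (1\<^sub>m n)"
    unfolding minframe_def by simp_all
  have ind: "v = 0\<^sub>v m" if "v \<in> carrier_vec m"
    "\<And>i. i < n \<Longrightarrow> (\<Oplus>\<^bsub>Z\<^esub>j\<in>{..<m}. v $ j \<odot>\<^bsub>Z\<^esub> z $$ (i, j)) = \<zero>\<^bsub>Z\<^esub>" for v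
    using mf that unfolding minframe_def by simp
  have zc: "mcar Z z" "dim_row z = n" "dim_col z = m" and yc: "dim_row y = m" "dim_col y = n"
    using z by (auto simp: equimat_def)
  note iE = inv_mat_inverse[OF E]
  obtain F where F: "F \<in> carrier_mat m m" "mm Z z\<^sup>T (mm Z (sc Z E) z) = sc Z F"
    using equimat_scalar[OF z(3,3)] zc by auto
  have dF: "dim_row F = m" "dim_col F = m" using F by auto
  have "det F \<noteq> 0"
  proof
    assume "det F = 0"
    then have "det F\<^sup>T = 0" using det_transpose[OF F(1)] by simp
    then obtain v where v: "v \<in> carrier_vec m" "v \<noteq> 0\<^sub>v m" "F\<^sup>T *\<^sub>v v = 0\<^sub>v m"
      using det_0_iff_vec_prod_zero_field[of "F\<^sup>T" m] F by auto
    define V where "V = mat m 1 (\<lambda>(i, j). v $ i)"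
    have dV: "dim_row V = m" "dim_col V = 1" by (auto simp: V_def)
    have VF: "V\<^sup>T * F = 0\<^sub>m 1 m"
    proof (rule eq_matI)
      fix i j assume "i < dim_row (0\<^sub>m 1 m :: 'k mat)" "j < dim_col (0\<^sub>m 1 m :: 'k mat)"
      then have ij: "i = 0" "j < m" by auto
      have "0 = (F\<^sup>T *\<^sub>v v) $ j" unfolding v(3) using ij by simp
      also have "\<dots> = (\<Sum>k = 0..<m. v $ k * F $$ (k, j))"
        using ij dF v(1) by (simp add: scalar_prod_def mult.commute)
      finally show "(V\<^sup>T * F) $$ (i, j) = 0\<^sub>m 1 m $$ (i, j)"
        using ij dF v(1) by (simp add: V_def scalar_prod_def)
    qed (use dF dV in auto)
    let ?x = "mm Z z (sc Z V)"
    have xT: "?x\<^sup>T = mm Z (sc Z V\<^sup>T) z\<^sup>T" using zc dV by (simp add: C.B.mm_transpose sc_transpose)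
    have "mm Z ?x\<^sup>T (mm Z (sc Z E) z) = mm Z (sc Z V\<^sup>T) (sc Z F)"
      unfolding xT F(2)[symmetric] using zc dV E by (simp add: C.B.mm_assoc)
    also have "\<dots> = sc Z (0\<^sub>m 1 m)" using dV dF by (simp add: C.B.sc_mult[symmetric] VF)
    finally have x0: "mm Z ?x\<^sup>T (mm Z (sc Z E) z) = sc Z (0\<^sub>m 1 m)" .
    \<comment> \<open>The right inverse y turns x^T E z = 0 into x^T = x^T E (z y) E^-1 = 0.\<close>
    have "?x\<^sup>T = mm Z ?x\<^sup>T (mm Z (sc Z E) (mm Z (mm Z z y) (sc Z (mat_inv E))))"
      using z(5) zc dV E by (simp add: C.B.sc_mult[symmetric] iE)
    also have "\<dots> = mm Z (mm Z (mm Z ?x\<^sup>T (mm Z (sc Z E) z)) y) (sc Z (mat_inv E))"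
      using zc yc z(4) dV E by (simp add: C.B.mm_assoc)
    also have "\<dots> = sc Z (0\<^sub>m 1 n)" unfolding x0 using z(4) yc E by (simp add: C.B.mm_zero)
    finally have xz: "?x\<^sup>T = sc Z (0\<^sub>m 1 n)" .
    have "(\<Oplus>\<^bsub>Z\<^esub>j\<in>{..<m}. v $ j \<odot>\<^bsub>Z\<^esub> z $$ (i, j)) = \<zero>\<^bsub>Z\<^esub>" if i: "i < n" for i
    proof -
      have "\<zero>\<^bsub>Z\<^esub> = ?x\<^sup>T $$ (0, i)" unfolding xz using i by simp
      also have "\<dots> = (\<Oplus>\<^bsub>Z\<^esub>j\<in>{..<m}. v $ j \<odot>\<^bsub>Z\<^esub> z $$ (i, j))"
        using i zc dV by (auto simp: V_def mcarD intro!: C.B.finsum_cong' del: equalityI)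
      finally show ?thesis by simp
    qed
    then show False using ind[OF v(1)] v(2) by simp
  qed
  then have iF: "inv_mat m F" by (rule inv_mat_det[OF F(1)])
  let ?p = "pinv Z E F z"
  have pc: "mcar Z ?p" "dim_row ?p = m" "dim_col ?p = n" using C.B.mcar_pinv[OF E iF z(1) zc(1)] E iF by auto
  have l: "mm Z ?p z = sc Z (1\<^sub>m m)" using C.B.pinv_left_iff[OF E iF z(1) zc(1)] F(2) by simp
  \<comment> \<open>z has the left inverse F^-1 z^T E and the right inverse y, so the two coincide;
    this yields the second relation of a point.\<close>
  have "?p = mm Z ?p (mm Z z y)" using pc z(5) by simp
  also have "\<dots> = mm Z (mm Z ?p z) y" using pc zc yc z(4) by (simp add: C.B.mm_assoc)
  also have "\<dots> = y" unfolding l using z(4) yc by simp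
  finally have "mm Z z ?p = sc Z (1\<^sub>m n)" using z(5) by simp
  then have "point Z n E m F z" using l C.B.point_iff_pinv[OF E iF z(1) zc(1)] by simp
  then show thesis by (rule that[OF iF _ z(3)])
qed

text \<open>Two bases of the space of equivariant columns differ by a scalar matrix.\<close>

lemma points_congruent:
  assumes F1: "inv_mat m1 F1" and u: "point Z n E m1 F1 u" "equimat u"
    and F2: "inv_mat m2 F2" and z: "point Z n E m2 F2 z" "equimat z"
  shows "m1 = m2 \<and> (\<exists>P. P \<in> carrier_mat m1 m1 \<and> invertible_mat P \<and> F1 = P * F2 * P\<^sup>T)"
proof -
  \<comment> \<open>u equals z times F2^-1 (z^T E u), and z^T E u is scalar by
    \<open>equimat_scalar\<close>.\<close>
  have key: "\<exists>Q. Q \<in> carrier_mat m2 m1 \<and> u = mm Z z (sc Z Q)"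
    if F1: "inv_mat m1 F1" and u: "point Z n E m1 F1 u" "equimat u"
      and F2: "inv_mat m2 F2" and z: "point Z n E m2 F2 z" "equimat z" for m1 m2 F1 F2 u z
  proof -
    have uc: "mcar Z u" "dim_row u = n" "dim_col u = m1" using u by (auto simp: point_def)
    have zc: "z \<in> carrier_mat n m2" "mcar Z z" "dim_row z = n" "dim_col z = m2" using z by (auto simp: point_def)
    obtain M where M: "M \<in> carrier_mat m2 m1" "mm Z z\<^sup>T (mm Z (sc Z E) u) = sc Z M"
      using equimat_scalar[OF z(2) u(2)] uc zc by auto
    have pc: "mcar Z (pinv Z E F2 z)" using C.B.mcar_pinv[OF E F2 zc(1,2)] .
    have "mm Z (pinv Z E F2 z) u = mm Z (sc Z (mat_inv F2)) (sc Z M)"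
      unfolding M(2)[symmetric] pinv_def using E F2 zc uc by (simp add: C.B.mm_assoc)
    also have "\<dots> = sc Z (mat_inv F2 * M)" using M F2 by (simp add: C.B.sc_mult)
    finally have "mm Z z (mm Z (pinv Z E F2 z) u) = mm Z z (sc Z (mat_inv F2 * M))" by simp
    moreover have "mm Z z (mm Z (pinv Z E F2 z) u) = mm Z (mm Z z (pinv Z E F2 z)) u"
      using pc zc uc E F2 by (simp add: C.B.mm_assoc)
    moreover have "mm Z z (pinv Z E F2 z) = sc Z (1\<^sub>m n)"
      using z(1) C.B.point_iff_pinv[OF E F2 zc(1,2)] by simp
    ultimately have "u = mm Z z (sc Z (mat_inv F2 * M))" using uc by simp
    moreover have "mat_inv F2 * M \<in> carrier_mat m2 m1" using inv_mat_inverse(1)[OF F2] M by simp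
    ultimately show ?thesis by blast
  qed
  \<comment> \<open>Substitution gives z = z Q Q', and z is cancelled by its left inverse.\<close>
  have canc: "Q * Q' = 1\<^sub>m m2"
    if F2: "inv_mat m2 F2" and z: "point Z n E m2 F2 z" and Q: "Q \<in> carrier_mat m2 m1" "Q' \<in> carrier_mat m1 m2"
      and e: "u = mm Z z (sc Z Q)" "z = mm Z u (sc Z Q')" for m1 m2 F2 u z Q Q'
  proof -
    have zc: "z \<in> carrier_mat n m2" "mcar Z z" "dim_row z = n" "dim_col z = m2" using z by (auto simp: point_def)
    have pc: "mcar Z (pinv Z E F2 z)" using C.B.mcar_pinv[OF E F2 zc(1,2)] .
    have l: "mm Z (pinv Z E F2 z) z = sc Z (1\<^sub>m m2)" using z C.B.point_iff_pinv[OF E F2 zc(1,2)] by simp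
    have "z = mm Z (mm Z z (sc Z Q)) (sc Z Q')" using e by simp
    also have "\<dots> = mm Z z (sc Z (Q * Q'))" using zc Q by (simp add: C.B.mm_assoc C.B.sc_mult)
    finally have "mm Z (pinv Z E F2 z) z = mm Z (pinv Z E F2 z) (mm Z z (sc Z (Q * Q')))" by simp
    also have "\<dots> = mm Z (mm Z (pinv Z E F2 z) z) (sc Z (Q * Q'))"
      using pc zc Q E F2 by (simp add: C.B.mm_assoc)
    finally have "sc Z (1\<^sub>m m2) = sc Z (Q * Q')" unfolding l using Q by simp
    then show ?thesis using C.B.sc_inj[OF nontrivial] by metis
  qed
  obtain Q where Q: "Q \<in> carrier_mat m2 m1" "u = mm Z z (sc Z Q)" using key[OF F1 u F2 z] by blast
  obtain Q' where Q': "Q' \<in> carrier_mat m1 m2" "z = mm Z u (sc Z Q')" using key[OF F2 z F1 u] by blast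
  have QQ: "Q * Q' = 1\<^sub>m m2" by (rule canc[OF F2 z(1) Q(1) Q'(1) Q(2) Q'(2)])
  have QQ': "Q' * Q = 1\<^sub>m m1" by (rule canc[OF F1 u(1) Q'(1) Q(1) Q'(2) Q(2)])
  have m: "m1 = m2"
    using two_sided_inverse_square[OF Q(1) Q'(1) QQ] two_sided_inverse_square[OF Q'(1) Q(1) QQ'] by simp
  have zc: "mcar Z z" "dim_row z = n" "dim_col z = m2" using z by (auto simp: point_def)
  \<comment> \<open>F1 = u^T E u with u = zQ, so the congruence is given by P = Q^T.\<close>
  have "sc Z F1 = mm Z u\<^sup>T (mm Z (sc Z E) u)" using u by (simp add: point_def)
  also have "\<dots> = mm Z (sc Z Q\<^sup>T) (mm Z (mm Z z\<^sup>T (mm Z (sc Z E) z)) (sc Z Q))"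
    unfolding Q(2) using zc Q(1) E by (simp add: C.B.mm_transpose sc_transpose C.B.mm_assoc)
  also have "mm Z z\<^sup>T (mm Z (sc Z E) z) = sc Z F2" using z by (simp add: point_def)
  also have "mm Z (sc Z Q\<^sup>T) (mm Z (sc Z F2) (sc Z Q)) = sc Z (Q\<^sup>T * (F2 * Q))"
    using Q F2 by (simp add: C.B.sc_mult)
  finally have "F1 = Q\<^sup>T * (F2 * Q)" using C.B.sc_inj[OF nontrivial] by blast
  also have "\<dots> = Q\<^sup>T * F2 * Q\<^sup>T\<^sup>T"
    using Q inv_mat_inverse(4)[OF F2] by (subst assoc_mult_mat[of _ m1 m2 _ m2 _ m1]) auto
  finally have "F1 = Q\<^sup>T * F2 * Q\<^sup>T\<^sup>T" .
  moreover have "inv_mat m1 Q\<^sup>T"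
  proof (rule inv_matI)
    show "Q\<^sup>T * Q'\<^sup>T = 1\<^sub>m m1" using transpose_mult[OF Q'(1) Q(1)] QQ' by simp
  qed (use Q Q' m in auto)
  then have "Q\<^sup>T \<in> carrier_mat m1 m1" "invertible_mat Q\<^sup>T" by (auto simp: inv_mat_def)
  ultimately show ?thesis using m by blast
qed

end

subsection \<open>Nonvanishing\<close>

text \<open>
  The module behind the nonvanishing theorem. On the free algebra on letters \<open>x\<^sub>0, x\<^sub>1, \<dots>\<close> let
  \<open>x\<^sub>i\<close> act by left multiplication and let \<open>y\<^sub>k\<close> be defined by the commutation rule
  \<open>y\<^sub>k x\<^sub>j = q x\<^sub>k y\<^sub>j + d\<^sub>k\<^sub>j\<close> and \<open>y\<^sub>k 1 = c\<^sub>k\<close>. With \<open>r = \<Sum> e\<^sub>i\<^sub>j x\<^sub>i x\<^sub>j\<close>,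
  \<open>Q = \<Sum> e\<^sub>i\<^sub>j x\<^sub>i y\<^sub>j - 1\<close> and \<open>P = \<Sum> e\<^sub>i\<^sub>j y\<^sub>i y\<^sub>j\<close> one finds
  \<open>Q x\<^sub>k = q r y\<^sub>k\<close>, \<open>y\<^sub>k r = q\<^sup>2 x\<^sub>k Q\<close> and \<open>P x\<^sub>k = q\<^sup>2 Q y\<^sub>k\<close>, so the relations hold modulo the left
  ideal \<open>N\<close> generated by \<open>r\<close> (two-sided) and \<open>\<ell> - 1\<close>, where \<open>\<ell> = \<Sum> e\<^sub>i\<^sub>j c\<^sub>j x\<^sub>i\<close>. The functional that
  multiplies the coordinates of the vectors \<open>b\<^sub>0, b\<^sub>1, \<dots>\<close> along a word shows \<open>1 \<notin> N\<close>.
\<close>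

type_synonym 'a ft = "nat word \<Rightarrow>\<^sub>0 'a"

locale fock =
  fixes n :: nat and e d :: "nat \<Rightarrow> nat \<Rightarrow> 'k::field" and c :: "nat \<Rightarrow> 'k" and q :: 'k
    and b :: "nat \<Rightarrow> nat \<Rightarrow> 'k"
  assumes ed: "\<And>i k. i < n \<Longrightarrow> k < n \<Longrightarrow> (\<Sum>j<n. e i j * d j k) = (if i = k then 1 else 0)"
    and de: "\<And>k j. k < n \<Longrightarrow> j < n \<Longrightarrow> (\<Sum>i<n. d k i * e i j) = (if k = j then 1 else 0)"
    and q: "q \<noteq> 0" "q * (\<Sum>i<n. \<Sum>j<n. e i j * d i j) = - (q * q) - 1"
    and iso: "(\<Sum>i<n. \<Sum>j<n. e i j * (c i * c j)) = 0"
    and b0: "\<And>t k. k \<ge> n \<Longrightarrow> b t k = 0"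
    and bb: "\<And>t. (\<Sum>i<n. \<Sum>j<n. e i j * (b t i * b (Suc t) j)) = 0"
    and bc: "\<And>t. (\<Sum>i<n. \<Sum>j<n. e i j * (b t i * c j)) = 1"
begin



abbreviation "FA \<equiv> free_alg UNIV :: ('k, 'k ft) module"
abbreviation x :: "nat \<Rightarrow> 'k ft" where "x i \<equiv> gen i"

interpretation FA: kalg FA by (rule free_alg_kalg)

lemma FA_simps [simp]: "carrier FA = UNIV" "add FA = (+)" "mult FA = (*)" "zero FA = 0" "one FA = 1" "smult FA = pscale"
  by (auto simp: free_alg_simps)

lemma T_induct [case_names zero one gen add]:
  fixes t :: "'k ft"
  assumes "P 0" "\<And>a. P (pscale a 1)" "\<And>k t. P t \<Longrightarrow> P (x k * t)" "\<And>s t. P s \<Longrightarrow> P t \<Longrightarrow> P (s + t)"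
  shows "P t"
proof -
  have "P (Poly_Mapping.single (Word l) a)" for l a
  proof (induction l)
    case Nil
    show ?case using assms(2)[of a] by (simp flip: single_one zero_word_def)
  next
    case (Cons k l)
    show ?case using assms(3)[OF Cons, of k] by (simp add: gen_def mult_single plus_word_def)
  qed
  then have single: "P (Poly_Mapping.single w a)" for w a by (cases w) simp
  have "Poly_Mapping.keys t \<subseteq> UNIV" by simp
  then show ?thesis by (induction rule: keys_induct) (auto intro: assms single)
qed

text \<open>The operator y_k on a word, by recursion on its first letter. The letters range over all
  natural numbers, and words starting with a letter of index at least n are sent to 0.\<close>

fun yw :: "nat list \<Rightarrow> nat \<Rightarrow> 'k ft" where
  "yw [] k = pscale (c k) 1"
| "yw (j # l) k = (if j < n then pscale q (x k * yw l j) + pscale (d k j) (Poly_Mapping.single (Word l) 1) else 0)"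

definition y :: "nat \<Rightarrow> 'k ft \<Rightarrow> 'k ft" where
  "y k = lin_ext FA (\<lambda>w. yw (letters w) k)"

lemma y_add: "y k (s + t) = y k s + y k t"
  using FA.lin_ext_add[of _ UNIV s t] by (simp add: y_def)

lemma y_pscale: "y k (pscale a t) = pscale a (y k t)"
  using FA.lin_ext_pscale[of _ UNIV t] by (simp add: y_def)

lemma y_zero [simp]: "y k 0 = 0"
  using FA.lin_ext_zero by (simp add: y_def)

lemma y_sum: "y k (\<Sum>i\<in>I. f i) = (\<Sum>i\<in>I. y k (f i))"
  by (induction I rule: infinite_finite_induct) (simp_all add: y_add)

lemma y_single: "y k (Poly_Mapping.single w a) = pscale a (yw (letters w) k)"
  using FA.lin_ext_single by (simp add: y_def)

lemma y_one: "y k 1 = pscale (c k) 1"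
  using y_single[of k 0 1] by simp

lemma y_x: "y k (x j * t) = (if j < n then pscale q (x k * y j t) + pscale (d k j) t else 0)"
proof -
  have "Poly_Mapping.keys t \<subseteq> UNIV" by simp
  then show ?thesis
  proof (induction rule: keys_induct)
    case (single w a)
    have "x j * Poly_Mapping.single w a = Poly_Mapping.single (Word (j # letters w)) a"
      by (simp add: gen_def mult_single plus_word_def)
    then show ?case by (cases w) (simp add: y_single pscale_mult pm.scale_right_distrib mult.commute[of a q] mult.commute[of a "d k j"])
  qed (auto simp: y_add distrib_left pm.scale_right_distrib add_ac)
qed

definition "r = (\<Sum>i<n. \<Sum>j<n. pscale (e i j) (x i * x j))"
definition "l1 = (\<Sum>i<n. \<Sum>j<n. pscale (e i j * c j) (x i)) - 1"
text \<open>Besides the multiples of r and of l - 1, a third family kills every word containing a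
  letter of index at least n, since the free algebra used here has all natural numbers as
  letters.\<close>

definition "N = pm.span (range (\<lambda>(u, v). u * (r * v)) \<union> range (\<lambda>u. u * l1) \<union> {u * (x k * v) | u v k. k \<ge> n})"
definition "Q t = (\<Sum>i<n. \<Sum>j<n. pscale (e i j) (x i * y j t)) - t"

lemma N_add: "s \<in> N \<Longrightarrow> t \<in> N \<Longrightarrow> s + t \<in> N" and N_zero [simp]: "0 \<in> N"
  and N_pscale: "t \<in> N \<Longrightarrow> pscale a t \<in> N" and N_diff: "s \<in> N \<Longrightarrow> t \<in> N \<Longrightarrow> s - t \<in> N"
  and N_neg: "t \<in> N \<Longrightarrow> - t \<in> N"
  unfolding N_def by (fact pm.span_add pm.span_zero pm.span_scale pm.span_diff pm.span_neg)+

lemma N_gens: "u * (r * v) \<in> N" "u * l1 \<in> N" "k \<ge> n \<Longrightarrow> u * (x k * v) \<in> N"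
  unfolding N_def by (rule pm.span_base, force)+

lemma N_induct [consumes 1, case_names zero r l x add]:
  assumes "t \<in> N" "P 0"
    and "\<And>a u v. P (pscale a (u * (r * v)))" "\<And>a u. P (pscale a (u * l1))"
    and "\<And>a u v k. k \<ge> n \<Longrightarrow> P (pscale a (u * (x k * v)))" "\<And>s t. P s \<Longrightarrow> P t \<Longrightarrow> P (s + t)"
  shows "P t"
  using assms(1) unfolding N_def by (induction rule: pm.span_induct_alt) (use assms(2-) in auto)

lemma N_left: "t \<in> N \<Longrightarrow> s * t \<in> N"
  by (induction rule: N_induct)
    (simp_all add: pscale_mult distrib_left N_add N_pscale N_gens mult.assoc[symmetric] N_gens[unfolded mult.assoc[symmetric]])

lemma r_in_N: "r * v \<in> N" and l1_in_N: "l1 \<in> N" and x_in_N: "k \<ge> n \<Longrightarrow> x k * v \<in> N"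
  using N_gens(1)[of 1 v] N_gens(2)[of 1] N_gens(3)[of k 1 v] by simp_all

lemma sum_de: "k < n \<Longrightarrow> (\<Sum>i<n. \<Sum>j<n. pscale (d k i * e i j) (f j)) = f k"
proof -
  assume k: "k < n"
  have "(\<Sum>i<n. \<Sum>j<n. pscale (d k i * e i j) (f j)) = (\<Sum>j<n. pscale (\<Sum>i<n. d k i * e i j) (f j))"
    by (subst sum.swap) (simp add: pm.scale_sum_left)
  also have "\<dots> = (\<Sum>j<n. if k = j then f j else 0)"
    using k by (intro sum.cong) (auto simp: de)
  finally show ?thesis using k by simp
qed

lemma sum_ed: "k < n \<Longrightarrow> (\<Sum>i<n. \<Sum>j<n. pscale (e i j * d j k) (f i)) = f k"
proof -
  assume k: "k < n"
  have "(\<Sum>i<n. \<Sum>j<n. pscale (e i j * d j k) (f i)) = (\<Sum>i<n. pscale (\<Sum>j<n. e i j * d j k) (f i))"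
    by (simp add: pm.scale_sum_left)
  also have "\<dots> = (\<Sum>i<n. if i = k then f i else 0)"
    using k by (intro sum.cong) (auto simp: ed)
  finally show ?thesis using k by simp
qed

lemma r_mult: "r * t = (\<Sum>i<n. \<Sum>j<n. pscale (e i j) (x i * (x j * t)))"
  by (simp add: r_def sum_distrib_right pscale_mult mult.assoc)

text \<open>The commutation rule produces sums of e_ij d_jk x_i t, which equal x_k t because e d = 1
  and cancel the subtracted term in \<open>Q\<close>.\<close>

lemma Q_x: "k < n \<Longrightarrow> Q (x k * t) = pscale q (r * y k t)"
  using sum_ed[of k "\<lambda>i. x i * t"]
  by (simp add: Q_def y_x r_mult distrib_left pscale_mult pm.scale_right_distrib sum.distrib pm.scale_sum_right
      mult.left_commute mult.commute[of q])

lemma Q_add: "Q (s + t) = Q s + Q t"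
  by (simp add: Q_def y_add distrib_left pm.scale_right_distrib sum.distrib)

lemma Q_pscale: "Q (pscale a t) = pscale a (Q t)"
  by (simp add: Q_def y_pscale pscale_mult pm.scale_right_diff_distrib pm.scale_sum_right mult.commute)

lemma Q_one: "Q 1 = l1"
  by (simp add: Q_def l1_def y_one pscale_mult)

text \<open>\<open>Q\<close> sends 1 to l - 1, and by \<open>Q_x\<close> it sends every other word
  over the first n letters to a multiple of r.\<close>

lemma Q_in_N: "Q t \<in> N"
proof (induction t rule: T_induct)
  case (gen k t)
  show ?case
  proof (cases "k < n")
    case True
    then show ?thesis by (simp add: Q_x N_pscale r_in_N)
  next
    case False
    then have "Q (x k * t) = - (x k * t)" by (simp add: Q_def y_x)
    then show ?thesis using False by (simp add: N_neg x_in_N)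
  qed
qed (simp_all add: Q_add Q_pscale Q_one N_add N_pscale l1_in_N, simp add: Q_def)

lemma Tr: "q * (\<Sum>i<n. \<Sum>j<n. e i j * d i j) + 1 = - (q * q)"
  using q by simp

text \<open>This is where the quadratic equation for q enters. Moving y_k past both letters of r
  leaves x_k t with total coefficient q^2 + q Tr + 1, which vanishes.\<close>

lemma y_r: "k < n \<Longrightarrow> y k (r * t) = pscale (q * q) (x k * Q t)"
proof -
  assume k: "k < n"
  have "y k (r * t) = (\<Sum>i<n. \<Sum>j<n. pscale (q * q * e i j) (x k * (x i * y j t)))
      + (\<Sum>i<n. \<Sum>j<n. pscale (q * (e i j * d i j)) (x k * t)) + (\<Sum>i<n. \<Sum>j<n. pscale (d k i * e i j) (x j * t))"
    unfolding r_mult by (simp add: y_sum y_pscale y_x distrib_left pscale_mult pm.scale_right_distrib sum.distrib ac_simps)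
  also have "(\<Sum>i<n. \<Sum>j<n. pscale (d k i * e i j) (x j * t)) = x k * t" by (rule sum_de[OF k])
  also have "(\<Sum>i<n. \<Sum>j<n. pscale (q * (e i j * d i j)) (x k * t)) = pscale (q * (\<Sum>i<n. \<Sum>j<n. e i j * d i j)) (x k * t)"
    by (simp add: pm.scale_sum_left sum_distrib_left)
  also have "(\<Sum>i<n. \<Sum>j<n. pscale (q * q * e i j) (x k * (x i * y j t))) = pscale (q * q) (x k * (Q t + t))"
    by (simp add: Q_def pm.scale_sum_right sum_distrib_left pscale_mult)
  also have "pscale (q * q) (x k * (Q t + t)) + pscale (q * (\<Sum>i<n. \<Sum>j<n. e i j * d i j)) (x k * t) + x k * t
     = pscale (q * q) (x k * (Q t + t)) + pscale (q * (\<Sum>i<n. \<Sum>j<n. e i j * d i j) + 1) (x k * t)"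
    by (simp only: pm.scale_left_distrib pm.scale_one add.assoc)
  also have "\<dots> = pscale (q * q) (x k * Q t)"
    unfolding Tr by (simp add: distrib_left pm.scale_right_distrib)
  finally show ?thesis .
qed

text \<open>y_k applied to l gives q times the value of the form at (c, c) times x_k, plus c_k, and
  y_k applied to 1 gives c_k. The difference vanishes because c is isotropic.\<close>

lemma y_l1: "k < n \<Longrightarrow> y k l1 = 0"
proof -
  assume k: "k < n"
  have "y k (x i) = pscale (q * c i) (x k) + pscale (d k i) 1" if "i < n" for i
    using y_x[of k i 1] that by (simp add: y_one pscale_mult)
  then have "y k l1 = (\<Sum>i<n. \<Sum>j<n. pscale (e i j * c j) (pscale (q * c i) (x k) + pscale (d k i) 1)) - pscale (c k) 1"
    using y_add[of k "l1" 1] by (simp add: l1_def y_sum y_pscale y_one eq_diff_eq)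
  also have "\<dots> = pscale (q * (\<Sum>i<n. \<Sum>j<n. e i j * (c i * c j))) (x k)
      + (\<Sum>i<n. \<Sum>j<n. pscale (d k i * e i j) (pscale (c j) 1)) - pscale (c k) 1"
    by (simp add: pm.scale_right_distrib sum.distrib pm.scale_sum_left sum_distrib_left ac_simps)
  also have "\<dots> = 0" unfolding iso sum_de[OF k] by simp
  finally show ?thesis .
qed

lemma y_left:
  assumes "\<And>k. k < n \<Longrightarrow> y k s \<in> N" "s \<in> N" "k < n"
  shows "y k (u * s) \<in> N"
  using assms(3)
proof (induction u arbitrary: k rule: T_induct)
  case (gen j u)
  then show ?case using assms(2) N_left by (simp add: mult.assoc y_x N_add N_pscale)
qed (simp_all add: y_add distrib_right N_add pscale_mult y_pscale N_pscale assms(1))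

text \<open>Stability of N lets the y_k act on the quotient by N. By \<open>y_left\<close> only the
  generators matter.\<close>

lemma y_N: "t \<in> N \<Longrightarrow> k < n \<Longrightarrow> y k t \<in> N"
proof (induction rule: N_induct)
  case (r a u v)
  have "y k (u * (r * v)) \<in> N" by (rule y_left) (use r in \<open>simp_all add: y_r r_in_N N_pscale N_left Q_in_N\<close>)
  then show ?case by (simp add: y_pscale N_pscale)
next
  case (l a u)
  have "y k (u * l1) \<in> N" by (rule y_left) (use l in \<open>simp_all add: y_l1 l1_in_N\<close>)
  then show ?case by (simp add: y_pscale N_pscale)
next
  case (x a u v j)
  have "y k (u * (local.x j * v)) \<in> N" by (rule y_left) (use x in \<open>simp_all add: y_x x_in_N\<close>)
  then show ?case by (simp add: y_pscale N_pscale)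
qed (simp_all add: y_add N_add)

text \<open>On 1 the value is the form at (c, c), which is zero; on x_k t the same cancellation as
  in \<open>y_r\<close> leaves q^2 Q(y_k t).\<close>

lemma yy_in_N: "(\<Sum>i<n. \<Sum>j<n. pscale (e i j) (y i (y j t))) \<in> N"
proof (induction t rule: T_induct)
  case (one a)
  have "(\<Sum>i<n. \<Sum>j<n. pscale (e i j) (y i (y j (pscale a 1)))) = pscale (a * (\<Sum>i<n. \<Sum>j<n. e i j * (c i * c j))) 1"
    by (simp add: y_pscale y_one sum_distrib_left pm.scale_sum_left ac_simps)
  then show ?case by (simp add: iso)
next
  case (gen k t)
  show ?case
  proof (cases "k < n")
    case True
    have "(\<Sum>i<n. \<Sum>j<n. pscale (e i j) (y i (y j (x k * t))))
      = (\<Sum>i<n. \<Sum>j<n. pscale (q * q * e i j) (x i * y j (y k t))) + (\<Sum>i<n. \<Sum>j<n. pscale (q * (e i j * d i j)) (y k t))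
        + (\<Sum>i<n. \<Sum>j<n. pscale (e i j * d j k) (y i t))"
      using True by (simp add: y_x y_add y_pscale pm.scale_right_distrib sum.distrib ac_simps)
    also have "(\<Sum>i<n. \<Sum>j<n. pscale (e i j * d j k) (y i t)) = y k t" by (rule sum_ed[OF True])
    also have "(\<Sum>i<n. \<Sum>j<n. pscale (q * (e i j * d i j)) (y k t)) = pscale (q * (\<Sum>i<n. \<Sum>j<n. e i j * d i j)) (y k t)"
      by (simp add: pm.scale_sum_left sum_distrib_left)
    also have "(\<Sum>i<n. \<Sum>j<n. pscale (q * q * e i j) (x i * y j (y k t))) = pscale (q * q) (Q (y k t) + y k t)"
      by (simp add: Q_def pm.scale_sum_right)
    also have "pscale (q * q) (Q (y k t) + y k t) + pscale (q * (\<Sum>i<n. \<Sum>j<n. e i j * d i j)) (y k t) + y k t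
      = pscale (q * q) (Q (y k t) + y k t) + pscale (q * (\<Sum>i<n. \<Sum>j<n. e i j * d i j) + 1) (y k t)"
      by (simp only: pm.scale_left_distrib pm.scale_one add.assoc)
    also have "\<dots> = pscale (q * q) (Q (y k t))"
      unfolding Tr by (simp add: pm.scale_right_distrib)
    finally show ?thesis by (simp add: N_pscale Q_in_N)
  next
    case False
    then show ?thesis by (simp add: y_x)
  qed
qed (simp_all add: y_add pm.scale_right_distrib sum.distrib N_add)

text \<open>The letter in position s is evaluated by the vector with index t + s. The shift is what
  makes both requirements solvable at once: consecutive vectors pair to 0, so r is killed, while
  each pairs to 1 with c, so l - 1 is killed.\<close>

fun pw :: "nat \<Rightarrow> nat list \<Rightarrow> 'k" where
  "pw t [] = 1"
| "pw t (i # l) = b t i * pw (Suc t) l"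

definition \<Phi> :: "nat \<Rightarrow> 'k ft \<Rightarrow> 'k" where
  "\<Phi> t = lin_ext ground_alg (\<lambda>w. pw t (letters w))"

lemma \<Phi>_simps: "\<Phi> t (u + v) = \<Phi> t u + \<Phi> t v" "\<Phi> t (pscale a u) = a * \<Phi> t u" "\<Phi> t 0 = 0"
  "\<Phi> t (Poly_Mapping.single w a) = a * pw t (letters w)"
  using ground.lin_ext_add[of _ UNIV u v] ground.lin_ext_pscale[of _ UNIV u] ground.lin_ext_zero ground.lin_ext_single
  by (simp_all add: \<Phi>_def)

lemma \<Phi>_sum: "\<Phi> t (\<Sum>i\<in>I. f i) = (\<Sum>i\<in>I. \<Phi> t (f i))"
  by (induction I rule: infinite_finite_induct) (simp_all add: \<Phi>_simps)

lemma \<Phi>_one: "\<Phi> t 1 = 1"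
  using \<Phi>_simps(4)[of t 0 1] by simp

lemma \<Phi>_x: "\<Phi> t (x i * u) = b t i * \<Phi> (Suc t) u"
proof -
  have "Poly_Mapping.keys u \<subseteq> UNIV" by simp
  then show ?thesis
  proof (induction rule: keys_induct)
    case (single w a)
    have "x i * Poly_Mapping.single w a = Poly_Mapping.single (Word (i # letters w)) a"
      by (simp add: gen_def mult_single plus_word_def)
    then show ?case by (simp add: \<Phi>_simps)
  qed (simp_all add: \<Phi>_simps distrib_left)
qed

text \<open>Each letter of u raises the starting index, so the hypothesis has to hold for all of
  them.\<close>

lemma \<Phi>_left: "(\<And>t. \<Phi> t s = 0) \<Longrightarrow> \<Phi> t (u * s) = 0"
  by (induction u arbitrary: t rule: T_induct) (simp_all add: distrib_right \<Phi>_simps pscale_mult mult.assoc \<Phi>_x)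

lemma \<Phi>_N: "t \<in> N \<Longrightarrow> \<Phi> m t = 0"
proof (induction rule: N_induct)
  case (r a u v)
  have "\<Phi> t (r * v) = (\<Sum>i<n. \<Sum>j<n. e i j * (b t i * b (Suc t) j)) * \<Phi> (Suc (Suc t)) v" for t
    by (simp add: r_mult \<Phi>_sum \<Phi>_simps \<Phi>_x sum_distrib_right mult.assoc)
  then show ?case by (simp add: \<Phi>_simps \<Phi>_left bb)
next
  case (l a u)
  have "\<Phi> t (x i) = b t i" for t i using \<Phi>_x[of t i 1] by (simp add: \<Phi>_one)
  then have "\<Phi> t l1 = 0" for t
    using \<Phi>_simps(1)[of t l1 1] bc[of t] by (simp add: l1_def \<Phi>_sum \<Phi>_simps \<Phi>_one ac_simps)
  then show ?case by (simp add: \<Phi>_simps \<Phi>_left)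
next
  case (x a u v k)
  then show ?case by (simp add: \<Phi>_simps \<Phi>_left \<Phi>_x b0)
qed (simp_all add: \<Phi>_simps)

lemma one_notin_N: "1 \<notin> N"
  using \<Phi>_N[of 1 0] \<Phi>_one[of 0] by auto

end

subsection \<open>Endomorphisms modulo a subspace\<close>

text \<open>The linear endomorphisms of the free algebra that preserve N. Modulo
  \<open>endo_null\<close> they act faithfully on the quotient by N, which need not be formed as a
  separate space.\<close>

definition endo_alg :: "'k ft set \<Rightarrow> ('k::field, 'k ft \<Rightarrow> 'k ft) module" where
  "endo_alg N = \<lparr>carrier = {f. (\<forall>s t. f (s + t) = f s + f t) \<and> (\<forall>a t. f (pscale a t) = pscale a (f t)) \<and> f ` N \<subseteq> N},
     mult = (\<circ>), one = id, zero = (\<lambda>_. 0), add = (\<lambda>f g t. f t + g t), smult = (\<lambda>a f t. pscale a (f t))\<rparr>"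

definition endo_null :: "'k ft set \<Rightarrow> ('k::field ft \<Rightarrow> 'k ft) set" where
  "endo_null N = {f \<in> carrier (endo_alg N). \<forall>t. f t \<in> N}"

lemma endo_simps [simp]:
  "f \<otimes>\<^bsub>endo_alg N\<^esub> g = f \<circ> g" "\<one>\<^bsub>endo_alg N\<^esub> = id" "\<zero>\<^bsub>endo_alg N\<^esub> = (\<lambda>_. 0)"
  "f \<oplus>\<^bsub>endo_alg N\<^esub> g = (\<lambda>t. f t + g t)" "a \<odot>\<^bsub>endo_alg N\<^esub> f = (\<lambda>t. pscale a (f t))"
  by (simp_all add: endo_alg_def)

lemma endo_carrier: "f \<in> carrier (endo_alg N) \<longleftrightarrow>
   (\<forall>s t. f (s + t) = f s + f t) \<and> (\<forall>a t. f (pscale a t) = pscale a (f t)) \<and> (\<forall>t\<in>N. f t \<in> N)"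
  by (auto simp: endo_alg_def)

locale endo =
  fixes N :: "'k::field ft set"
  assumes N: "pm.subspace N" and one: "1 \<notin> N"
begin

lemma NI: "0 \<in> N" "s \<in> N \<Longrightarrow> t \<in> N \<Longrightarrow> s + t \<in> N" "t \<in> N \<Longrightarrow> pscale a t \<in> N" "t \<in> N \<Longrightarrow> - t \<in> N"
  using N pm.subspace_neg by (auto simp: pm.subspace_def)

lemma endo_kalg: "kalg (endo_alg N)"
proof -
  have "\<exists>g\<in>carrier (endo_alg N). (\<lambda>t. g t + f t) = (\<lambda>t. 0)" if "f \<in> carrier (endo_alg N)" for f
    by (rule bexI[of _ "\<lambda>t. - f t"]) (use that NI in \<open>auto simp: endo_carrier\<close>)
  then have "ring (endo_alg N)"
    by (intro ringI abelian_groupI monoidI)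
      (auto simp: endo_carrier NI pm.scale_right_distrib add_ac comp_def)
  then show ?thesis
    by (intro kalgI k_algebraI)
      (auto simp: endo_carrier NI pm.scale_right_distrib pm.scale_left_distrib comp_def pm.scale_left_commute)
qed

sublocale R: kalg "endo_alg N" by (rule endo_kalg)

lemma endo_minus: "f \<in> carrier (endo_alg N) \<Longrightarrow> g \<in> carrier (endo_alg N) \<Longrightarrow> f \<ominus>\<^bsub>endo_alg N\<^esub> g = (\<lambda>t. f t - g t)"
  by (simp add: a_minus_def R.minus_conv_smult)

lemma endo_finsum:
  assumes "finite I" "\<And>i. i \<in> I \<Longrightarrow> f i \<in> carrier (endo_alg N)"
  shows "(\<Oplus>\<^bsub>endo_alg N\<^esub>i\<in>I. f i) t = (\<Sum>i\<in>I. f i t)"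
  using assms by (induction I rule: finite_induct) (simp_all add: R.finsum_insert Pi_def)

lemma endo_ideal: "ideal (endo_null N) (endo_alg N)"
proof (rule idealI[OF R.ring_axioms])
  show "subgroup (endo_null N) (add_monoid (endo_alg N))"
  proof (rule group.subgroupI)
    show "group (add_monoid (endo_alg N))" by (rule R.a_group)
    show "endo_null N \<noteq> {}" using R.zero_closed NI by (auto simp: endo_null_def)
    show "inv\<^bsub>add_monoid (endo_alg N)\<^esub> f \<in> endo_null N" if "f \<in> endo_null N" for f
      using that R.smult_closed[of f "- 1"] R.minus_conv_smult[of f] NI by (auto simp: endo_null_def a_inv_def)
  qed (auto simp: endo_null_def endo_carrier NI pm.scale_right_distrib)
qed (auto simp: endo_null_def endo_carrier)

sublocale I: kalg_ideal "endo_alg N" "endo_null N"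
  by (intro kalg_ideal.intro endo_kalg endo_ideal)

abbreviation "RQ \<equiv> quotient_alg (endo_alg N) (endo_null N)"
abbreviation "cls \<equiv> a_r_coset (endo_alg N) (endo_null N)"

lemma cls_eq:
  assumes "f \<in> carrier (endo_alg N)" "g \<in> carrier (endo_alg N)"
  shows "cls f = cls g \<longleftrightarrow> (\<forall>t. f t - g t \<in> N)"
proof -
  have "f \<ominus>\<^bsub>endo_alg N\<^esub> g \<in> endo_null N \<longleftrightarrow> (\<forall>t. f t - g t \<in> N)"
    using R.minus_closed[OF assms] unfolding endo_minus[OF assms] endo_null_def by blast
  with I.rcos_eq_iff[OF assms] show ?thesis by (rule trans)
qed

lemma RQ_nontrivial: "\<one>\<^bsub>RQ\<^esub> \<noteq> \<zero>\<^bsub>RQ\<^esub>"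
proof
  assume "\<one>\<^bsub>RQ\<^esub> = \<zero>\<^bsub>RQ\<^esub>"
  then have "\<forall>t. \<one>\<^bsub>endo_alg N\<^esub> t - \<zero>\<^bsub>endo_alg N\<^esub> t \<in> N"
    unfolding I.quotient_alg_simps by (rule cls_eq[OF R.one_closed R.zero_closed, THEN iffD1])
  then show False using one by simp
qed

text \<open>Turns an identity X M Y = G over the quotient algebra into a pointwise congruence modulo
  N, the form in which the operator relations are available.\<close>

lemma quad_cls:
  assumes "mcar (endo_alg N) X" "mcar (endo_alg N) Y" "dim_col X = dim_row M" "dim_col M = dim_row Y"
    "dim_row X = dim_row G" "dim_col Y = dim_col G"
    and eq: "\<And>i j t. i < dim_row G \<Longrightarrow> j < dim_col G \<Longrightarrow>
      (\<Sum>k<dim_row M. \<Sum>l<dim_col M. pscale (M $$ (k, l)) ((X $$ (i, k)) ((Y $$ (l, j)) t))) - pscale (G $$ (i, j)) t \<in> N"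
  shows "mm RQ (map_mat cls X) (mm RQ (sc RQ M) (map_mat cls Y)) = sc RQ G"
proof -
  have "mm RQ (map_mat cls X) (mm RQ (sc RQ M) (map_mat cls Y))
    = map_mat cls (mm (endo_alg N) X (mm (endo_alg N) (sc (endo_alg N) M) Y))"
    using assms by (simp add: R.mm_hom[OF I.quotient_kalg I.proj_hom] R.sc_hom[OF I.proj_hom])
  also have "\<dots> = map_mat cls (sc (endo_alg N) G)"
  proof (rule eq_matI; simp add: assms del: mm_index)
    fix i j assume ij: "i < dim_row G" "j < dim_col G"
    have cX: "X $$ (i, k) \<in> carrier (endo_alg N)" if "k < dim_row M" for k
      using that ij mcarD[OF assms(1), of i k] assms(3-6) by simp
    have cY: "Y $$ (l, j) \<in> carrier (endo_alg N)" if "l < dim_col M" for l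
      using that ij mcarD[OF assms(2), of l j] assms(3-6) by simp
    have cc: "(\<lambda>t. pscale (M $$ p) ((X $$ (i, fst p)) ((Y $$ (snd p, j)) t))) \<in> carrier (endo_alg N)"
      if p: "p \<in> {..<dim_row M} \<times> {..<dim_col M}" for p
    proof -
      have "X $$ (i, fst p) \<otimes>\<^bsub>endo_alg N\<^esub> Y $$ (snd p, j) \<in> carrier (endo_alg N)"
        by (rule R.m_closed[OF cX cY]) (use p in auto)
      from R.smult_closed[OF this, of "M $$ p"] show ?thesis by (simp add: comp_def)
    qed
    have e: "mm (endo_alg N) X (mm (endo_alg N) (sc (endo_alg N) M) Y) $$ (i, j)
      = (\<Oplus>\<^bsub>endo_alg N\<^esub>p\<in>{..<dim_row M} \<times> {..<dim_col M}. (\<lambda>t. pscale (M $$ p) ((X $$ (i, fst p)) ((Y $$ (snd p, j)) t))))"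
      using ij assms by (subst R.mm_quad_entry) (auto simp: comp_def)
    have fs: "(\<Oplus>\<^bsub>endo_alg N\<^esub>p\<in>{..<dim_row M} \<times> {..<dim_col M}. (\<lambda>t. pscale (M $$ p) ((X $$ (i, fst p)) ((Y $$ (snd p, j)) t)))) t
      = (\<Sum>p\<in>{..<dim_row M} \<times> {..<dim_col M}. pscale (M $$ p) ((X $$ (i, fst p)) ((Y $$ (snd p, j)) t)))" for t
      by (rule endo_finsum) (use cc in auto)
    have "\<forall>t. (\<Sum>p\<in>{..<dim_row M} \<times> {..<dim_col M}. pscale (M $$ p) ((X $$ (i, fst p)) ((Y $$ (snd p, j)) t)))
        - pscale (G $$ (i, j)) t \<in> N"
      using eq[OF ij] by (simp add: sum.cartesian_product case_prod_unfold)
    moreover have "(\<lambda>t. pscale (G $$ (i, j)) t) \<in> carrier (endo_alg N)"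
      using R.smult_closed[OF R.one_closed, of "G $$ (i, j)"] by simp
    moreover have "(\<Oplus>\<^bsub>endo_alg N\<^esub>p\<in>{..<dim_row M} \<times> {..<dim_col M}. (\<lambda>t. pscale (M $$ p) ((X $$ (i, fst p)) ((Y $$ (snd p, j)) t)))) \<in> carrier (endo_alg N)"
      using cc by (intro R.finsum_closed) auto
    ultimately show "cls (mm (endo_alg N) X (mm (endo_alg N) (sc (endo_alg N) M) Y) $$ (i, j)) = cls (\<lambda>t. pscale (G $$ (i, j)) t)"
      unfolding e by (subst cls_eq) (simp_all add: fs)
  qed
  also have "\<dots> = sc RQ G" by (rule R.sc_hom[OF I.proj_hom])
  finally show ?thesis .
qed

end

text \<open>The matrix for which the algebra \<open>\<B>\<close> is the coordinate ring of quantum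
  SL(2); for it Tr(E^-1 E^T) = -q - 1/q.\<close>

definition quantum_mat :: "'k::field \<Rightarrow> 'k mat" where
  "quantum_mat q = mat 2 2 (\<lambda>(i, j). if i = 0 \<and> j = 1 then 1 else if i = 1 \<and> j = 0 then - inverse q else 0)"

lemma quantum_mat:
  assumes "q \<noteq> 0"
  shows "inv_mat 2 (quantum_mat q)"
    "mat_inv (quantum_mat q) = mat 2 2 (\<lambda>(i, j). if i = 0 \<and> j = 1 then - q else if i = 1 \<and> j = 0 then 1 else 0)"
proof -
  let ?G = "mat 2 2 (\<lambda>(i, j). if i = 0 \<and> j = 1 then - q else if i = 1 \<and> j = 0 then 1 else 0)"
  have e: "quantum_mat q * ?G = 1\<^sub>m 2"
    using assms by (intro eq_matI) (auto simp: quantum_mat_def scalar_prod_def less_2_cases_iff atLeast0_lessThan_Suc numeral_2_eq_2)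
  show i: "inv_mat 2 (quantum_mat q)" by (rule inv_matI[OF _ _ e]) (simp_all add: quantum_mat_def)
  show "mat_inv (quantum_mat q) = ?G" by (rule mat_inv_unique[OF i _ e]) simp
qed

locale fock_mat = fock n "\<lambda>i j. E $$ (i, j)" "\<lambda>i j. mat_inv E $$ (i, j)" c q b
  for n and E :: "'k::field mat" and c q b +
  assumes E: "inv_mat n E"
begin

sublocale R: endo N
  by unfold_locales (use one_notin_N in \<open>auto simp: N_def\<close>)

definition "z0 = mat n 2 (\<lambda>(i, k). if k = 0 then \<lambda>t. x i * t else y i)"

lemma z0: "mcar (endo_alg N) z0"
  by (auto simp: z0_def mcar_def endo_carrier N_left y_N y_add y_pscale distrib_left pscale_mult)

lemma z0_simps [simp]: "i < n \<Longrightarrow> (z0 $$ (i, 0)) t = x i * t" "i < n \<Longrightarrow> (z0 $$ (i, Suc 0)) t = y i t"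
  "dim_row z0 = n" "dim_col z0 = 2"
  by (simp_all add: z0_def)

text \<open>With columns x and y, the four entries of z^T E z are r, Q + 1, the mixed sum of y_k
  x_l, and the sum of y_k y_l. Each is congruent modulo N to the matching entry of
  \<open>quantum_mat\<close>.\<close>

lemma point_z0: "point R.RQ n E 2 (quantum_mat q) (map_mat R.cls z0)"
proof -
  have d: "map_mat R.cls z0 \<in> carrier_mat n 2" by auto
  have m: "mcar R.RQ (map_mat R.cls z0)"
    using z0 by (auto simp: mcar_def R.I.quotient_alg_simps)
  have tr: "(map_mat R.cls z0)\<^sup>T = map_mat R.cls z0\<^sup>T" by (rule eq_matI) auto
  have trace: "(\<Sum>i<n. \<Sum>j<n. E $$ (i, j) * mat_inv E $$ (i, j)) = - q - inverse q"
    using q by (simp add: field_simps)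
  have 1: "mm R.RQ (map_mat R.cls z0\<^sup>T) (mm R.RQ (sc R.RQ E) (map_mat R.cls z0)) = sc R.RQ (quantum_mat q)"
  proof (rule R.quad_cls)
    fix i j t assume "i < dim_row (quantum_mat q)" "j < dim_col (quantum_mat q)"
    then have ij: "i < 2" "j < 2" by (simp_all add: quantum_mat_def)
    let ?s = "\<lambda>i j. \<Sum>k<n. \<Sum>l<n. pscale (E $$ (k, l)) ((z0 $$ (k, i)) ((z0 $$ (l, j)) t))"
    have s01: "?s 0 1 = Q t + t" by (simp add: Q_def)
    \<comment> \<open>The commutation rule turns the mixed sum into q(Q + 1) + Tr, and Tr = -q - 1/q
      leaves -1/q modulo N.\<close>
    have "?s 1 0 = pscale q (Q t + t) + pscale (- q - inverse q) t"
      unfolding trace[symmetric]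
      by (simp add: y_x Q_def pm.scale_right_distrib sum.distrib pm.scale_sum_right pm.scale_sum_left pm.scale_left_commute mult.commute[of _ q])
    then have s10: "?s 1 0 - pscale (- inverse q) t = pscale q (Q t)"
      by (simp add: pm.scale_right_distrib pm.scale_left_diff_distrib)
    have "?s i j - pscale (quantum_mat q $$ (i, j)) t \<in> N"
    proof -
      consider "i = 0" "j = 0" | "i = 0" "j = 1" | "i = 1" "j = 0" | "i = 1" "j = 1"
        using ij by (auto simp: less_2_cases_iff)
      then show ?thesis
      proof cases
        case 1
        then show ?thesis using r_in_N[of t] by (simp add: quantum_mat_def r_mult)
      next
        case 2
        then show ?thesis using s01 Q_in_N by (simp add: quantum_mat_def)
      next
        case 3
        then show ?thesis using s10 N_pscale[OF Q_in_N[of t], of q] by (simp add: quantum_mat_def)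
      next
        case 4
        then show ?thesis using yy_in_N by (simp add: quantum_mat_def)
      qed
    qed
    then show "(\<Sum>k<dim_row E. \<Sum>l<dim_col E. pscale (E $$ (k, l)) ((z0\<^sup>T $$ (i, k)) ((z0 $$ (l, j)) t))) - pscale (quantum_mat q $$ (i, j)) t \<in> N"
      using E ij by simp
  qed (use E z0 in \<open>simp_all add: quantum_mat_def\<close>)
  have 2: "mm R.RQ (map_mat R.cls z0) (mm R.RQ (sc R.RQ (mat_inv (quantum_mat q))) (map_mat R.cls z0\<^sup>T)) = sc R.RQ (mat_inv E)"
  proof (rule R.quad_cls)
    fix i j t assume "i < dim_row (mat_inv E)" "j < dim_col (mat_inv E)"
    then have ij: "i < n" "j < n" using E by simp_all
    \<comment> \<open>This relation is the commutation rule y_i x_j - q x_i y_j = d_ij itself and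
      holds exactly, not merely modulo N.\<close>
    have "(\<Sum>k<2. \<Sum>l<2. pscale (mat_inv (quantum_mat q) $$ (k, l)) ((z0 $$ (i, k)) ((z0 $$ (j, l)) t)))
      - pscale (mat_inv E $$ (i, j)) t = 0"
      using ij q by (simp add: quantum_mat numeral_2_eq_2 y_x)
    then show "(\<Sum>k<dim_row (mat_inv (quantum_mat q)). \<Sum>l<dim_col (mat_inv (quantum_mat q)).
        pscale (mat_inv (quantum_mat q) $$ (k, l)) ((z0 $$ (i, k)) ((z0\<^sup>T $$ (l, j)) t))) - pscale (mat_inv E $$ (i, j)) t \<in> N"
      using ij q by (simp add: quantum_mat)
  qed (use E z0 q in \<open>simp_all add: quantum_mat\<close>)
  show ?thesis unfolding point_def tr using d m 1 2 by blast
qed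

end

subsection \<open>Points over algebraically closed fields\<close>

lemma inv_mat_inverse_sum:
  assumes "inv_mat n E" "i < n" "k < n"
  shows "(\<Sum>j<n. E $$ (i, j) * mat_inv E $$ (j, k)) = (if i = k then 1 else 0)"
    "(\<Sum>j<n. mat_inv E $$ (i, j) * E $$ (j, k)) = (if i = k then 1 else 0)"
proof -
  note I = inv_mat_inverse[OF assms(1)]
  have "(E * mat_inv E) $$ (i, k) = 1\<^sub>m n $$ (i, k)" "(mat_inv E * E) $$ (i, k) = 1\<^sub>m n $$ (i, k)"
    by (simp_all only: I)
  then show "(\<Sum>j<n. E $$ (i, j) * mat_inv E $$ (j, k)) = (if i = k then 1 else 0)"
    "(\<Sum>j<n. mat_inv E $$ (i, j) * E $$ (j, k)) = (if i = k then 1 else 0)"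
    using assms by (simp_all add: scalar_prod_def lessThan_atLeast0)
qed

lemma mat_trace_inverse_transpose:
  assumes "inv_mat n E"
  shows "mat_trace (mat_inv E * E\<^sup>T) = (\<Sum>i<n. \<Sum>j<n. E $$ (i, j) * mat_inv E $$ (i, j))"
  using assms by (simp add: mat_trace_def scalar_prod_def lessThan_atLeast0 mult.commute)

text \<open>On vectors supported in the first two coordinates the form is a binary quadratic form,
  which has a nontrivial zero over an algebraically closed field.\<close>

lemma isotropic_vector:
  fixes e :: "nat \<Rightarrow> nat \<Rightarrow> 'k::alg_closed_field"
  assumes n: "n \<ge> 2"
  shows "\<exists>c. (\<forall>i\<ge>n. c i = 0) \<and> (\<exists>i<n. c i \<noteq> 0) \<and> (\<Sum>i<n. \<Sum>j<n. e i j * (c i * c j)) = 0"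
proof -
  have red: "(\<Sum>i<n. \<Sum>j<n. e i j * (c i * c j))
    = e 0 0 * (c 0 * c 0) + (e 0 1 + e 1 0) * (c 0 * c 1) + e 1 1 * (c 1 * c 1)"
    if c: "\<And>i. i \<ge> 2 \<Longrightarrow> c i = 0" for c :: "nat \<Rightarrow> 'k"
  proof -
    have "(\<Sum>i<n. \<Sum>j<n. e i j * (c i * c j)) = (\<Sum>i<2. \<Sum>j<n. e i j * (c i * c j))"
      by (rule sum.mono_neutral_right) (use n c in auto)
    also have "\<dots> = (\<Sum>i<2. \<Sum>j<2. e i j * (c i * c j))"
      by (rule sum.cong[OF refl], rule sum.mono_neutral_right) (use n c in auto)
    finally show ?thesis by (simp add: numeral_2_eq_2 algebra_simps)
  qed
  have "\<exists>a b. (a, b) \<noteq> (0, 0) \<and> e 0 0 * (a * a) + (e 0 1 + e 1 0) * (a * b) + e 1 1 * (b * b) = 0"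
  proof (cases "e 0 0 = 0")
    case True
    then show ?thesis by (intro exI[of _ 1] exI[of _ 0]) simp
  next
    case False
    then obtain x where "(\<Sum>k\<le>2. (if k = 2 then e 0 0 else if k = 1 then e 0 1 + e 1 0 else e 1 1) * x ^ k) = 0"
      using alg_closed[of 2 "\<lambda>k. if k = 2 then e 0 0 else if k = 1 then e 0 1 + e 1 0 else e 1 1"] by auto
    then have "e 0 0 * (x * x) + (e 0 1 + e 1 0) * (x * 1) + e 1 1 * (1 * 1) = 0"
      by (simp add: numeral_2_eq_2 algebra_simps)
    then show ?thesis by (intro exI[of _ x] exI[of _ 1]) simp
  qed
  then obtain a b where ab: "(a, b) \<noteq> (0, 0)" "e 0 0 * (a * a) + (e 0 1 + e 1 0) * (a * b) + e 1 1 * (b * b) = 0"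
    by blast
  let ?c = "\<lambda>i. if i = 0 then a else if i = 1 then b else 0"
  show ?thesis
  proof (rule exI[of _ ?c], intro conjI)
    show "\<exists>i<n. ?c i \<noteq> 0"
      using ab(1) n by (cases "a = 0") (auto intro: exI[of _ 0] exI[of _ 1])
    show "(\<Sum>i<n. \<Sum>j<n. e i j * (?c i * ?c j)) = 0"
      by (subst red) (use ab(2) in auto)
  qed (use n in auto)
qed

text \<open>Supplies the data of the module: an isotropic c, a vector a with B(a,c) = 1, which
  exists because E is nondegenerate, and the sequence b in the affine line a + k c.\<close>

lemma quantum_point:
  fixes E :: "'k::alg_closed_field mat"
  assumes E: "inv_mat n E" and n: "n \<ge> 2" and q: "q * q + mat_trace (mat_inv E * E\<^sup>T) * q + 1 = 0" "q \<noteq> 0"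
  shows "\<exists>(R :: ('k, ('k ft \<Rightarrow> 'k ft) set) module) z. kalg R \<and> \<one>\<^bsub>R\<^esub> \<noteq> \<zero>\<^bsub>R\<^esub> \<and> point R n E 2 (quantum_mat q) z"
proof -
  define e where "e i j = E $$ (i, j)" for i j
  define B where "B u v = (\<Sum>i<n. \<Sum>j<n. e i j * (u i * v j))" for u v
  have B_l: "B (\<lambda>i. u i + a * v i) w = B u w + a * B v w" for u v w a
    unfolding B_def by (simp add: sum.distrib sum_distrib_left algebra_simps)
  have B_r: "B w (\<lambda>i. u i + a * v i) = B w u + a * B w v" for u v w a
    unfolding B_def by (simp add: sum.distrib sum_distrib_left algebra_simps)
  have "\<exists>c. (\<forall>i\<ge>n. c i = 0) \<and> (\<exists>i<n. c i \<noteq> 0) \<and> B c c = 0"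
    unfolding B_def by (rule isotropic_vector[OF n])
  then obtain c where c: "\<And>i. i \<ge> n \<Longrightarrow> c i = 0" "\<exists>i<n. c i \<noteq> 0" "B c c = 0" by blast
  \<comment> \<open>If E c were zero then so would be c = E^-1 (E c).\<close>
  have "\<exists>k<n. (\<Sum>j<n. e k j * c j) \<noteq> 0"
  proof (rule ccontr)
    assume "\<not> ?thesis"
    then have z: "(\<Sum>j<n. e k j * c j) = 0" if "k < n" for k using that by blast
    have "c i = 0" if i: "i < n" for i
    proof -
      have "0 = (\<Sum>k<n. mat_inv E $$ (i, k) * (\<Sum>j<n. e k j * c j))" by (simp add: z)
      also have "\<dots> = (\<Sum>j<n. (\<Sum>k<n. mat_inv E $$ (i, k) * e k j) * c j)"
        unfolding sum_distrib_left sum_distrib_right by (subst sum.swap) (simp add: mult.assoc)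
      also have "\<dots> = (\<Sum>j<n. if i = j then c j else 0)"
        by (rule sum.cong) (use i inv_mat_inverse_sum(2)[OF E] in \<open>auto simp: e_def\<close>)
      finally show ?thesis using i by simp
    qed
    then show False using c(2) by blast
  qed
  then obtain k where k: "k < n" "(\<Sum>j<n. e k j * c j) \<noteq> 0" by blast
  define a where "a i = (if i = k then inverse (\<Sum>j<n. e k j * c j) else 0)" for i
  have "B a c = (\<Sum>i<n. if i = k then inverse (\<Sum>j<n. e k j * c j) * (\<Sum>j<n. e i j * c j) else 0)"
    unfolding B_def by (rule sum.cong) (auto simp: a_def sum_distrib_left mult.left_commute)
  then have ac: "B a c = 1" using k by simp
  \<comment> \<open>On the line a + k c the pairing with c is constantly 1. The condition B(b_t,
    b_{t+1}) = 0 reads B(a,a) + \<alpha>_{t+1} + \<alpha>_t B(c,a) = 0 and is solved recursively; B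
    need not be symmetric.\<close>
  define \<alpha> where "\<alpha> = rec_nat 0 (\<lambda>_ s. - B a a - s * B c a)"
  have \<alpha>: "\<alpha> (Suc t) = - B a a - \<alpha> t * B c a" for t by (simp add: \<alpha>_def)
  define b where "b t = (\<lambda>i. a i + \<alpha> t * c i)" for t
  have "fock_mat n E c q b"
  proof
    show "q * (\<Sum>i<n. \<Sum>j<n. E $$ (i, j) * mat_inv E $$ (i, j)) = - (q * q) - 1"
      using q(1) unfolding mat_trace_inverse_transpose[OF E] by (simp add: algebra_simps eq_neg_iff_add_eq_0)
    show "(\<Sum>i<n. \<Sum>j<n. E $$ (i, j) * (c i * c j)) = 0" using c(3) by (simp add: B_def e_def)
    show "b t i = 0" if "i \<ge> n" for t i using that c(1) k(1) by (auto simp: b_def a_def)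
    have "B (b t) (b (Suc t)) = 0" for t unfolding b_def B_l B_r \<alpha> ac c(3) by (simp add: algebra_simps)
    then show "(\<Sum>i<n. \<Sum>j<n. E $$ (i, j) * (b t i * b (Suc t) j)) = 0" for t by (simp add: B_def e_def)
    have "B (b t) c = 1" for t unfolding b_def B_l ac c(3) by simp
    then show "(\<Sum>i<n. \<Sum>j<n. E $$ (i, j) * (b t i * c j)) = 1" for t by (simp add: B_def e_def)
  qed (use E q inv_mat_inverse_sum[OF E] in simp_all)
  then interpret fock_mat n E c q b .
  show ?thesis using point_z0 R.RQ_nontrivial R.I.quotient_kalg by blast
qed

lemma exists_nontrivial_point:
  fixes E F :: "'k::alg_closed_field mat"
  assumes E: "inv_mat n E" and F: "inv_mat m F" and nm: "n \<ge> 2" "m \<ge> 2"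
    and t: "mat_trace (mat_inv F * F\<^sup>T) = mat_trace (mat_inv E * E\<^sup>T)"
  shows "\<exists>(R :: ('k, (((('k ft \<Rightarrow> 'k ft) set \<times> ('k ft \<Rightarrow> 'k ft) set) \<Rightarrow>\<^sub>0 'k) set)) module) z.
    kalg R \<and> \<one>\<^bsub>R\<^esub> \<noteq> \<zero>\<^bsub>R\<^esub> \<and> point R n E m F z"
proof -
  obtain q where q0: "(\<Sum>k\<le>2. (if k = 1 then mat_trace (mat_inv E * E\<^sup>T) else 1) * q ^ k) = 0"
    using alg_closed[of 2 "\<lambda>k. if k = 1 then mat_trace (mat_inv E * E\<^sup>T) else 1"] by auto
  then have q: "q * q + mat_trace (mat_inv E * E\<^sup>T) * q + 1 = 0" by (simp add: numeral_2_eq_2 algebra_simps)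
  \<comment> \<open>The constant term of the equation is 1.\<close>
  then have "q \<noteq> 0" by auto
  obtain R :: "('k, ('k ft \<Rightarrow> 'k ft) set) module" and z
    where R: "kalg R" "\<one>\<^bsub>R\<^esub> \<noteq> \<zero>\<^bsub>R\<^esub>" "point R n E 2 (quantum_mat q) z"
    using quantum_point[OF E nm(1) q \<open>q \<noteq> 0\<close>] by blast
  have q': "q * q + mat_trace (mat_inv F * F\<^sup>T) * q + 1 = 0" using q t by simp
  obtain S :: "('k, ('k ft \<Rightarrow> 'k ft) set) module" and w
    where S: "kalg S" "\<one>\<^bsub>S\<^esub> \<noteq> \<zero>\<^bsub>S\<^esub>" "point S m F 2 (quantum_mat q) w"
    using quantum_point[OF F nm(2) q' \<open>q \<noteq> 0\<close>] by blast
  have Q: "inv_mat 2 (quantum_mat q)" by (rule quantum_mat) fact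
  note w = point_opposite[OF S(1) F Q S(3)]
  have k: "kalg2 R (opposite_alg S)" by (intro kalg2I R opposite_kalg S)
  note p = kalg2.point_tensor[OF k E Q F R(3) w]
  moreover have "\<one>\<^bsub>tensor R (opposite_alg S)\<^esub> \<noteq> \<zero>\<^bsub>tensor R (opposite_alg S)\<^esub>"
    by (rule kalg2.tensor_nontrivial[OF k R(2)]) (use S(2) in \<open>simp add: opposite_alg_def\<close>)
  moreover have "kalg (tensor R (opposite_alg S))" by (rule kalg2.tensor_kalg[OF k])
  ultimately show ?thesis by blast
qed

subsection \<open>Restriction of scalars\<close>

definition restrict_scalars :: "('k::field \<Rightarrow> 'l) \<Rightarrow> ('l::field, 'a) module \<Rightarrow> ('k, 'a) module" where
  "restrict_scalars h R = \<lparr>carrier = carrier R, mult = mult R, one = one R, zero = zero R, add = add R, smult = (\<lambda>c. smult R (h c))\<rparr>"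

lemma restrict_scalars_simps [simp]:
  "carrier (restrict_scalars h R) = carrier R" "mult (restrict_scalars h R) = mult R" "one (restrict_scalars h R) = one R"
  "zero (restrict_scalars h R) = zero R" "add (restrict_scalars h R) = add R" "c \<odot>\<^bsub>restrict_scalars h R\<^esub> x = h c \<odot>\<^bsub>R\<^esub> x"
  "finsum (restrict_scalars h R) = finsum R"
  by (simp_all add: restrict_scalars_def finsum_def fun_eq_iff finprod_def)

lemma restrict_scalars_kalg:
  assumes "kalg R"
  shows "kalg (restrict_scalars to_ac R)"
proof -
  interpret kalg R by fact
  have "ring (restrict_scalars to_ac R)"
    by (intro ringI abelian_groupI monoidI) (auto simp: m_assoc l_distr r_distr a_ac intro: add.l_inv_ex)
  then show ?thesis by (intro kalgI k_algebraI) (auto simp: smult_l_distr smult_r_distr)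
qed

lemma inv_mat_to_ac:
  assumes F: "inv_mat n F"
  shows "inv_mat n (map_mat to_ac F)" "mat_inv (map_mat to_ac F) = map_mat to_ac (mat_inv F)"
proof -
  interpret semiring_hom to_ac by unfold_locales simp_all
  note I = inv_mat_inverse[OF F]
  have e: "map_mat to_ac F * map_mat to_ac (mat_inv F) = 1\<^sub>m n"
    unfolding mat_hom_mult[OF I(4,1), symmetric] I(2) by (rule mat_hom_one)
  show i: "inv_mat n (map_mat to_ac F)" by (rule inv_matI[OF _ _ e]) (use I in auto)
  show "mat_inv (map_mat to_ac F) = map_mat to_ac (mat_inv F)" by (rule mat_inv_unique[OF i _ e]) (use I in auto)
qed

lemma point_restrict_scalars:
  assumes E: "inv_mat n E" and F: "inv_mat m F" and p: "point R n (map_mat to_ac E) m (map_mat to_ac F) z"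
  shows "point (restrict_scalars to_ac R) n E m F z"
proof -
  have m: "mm (restrict_scalars to_ac R) = mm R" by (intro ext) (simp add: mm_def)
  have s: "sc (restrict_scalars to_ac R) M = sc R (map_mat to_ac M)" for M by (rule eq_matI) auto
  show ?thesis using p unfolding point_def m s inv_mat_to_ac(2)[OF E] inv_mat_to_ac(2)[OF F] by (simp add: mcar_def)
qed

lemma mat_trace_to_ac:
  assumes "inv_mat n E"
  shows "mat_trace (mat_inv (map_mat to_ac E) * (map_mat to_ac E)\<^sup>T) = to_ac (mat_trace (mat_inv E * E\<^sup>T))"
  unfolding mat_trace_inverse_transpose[OF assms] mat_trace_inverse_transpose[OF inv_mat_to_ac(1)[OF assms]]
  using assms by (simp add: inv_mat_to_ac to_ac_sum)

text \<open>The point found over the algebraic closure is also a point over k after restriction of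
  scalars. It gives a unital map from \<open>\<B>(E,F)\<close> to a nonzero algebra, so 1 = 0 is
  impossible in the source.\<close>

theorem BEF_nontrivial:
  fixes E F :: "'k::field mat"
  assumes E: "inv_mat n E" and F: "inv_mat m F" and nm: "n \<ge> 2" "m \<ge> 2" and t: "mat_trace (mat_inv F * F\<^sup>T) = mat_trace (mat_inv E * E\<^sup>T)"
  shows "\<one>\<^bsub>BEF_alg E F\<^esub> \<noteq> \<zero>\<^bsub>BEF_alg E F\<^esub>"
proof
  assume z: "\<one>\<^bsub>BEF_alg E F\<^esub> = \<zero>\<^bsub>BEF_alg E F\<^esub>"
  let ?E = "map_mat to_ac E" and ?F = "map_mat to_ac F"
  have "mat_trace (mat_inv ?F * ?F\<^sup>T) = mat_trace (mat_inv ?E * ?E\<^sup>T)"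
    using t by (simp add: mat_trace_to_ac[OF E] mat_trace_to_ac[OF F])
  then obtain R :: "('k alg_closure, (((('k alg_closure ft \<Rightarrow> 'k alg_closure ft) set \<times> ('k alg_closure ft \<Rightarrow> 'k alg_closure ft) set) \<Rightarrow>\<^sub>0 'k alg_closure) set)) module" and w
    where R: "kalg R" "\<one>\<^bsub>R\<^esub> \<noteq> \<zero>\<^bsub>R\<^esub>" "point R n ?E m ?F w"
    using exists_nontrivial_point[OF inv_mat_to_ac(1)[OF E] inv_mat_to_ac(1)[OF F] nm] by blast
  note k = restrict_scalars_kalg[OF R(1)] and p = point_restrict_scalars[OF E F R(3)]
  interpret bef n E m F by unfold_locales (fact E F)+
  have "alg_lift (restrict_scalars to_ac R) (\<lambda>p. w $$ p) \<in> alg_hom (BEF_alg E F) (restrict_scalars to_ac R)"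
    by (rule alg_lift_hom[OF k p]) simp
  from alg_hom_one[OF this] B.lin_hom_zero[OF k alg_hom_lin[OF this]] show False
    using R(2) z by simp
qed

subsection \<open>Isomorphism classes of Galois objects\<close>

lemma tensor_map_id:
  assumes "kalg H" "kalg X" "\<And>x. x \<in> carrier X \<Longrightarrow> f x = x" "t \<in> carrier (tensor H X)"
  shows "tensor_map H X id f t = t"
proof -
  interpret kalg2 H X by (rule kalg2I) fact+
  have f: "f \<in> lin_hom X X" using assms(3) by (intro lin_homI) auto
  note L = tensor_map_lin[OF assms(1,2,1,2) lin_hom_id' f] and P = tensor_map_pure[OF assms(1,2,1,2) lin_hom_id' f]
  show ?thesis
    by (rule tensor_lin_eq[OF tensor_kalg L lin_hom_id _ assms(4)]) (simp add: P assms(3))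
qed

lemma tensor_map_comp:
  assumes "kalg H" "kalg X" "kalg Y" "kalg Z" and f: "f \<in> lin_hom X Y" and g: "g \<in> lin_hom Y Z" and t: "t \<in> carrier (tensor H X)"
  shows "tensor_map H Z id g (tensor_map H Y id f t) = tensor_map H Z id (\<lambda>x. g (f x)) t"
proof -
  interpret HX: kalg2 H X by (rule kalg2I) fact+
  interpret HY: kalg2 H Y by (rule kalg2I) fact+
  interpret HZ: kalg2 H Z by (rule kalg2I) fact+
  note f' = tensor_map_lin[OF assms(1,2,1,3) lin_hom_id' f] tensor_map_pure[OF assms(1,2,1,3) lin_hom_id' f]
    and g' = tensor_map_lin[OF assms(1,3,1,4) lin_hom_id' g] tensor_map_pure[OF assms(1,3,1,4) lin_hom_id' g]
    and h' = tensor_map_lin[OF assms(1,2,1,4) lin_hom_id' lin_hom_comp[OF f g]]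
      tensor_map_pure[OF assms(1,2,1,4) lin_hom_id' lin_hom_comp[OF f g]]
  show ?thesis
    by (rule HX.tensor_lin_eq[OF HZ.tensor_kalg lin_hom_comp[OF f'(1) g'(1)] h'(1) _ t])
      (simp add: f'(2) g'(2) h'(2) lin_hom_closed[OF f])
qed

lemma galois_objectD:
  assumes "galois_object H Z"
  shows "kalg H" "kalg Z" "coact Z \<in> alg_hom Z (tensor H Z)"
  using assms by (auto simp: galois_object_def hopf_algebra_def comodule_algebra_def)

lemma comod_alg_isomorphic_refl:
  assumes "galois_object H Z"
  shows "comod_alg_isomorphic H Z Z"
  unfolding comod_alg_isomorphic_def
proof (intro bexI conjI ballI)
  note Z = galois_objectD[OF assms]
  show "id \<in> alg_hom Z Z" by (rule alg_hom_id')
  fix z assume "z \<in> carrier Z"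
  then have "coact Z z \<in> carrier (tensor H Z)" by (rule lin_hom_closed[OF alg_hom_lin[OF Z(3)]])
  from tensor_map_id[OF Z(1,2) _ this, of id] show "coact Z (id z) = tensor_map H Z id id (coact Z z)" by simp
qed simp

lemma comod_alg_isomorphic_sym:
  assumes Y: "galois_object H Y" and Z: "galois_object H Z" and iso: "comod_alg_isomorphic H Y Z"
  shows "comod_alg_isomorphic H Z Y"
proof -
  note Y = galois_objectD[OF Y] and Z = galois_objectD[OF Z]
  obtain f where f: "f \<in> alg_hom Y Z" "bij_betw f (carrier Y) (carrier Z)"
      "\<forall>y\<in>carrier Y. coact Z (f y) = tensor_map H Z id f (coact Y y)"
    using iso unfolding comod_alg_isomorphic_def by blast
  define g where "g = inv_into (carrier Y) f"
  interpret Y: kalg Y by (rule Y)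
  have fl: "f \<in> lin_hom Y Z" by (rule alg_hom_lin[OF f(1)])
  have gl: "g \<in> lin_hom Z Y" unfolding g_def by (rule lin_hom_inverse[OF Y(2) fl f(2)])
  have fg: "f (g z) = z" if "z \<in> carrier Z" for z unfolding g_def using bij_betw_inv_into_right[OF f(2) that] .
  have gf: "g (f y) = y" if "y \<in> carrier Y" for y unfolding g_def using bij_betw_inv_into_left[OF f(2) that] .
  note gc = lin_hom_closed[OF gl]
  have "g \<in> alg_hom Z Y"
  proof (rule alg_homI[OF gl])
    fix x y assume "x \<in> carrier Z" "y \<in> carrier Z"
    then show "g (x \<otimes>\<^bsub>Z\<^esub> y) = g x \<otimes>\<^bsub>Y\<^esub> g y"
      using gf[of "g x \<otimes>\<^bsub>Y\<^esub> g y"] by (simp add: alg_hom_mult[OF f(1)] gc fg)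
  next
    show "g \<one>\<^bsub>Z\<^esub> = \<one>\<^bsub>Y\<^esub>" using gf[of "\<one>\<^bsub>Y\<^esub>"] by (simp add: alg_hom_one[OF f(1)])
  qed
  moreover have "bij_betw g (carrier Z) (carrier Y)" unfolding g_def by (rule bij_betw_inv_into[OF f(2)])
  moreover have "coact Y (g z) = tensor_map H Y id g (coact Z z)" if z: "z \<in> carrier Z" for z
  proof -
    have c: "coact Y (g z) \<in> carrier (tensor H Y)" by (rule lin_hom_closed[OF alg_hom_lin[OF Y(3)] gc[OF z]])
    have "tensor_map H Y id g (coact Z z) = tensor_map H Y id g (tensor_map H Z id f (coact Y (g z)))"
      using f(3) gc[OF z] fg[OF z] by metis
    also have "\<dots> = tensor_map H Y id (\<lambda>x. g (f x)) (coact Y (g z))"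
      by (rule tensor_map_comp[OF Y(1,2) Z(2) Y(2) fl gl c])
    also have "\<dots> = coact Y (g z)" by (rule tensor_map_id[OF Y(1,2) gf c])
    finally show ?thesis by (rule sym)
  qed
  ultimately show ?thesis unfolding comod_alg_isomorphic_def by blast
qed

lemma comod_alg_isomorphic_trans:
  assumes X: "galois_object H X" and Y: "galois_object H Y" and Z: "galois_object H Z"
    and XY: "comod_alg_isomorphic H X Y" and YZ: "comod_alg_isomorphic H Y Z"
  shows "comod_alg_isomorphic H X Z"
proof -
  note X = galois_objectD[OF X] and Y = galois_objectD[OF Y] and Z = galois_objectD[OF Z]
  obtain f where f: "f \<in> alg_hom X Y" "bij_betw f (carrier X) (carrier Y)"
      "\<forall>x\<in>carrier X. coact Y (f x) = tensor_map H Y id f (coact X x)"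
    using XY unfolding comod_alg_isomorphic_def by blast
  obtain g where g: "g \<in> alg_hom Y Z" "bij_betw g (carrier Y) (carrier Z)"
      "\<forall>y\<in>carrier Y. coact Z (g y) = tensor_map H Z id g (coact Y y)"
    using YZ unfolding comod_alg_isomorphic_def by blast
  have "(\<lambda>x. g (f x)) \<in> alg_hom X Z" by (rule alg_hom_comp[OF f(1) g(1)])
  moreover have "bij_betw (\<lambda>x. g (f x)) (carrier X) (carrier Z)"
    using bij_betw_trans[OF f(2) g(2)] by (simp add: comp_def)
  moreover have "coact Z (g (f x)) = tensor_map H Z id (\<lambda>x. g (f x)) (coact X x)" if x: "x \<in> carrier X" for x
  proof -
    have "coact Z (g (f x)) = tensor_map H Z id g (tensor_map H Y id f (coact X x))"
      using f(3) g(3) x lin_hom_closed[OF alg_hom_lin[OF f(1)] x] by simp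
    also have "\<dots> = tensor_map H Z id (\<lambda>x. g (f x)) (coact X x)"
      by (rule tensor_map_comp[OF X(1,2) Y(2) Z(2) alg_hom_lin[OF f(1)] alg_hom_lin[OF g(1)]
            lin_hom_closed[OF alg_hom_lin[OF X(3)] x]])
    finally show ?thesis .
  qed
  ultimately show ?thesis unfolding comod_alg_isomorphic_def by blast
qed

lemma galois_iso_rel_equiv: "equiv {Z. galois_object H Z} (galois_iso_rel H)"
proof (rule equivI)
  show "galois_iso_rel H \<subseteq> {Z. galois_object H Z} \<times> {Z. galois_object H Z}"
    by (auto simp: galois_iso_rel_def)
  show "refl_on {Z. galois_object H Z} (galois_iso_rel H)"
    using comod_alg_isomorphic_refl by (auto simp: refl_on_def galois_iso_rel_def)
  show "sym (galois_iso_rel H)"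
    using comod_alg_isomorphic_sym unfolding sym_def galois_iso_rel_def by blast
  show "trans (galois_iso_rel H)"
    using comod_alg_isomorphic_trans unfolding trans_def galois_iso_rel_def by blast
qed

text \<open>The relation R is the pullback of the equivalence S along h, so h induces an injection
  on classes; it is onto since every element of Y is S-related to a value of h.\<close>

lemma quotient_bijection:
  assumes S: "equiv Y S" and R: "R \<subseteq> X \<times> X" and h: "\<And>x. x \<in> X \<Longrightarrow> h x \<in> Y"
    and iff: "\<And>x x'. x \<in> X \<Longrightarrow> x' \<in> X \<Longrightarrow> (x, x') \<in> R \<longleftrightarrow> (h x, h x') \<in> S"
    and surj: "\<And>y. y \<in> Y \<Longrightarrow> \<exists>x\<in>X. (h x, y) \<in> S"
  shows "\<exists>\<psi>. bij_betw \<psi> (X // R) (Y // S) \<and> (\<forall>x\<in>X. \<psi> (R `` {x}) = S `` {h x})"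
proof -
  \<comment> \<open>All members of the union coincide, so no representative has to be
    chosen.\<close>
  define \<psi> where "\<psi> C = (\<Union>x\<in>C. S `` {h x})" for C
  have eq: "\<psi> (R `` {x}) = S `` {h x}" if x: "x \<in> X" for x
  proof -
    have "S `` {h x'} = S `` {h x}" if "x' \<in> R `` {x}" for x'
    proof -
      have "(x, x') \<in> R" using that by simp
      moreover from this have "x' \<in> X" using R by blast
      ultimately have "(h x, h x') \<in> S" using iff[OF x] by blast
      then show ?thesis by (rule equiv_class_eq[OF S, symmetric])
    qed
    moreover have "x \<in> R `` {x}" using iff[OF x x] equiv_class_self[OF S h[OF x]] by auto
    ultimately show ?thesis unfolding \<psi>_def by blast
  qed
  have "R `` {x} = R `` {x'}" if "x \<in> X" "x' \<in> X" "S `` {h x} = S `` {h x'}" for x x'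
  proof -
    have "(x, y) \<in> R \<longleftrightarrow> (x', y) \<in> R" for y
    proof (cases "y \<in> X")
      case True
      have "(h x, h y) \<in> S \<longleftrightarrow> (h x', h y) \<in> S" using that(3) by blast
      then show ?thesis by (simp only: iff[OF that(1) True] iff[OF that(2) True])
    qed (use R in blast)
    then show ?thesis by blast
  qed
  note classes = this
  have "inj_on \<psi> (X // R)"
  proof (rule inj_onI)
    fix C D assume CD: "C \<in> X // R" "D \<in> X // R" "\<psi> C = \<psi> D"
    obtain x where x: "x \<in> X" "C = R `` {x}" using CD(1) by (rule quotientE)
    obtain y where y: "y \<in> X" "D = R `` {y}" using CD(2) by (rule quotientE)
    have "S `` {h x} = S `` {h y}" using CD(3) unfolding x(2) y(2) eq[OF x(1)] eq[OF y(1)] .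
    then show "C = D" unfolding x(2) y(2) by (rule classes[OF x(1) y(1)])
  qed
  moreover have "\<psi> ` (X // R) = Y // S"
  proof (intro equalityI subsetI)
    fix C assume "C \<in> \<psi> ` (X // R)"
    then obtain D where D: "D \<in> X // R" "C = \<psi> D" by blast
    obtain x where x: "x \<in> X" "D = R `` {x}" using D(1) by (rule quotientE)
    show "C \<in> Y // S" unfolding D(2) x(2) eq[OF x(1)] by (rule quotientI[OF h[OF x(1)]])
  next
    fix C assume "C \<in> Y // S"
    then obtain y where y: "y \<in> Y" "C = S `` {y}" by (rule quotientE)
    then obtain x where x: "x \<in> X" "(h x, y) \<in> S" using surj by blast
    then have "C = \<psi> (R `` {x})" using y equiv_class_eq[OF S x(2)] by (simp add: eq)
    then show "C \<in> \<psi> ` (X // R)" using quotientI[OF x(1)] by (rule image_eqI)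
  qed
  ultimately show ?thesis using eq unfolding bij_betw_def by blast
qed

text \<open>Passes from the record predicate to the locale: \<open>BE E\<close> and
  \<open>BEF_alg E E\<close> share their algebra structure, so all tensor constructions over them
  agree.\<close>

lemma galois_object_gal:
  assumes E: "inv_mat n E" and Z: "galois_object (BE E) Z"
  shows "gal n E Z (coact Z)"
proof -
  interpret HE: bef n E n E by unfold_locales (rule E E)+
  interpret Z: kalg Z by (rule galois_objectD(2)[OF Z])
  have cm: "comodule_algebra (BE E) Z" and nz: "carrier Z \<noteq> {\<zero>\<^bsub>Z\<^esub>}"
    and cb: "bij_betw (canonical_map (BE E) Z) (carrier (tensor Z Z)) (carrier (tensor (BE E) Z))"
    using Z unfolding galois_object_def by blast+
  have hom: "coact Z \<in> alg_hom Z (tensor (BEF_alg E E) Z)"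
    using galois_objectD(3)[OF Z] unfolding BE_simps .
  have c: "comod (BEF_alg E E) Z (coact Z)"
    by (rule comod.intro[OF kalg2I[OF HE.alg_kalg Z.kalg_axioms] comod_axioms.intro[OF hom]])
  have can: "comod.can (BEF_alg E E) Z (coact Z) = canonical_map (BE E) Z"
    unfolding comod.can_def[OF c] canonical_map_def BE_simps ..
  show ?thesis
  proof (rule gal.intro[OF HE.bef_axioms c], rule gal_axioms.intro)
    show "\<one>\<^bsub>Z\<^esub> \<noteq> \<zero>\<^bsub>Z\<^esub>" using nz Z.one_zeroD by blast
    show "bij_betw (comod.can (BEF_alg E E) Z (coact Z)) (carrier (tensor Z Z)) (carrier (tensor (BEF_alg E E) Z))"
      using cb unfolding can BE_simps .
    fix z assume z: "z \<in> carrier Z"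
    show "tensor_assoc (BEF_alg E E) (BEF_alg E E) Z
        (tensor_map (tensor (BEF_alg E E) (BEF_alg E E)) Z (coprod E E) id (coact Z z))
      = tensor_map (BEF_alg E E) (tensor (BEF_alg E E) Z) id (coact Z) (coact Z z)"
      using cm z unfolding comodule_algebra_def BE_simps BE_comult by blast
    show "tensor_lift Z (\<lambda>h y. counit (BE E) h \<odot>\<^bsub>Z\<^esub> y) (coact Z z) = z"
      using cm z unfolding comodule_algebra_def by blast
  qed
qed

section \<open>From points to comodule algebra maps and back\<close>

context gal
begin

lemma point_isomorphism:
  assumes F: "inv_mat m F" and z: "point Z n E m F z" "equimat z"
  shows "\<exists>f\<in>alg_hom (BEF_alg E F) Z. bij_betw f (carrier (BEF_alg E F)) (carrier Z) \<and>
    (\<forall>y\<in>carrier (BEF_alg E F). \<delta> (f y) = tensor_map A Z id f (coprod E F y))"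
proof -
  interpret F: bef n E m F by unfold_locales (rule E F)+
  define f where "f = alg_lift Z (\<lambda>p. z $$ p)"
  have zm: "z \<in> carrier_mat n m" and zc3: "mcar Z z" using z(1) unfolding point_def by blast+
  have zc: "dim_row z = n" "dim_col z = m" "mcar Z z" using zm zc3 by simp_all
  have f: "f \<in> alg_hom (BEF_alg E F) Z" unfolding f_def by (rule F.alg_lift_hom[OF kZ z(1)]) (rule refl)
  have f_gen: "f (BEF_gen E F i j) = z $$ (i, j)" if "i < n" "j < m" for i j
    unfolding f_def using that by (rule F.alg_lift_gen[OF kZ z(1) refl])
  have mf: "tensor_map A Z id f \<in> alg_hom (tensor A (BEF_alg E F)) (tensor A Z)"
    by (rule tensor_map_alg[OF kA F.alg_kalg kA kZ alg_hom_id' f])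
  have mp: "tensor_map A Z id f (pure_tensor A (BEF_alg E F) h y) = pure_tensor A Z (id h) (f y)"
    if "h \<in> carrier A" "y \<in> carrier (BEF_alg E F)" for h y
    by (rule tensor_map_pure[OF kA F.alg_kalg kA kZ lin_hom_id' alg_hom_lin[OF f] that])
  have co: "\<delta> (f y) = tensor_map A Z id f (coprod E F y)" if "y \<in> carrier (BEF_alg E F)" for y
  proof (rule F.alg_hom_eq[OF alg_hom_comp[OF f C.\<delta>] alg_hom_comp[OF F.coprod_hom mf] _ that])
    fix i j assume ij: "i < n" "j < m"
    have "tensor_map A Z id f (coprod E F (BEF_gen E F i j))
      = (\<Oplus>\<^bsub>tensor A Z\<^esub>l\<in>{..<n}. tensor_map A Z id f (pure_tensor A (BEF_alg E F) (a i l) (BEF_gen E F l j)))"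
      unfolding F.coprod_gen[OF ij]
      by (rule F.HZ.T.lin_hom_finsum[OF kAZ alg_hom_lin[OF mf]]) (use ij in \<open>auto del: equalityI\<close>)
    also have "\<dots> = (\<Oplus>\<^bsub>tensor A Z\<^esub>l\<in>{..<n}. pure_tensor A Z (a i l) (z $$ (l, j)))"
      by (rule C.T.finsum_cong', simp) (use ij zc in \<open>auto simp: mp f_gen mcarD[OF zc(3)] del: equalityI\<close>)
    also have "\<dots> = \<delta> (f (BEF_gen E F i j))"
      unfolding f_gen[OF ij] by (rule equimat_entry[OF z(2), symmetric]) (use ij zc in auto)
    finally show "\<delta> (f (BEF_gen E F i j)) = tensor_map A Z id f (coprod E F (BEF_gen E F i j))" by (rule sym)
  qed
  have "comod_morphism A (BEF_alg E F) (coprod E F) Z \<delta> f"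
    by (intro comod_morphism.intro comod_morphism_axioms.intro F.C.comod_axioms C.comod_axioms
        f co F.can_bij bij_betw_imp_inj_on[OF can_bij] nontrivial)
  from comod_morphism.bij[OF this] f co show ?thesis by blast
qed

lemma equimat_entryI:
  assumes "dim_row z = n" "mcar Z z" "\<And>i j. i < n \<Longrightarrow> j < dim_col z \<Longrightarrow>
    \<delta> (z $$ (i, j)) = (\<Oplus>\<^bsub>tensor A Z\<^esub>p\<in>{..<n}. pure_tensor A Z (a i p) (z $$ (p, j)))"
  shows "equimat z"
proof -
  have "map_mat \<delta> z = tmm A Z HE.gens z"
  proof (rule eq_matI)
    fix i j assume "i < dim_row (tmm A Z HE.gens z)" "j < dim_col (tmm A Z HE.gens z)"
    then have ij: "i < n" "j < dim_col z" by (simp_all add: tmm_def)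
    have "tmm A Z HE.gens z $$ (i, j) = (\<Oplus>\<^bsub>tensor A Z\<^esub>p\<in>{..<n}. pure_tensor A Z (HE.gens $$ (i, p)) (z $$ (p, j)))"
      using ij by (simp add: tmm_def)
    also have "\<dots> = (\<Oplus>\<^bsub>tensor A Z\<^esub>p\<in>{..<n}. pure_tensor A Z (a i p) (z $$ (p, j)))"
      by (rule C.T.finsum_cong', simp) (use ij assms(1) in \<open>auto simp: mcarD[OF assms(2)] del: equalityI\<close>)
    finally show "map_mat \<delta> z $$ (i, j) = tmm A Z HE.gens z $$ (i, j)"
      using ij assms by simp
  qed (use assms in \<open>simp_all add: tmm_def\<close>)
  then show ?thesis using assms by (simp add: equimat_def)
qed

end

context gal
begin

text \<open>The image of the universal point; equivariance of f on generators is exactly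
  equivariance of its columns.\<close>

lemma hom_point:
  assumes F: "inv_mat m F" and f: "f \<in> alg_hom (BEF_alg E F) Z"
    and co: "\<forall>y\<in>carrier (BEF_alg E F). \<delta> (f y) = tensor_map A Z id f (coprod E F y)"
  shows "\<exists>z. point Z n E m F z \<and> equimat z"
proof -
  interpret F: bef n E m F by unfold_locales (rule E F)+
  have fc: "f y \<in> carrier Z" if "y \<in> carrier (BEF_alg E F)" for y
    by (rule lin_hom_closed[OF alg_hom_lin[OF f] that])
  have mf: "tensor_map A Z id f \<in> lin_hom (tensor A (BEF_alg E F)) (tensor A Z)"
    by (rule tensor_map_lin[OF kA F.alg_kalg kA kZ lin_hom_id' alg_hom_lin[OF f]])
  have mp: "tensor_map A Z id f (pure_tensor A (BEF_alg E F) h y) = pure_tensor A Z (id h) (f y)"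
    if "h \<in> carrier A" "y \<in> carrier (BEF_alg E F)" for h y
    by (rule tensor_map_pure[OF kA F.alg_kalg kA kZ lin_hom_id' alg_hom_lin[OF f] that])
  have p: "point Z n E m F (map_mat f F.gens)" by (rule F.B.point_hom[OF kZ f E F F.gens_point])
  have "equimat (map_mat f F.gens)"
  proof (rule equimat_entryI)
    show "mcar Z (map_mat f F.gens)" using p unfolding point_def by blast
    fix i j assume "i < n" "j < dim_col (map_mat f F.gens)"
    then have ij: "i < n" "j < m" by simp_all
    have "\<delta> (f (BEF_gen E F i j)) = tensor_map A Z id f (coprod E F (BEF_gen E F i j))"
      using co F.gen_in_alg[OF ij] by blast
    also have "\<dots> = (\<Oplus>\<^bsub>tensor A Z\<^esub>l\<in>{..<n}. tensor_map A Z id f (pure_tensor A (BEF_alg E F) (a i l) (BEF_gen E F l j)))"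
      unfolding F.coprod_gen[OF ij]
      by (rule F.HZ.T.lin_hom_finsum[OF kAZ mf]) (use ij in \<open>auto del: equalityI\<close>)
    also have "\<dots> = (\<Oplus>\<^bsub>tensor A Z\<^esub>l\<in>{..<n}. pure_tensor A Z (a i l) (map_mat f F.gens $$ (l, j)))"
      by (rule C.T.finsum_cong', simp) (use ij in \<open>auto simp: mp fc del: equalityI\<close>)
    finally show "\<delta> (map_mat f F.gens $$ (i, j)) = (\<Oplus>\<^bsub>tensor A Z\<^esub>p\<in>{..<n}. pure_tensor A Z (a i p) (map_mat f F.gens $$ (p, j)))"
      using ij by simp
  qed simp
  with p show ?thesis by blast
qed

text \<open>For G = P F P^T the scalar matrix P^T is an (F,G)-point, and scalars commute with
  everything, so it can be composed with z. The second relation is P^T G^-1 P = F^-1.\<close>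

lemma congruent_point:
  assumes F: "inv_mat m F" and z: "point Z n E m F z" "equimat z"
    and P: "inv_mat m P" and G: "inv_mat m G" "G = P * F * P\<^sup>T"
  shows "\<exists>w. point Z n E m G w \<and> equimat w"
proof -
  have zm: "z \<in> carrier_mat n m" and zc: "mcar Z z" using z(1) unfolding point_def by blast+
  note iF = inv_mat_inverse[OF F] and iG = inv_mat_inverse[OF G(1)] and iP = inv_mat_inverse[OF P]
  have Pt: "P\<^sup>T \<in> carrier_mat m m" using iP by simp
  have G': "G = P * (F * P\<^sup>T)" unfolding G(2) by (rule assoc_mult_mat[OF iP(4) iF(4) Pt])
  have "P * (F * (P\<^sup>T * mat_inv G)) = P * (F * P\<^sup>T) * mat_inv G"
    using iP(4) iF(4) Pt iG(1) by (simp add: assoc_mult_mat[of _ m m _ m _ m])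
  also have "\<dots> = 1\<^sub>m m" unfolding G'[symmetric] by (rule iG(2))
  finally have "mat_inv P = F * (P\<^sup>T * mat_inv G)"
    by (rule mat_inv_unique[OF P, rotated]) (use iF(4) Pt iG(1) in simp)
  then have "F * (P\<^sup>T * (mat_inv G * P)) = mat_inv P * P"
    using iP(4) iF(4) Pt iG(1) by (simp add: assoc_mult_mat[of _ m m _ m _ m])
  then have iF': "P\<^sup>T * (mat_inv G * P) = mat_inv F"
    using iP iF(4) Pt iG(1) by (intro mat_inv_unique[OF F, symmetric]) simp_all
  have w: "point Z m F m G (sc Z P\<^sup>T)"
    unfolding point_def
  proof (intro conjI)
    show "mm Z (sc Z P\<^sup>T)\<^sup>T (mm Z (sc Z F) (sc Z P\<^sup>T)) = sc Z G"
      using iP(4) iF(4) by (simp add: sc_transpose G' C.B.sc_mult)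
    show "mm Z (sc Z P\<^sup>T) (mm Z (sc Z (mat_inv G)) (sc Z P\<^sup>T)\<^sup>T) = sc Z (mat_inv F)"
      using iP(4) iG(1) by (simp add: sc_transpose iF'[symmetric] C.B.sc_mult)
    show "sc Z P\<^sup>T \<in> carrier_mat m m" by (rule carrier_matI) (use iP(4) in simp_all)
  qed simp
  have "point Z n E m G (mm Z z (sc Z P\<^sup>T))"
    by (rule C.B.point_compose[OF E F G(1) z(1) w]) (simp add: zc)
  moreover have "equimat (mm Z z (sc Z P\<^sup>T))" by (rule equimat_sc[OF z(2)]) (use zm Pt in simp)
  ultimately show ?thesis by blast
qed

end

subsection \<open>The bijection\<close>

lemma comod_alg_isomorphic_BEF:
  "comod_alg_isomorphic (BE E) (BEF E F) Z \<longleftrightarrow>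
    (\<exists>f\<in>alg_hom (BEF_alg E F) Z. bij_betw f (carrier (BEF_alg E F)) (carrier Z) \<and>
      (\<forall>y\<in>carrier (BEF_alg E F). coact Z (f y) = tensor_map (BEF_alg E E) Z id f (coprod E F y)))"
  unfolding comod_alg_isomorphic_def BE_simps BEF_simps BEF_coact ..

lemma X0_E_iff: "F \<in> X0_E E \<longleftrightarrow> (\<exists>m\<ge>2. inv_mat m F \<and> mat_trace (mat_inv F * F\<^sup>T) = mat_trace (mat_inv E * E\<^sup>T))"
  by (auto simp: X0_E_def inv_mat_def)

context
  fixes n :: nat and E :: "'k::field mat"
  assumes E: "inv_mat n E" and n: "n \<ge> 2"
begin

lemma galois_object_X0:
  assumes "F \<in> X0_E E"
  shows "galois_object (BE E) (BEF E F)"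
proof -
  obtain m where m: "m \<ge> 2" "inv_mat m F" "mat_trace (mat_inv F * F\<^sup>T) = mat_trace (mat_inv E * E\<^sup>T)"
    using assms unfolding X0_E_iff by blast
  show ?thesis by (rule bef.galois_object_BEF[OF bef.intro[OF E m(2)] BEF_nontrivial[OF E m(2) n m(1,3)]])
qed

lemma galois_object_classified:
  assumes Z: "galois_object (BE E) Z"
  shows "\<exists>F\<in>X0_E E. comod_alg_isomorphic (BE E) (BEF E F) Z"
proof -
  interpret gal n E Z "coact Z" by (rule galois_object_gal[OF E Z])
  obtain m F z where z: "inv_mat m F" "point Z n E m F z" "equimat z" by (rule exists_point)
  have "comod_alg_isomorphic (BE E) (BEF E F) Z"
    unfolding comod_alg_isomorphic_BEF by (rule point_isomorphism[OF z])
  moreover have "F \<in> X0_E E"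
    unfolding X0_E_iff using C.B.point_size[OF E z(1,2) nontrivial n] C.B.point_trace[OF E z(1,2) nontrivial] z(1) by blast
  ultimately show ?thesis by blast
qed

text \<open>Two isomorphisms onto the same Z give two points over Z, to which
  \<open>points_congruent\<close> applies.\<close>

lemma isomorphic_imp_congruent:
  assumes Z: "galois_object (BE E) Z" and F: "inv_mat m1 F1" "inv_mat m2 F2"
    and iso: "comod_alg_isomorphic (BE E) (BEF E F1) Z" "comod_alg_isomorphic (BE E) (BEF E F2) Z"
  shows "m1 = m2 \<and> (\<exists>P. P \<in> carrier_mat m1 m1 \<and> invertible_mat P \<and> F1 = P * F2 * P\<^sup>T)"
proof -
  interpret gal n E Z "coact Z" by (rule galois_object_gal[OF E Z])
  obtain u where u: "point Z n E m1 F1 u" "equimat u"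
    using iso(1) hom_point[OF F(1)] unfolding comod_alg_isomorphic_BEF by blast
  obtain z where z: "point Z n E m2 F2 z" "equimat z"
    using iso(2) hom_point[OF F(2)] unfolding comod_alg_isomorphic_BEF by blast
  show ?thesis by (rule points_congruent[OF F(1) u F(2) z])
qed

lemma congruent_imp_isomorphic:
  assumes Z: "galois_object (BE E) Z" and iso: "comod_alg_isomorphic (BE E) (BEF E F) Z"
    and F: "inv_mat m F" and P: "inv_mat m P" and G: "inv_mat m G" "G = P * F * P\<^sup>T"
  shows "comod_alg_isomorphic (BE E) (BEF E G) Z"
proof -
  interpret gal n E Z "coact Z" by (rule galois_object_gal[OF E Z])
  obtain z where z: "point Z n E m F z" "equimat z"
    using iso hom_point[OF F] unfolding comod_alg_isomorphic_BEF by blast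
  obtain w where w: "point Z n E m G w" "equimat w" using congruent_point[OF F z P G] by blast
  show ?thesis unfolding comod_alg_isomorphic_BEF by (rule point_isomorphism[OF G(1) w])
qed

text \<open>Both directions compare points over the single target \<open>BEF E F2\<close>, whose own
  point is supplied by the identity isomorphism.\<close>

lemma congruence_rel_iff:
  assumes "F1 \<in> X0_E E" "F2 \<in> X0_E E"
  shows "(F1, F2) \<in> congruence_rel E \<longleftrightarrow> (BEF E F1, BEF E F2) \<in> galois_iso_rel (BE E)"
proof -
  note g = galois_object_X0[OF assms(1)] galois_object_X0[OF assms(2)]
  obtain m1 m2 where m: "inv_mat m1 F1" "inv_mat m2 F2" using assms unfolding X0_E_iff by blast
  note refl = comod_alg_isomorphic_refl[OF g(2)]
  show ?thesis
  proof
    assume "(F1, F2) \<in> congruence_rel E"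
    then obtain m P where P: "F1 \<in> carrier_mat m m" "F2 \<in> carrier_mat m m" "P \<in> carrier_mat m m"
        "invertible_mat P" "F1 = P * F2 * P\<^sup>T"
      unfolding congruence_rel_def by blast
    have "m1 = m" "m2 = m" using inv_mat_dim(1)[OF m(1)] inv_mat_dim(1)[OF m(2)] P(1,2) by simp_all
    then have mm: "inv_mat m F1" "inv_mat m F2" "inv_mat m P" using m P(3,4) by (simp_all add: inv_mat_def)
    show "(BEF E F1, BEF E F2) \<in> galois_iso_rel (BE E)"
      unfolding galois_iso_rel_def using g congruent_imp_isomorphic[OF g(2) refl mm(2,3,1) P(5)] by blast
  next
    assume "(BEF E F1, BEF E F2) \<in> galois_iso_rel (BE E)"
    then have iso: "comod_alg_isomorphic (BE E) (BEF E F1) (BEF E F2)" unfolding galois_iso_rel_def by blast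
    have "m1 = m2 \<and> (\<exists>P. P \<in> carrier_mat m1 m1 \<and> invertible_mat P \<and> F1 = P * F2 * P\<^sup>T)"
      by (rule isomorphic_imp_congruent[OF g(2) m iso refl])
    moreover have "F1 \<in> carrier_mat m1 m1" "F2 \<in> carrier_mat m2 m2" using m unfolding inv_mat_def by blast+
    ultimately show "(F1, F2) \<in> congruence_rel E" using assms unfolding congruence_rel_def by blast
  qed
qed

end

text \<open>\<open>Gal (BE E)\<close> is read over the element type of the algebras
  \<open>BEF E F\<close>. The second conjunct, with an arbitrary type \<open>'z\<close>, ensures
  that no isomorphism class is missed by this choice.\<close>

theorem corollary9:
  fixes E :: "'k::field mat" and n :: nat
  assumes "n \<ge> 2" and "E \<in> carrier_mat n n" and "invertible_mat E"
  shows "(\<exists>\<psi>. bij_betw \<psi> (X_E E) (Gal (BE E)) \<and>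
            (\<forall>F\<in>X0_E E. \<psi> (congruence_rel E `` {F}) = galois_iso_rel (BE E) `` {BEF E F})) \<and>
         (\<forall>Z :: ('k, 'k free_elt set, 'z) comod_alg. galois_object (BE E) Z \<longrightarrow>
            (\<exists>Z' :: ('k, 'k free_elt set, 'k free_elt set) comod_alg.
               galois_object (BE E) Z' \<and> comod_alg_isomorphic (BE E) Z Z'))"
proof (intro conjI allI impI)
  have E: "inv_mat n E" using assms by (simp add: inv_mat_def)
  note galois = galois_object_X0[OF E assms(1)]
  show "\<exists>\<psi>. bij_betw \<psi> (X_E E) (Gal (BE E)) \<and>
      (\<forall>F\<in>X0_E E. \<psi> (congruence_rel E `` {F}) = galois_iso_rel (BE E) `` {BEF E F})"
    unfolding X_E_def Gal_def
  proof (rule quotient_bijection[OF galois_iso_rel_equiv])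
    show "congruence_rel E \<subseteq> X0_E E \<times> X0_E E" unfolding congruence_rel_def by blast
    show "BEF E F \<in> {Z. galois_object (BE E) Z}" if "F \<in> X0_E E" for F using galois[OF that] by simp
    show "(F1, F2) \<in> congruence_rel E \<longleftrightarrow> (BEF E F1, BEF E F2) \<in> galois_iso_rel (BE E)"
      if "F1 \<in> X0_E E" "F2 \<in> X0_E E" for F1 F2 by (rule congruence_rel_iff[OF E assms(1) that])
    fix Z assume "Z \<in> {Z :: ('k, 'k free_elt set, 'k free_elt set) comod_alg. galois_object (BE E) Z}"
    then have Z: "galois_object (BE E) Z" by simp
    obtain F where "F \<in> X0_E E" "comod_alg_isomorphic (BE E) (BEF E F) Z"
      using galois_object_classified[OF E assms(1) Z] by blast
    then show "\<exists>F\<in>X0_E E. (BEF E F, Z) \<in> galois_iso_rel (BE E)"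
      using galois Z unfolding galois_iso_rel_def by blast
  qed
  fix Z :: "('k, 'k free_elt set, 'z) comod_alg" assume Z: "galois_object (BE E) Z"
  obtain F where F: "F \<in> X0_E E" "comod_alg_isomorphic (BE E) (BEF E F) Z"
    using galois_object_classified[OF E assms(1) Z] by blast
  show "\<exists>Z' :: ('k, 'k free_elt set, 'k free_elt set) comod_alg.
      galois_object (BE E) Z' \<and> comod_alg_isomorphic (BE E) Z Z'"
    using galois[OF F(1)] comod_alg_isomorphic_sym[OF galois[OF F(1)] Z F(2)] by blast
qed

end
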